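(* Let $u\in H$. For $j\in\mathbb N$ the following statements are equivalent: (i) $u\in D(A^j)$; (ii) $\lambda\mapsto\lambda^j(Vu)(\lambda)$ belongs to $L^2_\sigma$; (iii) $\lambda\mapsto\lambda^j(Vu)_k(\lambda)$ belongs to $L^2([a_k,+\infty),\sigma_k)$ for $k=1,\dots,n$.
   Context: Let $n\ge 2$, $c_1,\dots,c_n>0$ and $0\le a_1\le a_2\le\dots\le a_n<+\infty$. Let $N_1,\dots,N_n$ be $n$ disjoint copies of $(0,+\infty)$ and let $N=\bigcup_{k=1}^n\overline{N_k}$ with the endpoints $0$ of all branches identified (star-shaped network). A function $f$ on $N$ is identified with the tuple $(f_1,\dots,f_n)$ of its restrictions to the branches, and $\int_N f\,dx:=\sum_{k=1}^n\int_0^\infty f_k\,dx$. Transmission conditions for $(u_k)_{k=1}^n$: $(T_0)$: $u_k\in C^0([0,\infty))$ and $u_i(0)=u_k(0)$ for all $i,k$; $(T_1)$: $u_k\in C^1([0,\infty))$ and $\sum_{k=1}^n c_k u_k'(0^+)=0$. $H=\prod_{k=1}^n L^2(N_k)$ (complex-valued functions) with $(u,v)_H=\sum_k(u_k,v_k)_{L^2(N_k)}$. The operator $A:D(A)\to H$ is $A(u_k)_k=(-c_k u_k''+a_k u_k)_k$ with $D(A)=\{(u_k)\in\prod_k H^2(N_k): (T_0)\text{ and }(T_1)\text{ hold}\}$ (it is self-adjoint). The complex square root is $\sqrt{re^{i\phi}}=\sqrt r\,e^{i\phi/2}$ for $r>0$, $\phi\in[-\pi,\pi)$. For $\lambda\in\mathbb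 C$: $\xi_k(\lambda)=\sqrt{(\lambda-a_k)/c_k}$, $s_k(\lambda)=-\dfrac{\sum_{l\ne k}c_l\xi_l(\lambda)}{c_k\xi_k(\lambda)}$. The functions $F_\lambda^{-,j}:N\to\mathbb C$ are given on $\overline{N_k}$ by $F_{\lambda,k}^{-,j}$, where $F_{\lambda,j}^{-,j}(x)=\cos(\xi_j(\lambda)x)- i\,s_j(\lambda)\sin(\xi_j(\lambda)x)$ and $F_{\lambda,k}^{-,j}(x)=\exp(- i\xi_k(\lambda)x)$ for $k\ne j$. For real $\lambda$, $w(\lambda)=-i\sum_{j=1}^n c_j\xi_j(\lambda)$. Weights: for $\lambda>a_k$, $\sigma_k(\lambda)=\dfrac1\pi\dfrac{c_k\xi_k(\lambda)}{|w(\lambda)|^2}$. $L^2([a_k,+\infty),\sigma_k)$ is the weighted $L^2$-space with inner product $\int_{a_k}^\infty\sigma_k F\overline G\,d\lambda$, and $L^2_\sigma=\prod_{k=1}^nL^2([a_k,+\infty),\sigma_k)$ with inner product $(F,G)_\sigma=\sum_k(F_k,G_k)_{L^2([a_k,\infty),\sigma_k)}$. For $f\in\prod_{k=1}^nC_c^\infty(N_k)$, $Vf=((Vf)_1,\dots,(Vf)_n)$ with $(Vf)_k(\lambda)=\int_N f(x)\overline{F_\lambda^{-,k}(x)}\,dx$ for $\lambda\in[a_k,+\infty)$. This $V$ is isometric from $\prod_kC_c^\infty(N_k)$ (with the norm of $H$) into $L^2_\sigma$; its extension to an isometry $H\to L^2_\sigma$ is again denoted $V$. *)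

theory Defs
  imports "HOL-Analysis.Analysis"
begin

text \<open>
  Branches are indexed by \<open>k \<in> {1..n}\<close>, and a function on the network is a tuple
  \<open>f :: nat \<Rightarrow> real \<Rightarrow> complex\<close> of which only the components in \<open>{1..n}\<close> matter.
  Elements of \<open>L\<^sup>2\<close> spaces are represented by Borel functions; every predicate below that
  is meant for \<open>L\<^sup>2\<close> classes depends on the function only up to equality almost everywhere.
\<close>

section \<open>Square-integrable functions\<close>

definition L2 :: "real measure \<Rightarrow> (real \<Rightarrow> complex) set" where
  "L2 M = {f \<in> borel_measurable M. integrable M (\<lambda>x. (cmod (f x))\<^sup>2)}"

definition prod_L2 :: "nat \<Rightarrow> (nat \<Rightarrow> real measure) \<Rightarrow> (nat \<Rightarrow> real \<Rightarrow> complex) set" where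
  "prod_L2 n M = {F. \<forall>k\<in>{1..n}. F k \<in> L2 (M k)}"

definition prod_L2_norm :: "nat \<Rightarrow> (nat \<Rightarrow> real measure) \<Rightarrow> (nat \<Rightarrow> real \<Rightarrow> complex) \<Rightarrow> real" where
  "prod_L2_norm n M F = sqrt (\<Sum>k\<in>{1..n}. \<integral>x. (cmod (F k x))\<^sup>2 \<partial>(M k))"

definition branch :: "real measure" where
  "branch = restrict_space lborel {0<..}"

definition H :: "nat \<Rightarrow> (nat \<Rightarrow> real \<Rightarrow> complex) set" where
  "H n = prod_L2 n (\<lambda>k. branch)"

section \<open>Test functions, weak derivatives and \<open>H\<^sup>2\<close> on the half-line\<close>

definition vderiv :: "nat \<Rightarrow> (real \<Rightarrow> complex) \<Rightarrow> real \<Rightarrow> complex" where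
  "vderiv m = (\<lambda>f x. vector_derivative f (at x)) ^^ m"

text \<open>\<open>C\<^sub>c\<^sup>\<infinity>(0,\<infinity>)\<close>; test functions are extended by zero to the whole real line.\<close>

definition test_functions :: "(real \<Rightarrow> complex) set" where
  "test_functions = {\<phi>. (\<forall>m x. vderiv m \<phi> differentiable (at x)) \<and>
     compact (closure {x. \<phi> x \<noteq> 0}) \<and> closure {x. \<phi> x \<noteq> 0} \<subseteq> {0<..}}"

definition is_weak_deriv :: "nat \<Rightarrow> (real \<Rightarrow> complex) \<Rightarrow> (real \<Rightarrow> complex) \<Rightarrow> bool" where
  "is_weak_deriv m f g \<longleftrightarrow> (\<forall>\<phi>\<in>test_functions.
     (\<integral>x. f x * vderiv m \<phi> x \<partial>branch) = (-1) ^ m * (\<integral>x. g x * \<phi> x \<partial>branch))"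

definition H2 :: "(real \<Rightarrow> complex) set" where
  "H2 = {f \<in> L2 branch. \<forall>m\<in>{1, 2}. \<exists>g \<in> L2 branch. is_weak_deriv m f g}"

text \<open>The \<open>L\<^sup>2\<close> weak derivative is unique up to a null set; \<open>SOME\<close> picks a representative.\<close>

definition weak_deriv :: "nat \<Rightarrow> (real \<Rightarrow> complex) \<Rightarrow> real \<Rightarrow> complex" where
  "weak_deriv m f = (SOME g. g \<in> L2 branch \<and> is_weak_deriv m f g)"

section \<open>The operator \<open>A\<close>\<close>

definition C1_halfline :: "(real \<Rightarrow> complex) \<Rightarrow> bool" where
  "C1_halfline f \<longleftrightarrow> (\<exists>f'. continuous_on {0..} f' \<and>
     (\<forall>x\<ge>0. (f has_vector_derivative f' x) (at x within {0..})))"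

definition T0 :: "nat \<Rightarrow> (nat \<Rightarrow> real \<Rightarrow> complex) \<Rightarrow> bool" where
  "T0 n v \<longleftrightarrow> (\<forall>k\<in>{1..n}. continuous_on {0..} (v k)) \<and> (\<forall>i\<in>{1..n}. \<forall>k\<in>{1..n}. v i 0 = v k 0)"

definition T1 :: "nat \<Rightarrow> (nat \<Rightarrow> real) \<Rightarrow> (nat \<Rightarrow> real \<Rightarrow> complex) \<Rightarrow> bool" where
  "T1 n c v \<longleftrightarrow> (\<forall>k\<in>{1..n}. C1_halfline (v k)) \<and>
     (\<Sum>k\<in>{1..n}. of_real (c k) * vector_derivative (v k) (at 0 within {0..})) = 0"

text \<open>
  The transmission conditions involve values at the endpoint, hence they are imposed on the
  regular representative \<open>v\<close> of \<open>u\<close>.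
\<close>

definition dom_A :: "nat \<Rightarrow> (nat \<Rightarrow> real) \<Rightarrow> (nat \<Rightarrow> real \<Rightarrow> complex) set" where
  "dom_A n c = {u. (\<forall>k\<in>{1..n}. u k \<in> H2) \<and>
     (\<exists>v. (\<forall>k\<in>{1..n}. AE x in branch. v k x = u k x) \<and> T0 n v \<and> T1 n c v)}"

definition A :: "(nat \<Rightarrow> real) \<Rightarrow> (nat \<Rightarrow> real) \<Rightarrow> (nat \<Rightarrow> real \<Rightarrow> complex) \<Rightarrow> nat \<Rightarrow> real \<Rightarrow> complex" where
  "A c a u k x = - of_real (c k) * weak_deriv 2 (u k) x + of_real (a k) * u k x"

primrec dom_A_pow ::
  "nat \<Rightarrow> (nat \<Rightarrow> real) \<Rightarrow> (nat \<Rightarrow> real) \<Rightarrow> nat \<Rightarrow> (nat \<Rightarrow> real \<Rightarrow> complex) set" where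
  "dom_A_pow n c a 0 = H n"
| "dom_A_pow n c a (Suc j) = {u \<in> dom_A n c. A c a u \<in> dom_A_pow n c a j}"

section \<open>Generalized eigenfunctions\<close>

text \<open>
  The square root is taken with arguments in \<open>[-\<pi>, \<pi>)\<close>. The library's \<open>Arg\<close> and \<open>csqrt\<close> use
  \<open>(-\<pi>, \<pi>]\<close>, which gives the opposite sign on the negative real axis.
\<close>

definition lower_arg :: "complex \<Rightarrow> real" where
  "lower_arg z = (if Arg z = pi then - pi else Arg z)"

definition lower_sqrt :: "complex \<Rightarrow> complex" where
  "lower_sqrt z = rcis (sqrt (cmod z)) (lower_arg z / 2)"

lemma lower_sqrt_rcis:
  assumes "r > 0" "- pi \<le> \<phi>" "\<phi> < pi"
  shows "lower_sqrt (rcis r \<phi>) = rcis (sqrt r) (\<phi> / 2)"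
proof -
  have "Arg (rcis r \<phi>) = (if \<phi> = - pi then pi else \<phi>)"
  proof (rule cis_Arg_unique)
    show "sgn (rcis r \<phi>) = cis (if \<phi> = - pi then pi else \<phi>)"
      using assms(1) by (auto simp: rcis_def sgn_mult sgn_of_real complex_eq_iff sgn_eq norm_mult)
  qed (use assms in auto)
  then have "lower_arg (rcis r \<phi>) = \<phi>"
    using assms by (auto simp: lower_arg_def)
  then show ?thesis
    using assms by (simp add: lower_sqrt_def)
qed

definition xi :: "(nat \<Rightarrow> real) \<Rightarrow> (nat \<Rightarrow> real) \<Rightarrow> nat \<Rightarrow> complex \<Rightarrow> complex" where
  "xi c a k z = lower_sqrt ((z - of_real (a k)) / of_real (c k))"

definition s :: "nat \<Rightarrow> (nat \<Rightarrow> real) \<Rightarrow> (nat \<Rightarrow> real) \<Rightarrow> nat \<Rightarrow> complex \<Rightarrow> complex" where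
  "s n c a k z = - (\<Sum>l\<in>{1..n} - {k}. of_real (c l) * xi c a l z) / (of_real (c k) * xi c a k z)"

text \<open>\<open>F_minus n c a z j k\<close> is the component on branch \<open>k\<close> of the \<open>j\<close>-th eigenfunction.\<close>

definition F_minus ::
  "nat \<Rightarrow> (nat \<Rightarrow> real) \<Rightarrow> (nat \<Rightarrow> real) \<Rightarrow> complex \<Rightarrow> nat \<Rightarrow> nat \<Rightarrow> real \<Rightarrow> complex" where
  "F_minus n c a z j k x =
     (if k = j
      then cos (xi c a j z * of_real x) - \<i> * s n c a j z * sin (xi c a j z * of_real x)
      else exp (- \<i> * xi c a k z * of_real x))"

definition w :: "nat \<Rightarrow> (nat \<Rightarrow> real) \<Rightarrow> (nat \<Rightarrow> real) \<Rightarrow> real \<Rightarrow> complex" where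
  "w n c a \<mu> = - \<i> * (\<Sum>j\<in>{1..n}. of_real (c j) * xi c a j (of_real \<mu>))"

section \<open>The weighted spaces and the transform \<open>V\<close>\<close>

text \<open>The spectral variable is written \<open>\<mu>\<close>. For \<open>\<mu> > a k\<close> the number \<open>xi c a k \<mu>\<close> is real (and positive); \<open>Re\<close> only adjusts the type.\<close>

definition sigma :: "nat \<Rightarrow> (nat \<Rightarrow> real) \<Rightarrow> (nat \<Rightarrow> real) \<Rightarrow> nat \<Rightarrow> real \<Rightarrow> real" where
  "sigma n c a k \<mu> = 1 / pi * (c k * Re (xi c a k (of_real \<mu>)) / (cmod (w n c a \<mu>))\<^sup>2)"

definition sigma_measure :: "nat \<Rightarrow> (nat \<Rightarrow> real) \<Rightarrow> (nat \<Rightarrow> real) \<Rightarrow> nat \<Rightarrow> real measure" where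
  "sigma_measure n c a k =
     density (restrict_space lborel {a k..}) (\<lambda>\<mu>. ennreal (sigma n c a k \<mu>))"

definition L2_sigma :: "nat \<Rightarrow> (nat \<Rightarrow> real) \<Rightarrow> (nat \<Rightarrow> real) \<Rightarrow> (nat \<Rightarrow> real \<Rightarrow> complex) set" where
  "L2_sigma n c a = prod_L2 n (sigma_measure n c a)"

definition V_test ::
  "nat \<Rightarrow> (nat \<Rightarrow> real) \<Rightarrow> (nat \<Rightarrow> real) \<Rightarrow> (nat \<Rightarrow> real \<Rightarrow> complex) \<Rightarrow> nat \<Rightarrow> real \<Rightarrow> complex" where
  "V_test n c a f k \<mu> =
     (\<Sum>m\<in>{1..n}. \<integral>x. f m x * cnj (F_minus n c a (of_real \<mu>) k m x) \<partial>branch)"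

text \<open>
  The extension by continuity: \<open>V u\<close> is the limit in \<open>L2_sigma\<close> of \<open>V_test (\<phi> i)\<close> for test
  tuples \<open>\<phi> i\<close> converging to \<open>u\<close> in \<open>H\<close>. Since \<open>V_test\<close> is isometric and the test tuples are
  dense, the limit exists and, as an element of \<open>L2_sigma\<close>, does not depend on the sequence;
  \<open>SOME\<close> only picks a representative of it.
\<close>

definition V ::
  "nat \<Rightarrow> (nat \<Rightarrow> real) \<Rightarrow> (nat \<Rightarrow> real) \<Rightarrow> (nat \<Rightarrow> real \<Rightarrow> complex) \<Rightarrow> nat \<Rightarrow> real \<Rightarrow> complex" where
  "V n c a u = (SOME G. G \<in> L2_sigma n c a \<and>
     (\<exists>\<phi> :: nat \<Rightarrow> nat \<Rightarrow> real \<Rightarrow> complex.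
        (\<forall>i. \<forall>k\<in>{1..n}. \<phi> i k \<in> test_functions) \<and>
        (\<lambda>i. prod_L2_norm n (\<lambda>k. branch) (\<lambda>k x. \<phi> i k x - u k x)) \<longlonglongrightarrow> 0 \<and>
        (\<lambda>i. prod_L2_norm n (sigma_measure n c a) (\<lambda>k \<mu>. V_test n c a (\<phi> i) k \<mu> - G k \<mu>))
          \<longlonglongrightarrow> 0))"

end

theory Submission
  imports Defs "HOL-Complex_Analysis.Complex_Analysis"
begin

text \<open>Branches are numbered from \<open>1\<close> and first derivatives are written
  \<open>vderiv 1\<close>; simplification must not turn this \<open>1\<close> into
  \<open>Suc 0\<close>. Where the recursion of \<open>vderiv\<close> is wanted,
  \<open>One_nat_def\<close> is supplied by hand.\<close>

declare One_nat_def [simp del]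

text \<open>
  The isometry of the transform on test functions is a contour integral. With \<open>\<lambda> = a 1 + \<zeta>\<^sup>2\<close>, the form
  \<open>2 \<zeta> ((A - \<lambda>)\<^sup>-\<^sup>1 f, f)\<close>, written down from the Green kernels of the branches, is holomorphic in the open
  fourth quadrant and behaves like \<open>- 2 |f|\<^sup>2 / \<zeta>\<close> at infinity. Its integral along the imaginary axis
  is real, so Cauchy's theorem on a growing triangle expresses \<open>|f|\<^sup>2\<close> by the imaginary part on the real axis, which
  an algebraic identity turns into the sum of the \<open>|(V f)\<^sub>k|\<^sup>2 \<sigma>\<^sub>k\<close>.

  If \<open>u\<close> lies in the domain, integration by parts on \<open>[0, N]\<close> shows that \<open>V (A u)\<close> and \<open>\<mu> V u\<close> differ by
  boundary terms at \<open>N\<close>, which vanish along a sequence tending to infinity; hence \<open>V (A u) = \<mu> V u\<close>.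
  Conversely, let \<open>\<mu> V u\<close> be square integrable and \<open>f\<close> its image under the adjoint of \<open>V\<close>. Then
  \<open>(u, A \<psi>) = (f, \<psi>)\<close> for every \<open>\<psi>\<close> in the domain: test functions give \<open>- c u'' + a u = f\<close> weakly, and
  functions that are linear near \<open>0\<close> give the transmission conditions. Powers follow by induction.
\<close>

section \<open>The space \<open>L\<^sup>2\<close>\<close>

text \<open>\<open>V\<close> picks a limit by \<open>SOME\<close>, so nothing can be said about it
  until such limits exist; this is why the isometry on test tuples comes first. The factor
  \<open>2 \<zeta>\<close> is the Jacobian of \<lambda> = a 1 + \<zeta>^2, so the imaginary part on
  the real half-axis is Stone's formula for the spectral measure, written in \<zeta>. In this
  variable all square roots extend continuously to the whole boundary, thresholds included. The
  resolvent decays like - 1 / \<lambda>; the quarter turn of - 2 |f|^2 / \<zeta> along the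
  hypotenuse gives \<i> \<pi> |f|^2, the source of the \<pi> in \<open>sigma\<close>. The
  eigenfunctions do not belong to \<open>H n\<close>, hence the cut at N; that the boundary terms
  die out rests on v' being in L^2, which is derived from v and v'' being in L^2. The converse is
  the chain (u, A \<psi>) = (V u, \<mu> V \<psi>) = (\<mu> V u, V \<psi>) = (f, \<psi>), where \<mu>
  is real and f comes from projecting \<mu> V u onto the closed range of \<open>V\<close>.\<close>

definition l2norm :: "real measure \<Rightarrow> (real \<Rightarrow> complex) \<Rightarrow> real" where
  "l2norm M f = sqrt (\<integral>x. (cmod (f x))\<^sup>2 \<partial>M)"

lemma L2_measurable: "f \<in> L2 M \<Longrightarrow> f \<in> borel_measurable M"
  by (simp add: L2_def)

lemma L2_integrable: "f \<in> L2 M \<Longrightarrow> integrable M (\<lambda>x. (cmod (f x))\<^sup>2)"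
  by (simp add: L2_def)

lemma l2norm_nonneg [simp]: "l2norm M f \<ge> 0"
  by (simp add: l2norm_def)

lemma l2norm_power2: "(l2norm M f)\<^sup>2 = (\<integral>x. (cmod (f x))\<^sup>2 \<partial>M)"
  by (simp add: l2norm_def)

lemma L2_zero [simp]: "(\<lambda>x. 0) \<in> L2 M"
  by (simp add: L2_def)

lemma l2norm_zero [simp]: "l2norm M (\<lambda>x. 0) = 0"
  by (simp add: l2norm_def)

lemma l2norm_cong_AE:
  assumes "f \<in> borel_measurable M" "g \<in> borel_measurable M" "AE x in M. f x = g x"
  shows "l2norm M f = l2norm M g"
  unfolding l2norm_def using assms by (intro arg_cong[where f=sqrt] integral_cong_AE) auto

lemma L2_cong_AE:
  assumes "f \<in> L2 M" "g \<in> borel_measurable M" "AE x in M. f x = g x"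
  shows "g \<in> L2 M"
proof -
  have "integrable M (\<lambda>x. (cmod (g x))\<^sup>2) \<longleftrightarrow> integrable M (\<lambda>x. (cmod (f x))\<^sup>2)"
    using assms L2_measurable[OF assms(1)] by (intro integrable_cong_AE) auto
  then show ?thesis using assms by (simp add: L2_def)
qed

lemma L2_bound:
  assumes "g \<in> borel_measurable M" "integrable M h" "AE x in M. (cmod (g x))\<^sup>2 \<le> h x"
  shows "g \<in> L2 M"
  unfolding L2_def using assms
  by (auto intro!: Bochner_Integration.integrable_bound[OF assms(2)] elim!: eventually_mono)

lemma power2_sum_le: "(x + y)\<^sup>2 \<le> 2 * x\<^sup>2 + 2 * (y::real)\<^sup>2"
  using sum_squares_bound[of x y] by (simp add: power2_sum)

lemma L2_add:
  assumes "f \<in> L2 M" "g \<in> L2 M"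
  shows "(\<lambda>x. f x + g x) \<in> L2 M"
proof (rule L2_bound)
  show "integrable M (\<lambda>x. 2 * (cmod (f x))\<^sup>2 + 2 * (cmod (g x))\<^sup>2)"
    using assms[THEN L2_integrable] by simp
  have "(cmod (f x + g x))\<^sup>2 \<le> 2 * (cmod (f x))\<^sup>2 + 2 * (cmod (g x))\<^sup>2" for x
    by (rule order_trans[OF power_mono[OF norm_triangle_ineq] power2_sum_le]) auto
  then show "AE x in M. (cmod (f x + g x))\<^sup>2 \<le> 2 * (cmod (f x))\<^sup>2 + 2 * (cmod (g x))\<^sup>2"
    by simp
qed (use assms in \<open>auto dest!: L2_measurable\<close>)

lemma L2_mult_bounded:
  assumes "f \<in> L2 M" "g \<in> borel_measurable M" "AE x in M. cmod (g x) \<le> C"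
  shows "(\<lambda>x. g x * f x) \<in> L2 M"
proof (rule L2_bound)
  show "integrable M (\<lambda>x. C\<^sup>2 * (cmod (f x))\<^sup>2)"
    using assms(1)[THEN L2_integrable] by simp
  show "AE x in M. (cmod (g x * f x))\<^sup>2 \<le> C\<^sup>2 * (cmod (f x))\<^sup>2"
    using assms(3) by eventually_elim (auto simp: norm_mult power_mult_distrib intro!: mult_right_mono power_mono)
qed (use assms in \<open>auto dest!: L2_measurable\<close>)

lemma L2_cmult: "f \<in> L2 M \<Longrightarrow> (\<lambda>x. z * f x) \<in> L2 M"
  by (rule L2_mult_bounded[where C="cmod z"]) auto

lemma L2_uminus: "f \<in> L2 M \<Longrightarrow> (\<lambda>x. - f x) \<in> L2 M"
  using L2_cmult[of f M "-1"] by simp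

lemma L2_diff: "f \<in> L2 M \<Longrightarrow> g \<in> L2 M \<Longrightarrow> (\<lambda>x. f x - g x) \<in> L2 M"
  using L2_add[OF _ L2_uminus, of f M g] by simp

lemma l2norm_cmult: "l2norm M (\<lambda>x. z * f x) = cmod z * l2norm M f"
  by (simp add: l2norm_def norm_mult power_mult_distrib real_sqrt_mult)

lemma L2_mult_norm_integrable:
  assumes "f \<in> L2 M" "g \<in> L2 M"
  shows "integrable M (\<lambda>x. cmod (f x) * cmod (g x))"
proof (rule Bochner_Integration.integrable_bound)
  show "integrable M (\<lambda>x. (cmod (f x))\<^sup>2 + (cmod (g x))\<^sup>2)"
    using assms[THEN L2_integrable] by simp
  have "cmod (f x) * cmod (g x) \<le> (cmod (f x))\<^sup>2 + (cmod (g x))\<^sup>2" for x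
    using sum_squares_bound[of "cmod (f x)" "cmod (g x)"] mult_nonneg_nonneg[of "cmod (f x)" "cmod (g x)"]
    by (simp del: mult_nonneg_nonneg)
  then show "AE x in M. norm (cmod (f x) * cmod (g x)) \<le> norm ((cmod (f x))\<^sup>2 + (cmod (g x))\<^sup>2)"
    by (simp add: abs_mult)
qed (use assms in \<open>auto dest!: L2_measurable\<close>)

lemma L2_mult_integrable:
  assumes "f \<in> L2 M" "g \<in> L2 M"
  shows "integrable M (\<lambda>x. f x * g x)"
  by (rule Bochner_Integration.integrable_bound[OF L2_mult_norm_integrable[OF assms]])
     (use assms in \<open>auto dest!: L2_measurable simp: norm_mult\<close>)

section \<open>The inequalities of Cauchy-Schwarz and Minkowski\<close>

text \<open>The square of t |f| - |g| integrates to a quadratic polynomial in the real variable t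
  that is never negative; the inequality is the sign of its discriminant.\<close>

lemma L2_Cauchy_Schwarz_norm:
  assumes "f \<in> L2 M" "g \<in> L2 M"
  shows "(\<integral>x. cmod (f x) * cmod (g x) \<partial>M) \<le> l2norm M f * l2norm M g"
proof -
  define p where "p = (\<integral>x. (cmod (f x))\<^sup>2 \<partial>M)"
  define q where "q = (\<integral>x. (cmod (g x))\<^sup>2 \<partial>M)"
  define b where "b = (\<integral>x. cmod (f x) * cmod (g x) \<partial>M)"
  have int: "integrable M (\<lambda>x. (cmod (f x))\<^sup>2)" "integrable M (\<lambda>x. (cmod (g x))\<^sup>2)"
    "integrable M (\<lambda>x. cmod (f x) * cmod (g x))"
    using assms[THEN L2_integrable] L2_mult_norm_integrable[OF assms] by auto
  have pos: "p \<ge> 0" "q \<ge> 0" "b \<ge> 0" by (auto simp: p_def q_def b_def)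
  have *: "0 \<le> t\<^sup>2 * p - 2 * t * b + q" for t :: real
  proof -
    have "0 \<le> (\<integral>x. (t * cmod (f x) - cmod (g x))\<^sup>2 \<partial>M)" by simp
    also have "\<dots> = (\<integral>x. t\<^sup>2 * (cmod (f x))\<^sup>2 - 2 * t * (cmod (f x) * cmod (g x)) + (cmod (g x))\<^sup>2 \<partial>M)"
      by (intro Bochner_Integration.integral_cong) (auto simp: power2_eq_square algebra_simps)
    also have "\<dots> = t\<^sup>2 * p - 2 * t * b + q"
      using int by (simp add: p_def q_def b_def)
    finally show ?thesis .
  qed
  have "b\<^sup>2 \<le> p * q"
  proof (cases "p = 0")
    case True
    have "b = 0"
    proof (rule ccontr)
      assume "b \<noteq> 0"
      then have "2 * ((q+1)/b) * b = 2 * (q + 1)" by simp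
      \<comment> \<open>For \<open>p = 0\<close> the polynomial is linear in t; at this t it equals
        \<open>- q - 2\<close>, which is negative.\<close>
      with *[of "(q+1)/b"] True pos show False by simp
    qed
    then show ?thesis using True by simp
  next
    case False
    then have "p > 0" using pos by simp
    \<comment> \<open>The polynomial attains its minimum at t = b / p.\<close>
    have "0 \<le> (b/p)\<^sup>2 * p - 2 * (b/p) * b + q" by (rule *)
    also have "\<dots> = q - b\<^sup>2 / p" using \<open>p > 0\<close> by (simp add: power2_eq_square field_simps)
    finally show ?thesis using \<open>p > 0\<close> by (simp add: field_simps)
  qed
  then have "b \<le> sqrt (p * q)" by (rule real_le_rsqrt)
  then show ?thesis by (simp add: l2norm_def p_def q_def b_def real_sqrt_mult)
qed

lemma L2_Cauchy_Schwarz: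
  assumes "f \<in> L2 M" "g \<in> L2 M"
  shows "cmod (\<integral>x. f x * g x \<partial>M) \<le> l2norm M f * l2norm M g"
proof -
  have "cmod (\<integral>x. f x * g x \<partial>M) \<le> (\<integral>x. cmod (f x * g x) \<partial>M)" by (rule integral_norm_bound)
  then show ?thesis using L2_Cauchy_Schwarz_norm[OF assms] by (simp add: norm_mult)
qed

lemma l2norm_triangle:
  assumes "f \<in> L2 M" "g \<in> L2 M"
  shows "l2norm M (\<lambda>x. f x + g x) \<le> l2norm M f + l2norm M g"
proof -
  have int: "integrable M (\<lambda>x. (cmod (f x))\<^sup>2)" "integrable M (\<lambda>x. (cmod (g x))\<^sup>2)"
    "integrable M (\<lambda>x. cmod (f x) * cmod (g x))"
    using assms[THEN L2_integrable] L2_mult_norm_integrable[OF assms] by auto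
  have "(l2norm M (\<lambda>x. f x + g x))\<^sup>2 \<le>
    (\<integral>x. (cmod (f x))\<^sup>2 + 2 * (cmod (f x) * cmod (g x)) + (cmod (g x))\<^sup>2 \<partial>M)"
    unfolding l2norm_power2
  proof (rule integral_mono)
    show "(cmod (f x + g x))\<^sup>2 \<le> (cmod (f x))\<^sup>2 + 2 * (cmod (f x) * cmod (g x)) + (cmod (g x))\<^sup>2" for x
      using power_mono[OF norm_triangle_ineq[of "f x" "g x"], of 2] by (simp add: power2_sum algebra_simps)
  qed (use int L2_integrable[OF L2_add[OF assms]] in auto)
  also have "\<dots> \<le> (l2norm M f + l2norm M g)\<^sup>2"
    using int L2_Cauchy_Schwarz_norm[OF assms] by (simp add: power2_sum l2norm_power2)
  finally show ?thesis by (rule power2_le_imp_le) (simp)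
qed

lemma l2norm_triangle_diff:
  assumes "f \<in> L2 M" "g \<in> L2 M" "h \<in> L2 M"
  shows "l2norm M (\<lambda>x. f x - h x) \<le> l2norm M (\<lambda>x. f x - g x) + l2norm M (\<lambda>x. g x - h x)"
  using l2norm_triangle[OF L2_diff[OF assms(1,2)] L2_diff[OF assms(2,3)]] by simp

lemma l2norm_eq_0_imp_AE:
  assumes "f \<in> L2 M" "l2norm M f = 0"
  shows "AE x in M. f x = 0"
proof -
  have "(\<integral>x. (cmod (f x))\<^sup>2 \<partial>M) = 0" using assms(2) by (simp add: l2norm_def)
  then have "AE x in M. (cmod (f x))\<^sup>2 = 0"
    using integral_nonneg_eq_0_iff_AE[OF L2_integrable[OF assms(1)]] by simp
  then show ?thesis by simp
qed

lemma l2norm_dominated: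
  fixes g :: "real \<Rightarrow> real"
  assumes "\<And>i. F i \<in> borel_measurable M" "f \<in> borel_measurable M"
    and "integrable M (\<lambda>x. (g x)\<^sup>2)"
    and "\<And>i. AE x in M. cmod (F i x - f x) \<le> g x"
    and "AE x in M. (\<lambda>i. F i x) \<longlonglongrightarrow> f x"
  shows "(\<lambda>i. l2norm M (\<lambda>x. F i x - f x)) \<longlonglongrightarrow> 0"
proof -
  have "(\<lambda>i. \<integral>x. (cmod (F i x - f x))\<^sup>2 \<partial>M) \<longlonglongrightarrow> (\<integral>x. 0 \<partial>M)"
  proof (rule integral_dominated_convergence)
    show "AE x in M. (\<lambda>i. (cmod (F i x - f x))\<^sup>2) \<longlonglongrightarrow> 0"
      using assms(5)
    proof eventually_elim
      case (elim x)
      then have "(\<lambda>i. (cmod (F i x - f x))\<^sup>2) \<longlonglongrightarrow> (cmod (f x - f x))\<^sup>2" by (intro tendsto_intros)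
      then show ?case by simp
    qed
    show "AE x in M. norm ((cmod (F i x - f x))\<^sup>2) \<le> (g x)\<^sup>2" for i
      using assms(4)[of i] by eventually_elim (auto intro!: power_mono)
  qed (use assms in auto)
  then have "(\<lambda>i. sqrt (\<integral>x. (cmod (F i x - f x))\<^sup>2 \<partial>M)) \<longlonglongrightarrow> sqrt 0"
    by (intro tendsto_real_sqrt) simp
  then show ?thesis by (simp add: l2norm_def)
qed

section \<open>Almost everywhere convergence and completeness\<close>

lemma l2norm_tendsto_AE_subseq:
  assumes "\<And>i. F i \<in> L2 M" "f \<in> L2 M" "(\<lambda>i. l2norm M (\<lambda>x. F i x - f x)) \<longlonglongrightarrow> 0"
  shows "\<exists>r :: nat \<Rightarrow> nat. strict_mono r \<and> (AE x in M. (\<lambda>i. F (r i) x) \<longlonglongrightarrow> f x)"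
proof -
  have "(\<lambda>i. \<integral>x. norm ((cmod (F i x - f x))\<^sup>2) \<partial>M) \<longlonglongrightarrow> 0"
    using tendsto_power[OF assms(3), of 2] by (simp add: l2norm_power2)
  from tendsto_L1_AE_subseq[OF L2_integrable[OF L2_diff[OF assms(1,2)]] this]
  obtain r :: "nat \<Rightarrow> nat" where r: "strict_mono r" "AE x in M. (\<lambda>i. (cmod (F (r i) x - f x))\<^sup>2) \<longlonglongrightarrow> 0" by blast
  from r(2) have "AE x in M. (\<lambda>i. F (r i) x) \<longlonglongrightarrow> f x"
  proof eventually_elim
    case (elim x)
    from tendsto_real_sqrt[OF this] have "(\<lambda>i. F (r i) x - f x) \<longlonglongrightarrow> 0"
      by (simp add: tendsto_norm_zero_iff)
    then show ?case by (simp add: LIM_zero_iff)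
  qed
  with r(1) show ?thesis by blast
qed

text \<open>Fatou's lemma for the squares delivers membership in L^2 together with the bound. It
  serves limits that are known only pointwise: the limit in the completeness proof, and later a
  derivative exhausted by its truncations.\<close>

lemma l2norm_Fatou:
  assumes "\<And>i. F i \<in> L2 M" "f \<in> borel_measurable M" "AE x in M. (\<lambda>i. F i x) \<longlonglongrightarrow> f x"
    and "\<And>i. l2norm M (F i) \<le> C"
  shows "f \<in> L2 M \<and> l2norm M f \<le> C"
proof -
  have [measurable]: "F i \<in> borel_measurable M" for i using L2_measurable[OF assms(1)] .
  note [measurable] = assms(2)
  have C: "C \<ge> 0" using assms(4)[of 0] l2norm_nonneg[of M "F 0"] by linarith
  have "(\<integral>\<^sup>+x. ennreal ((cmod (f x))\<^sup>2) \<partial>M) = (\<integral>\<^sup>+x. liminf (\<lambda>i. ennreal ((cmod (F i x))\<^sup>2)) \<partial>M)"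
  proof (rule nn_integral_cong_AE, use assms(3) in eventually_elim)
    case (elim x)
    then have "(\<lambda>i. ennreal ((cmod (F i x))\<^sup>2)) \<longlonglongrightarrow> ennreal ((cmod (f x))\<^sup>2)"
      by (intro tendsto_intros)
    from lim_imp_Liminf[OF sequentially_bot this] show ?case by simp
  qed
  also have "\<dots> \<le> liminf (\<lambda>i. \<integral>\<^sup>+x. ennreal ((cmod (F i x))\<^sup>2) \<partial>M)"
    by (rule nn_integral_liminf) simp
  also have "\<dots> \<le> liminf (\<lambda>i. ennreal (C\<^sup>2))"
  proof (rule Liminf_mono, rule always_eventually, rule allI)
    fix i
    have "(\<integral>\<^sup>+x. ennreal ((cmod (F i x))\<^sup>2) \<partial>M) = ennreal ((l2norm M (F i))\<^sup>2)"
      unfolding l2norm_power2 by (rule nn_integral_eq_integral[OF L2_integrable[OF assms(1)]]) auto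
    also have "\<dots> \<le> ennreal (C\<^sup>2)" using assms(4)[of i] by (intro ennreal_leI power_mono) auto
    finally show "(\<integral>\<^sup>+x. ennreal ((cmod (F i x))\<^sup>2) \<partial>M) \<le> ennreal (C\<^sup>2)" .
  qed
  also have "\<dots> = ennreal (C\<^sup>2)" by (simp add: Liminf_const)
  finally have le: "(\<integral>\<^sup>+x. ennreal ((cmod (f x))\<^sup>2) \<partial>M) \<le> ennreal (C\<^sup>2)" .
  then have int: "integrable M (\<lambda>x. (cmod (f x))\<^sup>2)"
    by (intro integrableI_bounded) (auto simp: top.extremum_strict order_le_less_trans)
  have "ennreal ((l2norm M f)\<^sup>2) \<le> ennreal (C\<^sup>2)"
    unfolding l2norm_power2 using le nn_integral_eq_integral[OF int] by simp
  then have "(l2norm M f)\<^sup>2 \<le> C\<^sup>2" by (simp add: ennreal_le_iff)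
  then show ?thesis using int assms(2) C by (auto simp: L2_def intro: power2_le_imp_le)
qed

text \<open>Riesz-Fischer: a subsequence with geometrically small increments converges almost
  everywhere, and Fatou's lemma turns the Cauchy property of the whole sequence into convergence to
  that pointwise limit.\<close>

lemma L2_complete:
  fixes F :: "nat \<Rightarrow> real \<Rightarrow> complex"
  assumes F: "\<And>i. F i \<in> L2 M"
    and Cauchy: "\<And>e. e > 0 \<Longrightarrow> \<exists>N. \<forall>i\<ge>N. \<forall>j\<ge>N. l2norm M (\<lambda>x. F i x - F j x) < e"
  shows "\<exists>f\<in>L2 M. (\<lambda>i. l2norm M (\<lambda>x. F i x - f x)) \<longlonglongrightarrow> 0"
proof -
  have [measurable]: "F i \<in> borel_measurable M" for i using L2_measurable[OF F] .
  have "\<forall>m. \<exists>N. \<forall>i\<ge>N. \<forall>j\<ge>N. l2norm M (\<lambda>x. F i x - F j x) < (1/2)^m"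
    using Cauchy by simp
  then obtain N where N: "\<And>m i j. i \<ge> N m \<Longrightarrow> j \<ge> N m \<Longrightarrow> l2norm M (\<lambda>x. F i x - F j x) < (1/2)^m"
    by metis
  \<comment> \<open>The sum bounds every \<open>N i\<close> with i \<le> m at once, so the tail of
    \<open>r\<close> from \<open>m\<close> on stays above \<open>N m\<close> although
    \<open>N\<close> need not be monotone.\<close>
  define r where "r m = (\<Sum>i\<le>m. N i)" for m
  have rN: "r m \<ge> N m" for m unfolding r_def by (rule member_le_sum) auto
  have rS: "r (Suc m) \<ge> N m" for m using rN[of m] by (simp add: r_def)
  define D where "D m x = F (r (Suc m)) x - F (r m) x" for m x
  have D: "D m \<in> L2 M" for m unfolding D_def by (intro L2_diff F)
  have [measurable]: "D m \<in> borel_measurable M" for m using L2_measurable[OF D] .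
  \<comment> \<open>The squared increments have integral below (1/4)^m, so the weight 2^m leaves a
    convergent series of integrals; at almost every point it forces the increments to decay like
    (1/2)^(m/2).\<close>
  have "(\<integral>\<^sup>+x. (\<Sum>m. ennreal (2^m * (cmod (D m x))\<^sup>2)) \<partial>M) = (\<Sum>m. \<integral>\<^sup>+x. ennreal (2^m * (cmod (D m x))\<^sup>2) \<partial>M)"
    by (rule nn_integral_suminf) simp
  also have "\<dots> \<le> (\<Sum>m. ennreal ((1/2)^m))"
  proof (rule suminf_le)
    fix m
    have "(\<integral>\<^sup>+x. ennreal (2^m * (cmod (D m x))\<^sup>2) \<partial>M) = ennreal (2^m * (l2norm M (D m))\<^sup>2)"
      using nn_integral_eq_integral[of M "\<lambda>x. 2^m * (cmod (D m x))\<^sup>2"] L2_integrable[OF D[of m]]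
      by (simp add: l2norm_power2)
    also have "2^m * (l2norm M (D m))\<^sup>2 \<le> 2^m * ((1/2)^m)\<^sup>2"
      using N[OF rS rN, of m] by (intro mult_left_mono power_mono) (auto simp: D_def[abs_def])
    also have "\<dots> = (1/2::real)^m" by (simp add: power2_eq_square power_one_over field_simps)
    finally show "(\<integral>\<^sup>+x. ennreal (2^m * (cmod (D m x))\<^sup>2) \<partial>M) \<le> ennreal ((1/2)^m)" by (simp add: ennreal_leI)
  qed auto
  also have "\<dots> = ennreal (\<Sum>m. (1/2)^m)"
    by (rule suminf_ennreal2) (auto intro: summable_geometric)
  finally have "(\<integral>\<^sup>+x. (\<Sum>m. ennreal (2^m * (cmod (D m x))\<^sup>2)) \<partial>M) < \<infinity>"
    by (rule order_le_less_trans) simp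
  then have "AE x in M. (\<Sum>m. ennreal (2^m * (cmod (D m x))\<^sup>2)) \<noteq> \<infinity>"
    by (intro nn_integral_PInf_AE) auto
  then have "AE x in M. summable (\<lambda>m. D m x)"
  proof eventually_elim
    case (elim x)
    have sm: "summable (\<lambda>m. 2^m * (cmod (D m x))\<^sup>2)"
      using elim by (intro summable_suminf_not_top) auto
    have "Bseq (\<lambda>m. 2^m * (cmod (D m x))\<^sup>2)"
      using summable_LIMSEQ_zero[OF sm] by (intro convergent_imp_Bseq convergentI)
    then obtain B where B: "\<And>m. norm (2^m * (cmod (D m x))\<^sup>2) \<le> B"
      by (auto simp: Bseq_def)
    show ?case
    proof (rule summable_comparison_test')
      show "summable (\<lambda>m. sqrt B * (sqrt (1/2))^m)"
        by (intro summable_mult summable_geometric) (simp add: real_sqrt_divide)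
      fix m :: nat
      have "(cmod (D m x))\<^sup>2 \<le> B * (1/2)^m"
        using B[of m] by (simp add: abs_mult power_one_over field_simps)
      then have "cmod (D m x) \<le> sqrt (B * (1/2)^m)" by (rule real_le_rsqrt)
      then show "norm (D m x) \<le> sqrt B * (sqrt (1/2))^m" by (simp add: real_sqrt_mult real_sqrt_power)
    qed
  qed
  then have conv: "AE x in M. convergent (\<lambda>m. F (r m) x)"
  proof eventually_elim
    case (elim x)
    have eq: "(\<Sum>m<k. D m x) = F (r k) x - F (r 0) x" for k
      unfolding D_def by (rule sum_lessThan_telescope)
    have "(\<lambda>k. F (r k) x - F (r 0) x) \<longlonglongrightarrow> suminf (\<lambda>m. D m x)"
      using summable_LIMSEQ[OF elim] by (simp add: eq)
    from tendsto_add[OF this tendsto_const[of "F (r 0) x"]] show ?case by (auto simp: convergent_def)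
  qed
  define f where "f x = lim (\<lambda>m. F (r m) x)" for x
  have [measurable]: "f \<in> borel_measurable M" unfolding f_def by measurable
  have lim: "AE x in M. (\<lambda>m. F (r m) x) \<longlonglongrightarrow> f x"
    using conv unfolding f_def by eventually_elim (simp add: convergent_LIMSEQ_iff)
  \<comment> \<open>Fatou's lemma with \<open>i\<close> fixed and the other index running along the
    subsequence from \<open>m\<close> on.\<close>
  have main: "(\<lambda>x. F i x - f x) \<in> L2 M \<and> l2norm M (\<lambda>x. F i x - f x) \<le> (1/2)^m" if "i \<ge> N m" for i m
  proof (rule l2norm_Fatou[where F="\<lambda>j x. F i x - F (r (m + j)) x"])
    have "r (m + j) \<ge> N m" for j unfolding r_def by (rule member_le_sum) auto
    then show "l2norm M (\<lambda>x. F i x - F (r (m + j)) x) \<le> (1/2)^m" for j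
      using N[OF that, of "r (m+j)"] by (simp add: less_imp_le)
    show "AE x in M. (\<lambda>j. F i x - F (r (m + j)) x) \<longlonglongrightarrow> F i x - f x"
      using lim
    proof eventually_elim
      case (elim x)
      show ?case using LIMSEQ_ignore_initial_segment[OF elim, of m] by (intro tendsto_intros) (simp add: add.commute)
    qed
  qed (use F in \<open>auto intro!: L2_diff\<close>)
  have "f \<in> L2 M"
    using L2_diff[OF F[of "N 0"] conjunct1[OF main[where m=0 and i="N 0", OF order_refl]]] by simp
  moreover have "(\<lambda>i. l2norm M (\<lambda>x. F i x - f x)) \<longlonglongrightarrow> 0"
  proof (rule LIMSEQ_I)
    fix e :: real assume "e > 0"
    then obtain m where m: "(1/2::real)^m < e" using real_arch_pow_inv[of e "1/2"] by auto
    show "\<exists>no. \<forall>i\<ge>no. norm (l2norm M (\<lambda>x. F i x - f x) - 0) < e"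
      using order_le_less_trans[OF conjunct2[OF main] m] by (intro exI[of _ "N m"]) auto
  qed
  ultimately show ?thesis by blast
qed

subsection \<open>Tuples\<close>

lemma prod_L2_norm_eq: "prod_L2_norm n M F = L2_set (\<lambda>k. l2norm (M k) (F k)) {1..n}"
  by (simp add: prod_L2_norm_def L2_set_def l2norm_power2)

lemma prod_L2_norm_nonneg [simp]: "prod_L2_norm n M F \<ge> 0"
  by (simp add: prod_L2_norm_eq L2_set_nonneg)

lemma l2norm_le_prod_L2_norm: "k \<in> {1..n} \<Longrightarrow> l2norm (M k) (F k) \<le> prod_L2_norm n M F"
  unfolding prod_L2_norm_eq by (rule member_le_L2_set) auto

lemma prod_L2_norm_le_sum: "prod_L2_norm n M F \<le> (\<Sum>k\<in>{1..n}. l2norm (M k) (F k))"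
  unfolding prod_L2_norm_eq by (rule L2_set_le_sum) auto

lemma prod_L2_norm_tendsto_0_iff:
  "(\<lambda>i. prod_L2_norm n M (F i)) \<longlonglongrightarrow> 0 \<longleftrightarrow> (\<forall>k\<in>{1..n}. (\<lambda>i. l2norm (M k) (F i k)) \<longlonglongrightarrow> 0)"
proof
  assume *: "(\<lambda>i. prod_L2_norm n M (F i)) \<longlonglongrightarrow> 0"
  show "\<forall>k\<in>{1..n}. (\<lambda>i. l2norm (M k) (F i k)) \<longlonglongrightarrow> 0"
  proof
    fix k assume "k \<in> {1..n}"
    then show "(\<lambda>i. l2norm (M k) (F i k)) \<longlonglongrightarrow> 0"
      by (intro tendsto_sandwich[OF always_eventually always_eventually tendsto_const *])
         (simp_all add: l2norm_le_prod_L2_norm)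
  qed
next
  assume *: "\<forall>k\<in>{1..n}. (\<lambda>i. l2norm (M k) (F i k)) \<longlonglongrightarrow> 0"
  have "(\<lambda>i. \<Sum>k\<in>{1..n}. l2norm (M k) (F i k)) \<longlonglongrightarrow> (\<Sum>k\<in>{1..n}. 0)"
    using * by (intro tendsto_sum) blast
  then have **: "(\<lambda>i. \<Sum>k\<in>{1..n}. l2norm (M k) (F i k)) \<longlonglongrightarrow> 0" by simp
  show "(\<lambda>i. prod_L2_norm n M (F i)) \<longlonglongrightarrow> 0"
    by (rule tendsto_sandwich[OF always_eventually always_eventually tendsto_const **])
       (intro allI prod_L2_norm_nonneg prod_L2_norm_le_sum)+
qed

lemma prod_L2_add: "F \<in> prod_L2 n M \<Longrightarrow> G \<in> prod_L2 n M \<Longrightarrow> (\<lambda>k x. F k x + G k x) \<in> prod_L2 n M"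
  by (auto simp: prod_L2_def intro: L2_add)

lemma prod_L2_diff: "F \<in> prod_L2 n M \<Longrightarrow> G \<in> prod_L2 n M \<Longrightarrow> (\<lambda>k x. F k x - G k x) \<in> prod_L2 n M"
  by (auto simp: prod_L2_def intro: L2_diff)

lemma prod_L2_norm_minus_commute:
  "prod_L2_norm n M (\<lambda>k x. F k x - G k x) = prod_L2_norm n M (\<lambda>k x. G k x - F k x)"
  by (simp add: prod_L2_norm_def norm_minus_commute)

lemma prod_L2_norm_triangle:
  assumes "F \<in> prod_L2 n M" "G \<in> prod_L2 n M"
  shows "prod_L2_norm n M (\<lambda>k x. F k x + G k x) \<le> prod_L2_norm n M F + prod_L2_norm n M G"
proof -
  have "prod_L2_norm n M (\<lambda>k x. F k x + G k x) \<le> L2_set (\<lambda>k. l2norm (M k) (F k) + l2norm (M k) (G k)) {1..n}"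
    unfolding prod_L2_norm_eq using assms by (intro L2_set_mono l2norm_triangle) (auto simp: prod_L2_def)
  also have "\<dots> \<le> prod_L2_norm n M F + prod_L2_norm n M G"
    unfolding prod_L2_norm_eq by (rule L2_set_triangle_ineq)
  finally show ?thesis .
qed

lemma prod_L2_norm_triangle_diff:
  assumes "F \<in> prod_L2 n M" "G \<in> prod_L2 n M" "K \<in> prod_L2 n M"
  shows "prod_L2_norm n M (\<lambda>k x. F k x - K k x) \<le>
    prod_L2_norm n M (\<lambda>k x. F k x - G k x) + prod_L2_norm n M (\<lambda>k x. G k x - K k x)"
  using prod_L2_norm_triangle[OF prod_L2_diff[OF assms(1,2)] prod_L2_diff[OF assms(2,3)]] by simp

lemma prod_L2_norm_abs_diff_le:
  assumes "F \<in> prod_L2 n M" "G \<in> prod_L2 n M"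
  shows "\<bar>prod_L2_norm n M F - prod_L2_norm n M G\<bar> \<le> prod_L2_norm n M (\<lambda>k x. F k x - G k x)"
proof -
  have 0: "(\<lambda>k x. 0) \<in> prod_L2 n M" by (simp add: prod_L2_def)
  show ?thesis
    using prod_L2_norm_triangle_diff[OF assms 0] prod_L2_norm_triangle_diff[OF assms(2,1) 0]
    by (simp add: prod_L2_norm_minus_commute[of n M G F])
qed

lemma prod_L2_norm_eq_0_imp_AE:
  assumes "F \<in> prod_L2 n M" "prod_L2_norm n M F = 0" "k \<in> {1..n}"
  shows "AE x in M k. F k x = 0"
  using assms l2norm_le_prod_L2_norm[OF assms(3), of M F]
  by (intro l2norm_eq_0_imp_AE) (auto simp: prod_L2_def order_antisym)

lemma prod_L2_complete:
  assumes F: "\<And>i. F i \<in> prod_L2 n M"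
    and Cauchy: "\<And>e. e > 0 \<Longrightarrow> \<exists>N. \<forall>i\<ge>N. \<forall>j\<ge>N. prod_L2_norm n M (\<lambda>k x. F i k x - F j k x) < e"
  shows "\<exists>f\<in>prod_L2 n M. (\<lambda>i. prod_L2_norm n M (\<lambda>k x. F i k x - f k x)) \<longlonglongrightarrow> 0"
proof -
  have "\<exists>g\<in>L2 (M k). (\<lambda>i. l2norm (M k) (\<lambda>x. F i k x - g x)) \<longlonglongrightarrow> 0" if k: "k \<in> {1..n}" for k
  proof (rule L2_complete)
    show "F i k \<in> L2 (M k)" for i using F[of i] k by (simp add: prod_L2_def)
    show "\<exists>N. \<forall>i\<ge>N. \<forall>j\<ge>N. l2norm (M k) (\<lambda>x. F i k x - F j k x) < e" if "e > 0" for e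
    proof -
      from Cauchy[OF that] obtain N where N: "\<And>i j. i \<ge> N \<Longrightarrow> j \<ge> N \<Longrightarrow> prod_L2_norm n M (\<lambda>k x. F i k x - F j k x) < e"
        by blast
      show ?thesis
        using order_le_less_trans[OF l2norm_le_prod_L2_norm[OF k] N] by (intro exI[of _ N]) auto
    qed
  qed
  then obtain g where "\<And>k. k \<in> {1..n} \<Longrightarrow> g k \<in> L2 (M k) \<and> (\<lambda>i. l2norm (M k) (\<lambda>x. F i k x - g k x)) \<longlonglongrightarrow> 0"
    by metis
  then show ?thesis by (intro bexI[of _ g]) (auto simp: prod_L2_norm_tendsto_0_iff prod_L2_def)
qed

lemma prod_L2_norm_tendsto_Cauchy:
  assumes F: "\<And>i. F i \<in> prod_L2 n M" and f: "f \<in> prod_L2 n M"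
    and lim: "(\<lambda>i. prod_L2_norm n M (\<lambda>k x. F i k x - f k x)) \<longlonglongrightarrow> 0" and "e > 0"
  shows "\<exists>N. \<forall>i\<ge>N. \<forall>j\<ge>N. prod_L2_norm n M (\<lambda>k x. F i k x - F j k x) < e"
proof -
  from \<open>e > 0\<close> obtain N where N: "\<And>i. i \<ge> N \<Longrightarrow> prod_L2_norm n M (\<lambda>k x. F i k x - f k x) < e / 2"
    using LIMSEQ_D[OF lim, of "e/2"] by auto
  have "prod_L2_norm n M (\<lambda>k x. F i k x - F j k x) < e" if "i \<ge> N" "j \<ge> N" for i j
    using prod_L2_norm_triangle_diff[OF F[of i] f F[of j]] N[OF that(1)] N[OF that(2)]
    by (simp add: prod_L2_norm_minus_commute[of n M f])
  then show ?thesis by blast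
qed

section \<open>Test functions\<close>

definition smooth :: "(real \<Rightarrow> complex) \<Rightarrow> bool" where
  "smooth f \<longleftrightarrow> (\<forall>m x. vderiv m f differentiable (at x))"

lemma vderiv_0 [simp]: "vderiv 0 f = f"
  by (simp add: vderiv_def)

lemma vderiv_Suc: "vderiv (Suc m) f = vderiv m (\<lambda>x. vector_derivative f (at x))"
  unfolding vderiv_def funpow_Suc_right comp_def ..

lemma vderiv_eq:
  assumes "\<And>x. (f has_vector_derivative f' x) (at x)"
  shows "vderiv (Suc m) f = vderiv m f'"
proof -
  have "(\<lambda>x. vector_derivative f (at x)) = f'"
    using assms by (auto intro: vector_derivative_at)
  then show ?thesis by (simp add: vderiv_Suc)
qed

text \<open>A class of functions in which every member has a derivative again in the class consists
  of smooth functions. All closure properties below are proved by naming such a class, without a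
  formula for the m-th derivative.\<close>

lemma smooth_coinduct:
  assumes "P f" and step: "\<And>f. P f \<Longrightarrow> \<exists>f'. P f' \<and> (\<forall>x. (f has_vector_derivative f' x) (at x))"
  shows "smooth f"
proof -
  have "\<forall>x. vderiv m f differentiable (at x)" if "P f" for m f
    using that
  proof (induction m arbitrary: f)
    case 0
    then show ?case using step by (fastforce intro: differentiableI_vector)
  next
    case (Suc m)
    obtain f' where f': "P f'" "\<And>x. (f has_vector_derivative f' x) (at x)" using step[OF Suc.prems] by blast
    show ?case using Suc.IH[OF f'(1)] by (simp add: vderiv_eq[OF f'(2)])
  qed
  then show ?thesis using assms(1) by (auto simp: smooth_def)
qed

lemma smooth_has_derivative:
  assumes "smooth f"
  shows "(f has_vector_derivative vderiv 1 f x) (at x)"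
proof -
  have "vderiv 0 f differentiable (at x)" using assms unfolding smooth_def by blast
  then show ?thesis by (simp add: vector_derivative_works vderiv_Suc One_nat_def)
qed

lemma vderiv_vderiv: "vderiv m (vderiv k f) = vderiv (m + k) f"
  by (simp add: vderiv_def funpow_add)

lemma smooth_vderiv: "smooth f \<Longrightarrow> smooth (vderiv k f)"
  by (auto simp: smooth_def vderiv_vderiv)

lemma smooth_has_derivative':
  assumes "smooth f"
  shows "(vderiv m f has_vector_derivative vderiv (Suc m) f x) (at x)"
  using smooth_has_derivative[OF smooth_vderiv[OF assms, of m]] by (simp add: vderiv_vderiv One_nat_def)

lemma smooth_continuous: "smooth f \<Longrightarrow> continuous_on S f"
  using has_vector_derivative_continuous[OF smooth_has_derivative]
  by (intro continuous_at_imp_continuous_on) blast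

lemma smooth_continuous_vderiv: "smooth f \<Longrightarrow> continuous_on S (vderiv m f)"
  by (rule smooth_continuous[OF smooth_vderiv])

lemma smooth_antiderivative:
  assumes "smooth f'" "\<And>x. (f has_vector_derivative f' x) (at x)"
  shows "smooth f"
proof (rule smooth_coinduct[where P="\<lambda>g. g = f \<or> smooth g"])
  fix g assume "g = f \<or> smooth g"
  then show "\<exists>g'. (g' = f \<or> smooth g') \<and> (\<forall>x. (g has_vector_derivative g' x) (at x))"
    using assms smooth_has_derivative smooth_vderiv by blast
qed simp

lemma smooth_zero: "smooth (\<lambda>x. 0)"
  by (rule smooth_coinduct[where P="\<lambda>f. f = (\<lambda>x. 0)"]) (auto intro!: derivative_eq_intros)

lemma smooth_add: 
  assumes "smooth f" "smooth g"
  shows "smooth (\<lambda>x. f x + g x)"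
proof (rule smooth_coinduct[where P="\<lambda>h. \<exists>f g. smooth f \<and> smooth g \<and> h = (\<lambda>x. f x + g x)"])
  fix h assume "\<exists>f g. smooth f \<and> smooth g \<and> h = (\<lambda>x. f x + g x)"
  then obtain f g where h: "smooth f" "smooth g" "h = (\<lambda>x. f x + g x)" by blast
  have "(h has_vector_derivative vderiv 1 f x + vderiv 1 g x) (at x)" for x
    unfolding h(3) by (intro derivative_intros smooth_has_derivative h(1,2))
  with smooth_vderiv[OF h(1)] smooth_vderiv[OF h(2)]
  show "\<exists>h'. (\<exists>f g. smooth f \<and> smooth g \<and> h' = (\<lambda>x. f x + g x)) \<and> (\<forall>x. (h has_vector_derivative h' x) (at x))"
    by blast
qed (use assms in blast)

lemma smooth_cmult:
  assumes "smooth f"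
  shows "smooth (\<lambda>x. z * f x)"
proof (rule smooth_coinduct[where P="\<lambda>h. \<exists>f. smooth f \<and> h = (\<lambda>x. z * f x)"])
  fix h assume "\<exists>f. smooth f \<and> h = (\<lambda>x. z * f x)"
  then obtain f where h: "smooth f" "h = (\<lambda>x. z * f x)" by blast
  have "(h has_vector_derivative z * vderiv 1 f x) (at x)" for x
    unfolding h(2) by (rule has_vector_derivative_mult_right[OF smooth_has_derivative[OF h(1)]])
  with smooth_vderiv[OF h(1)]
  show "\<exists>h'. (\<exists>f. smooth f \<and> h' = (\<lambda>x. z * f x)) \<and> (\<forall>x. (h has_vector_derivative h' x) (at x))"
    by blast
qed (use assms in blast)

lemma smooth_cnj:
  assumes "smooth f"
  shows "smooth (\<lambda>x. cnj (f x))"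
proof (rule smooth_coinduct[where P="\<lambda>h. \<exists>f. smooth f \<and> h = (\<lambda>x. cnj (f x))"])
  fix h assume "\<exists>f. smooth f \<and> h = (\<lambda>x. cnj (f x))"
  then obtain f where h: "smooth f" "h = (\<lambda>x. cnj (f x))" by blast
  have "(h has_vector_derivative cnj (vderiv 1 f x)) (at x)" for x
    unfolding h(2) by (rule has_vector_derivative_cnj[OF smooth_has_derivative[OF h(1)]])
  with smooth_vderiv[OF h(1)]
  show "\<exists>h'. (\<exists>f. smooth f \<and> h' = (\<lambda>x. cnj (f x))) \<and> (\<forall>x. (h has_vector_derivative h' x) (at x))"
    by blast
qed (use assms in blast)

lemma smooth_affine:
  assumes "smooth f"
  shows "smooth (\<lambda>x. f (r * x + d))"
proof (rule smooth_coinduct[where P="\<lambda>h. \<exists>f. smooth f \<and> h = (\<lambda>x. f (r * x + d))"])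
  fix h assume "\<exists>f. smooth f \<and> h = (\<lambda>x. f (r * x + d))"
  then obtain f where h: "smooth f" "h = (\<lambda>x. f (r * x + d))" by blast
  have "(f \<circ> (\<lambda>x. r * x + d) has_vector_derivative r *\<^sub>R vderiv 1 f (r * x + d)) (at x)" for x
    by (rule vector_diff_chain_at[OF _ smooth_has_derivative[OF h(1)]]) (auto intro!: derivative_eq_intros)
  then have "(h has_vector_derivative of_real r * vderiv 1 f (r * x + d)) (at x)" for x
    by (simp add: h(2) comp_def scaleR_conv_of_real)
  moreover have "smooth (\<lambda>x. of_real r * vderiv 1 f x)"
    by (intro smooth_cmult smooth_vderiv h)
  ultimately
  show "\<exists>h'. (\<exists>f. smooth f \<and> h' = (\<lambda>x. f (r * x + d))) \<and> (\<forall>x. (h has_vector_derivative h' x) (at x))"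
    by (intro exI[of _ "\<lambda>x. of_real r * vderiv 1 f (r * x + d)"] conjI exI[of _ "\<lambda>x. of_real r * vderiv 1 f x"]) auto
qed (use assms in blast)

text \<open>Working form of the definition: the compact support is replaced by an explicit interval,
  and its left end being positive is what keeps the function away from the vertex.\<close>

lemma test_functions_iff:
  "\<phi> \<in> test_functions \<longleftrightarrow> smooth \<phi> \<and> (\<exists>\<alpha> \<beta>. 0 < \<alpha> \<and> \<alpha> \<le> \<beta> \<and> (\<forall>x. x \<notin> {\<alpha>..\<beta>} \<longrightarrow> \<phi> x = 0))"
proof
  assume \<phi>: "\<phi> \<in> test_functions"
  define S where "S = closure {x. \<phi> x \<noteq> 0}"
  have S: "compact S" "S \<subseteq> {0<..}" "\<And>x. \<phi> x \<noteq> 0 \<Longrightarrow> x \<in> S"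
    using \<phi> closure_subset[of "{x. \<phi> x \<noteq> 0}"] by (auto simp: test_functions_def S_def)
  have "\<exists>\<alpha> \<beta>. 0 < \<alpha> \<and> \<alpha> \<le> \<beta> \<and> (\<forall>x. x \<notin> {\<alpha>..\<beta>} \<longrightarrow> \<phi> x = 0)"
  proof (cases "S = {}")
    case True
    then show ?thesis using S(3) by (intro exI[of _ 1]) auto
  next
    case False
    obtain \<alpha> where \<alpha>: "\<alpha> \<in> S" "\<And>x. x \<in> S \<Longrightarrow> \<alpha> \<le> x" using compact_attains_inf[OF S(1) False] by blast
    obtain \<beta> where \<beta>: "\<beta> \<in> S" "\<And>x. x \<in> S \<Longrightarrow> x \<le> \<beta>" using compact_attains_sup[OF S(1) False] by blast
    show ?thesis
      using \<alpha> \<beta> S(2,3) by (intro exI[of _ \<alpha>] exI[of _ \<beta>]) auto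
  qed
  then show "smooth \<phi> \<and> (\<exists>\<alpha> \<beta>. 0 < \<alpha> \<and> \<alpha> \<le> \<beta> \<and> (\<forall>x. x \<notin> {\<alpha>..\<beta>} \<longrightarrow> \<phi> x = 0))"
    using \<phi> by (simp add: test_functions_def smooth_def)
next
  assume "smooth \<phi> \<and> (\<exists>\<alpha> \<beta>. 0 < \<alpha> \<and> \<alpha> \<le> \<beta> \<and> (\<forall>x. x \<notin> {\<alpha>..\<beta>} \<longrightarrow> \<phi> x = 0))"
  then obtain \<alpha> \<beta> where *: "smooth \<phi>" "0 < \<alpha>" "\<alpha> \<le> \<beta>" "\<And>x. x \<notin> {\<alpha>..\<beta>} \<Longrightarrow> \<phi> x = 0" by blast
  have "closure {x. \<phi> x \<noteq> 0} \<subseteq> {\<alpha>..\<beta>}"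
    by (rule closure_minimal) (use *(4) in blast, simp)
  moreover from this have "compact (closure {x. \<phi> x \<noteq> 0})"
    using compact_Int_closed[OF compact_Icc[of \<alpha> \<beta>] closed_closure[of "{x. \<phi> x \<noteq> 0}"]] by (simp add: Int_absorb1)
  ultimately show "\<phi> \<in> test_functions" using * by (force simp: test_functions_def smooth_def)
qed

lemma test_functions_smooth: "\<phi> \<in> test_functions \<Longrightarrow> smooth \<phi>"
  by (simp add: test_functions_iff)

lemma test_functions_support:
  assumes "\<phi> \<in> test_functions"
  obtains \<alpha> \<beta> where "0 < \<alpha>" "\<alpha> \<le> \<beta>" "\<And>x. x \<notin> {\<alpha>..\<beta>} \<Longrightarrow> \<phi> x = 0"
  using assms by (auto simp: test_functions_iff)

lemma test_functions_zero: "(\<lambda>x. 0) \<in> test_functions"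
  by (auto simp: test_functions_iff smooth_zero intro!: exI[of _ "1::real"])

lemma test_functions_add:
  assumes "f \<in> test_functions" "g \<in> test_functions"
  shows "(\<lambda>x. f x + g x) \<in> test_functions"
proof -
  obtain a b where f: "0 < a" "a \<le> b" "\<And>x. x \<notin> {a..b} \<Longrightarrow> f x = 0" using test_functions_support[OF assms(1)] by metis
  obtain a' b' where g: "0 < a'" "a' \<le> b'" "\<And>x. x \<notin> {a'..b'} \<Longrightarrow> g x = 0" using test_functions_support[OF assms(2)] by metis
  have "0 < min a a'" "min a a' \<le> max b b'" "\<forall>x. x \<notin> {min a a'..max b b'} \<longrightarrow> f x + g x = 0"
  proof -
    have "f x + g x = 0" if "x \<notin> {min a a'..max b b'}" for x
    proof -
      have "x \<notin> {a..b}" "x \<notin> {a'..b'}" using that by auto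
      then show ?thesis using f(3) g(3) by simp
    qed
    then show "\<forall>x. x \<notin> {min a a'..max b b'} \<longrightarrow> f x + g x = 0" by blast
  qed (use f g in auto)
  then show ?thesis
    using assms[THEN test_functions_smooth] unfolding test_functions_iff by (blast intro: smooth_add)
qed

lemma test_functions_cmult: "f \<in> test_functions \<Longrightarrow> (\<lambda>x. z * f x) \<in> test_functions"
  by (auto simp: test_functions_iff intro!: smooth_cmult)

lemma vderiv_eq_0_outside:
  assumes "smooth f" "\<And>x. x \<notin> {\<alpha>..\<beta>} \<Longrightarrow> f x = 0" "x \<notin> {\<alpha>..\<beta>}"
  shows "vderiv m f x = 0"
  using assms(3)
proof (induction m arbitrary: x)
  case (Suc m)
  have "open (- {\<alpha>..\<beta>})" by (intro open_Compl closed_atLeastAtMost)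
  then have "((\<lambda>x. 0) has_vector_derivative vderiv (Suc m) f x) (at x)"
    by (rule has_vector_derivative_transform_within_open[OF smooth_has_derivative'[OF assms(1)]])
       (use Suc in auto)
  then show ?case using vector_derivative_unique_at has_vector_derivative_const by blast
qed (use assms(2) in auto)

lemma test_functions_vderiv:
  assumes "f \<in> test_functions"
  shows "vderiv m f \<in> test_functions"
proof -
  obtain \<alpha> \<beta> where *: "0 < \<alpha>" "\<alpha> \<le> \<beta>" "\<And>x. x \<notin> {\<alpha>..\<beta>} \<Longrightarrow> f x = 0" using test_functions_support[OF assms] by metis
  show ?thesis
    using vderiv_eq_0_outside[OF test_functions_smooth[OF assms] *(3)] * smooth_vderiv[OF test_functions_smooth[OF assms]]
    unfolding test_functions_iff by blast
qed

subsection \<open>A smooth step\<close>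

text \<open>The derivatives of \<open>exp (- 1 / (x * (1 - x)))\<close> all have this form, which makes the bump function smooth by coinduction.\<close>

definition bump_fun :: "real poly \<Rightarrow> nat \<Rightarrow> real \<Rightarrow> real" where
  "bump_fun p m x = (if 0 < x \<and> x < 1 then poly p x / (x * (1 - x)) ^ m * exp (- 1 / (x * (1 - x))) else 0)"

lemma power_div_fact_le_exp:
  assumes "x \<ge> (0::real)"
  shows "x ^ k / fact k \<le> exp x"
proof -
  have "(\<Sum>n\<in>{k}. x ^ n /\<^sub>R fact n) \<le> (\<Sum>n. x ^ n /\<^sub>R fact n)"
    using assms by (intro sum_le_suminf summable_exp_generic) auto
  then show ?thesis by (simp add: exp_def field_simps)
qed

text \<open>One term of the exponential series at 1 / q, chosen with two powers of q to spare. The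
  surplus q^2 is what makes difference quotients at the end points of the bump tend to zero.\<close>

lemma exp_inverse_le:
  assumes "q > (0::real)"
  shows "exp (- 1 / q) / q ^ m \<le> fact (m + 2) * q\<^sup>2"
proof -
  have "(1 / q) ^ (m + 2) / fact (m + 2) \<le> exp (1 / q)"
    using assms by (intro power_div_fact_le_exp) simp
  then have "1 \<le> exp (1 / q) * (fact (m + 2) * q ^ (m + 2))"
    using assms by (simp add: power_one_over divide_simps mult_ac del: fact_Suc)
  then have "exp (- 1 / q) * 1 \<le> exp (- 1 / q) * (exp (1 / q) * (fact (m + 2) * q ^ (m + 2)))"
    by (intro mult_left_mono) auto
  also have "\<dots> = exp (- 1 / q) * exp (1 / q) * (fact (m + 2) * q ^ (m + 2))"
    by (rule mult.assoc[symmetric])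
  also have "exp (- 1 / q) * exp (1 / q) = 1"
    by (subst exp_add[symmetric]) simp
  also have "1 * (fact (m + 2) * q ^ (m + 2)) = fact (m + 2) * q\<^sup>2 * q ^ m"
    by (simp only: power_add mult_1_left mult_ac)
  finally show ?thesis using assms by (simp add: divide_simps del: fact_Suc)
qed

text \<open>Inside the unit interval y (1 - y) is at most the distance of y to either end point, so
  the surplus q^2 of \<open>exp_inverse_le\<close> becomes a quadratic bound at both ends.\<close>

lemma bump_fun_bound:
  obtains C where "\<And>x y. x = 0 \<or> x = 1 \<Longrightarrow> \<bar>bump_fun p m y\<bar> \<le> C * (y - x)\<^sup>2"
proof -
  have "compact (poly p ` {0..1})" by (intro compact_continuous_image continuous_intros) auto
  then obtain B where B: "\<And>y. y \<in> {0..1} \<Longrightarrow> \<bar>poly p y\<bar> \<le> B"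
    by (force dest!: compact_imp_bounded simp: bounded_iff)
  have B0: "B \<ge> 0" using B[of 0] by simp
  have "\<bar>bump_fun p m y\<bar> \<le> B * fact (m + 2) * (y - x)\<^sup>2" if x: "x = 0 \<or> x = 1" for x y
  proof (cases "0 < y \<and> y < 1")
    case True
    define q where "q = y * (1 - y)"
    have q: "q > 0" "q \<le> \<bar>y - x\<bar>" using True x by (auto simp: q_def mult_left_le mult_left_le_one_le)
    have "\<bar>bump_fun p m y\<bar> = \<bar>poly p y\<bar> * (exp (- 1 / q) / q ^ m)"
      using True q by (simp add: bump_fun_def q_def[symmetric] abs_mult)
    also have "\<dots> \<le> B * (fact (m + 2) * q\<^sup>2)"
      using B[of y] True exp_inverse_le[OF q(1)] q(1) B0 by (intro mult_mono) auto
    also have "\<dots> \<le> B * (fact (m + 2) * \<bar>y - x\<bar>\<^sup>2)"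
      using q B0 by (intro mult_left_mono power_mono) auto
    finally show ?thesis by (simp add: mult_ac)
  qed (use B0 in \<open>auto simp: bump_fun_def\<close>)
  then show ?thesis by (rule that)
qed

text \<open>With Q = x (1 - x), differentiation produces the denominators Q^m, Q^(m+1) and Q^(m+2);
  \<open>p'\<close> is the numerator over the common denominator Q^(m+2). At the end points the
  quadratic bound gives derivative zero.\<close>

lemma bump_fun_derivative:
  fixes p :: "real poly" and m :: nat
  defines "Q \<equiv> [:0, 1, -1:]" and "Q' \<equiv> [:1, -2:]"
  defines "p' \<equiv> pderiv p * Q\<^sup>2 - smult (real m) (p * Q' * Q) + p * Q'"
  shows "(bump_fun p m has_real_derivative bump_fun p' (m + 2) x) (at x)"
proof -
  consider "0 < x" "x < 1" | "x < 0 \<or> x > 1" | "x = 0 \<or> x = 1" by linarith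
  then show ?thesis
  proof cases
    case 1
    define q where "q = x * (1 - x)"
    have q: "q > 0" using 1 by (simp add: q_def)
    define g where "g x = x * (1 - x)" for x :: real
    have g: "(g has_real_derivative 1 - 2 * x) (at x)" "g x = q"
      unfolding g_def q_def by (auto intro!: derivative_eq_intros)
    have e: "((\<lambda>x. exp (- 1 / g x)) has_real_derivative exp (- 1 / q) * ((1 - 2 * x) / (q * q))) (at x)"
      using q by (auto intro!: derivative_eq_intros g simp: g(2) divide_simps algebra_simps)
    have d: "((\<lambda>x. poly p x / g x ^ m) has_real_derivative
        (poly (pderiv p) x * q ^ m - poly p x * (real m * (q ^ (m - 1) * (1 - 2 * x)))) / (q ^ m * q ^ m)) (at x)"
      using q by (auto intro!: derivative_eq_intros g simp: g(2) One_nat_def)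
    have D: "((\<lambda>x. poly p x / (x * (1 - x)) ^ m * exp (- 1 / (x * (1 - x)))) has_real_derivative
        (poly (pderiv p) x * q ^ m - poly p x * (real m * (q ^ (m - 1) * (1 - 2 * x)))) / (q ^ m * q ^ m) * exp (- 1 / q)
        + poly p x / q ^ m * (exp (- 1 / q) * ((1 - 2 * x) / (q * q)))) (at x)"
      using DERIV_mult[OF d e] by (simp add: g_def q_def mult_ac)
    have eq: "(poly (pderiv p) x * q ^ m - poly p x * (real m * (q ^ (m - 1) * (1 - 2 * x)))) / (q ^ m * q ^ m) * exp (- 1 / q)
        + poly p x / q ^ m * (exp (- 1 / q) * ((1 - 2 * x) / (q * q))) = bump_fun p' (m + 2) x"
    proof -
      have Q: "poly Q x = q" "poly Q' x = 1 - 2 * x" by (auto simp: Q_def Q'_def q_def algebra_simps)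
      \<comment> \<open>The subtraction is truncated; for \<open>m = 0\<close> both sides vanish
        because of the factor \<open>real m\<close>.\<close>
      have "real m * q ^ (m - 1) = real m * q ^ m / q"
        using q by (cases m) auto
      then have "real m * (q ^ (m - 1) * (1 - 2 * x)) = real m * q ^ m / q * (1 - 2 * x)" by (metis mult.assoc)
      then show ?thesis
        using 1 q by (simp add: bump_fun_def q_def[symmetric] p'_def Q) (simp add: field_simps power2_eq_square)
    qed
    show ?thesis
      using D unfolding eq
      by (rule has_field_derivative_transform_within_open[where S="{0<..<1}"]) (use 1 in \<open>auto simp: bump_fun_def\<close>)
  next
    case 2
    have "((\<lambda>_. 0) has_real_derivative bump_fun p' (m + 2) x) (at x)"
      using 2 by (auto simp: bump_fun_def)
    then show ?thesis
      by (rule has_field_derivative_transform_within_open[where S="{..<0} \<union> {1<..}"])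
         (use 2 in \<open>auto simp: bump_fun_def\<close>)
  next
    case 3
    obtain C where C: "\<And>x y. x = 0 \<or> x = 1 \<Longrightarrow> \<bar>bump_fun p m y\<bar> \<le> C * (y - x)\<^sup>2"
      using bump_fun_bound by blast
    have "((\<lambda>h. (bump_fun p m (x + h) - bump_fun p m x) / h) \<longlongrightarrow> 0) (at 0)"
    proof (rule Lim_null_comparison)
      have "((\<lambda>h. \<bar>C\<bar> * \<bar>h\<bar>) \<longlongrightarrow> \<bar>C\<bar> * \<bar>0::real\<bar>) (at 0)" by (intro tendsto_intros)
      then show "((\<lambda>h. \<bar>C\<bar> * \<bar>h\<bar>) \<longlongrightarrow> 0) (at 0)" by simp
      have "\<bar>(bump_fun p m (x + h) - bump_fun p m x) / h\<bar> \<le> \<bar>C\<bar> * \<bar>h\<bar>" if "h \<noteq> 0" for h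
      proof -
        have "\<bar>bump_fun p m (x + h)\<bar> \<le> C * h\<^sup>2" using C[OF 3, of "x + h"] by simp
        also have "\<dots> \<le> \<bar>C\<bar> * \<bar>h\<bar> * \<bar>h\<bar>" by (simp add: power2_eq_square mult.assoc mult_right_mono)
        finally show ?thesis using 3 that by (auto simp: bump_fun_def divide_simps)
      qed
      then show "\<forall>\<^sub>F h in at 0. norm ((bump_fun p m (x + h) - bump_fun p m x) / h) \<le> \<bar>C\<bar> * \<bar>h\<bar>"
        by (auto simp: eventually_at intro!: exI[of _ 1])
    qed
    then show ?thesis using 3 by (auto simp: DERIV_def bump_fun_def)
  qed
qed

lemma smooth_bump_fun: "smooth (\<lambda>x. of_real (bump_fun p m x))"
proof (rule smooth_coinduct[where P="\<lambda>f. \<exists>p m. f = (\<lambda>x. of_real (bump_fun p m x))"])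
  fix f :: "real \<Rightarrow> complex" assume "\<exists>p m. f = (\<lambda>x. of_real (bump_fun p m x))"
  then obtain p m where f: "f = (\<lambda>x. of_real (bump_fun p m x))" by blast
  show "\<exists>f'. (\<exists>p m. f' = (\<lambda>x. of_real (bump_fun p m x))) \<and> (\<forall>x. (f has_vector_derivative f' x) (at x))"
    unfolding f using has_vector_derivative_of_real[OF bump_fun_derivative[of p m]] by blast
qed blast

text \<open>The primitive of the bump function, normalised by its increase over the unit interval,
  which is positive by the mean value theorem.\<close>

lemma smooth_step_exists:
  "\<exists>\<Theta> :: real \<Rightarrow> real. smooth (\<lambda>x. of_real (\<Theta> x)) \<and> (\<forall>x\<le>0. \<Theta> x = 0) \<and> (\<forall>x\<ge>1. \<Theta> x = 1) \<and> (\<forall>x. 0 \<le> \<Theta> x \<and> \<Theta> x \<le> 1)"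
proof -
  let ?B = "bump_fun 1 0"
  have "\<exists>F. \<forall>x::real. - \<infinity> < ereal x \<longrightarrow> ereal x < \<infinity> \<longrightarrow> (F has_vector_derivative ?B x) (at x)"
    by (rule einterval_antiderivative) (use DERIV_isCont[OF bump_fun_derivative] in auto)
  then obtain F where F: "\<And>x. (F has_real_derivative ?B x) (at x)"
    by (auto simp: has_real_derivative_iff_has_vector_derivative)
  have mvt: "\<exists>z. x < z \<and> z < y \<and> F y - F x = (y - x) * ?B z" if "x < y" for x y
    by (rule MVT2[OF that F])
  have B: "?B x \<ge> 0" for x by (simp add: bump_fun_def)
  have mono: "F x \<le> F y" if "x \<le> y" for x y
  proof (cases "x = y")
    case False
    then have "x < y" using that by simp
    then obtain z where "F y - F x = (y - x) * ?B z" using mvt by blast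
    moreover have "0 \<le> (y - x) * ?B z" using that B by simp
    ultimately show ?thesis by simp
  qed simp
  have F0: "F x = F 0" if "x \<le> 0" for x
    using mvt[of x 0] that by (cases "x = 0") (auto simp: bump_fun_def)
  have F1: "F x = F 1" if "x \<ge> 1" for x
    using mvt[of 1 x] that by (cases "x = 1") (auto simp: bump_fun_def)
  have pos: "F 0 < F 1"
  proof -
    obtain z where z: "0 < z" "z < 1" "F 1 - F 0 = (1 - 0) * ?B z" using mvt[of 0 1] by auto
    then have "?B z > 0" by (simp add: bump_fun_def)
    with z show ?thesis by simp
  qed
  define \<Theta> where "\<Theta> x = (F x - F 0) / (F 1 - F 0)" for x
  have "smooth (\<lambda>x. of_real (\<Theta> x))"
  proof (rule smooth_antiderivative)
    show "smooth (\<lambda>x. of_real (1 / (F 1 - F 0)) * of_real (?B x))"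
      by (intro smooth_cmult smooth_bump_fun)
    have "(\<Theta> has_real_derivative 1 / (F 1 - F 0) * ?B x) (at x)" for x
      unfolding \<Theta>_def using pos by (auto intro!: derivative_eq_intros F)
    then have "((\<lambda>x. complex_of_real (\<Theta> x)) has_vector_derivative of_real (1 / (F 1 - F 0) * ?B x)) (at x)" for x
      by (rule has_vector_derivative_of_real)
    then show "((\<lambda>x. complex_of_real (\<Theta> x)) has_vector_derivative of_real (1 / (F 1 - F 0)) * of_real (?B x)) (at x)" for x
      by simp
  qed
  moreover have "F 0 \<le> F x \<and> F x \<le> F 1" for x
    using mono[of 0 x] mono[of x 1] F0[of x] F1[of x] pos by linarith
  then have "0 \<le> \<Theta> x \<and> \<Theta> x \<le> 1" for x
    using pos by (simp add: \<Theta>_def)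
  moreover have "\<Theta> x = 0" if "x \<le> 0" for x using F0[OF that] by (simp add: \<Theta>_def)
  moreover have "\<Theta> x = 1" if "x \<ge> 1" for x using F1[OF that] pos by (simp add: \<Theta>_def)
  ultimately show ?thesis by blast
qed

definition step :: "real \<Rightarrow> real" where
  "step = (SOME \<Theta>. smooth (\<lambda>x. of_real (\<Theta> x)) \<and> (\<forall>x\<le>0. \<Theta> x = 0) \<and> (\<forall>x\<ge>1. \<Theta> x = 1) \<and> (\<forall>x. 0 \<le> \<Theta> x \<and> \<Theta> x \<le> 1))"

lemma step:
  shows smooth_step: "smooth (\<lambda>x. of_real (step x))"
    and step_0: "x \<le> 0 \<Longrightarrow> step x = 0" and step_1: "x \<ge> 1 \<Longrightarrow> step x = 1"
    and step_ge_0: "0 \<le> step x" and step_le_1: "step x \<le> 1"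
  using someI_ex[OF smooth_step_exists] unfolding step_def by auto

text \<open>A smooth stand-in for the indicator of \<open>{a<..b}\<close> when r is large: one step
  rises between a + 1/r and a + 2/r, the other takes it back between b + 1/r and b + 2/r. The shift
  by 1 inside \<open>step\<close> keeps the support strictly to the right of \<open>a\<close>, so
  that \<open>a = 0\<close> is admissible.\<close>

definition window :: "real \<Rightarrow> real \<Rightarrow> real \<Rightarrow> real \<Rightarrow> real" where
  "window r a b x = step (r * (x - a) - 1) - step (r * (x - b) - 1)"

lemma window_eq_0:
  assumes "r > 0" "a \<le> b" "x \<le> a + 1 / r \<or> x \<ge> b + 2 / r"
  shows "window r a b x = 0"
proof -
  have mono: "r * (x - a) \<ge> r * (x - b)" using assms by (intro mult_left_mono) auto
  show ?thesis
  proof (cases "x \<le> a + 1 / r")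
    case True
    then have "r * (x - a) \<le> r * (1 / r)" using assms by (intro mult_left_mono) auto
    then have "r * (x - a) \<le> 1" using assms by simp
    then have "r * (x - a) - 1 \<le> 0" "r * (x - b) - 1 \<le> 0" using mono by linarith+
    then show ?thesis by (simp add: window_def step_0 del: diff_le_0_iff_le)
  next
    case False
    then have "r * (x - b) \<ge> r * (2 / r)" using assms by (intro mult_left_mono) auto
    then have "r * (x - b) \<ge> 2" using assms by simp
    then have "r * (x - a) - 1 \<ge> 1" "r * (x - b) - 1 \<ge> 1" using mono by linarith+
    then show ?thesis by (simp add: window_def step_1)
  qed
qed

lemma window_abs_le_1: "\<bar>window r a b x\<bar> \<le> 1"
  using step_ge_0[of "r * (x - a) - 1"] step_le_1[of "r * (x - a) - 1"]
    step_ge_0[of "r * (x - b) - 1"] step_le_1[of "r * (x - b) - 1"]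
  by (simp add: window_def abs_le_iff)

lemma smooth_window: "smooth (\<lambda>x. of_real (window r a b x))"
proof -
  have "smooth (\<lambda>x. of_real (step (r * x + (- r * a - 1))) + (-1) * of_real (step (r * x + (- r * b - 1))))"
    by (intro smooth_add smooth_cmult smooth_affine[OF smooth_step])
  then show ?thesis by (simp add: window_def algebra_simps)
qed

lemma window_test_function:
  assumes "r > 0" "0 \<le> a" "a \<le> b"
  shows "(\<lambda>x. of_real (window r a b x)) \<in> test_functions"
  unfolding test_functions_iff
proof (intro conjI exI)
  show "0 < a + 1 / r" using assms by (simp add: add_nonneg_pos)
  show "a + 1 / r \<le> b + 2 / r" using assms by (intro add_mono) (auto simp: divide_right_mono)
  show "\<forall>x. x \<notin> {a + 1 / r..b + 2 / r} \<longrightarrow> complex_of_real (window r a b x) = 0"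
    using window_eq_0[OF assms(1,3)] by auto
qed (rule smooth_window)

lemma step_tendsto:
  "(\<lambda>i. step (real (Suc i) * (x - a) - 1)) \<longlonglongrightarrow> (if x > a then 1 else 0)"
proof (cases "x > a")
  case True
  then obtain N where N: "2 / (x - a) < real N" using reals_Archimedean2 by blast
  have "step (real (Suc i) * (x - a) - 1) = 1" if "i \<ge> N" for i
  proof -
    have "2 / (x - a) \<le> real (Suc i)" using N that by linarith
    then show ?thesis using True by (intro step_1) (simp add: field_simps)
  qed
  then show ?thesis using True by (intro tendsto_eventually) (auto simp: eventually_sequentially)
next
  case False
  then have "real (Suc i) * (x - a) \<le> 0" for i by (intro mult_nonneg_nonpos) auto
  then have "step (real (Suc i) * (x - a) - 1) = 0" for i
    by (intro step_0) (smt (verit))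
  then show ?thesis using False by simp
qed

lemma window_tendsto:
  assumes "a \<le> b"
  shows "(\<lambda>i. window (real (Suc i)) a b x) \<longlonglongrightarrow> indicator {a<..b} x"
proof -
  have "(\<lambda>i. window (real (Suc i)) a b x) \<longlonglongrightarrow> (if x > a then 1 else 0) - (if x > b then 1 else 0)"
    unfolding window_def by (intro tendsto_diff step_tendsto)
  also have "(if x > a then 1 else 0) - (if x > b then 1 else 0::real) = indicator {a<..b} x"
    using assms by (auto simp: indicator_def)
  finally show ?thesis .
qed

section \<open>Density of the test functions\<close>

lemma space_branch [simp]: "space branch = {0<..}"
  by (simp add: branch_def space_restrict_space)

lemma sets_branch: "X \<in> sets branch \<longleftrightarrow> X \<in> sets borel \<and> X \<subseteq> {0<..}"
  by (auto simp: branch_def sets_restrict_space_iff)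

lemma emeasure_branch: "X \<in> sets branch \<Longrightarrow> emeasure branch X = emeasure lborel X"
  using emeasure_restrict_space[of "{0<..}" lborel X] by (simp add: branch_def sets_branch[unfolded branch_def])

lemma borel_measurable_branch: "f \<in> borel_measurable borel \<Longrightarrow> f \<in> borel_measurable branch"
  unfolding branch_def by (rule measurable_restrict_space1) simp

lemma AE_branch_iff: "(AE x in branch. P x) \<longleftrightarrow> (AE x in lborel. x > 0 \<longrightarrow> P x)"
  unfolding branch_def by (subst AE_restrict_space_iff) auto

lemma AE_branchI: "(\<And>x. x > 0 \<Longrightarrow> P x) \<Longrightarrow> AE x in branch. P x"
  by (simp add: AE_branch_iff)

lemma integral_branch:
  fixes f :: "real \<Rightarrow> 'a::{banach, second_countable_topology}"
  shows "(\<integral>x. f x \<partial>branch) = (LINT x:{0<..}|lborel. f x)"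
  unfolding branch_def set_lebesgue_integral_def by (subst integral_restrict_space) auto

lemma integrable_indicator_branch:
  assumes "X \<in> sets borel" "X \<subseteq> {0..N}"
  shows "integrable branch (\<lambda>x. indicator X x :: real)"
proof -
  have "emeasure branch (X \<inter> {0<..}) \<le> emeasure lborel {0..N}"
    using assms by (subst emeasure_branch) (auto simp: sets_branch intro!: emeasure_mono)
  then have "emeasure branch (X \<inter> {0<..}) < \<infinity>"
    by (rule order_le_less_trans) (simp add: emeasure_lborel_Icc_eq)
  then have "integrable branch (\<lambda>x. indicator (X \<inter> {0<..}) x :: real)"
    using assms by (intro integrable_real_indicator) (auto simp: sets_branch)
  moreover have "integrable branch (\<lambda>x. indicator (X \<inter> {0<..}) x :: real) \<longleftrightarrow> integrable branch (\<lambda>x. indicator X x :: real)"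
    by (intro Bochner_Integration.integrable_cong) (auto simp: indicator_def)
  ultimately show ?thesis by simp
qed

section \<open>Approximation in L^1 and L^2 at the same time\<close>

text \<open>Both norms matter for the transform: the L^1 norm controls the integral
  \<open>V_test\<close> at each fixed \<mu>, the L^2 norm controls the isometric extension
  \<open>V\<close>. Approximation in both norms is what later identifies the two on this
  class.\<close>

definition L12 :: "(real \<Rightarrow> complex) set" where
  "L12 = {f \<in> L2 branch. integrable branch f}"

definition l1norm :: "(real \<Rightarrow> complex) \<Rightarrow> real" where
  "l1norm f = (\<integral>x. cmod (f x) \<partial>branch)"

lemma L12_L2: "f \<in> L12 \<Longrightarrow> f \<in> L2 branch"
  by (simp add: L12_def)

lemma L12_integrable: "f \<in> L12 \<Longrightarrow> integrable branch f"
  by (simp add: L12_def)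

lemma l1norm_nonneg [simp]: "l1norm f \<ge> 0"
  by (simp add: l1norm_def)

lemma L12_add: "f \<in> L12 \<Longrightarrow> g \<in> L12 \<Longrightarrow> (\<lambda>x. f x + g x) \<in> L12"
  by (simp add: L12_def L2_add)

lemma L12_cmult: "f \<in> L12 \<Longrightarrow> (\<lambda>x. z * f x) \<in> L12"
  by (simp add: L12_def L2_cmult)

lemma L12_diff: "f \<in> L12 \<Longrightarrow> g \<in> L12 \<Longrightarrow> (\<lambda>x. f x - g x) \<in> L12"
  by (simp add: L12_def L2_diff)

lemma L12_bound:
  assumes "g \<in> L12" "f \<in> borel_measurable branch" "AE x in branch. cmod (f x) \<le> C * cmod (g x)"
  shows "f \<in> L12"
proof -
  have "integrable branch f"
  proof (rule Bochner_Integration.integrable_bound[OF _ assms(2)])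
    show "integrable branch (\<lambda>x. of_real C * g x)" using L12_integrable[OF assms(1)] by simp
    show "AE x in branch. norm (f x) \<le> norm (of_real C * g x)"
      using assms(3)
    proof eventually_elim
      case (elim x)
      have "C * cmod (g x) \<le> \<bar>C\<bar> * cmod (g x)" by (intro mult_right_mono) auto
      with elim show ?case by (simp add: norm_mult)
    qed
  qed
  moreover have "f \<in> L2 branch"
  proof (rule L2_bound[OF assms(2)])
    show "integrable branch (\<lambda>x. C\<^sup>2 * (cmod (g x))\<^sup>2)"
      using L2_integrable[OF L12_L2[OF assms(1)]] by simp
    show "AE x in branch. (cmod (f x))\<^sup>2 \<le> C\<^sup>2 * (cmod (g x))\<^sup>2"
      using assms(3)
    proof eventually_elim
      case (elim x)
      from power_mono[OF this norm_ge_zero, of 2] show ?case by (simp add: power_mult_distrib)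
    qed
  qed
  ultimately show ?thesis by (simp add: L12_def)
qed

lemma l1norm_triangle:
  assumes "f \<in> L12" "g \<in> L12"
  shows "l1norm (\<lambda>x. f x + g x) \<le> l1norm f + l1norm g"
proof -
  have "l1norm (\<lambda>x. f x + g x) \<le> (\<integral>x. cmod (f x) + cmod (g x) \<partial>branch)"
    unfolding l1norm_def using assms
    by (intro integral_mono norm_triangle_ineq Bochner_Integration.integrable_add integrable_norm L12_integrable L12_add)
  then show ?thesis using assms by (simp add: l1norm_def L12_integrable)
qed

lemma l1norm_cmult: "l1norm (\<lambda>x. z * f x) = cmod z * l1norm f"
  by (simp add: l1norm_def norm_mult)

lemma l1norm_dominated:
  assumes "\<And>i. F i \<in> borel_measurable branch" "f \<in> borel_measurable branch"
    and "integrable branch g"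
    and "\<And>i. AE x in branch. cmod (F i x - f x) \<le> g x"
    and "AE x in branch. (\<lambda>i. F i x) \<longlonglongrightarrow> f x"
  shows "(\<lambda>i. l1norm (\<lambda>x. F i x - f x)) \<longlonglongrightarrow> 0"
proof -
  have "(\<lambda>i. \<integral>x. cmod (F i x - f x) \<partial>branch) \<longlonglongrightarrow> (\<integral>x. 0 \<partial>branch)"
  proof (rule integral_dominated_convergence)
    show "AE x in branch. (\<lambda>i. cmod (F i x - f x)) \<longlonglongrightarrow> 0"
      using assms(5)
    proof eventually_elim
      case (elim x)
      then have "(\<lambda>i. cmod (F i x - f x)) \<longlonglongrightarrow> cmod (f x - f x)" by (intro tendsto_intros)
      then show ?case by simp
    qed
    show "AE x in branch. norm (cmod (F i x - f x)) \<le> g x" for i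
      using assms(4)[of i] by eventually_elim auto
  qed (use assms in auto)
  then show ?thesis by (simp add: l1norm_def)
qed

definition approx_dist :: "(real \<Rightarrow> complex) \<Rightarrow> real" where
  "approx_dist f = l2norm branch f + l1norm f"

lemma approx_dist_triangle: "f \<in> L12 \<Longrightarrow> g \<in> L12 \<Longrightarrow> approx_dist (\<lambda>x. f x + g x) \<le> approx_dist f + approx_dist g"
  using l2norm_triangle[of f branch g] l1norm_triangle[of f g] by (simp add: approx_dist_def L12_L2)

lemma approx_dist_cmult: "approx_dist (\<lambda>x. z * f x) = cmod z * approx_dist f"
  by (simp add: approx_dist_def l1norm_cmult l2norm_cmult algebra_simps)

lemma approx_dist_nonneg [simp]: "approx_dist f \<ge> 0"
  by (simp add: approx_dist_def)

lemma bounded_support_L12: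
  assumes [measurable]: "f \<in> borel_measurable borel"
    and "\<And>x. x > 0 \<Longrightarrow> cmod (f x) \<le> B" "\<And>x. x > N \<Longrightarrow> f x = 0"
  shows "f \<in> L12"
proof (rule L12_bound)
  show "(\<lambda>x. of_real (indicator {0..N} x)) \<in> L12"
    unfolding L12_def
  proof (intro CollectI conjI L2_bound[where h="indicator {0..N}"])
    show "integrable branch (indicat_real {0..N})"
      using integrable_indicator_branch[of "{0..N}" N] by simp
    show "integrable branch (\<lambda>x. complex_of_real (indicator {0..N} x))"
      using integrable_indicator_branch[of "{0..N}" N] by simp
  qed (auto simp: indicator_def intro!: borel_measurable_branch)
  show "AE x in branch. cmod (f x) \<le> B * cmod (complex_of_real (indicator {0..N} x))"
    using assms(2,3) by (intro AE_branchI) (auto simp: indicator_def not_le)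
qed (auto intro: borel_measurable_branch)

lemma smooth_measurable: "smooth f \<Longrightarrow> f \<in> borel_measurable borel"
  by (rule borel_measurable_continuous_onI[OF smooth_continuous])

lemma test_functions_bounded:
  assumes "f \<in> test_functions"
  obtains B where "\<And>x. cmod (f x) \<le> B"
proof -
  obtain \<alpha> \<beta> where s: "0 < \<alpha>" "\<alpha> \<le> \<beta>" "\<And>x. x \<notin> {\<alpha>..\<beta>} \<Longrightarrow> f x = 0"
    using test_functions_support[OF assms] by metis
  have "compact (f ` {\<alpha>..\<beta>})"
    using assms by (intro compact_continuous_image smooth_continuous test_functions_smooth) auto
  then obtain B where B: "\<And>x. x \<in> {\<alpha>..\<beta>} \<Longrightarrow> cmod (f x) \<le> B"
    by (force dest!: compact_imp_bounded simp: bounded_iff)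
  have "cmod (f x) \<le> max B 0" for x using B[of x] s(3)[of x] by (cases "x \<in> {\<alpha>..\<beta>}") auto
  then show ?thesis by (rule that)
qed

lemma test_functions_L12:
  assumes "f \<in> test_functions"
  shows "f \<in> L12"
proof -
  obtain \<alpha> \<beta> where s: "0 < \<alpha>" "\<alpha> \<le> \<beta>" "\<And>x. x \<notin> {\<alpha>..\<beta>} \<Longrightarrow> f x = 0"
    using test_functions_support[OF assms] by metis
  obtain B where "\<And>x. cmod (f x) \<le> B" using test_functions_bounded[OF assms] by metis
  then show ?thesis
    using s(3) by (intro bounded_support_L12[of _ B \<beta>] smooth_measurable test_functions_smooth assms) auto
qed

lemmas test_functions_L2 = test_functions_L12[THEN L12_L2]

definition test_closure :: "(real \<Rightarrow> complex) set" where
  "test_closure = {f \<in> L12. \<forall>e>0. \<exists>\<phi>\<in>test_functions. approx_dist (\<lambda>x. \<phi> x - f x) < e}"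

lemma test_closure_limit:
  assumes "f \<in> L12" "\<And>i. F i \<in> test_closure" "(\<lambda>i. approx_dist (\<lambda>x. F i x - f x)) \<longlonglongrightarrow> 0"
  shows "f \<in> test_closure"
  unfolding test_closure_def
proof (intro CollectI conjI allI impI assms(1))
  fix e :: real assume "e > 0"
  then obtain i where i: "approx_dist (\<lambda>x. F i x - f x) < e / 2"
    using LIMSEQ_D[OF assms(3), of "e / 2"] by auto
  obtain \<phi> where \<phi>: "\<phi> \<in> test_functions" "approx_dist (\<lambda>x. \<phi> x - F i x) < e / 2"
    using assms(2)[of i] \<open>e > 0\<close> unfolding test_closure_def by (auto dest!: spec[of _ "e/2"])
  have "F i \<in> L12" using assms(2)[of i] by (simp add: test_closure_def)
  then have "approx_dist (\<lambda>x. (\<phi> x - F i x) + (F i x - f x)) \<le> approx_dist (\<lambda>x. \<phi> x - F i x) + approx_dist (\<lambda>x. F i x - f x)"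
    by (intro approx_dist_triangle L12_diff test_functions_L12[OF \<phi>(1)] assms(1))
  with i \<phi> show "\<exists>\<phi>\<in>test_functions. approx_dist (\<lambda>x. \<phi> x - f x) < e"
    by (intro bexI[of _ \<phi>]) auto
qed

lemma test_closure_dominated:
  fixes g :: "real \<Rightarrow> real"
  assumes "f \<in> L12" "\<And>i. F i \<in> test_closure" "integrable branch g" "integrable branch (\<lambda>x. (g x)\<^sup>2)"
    and "\<And>i x. x > 0 \<Longrightarrow> cmod (F i x - f x) \<le> g x"
    and "\<And>x. x > 0 \<Longrightarrow> (\<lambda>i. F i x) \<longlonglongrightarrow> f x"
  shows "f \<in> test_closure"
proof (rule test_closure_limit[OF assms(1,2)])
  have m: "F i \<in> borel_measurable branch" "f \<in> borel_measurable branch" for i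
    using assms(1) assms(2)[of i] by (auto simp: test_closure_def L12_def L2_def)
  have "(\<lambda>i. l2norm branch (\<lambda>x. F i x - f x)) \<longlonglongrightarrow> 0"
    by (rule l2norm_dominated[OF m assms(4)]) (auto intro!: AE_branchI assms)
  moreover have "(\<lambda>i. l1norm (\<lambda>x. F i x - f x)) \<longlonglongrightarrow> 0"
    by (rule l1norm_dominated[OF m assms(3)]) (auto intro!: AE_branchI assms)
  ultimately show "(\<lambda>i. approx_dist (\<lambda>x. F i x - f x)) \<longlonglongrightarrow> 0"
    unfolding approx_dist_def using tendsto_add by fastforce
qed

lemma test_functions_test_closure: "f \<in> test_functions \<Longrightarrow> f \<in> test_closure"
  by (auto simp: test_closure_def test_functions_L12 approx_dist_def l1norm_def intro!: bexI[of _ f])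

lemma test_closure_add:
  assumes "f \<in> test_closure" "g \<in> test_closure"
  shows "(\<lambda>x. f x + g x) \<in> test_closure"
  unfolding test_closure_def
proof (intro CollectI conjI allI impI)
  have L: "f \<in> L12" "g \<in> L12" using assms by (auto simp: test_closure_def)
  then show "(\<lambda>x. f x + g x) \<in> L12" by (rule L12_add)
  fix e :: real assume "e > 0"
  then obtain \<phi> \<psi> where \<phi>: "\<phi> \<in> test_functions" "approx_dist (\<lambda>x. \<phi> x - f x) < e / 2"
    and \<psi>: "\<psi> \<in> test_functions" "approx_dist (\<lambda>x. \<psi> x - g x) < e / 2"
    using assms unfolding test_closure_def by (auto dest!: spec[of _ "e/2"])
  have "approx_dist (\<lambda>x. (\<phi> x - f x) + (\<psi> x - g x)) \<le> approx_dist (\<lambda>x. \<phi> x - f x) + approx_dist (\<lambda>x. \<psi> x - g x)"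
    by (intro approx_dist_triangle L12_diff test_functions_L12 \<phi> \<psi> L)
  with \<phi> \<psi> show "\<exists>\<phi>\<in>test_functions. approx_dist (\<lambda>x. \<phi> x - (f x + g x)) < e"
    by (intro bexI[of _ "\<lambda>x. \<phi> x + \<psi> x"] test_functions_add) (auto simp: algebra_simps)
qed

lemma test_closure_cmult:
  assumes "f \<in> test_closure"
  shows "(\<lambda>x. z * f x) \<in> test_closure"
proof (cases "z = 0")
  case True
  then show ?thesis using test_functions_test_closure[OF test_functions_zero] by simp
next
  case False
  show ?thesis
    unfolding test_closure_def
  proof (intro CollectI conjI allI impI)
    show "(\<lambda>x. z * f x) \<in> L12" using assms by (auto simp: test_closure_def L12_cmult)
    fix e :: real assume "e > 0"
    then have "e / cmod z > 0" using False by simp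
    then obtain \<phi> where \<phi>: "\<phi> \<in> test_functions" "approx_dist (\<lambda>x. \<phi> x - f x) < e / cmod z"
      using assms unfolding test_closure_def by blast
    have "approx_dist (\<lambda>x. z * \<phi> x - z * f x) < e"
      using \<phi>(2) approx_dist_cmult[of z "\<lambda>x. \<phi> x - f x"] False by (simp add: algebra_simps pos_less_divide_eq)
    then show "\<exists>\<phi>\<in>test_functions. approx_dist (\<lambda>x. \<phi> x - z * f x) < e"
      using test_functions_cmult[OF \<phi>(1), of z] by (intro bexI)
  qed
qed

lemma test_closure_sum:
  assumes "finite S" "\<And>y. y \<in> S \<Longrightarrow> f y \<in> test_closure"
  shows "(\<lambda>x. \<Sum>y\<in>S. f y x) \<in> test_closure"
  using assms
  by (induction S) (auto intro: test_functions_test_closure[OF test_functions_zero] test_closure_add)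

section \<open>From intervals to Borel sets to integrable functions\<close>

abbreviation cindicator :: "real set \<Rightarrow> real \<Rightarrow> complex" where
  "cindicator X \<equiv> \<lambda>x. of_real (indicator X x)"

lemma cindicator_L12: "X \<in> sets borel \<Longrightarrow> X \<subseteq> {0..N} \<Longrightarrow> cindicator X \<in> L12"
  by (rule bounded_support_L12[where B=1 and N=N]) (auto simp: indicator_def)

lemma dominated_on_interval:
  fixes N C :: real
  assumes "f \<in> L12" "\<And>i. F i \<in> test_closure" 
    and "\<And>i x. x > 0 \<Longrightarrow> cmod (F i x - f x) \<le> C"
    and "\<And>i x. x > N \<Longrightarrow> F i x = 0" "\<And>x. x > N \<Longrightarrow> f x = 0"
    and "\<And>x. x > 0 \<Longrightarrow> (\<lambda>i. F i x) \<longlonglongrightarrow> f x"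
  shows "f \<in> test_closure"
proof (rule test_closure_dominated[OF assms(1,2)])
  have i: "integrable branch (indicat_real {0..N})" using integrable_indicator_branch[of "{0..N}" N] by simp
  then show "integrable branch (\<lambda>x. C * indicat_real {0..N} x)" by simp
  have "(\<lambda>x. (C * indicat_real {0..N} x)\<^sup>2) = (\<lambda>x. C\<^sup>2 * indicat_real {0..N} x)"
    by (auto simp: indicator_def)
  then show "integrable branch (\<lambda>x. (C * indicat_real {0..N} x)\<^sup>2)" using i by simp
  show "cmod (F i x - f x) \<le> C * indicat_real {0..N} x" if "x > 0" for i x
    using assms(3)[OF that, of i] assms(4)[of x i] assms(5)[of x] that by (auto simp: indicator_def not_le)
qed (rule assms(6))

lemma test_closure_interval:
  assumes "0 \<le> a" "a \<le> b"
  shows "cindicator {a<..b} \<in> test_closure"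
\<comment> \<open>All windows used here have parameter at least 1 and vanish beyond
  \<open>b + 2\<close>; window and indicator are each bounded by 1, which gives the constant
  2.\<close>
proof (rule dominated_on_interval[where F="\<lambda>i x. of_real (window (real (Suc i)) a b x)" and C=2 and N="b + 2"])
  show "cindicator {a<..b} \<in> L12" by (rule cindicator_L12[of _ b]) (use assms in auto)
  show "(\<lambda>x. complex_of_real (window (real (Suc i)) a b x)) \<in> test_closure" for i
    by (intro test_functions_test_closure window_test_function assms) simp
  show "(\<lambda>i. complex_of_real (window (real (Suc i)) a b x)) \<longlonglongrightarrow> cindicator {a<..b} x" for x
    by (intro tendsto_of_real window_tendsto assms)
  show "cmod (complex_of_real (window (real (Suc i)) a b x) - cindicator {a<..b} x) \<le> 2" for i x
    using window_abs_le_1[of "real (Suc i)" a b x]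
    by (auto simp: indicator_def simp flip: of_real_diff)
  show "complex_of_real (window (real (Suc i)) a b x) = 0" if "x > b + 2" for i x
  proof -
    have "2 / real (Suc i) \<le> 2" by (simp add: divide_le_eq)
    then have "b + 2 / real (Suc i) \<le> x" using that by linarith
    then show ?thesis using window_eq_0[of "real (Suc i)" a b x] assms by simp
  qed
qed (auto simp: indicator_def)

text \<open>Half-open intervals form an intersection-stable generator of the Borel sets, and the
  sets whose trace on \<open>{0<..N}\<close> can be approximated form a Dynkin system. The cut at
  \<open>N\<close> keeps every indicator integrable, so complements stay within reach.\<close>

lemma test_closure_borel:
  assumes "X \<in> sets borel" "N \<ge> 0"
  shows "cindicator (X \<inter> {0<..N}) \<in> test_closure"
proof -
  let ?G = "range (\<lambda>(a, b). {a<..b::real})"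
  have "Int_stable ?G"
    by (auto simp: Int_stable_def Int_greaterThanAtMost)
  moreover have "?G \<subseteq> Pow UNIV" by simp
  moreover have "X \<in> sigma_sets UNIV ?G"
    using assms(1) by (simp add: borel_sigma_sets_Ioc)
  ultimately show ?thesis
  proof (induction rule: sigma_sets_induct_disjoint)
    fix X assume "X \<in> ?G"
    then obtain a b where X: "X = {a<..b}" by auto
    show "cindicator (X \<inter> {0<..N}) \<in> test_closure"
    proof (cases "max a 0 \<le> min b N")
      case True
      have "X \<inter> {0<..N} = {max a 0<..min b N}" by (auto simp: X)
      then show ?thesis using test_closure_interval[OF _ True] by simp
    next
      case False
      then have "X \<inter> {0<..N} = {}" using assms by (auto simp: X)
      then show ?thesis using test_functions_test_closure[OF test_functions_zero] by simp
    qed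
  next
    show "cindicator ({} \<inter> {0<..N}) \<in> test_closure"
      using test_functions_test_closure[OF test_functions_zero] by simp
  next
    fix X assume "cindicator (X \<inter> {0<..N}) \<in> test_closure"
    then have "(\<lambda>x. cindicator {0<..N} x + (-1) * cindicator (X \<inter> {0<..N}) x) \<in> test_closure"
      using assms(2) by (intro test_closure_add test_closure_cmult test_closure_interval) auto
    also have "(\<lambda>x. cindicator {0<..N} x + (-1) * cindicator (X \<inter> {0<..N}) x) = cindicator ((UNIV - X) \<inter> {0<..N})"
      by (auto simp: indicator_def fun_eq_iff)
    finally show "cindicator ((UNIV - X) \<inter> {0<..N}) \<in> test_closure" .
  next
    fix X :: "nat \<Rightarrow> real set"
    assume disj: "disjoint_family X" and X: "range X \<subseteq> sigma_sets UNIV ?G"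
      and IH: "\<And>i. cindicator (X i \<inter> {0<..N}) \<in> test_closure"
    have Ab: "X i \<in> sets borel" for i using X by (auto simp: borel_sigma_sets_Ioc)
    have eq: "(\<Sum>j<i. cindicator (X j \<inter> {0<..N}) x) = cindicator ((\<Union>j<i. X j) \<inter> {0<..N}) x" for i x
    proof (induction i)
      case (Suc i)
      have *: "X i \<inter> X j = {}" if "j < i" for j
        using disjoint_family_onD[OF disj, of i j] that by simp
      show ?case
      proof (cases "x \<in> X i")
        case True
        then have "x \<notin> (\<Union>j<i. X j)" using * by blast
        then have "(\<Sum>j<i. cindicator (X j \<inter> {0<..N}) x) = 0" unfolding Suc by simp
        moreover have "x \<in> (\<Union>j<Suc i. X j)" using True by auto
        ultimately show ?thesis using True by (simp add: indicator_def)
      next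
        case False
        then have "x \<in> (\<Union>j<Suc i. X j) \<longleftrightarrow> x \<in> (\<Union>j<i. X j)" by (auto simp: less_Suc_eq)
        then show ?thesis using False Suc by (simp add: indicator_def)
      qed
    qed simp
    show "cindicator (\<Union> (range X) \<inter> {0<..N}) \<in> test_closure"
    proof (rule dominated_on_interval[where F="\<lambda>i. cindicator ((\<Union>j<i. X j) \<inter> {0<..N})" and C=1 and N=N])
      show "cindicator (\<Union> (range X) \<inter> {0<..N}) \<in> L12"
        using Ab by (intro cindicator_L12[of _ N]) auto
      show "cindicator ((\<Union>j<i. X j) \<inter> {0<..N}) \<in> test_closure" for i
        using test_closure_sum[of "{..<i}" "\<lambda>j. cindicator (X j \<inter> {0<..N})"] IH by (simp add: eq)
      show "(\<lambda>i. cindicator ((\<Union>j<i. X j) \<inter> {0<..N}) x) \<longlonglongrightarrow> cindicator (\<Union> (range X) \<inter> {0<..N}) x" for x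
      proof (cases "\<exists>j. x \<in> X j")
        case True
        then obtain j where "x \<in> X j" by blast
        then have "cindicator ((\<Union>j<i. X j) \<inter> {0<..N}) x = cindicator (\<Union> (range X) \<inter> {0<..N}) x" if "i \<ge> Suc j" for i
          using that by (auto simp: indicator_def)
        then show ?thesis by (intro tendsto_eventually) (auto simp: eventually_sequentially)
      qed (auto simp: indicator_def)
    qed (auto simp: indicator_def)
  qed
qed

lemma simple_function_eq_sum:
  assumes "simple_function M f" "x \<in> space M"
  shows "f x = (\<Sum>y\<in>f ` space M. y * of_real (indicator (f -` {y} \<inter> space M) x) :: complex)"
proof -
  have "(\<Sum>y\<in>f ` space M. y * of_real (indicator (f -` {y} \<inter> space M) x)) = (\<Sum>y\<in>f ` space M. if y = f x then y else 0)"
    using assms(2) by (intro sum.cong) (auto simp: indicator_def)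
  also have "\<dots> = f x" using assms by (subst sum.delta) (auto simp: simple_functionD)
  finally show ?thesis by simp
qed

text \<open>Simple functions bounded by 2 |f| converge to f pointwise; after a cut they are finite
  combinations of indicators of bounded Borel sets, and 3 |f| dominates the error in both
  norms.\<close>

lemma L12_subset_test_closure:
  assumes f: "f \<in> L12"
  shows "f \<in> test_closure"
proof -
  have [measurable]: "f \<in> borel_measurable branch" using f by (simp add: L12_def L2_def)
  obtain s where s: "\<And>i. simple_function branch (s i)" "\<And>x. x > 0 \<Longrightarrow> (\<lambda>i. s i x) \<longlonglongrightarrow> f x"
    "\<And>i x. x > 0 \<Longrightarrow> cmod (s i x) \<le> 2 * cmod (f x)"
  proof -
    have "\<exists>F. (\<forall>i. simple_function branch (F i)) \<and> (\<forall>x\<in>space branch. (\<lambda>i. F i x) \<longlonglongrightarrow> f x) \<and>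
      (\<forall>i. \<forall>x\<in>space branch. dist (F i x) 0 \<le> 2 * dist (f x) 0)"
      by (rule borel_measurable_implies_sequence_metric) measurable
    then obtain F where F: "\<forall>i. simple_function branch (F i)" "\<forall>x\<in>space branch. (\<lambda>i. F i x) \<longlonglongrightarrow> f x"
      "\<forall>i. \<forall>x\<in>space branch. dist (F i x) 0 \<le> 2 * dist (f x) 0"
      by blast
    show ?thesis by (rule that[of F]) (use F in \<open>auto simp: dist_norm\<close>)
  qed
  \<comment> \<open>The level sets of a simple function may be unbounded; the cut at
    \<open>i\<close> makes \<open>test_closure_borel\<close> applicable to them.\<close>
  define F where "F i x = (\<Sum>y\<in>s i ` {0<..}. y * cindicator ((s i -` {y} \<inter> {0<..}) \<inter> {0<..real i}) x)" for i x
  have Feq: "F i x = s i x * cindicator {0<..real i} x" if "x > 0" for i x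
    using simple_function_eq_sum[OF s(1)[of i], of x] that
    by (cases "x \<le> real i") (simp_all add: F_def indicator_def)
  have F: "F i \<in> test_closure" for i
    unfolding F_def
  proof (intro test_closure_sum test_closure_cmult test_closure_borel)
    show "finite (s i ` {0<..})" using s(1)[of i] by (simp add: simple_function_def)
    show "s i -` {y} \<inter> {0<..} \<in> sets borel" for y
      using simple_functionD(2)[OF s(1)[of i], of "{y}"] by (simp add: sets_branch)
  qed simp
  show ?thesis
  proof (rule test_closure_dominated[OF f F])
    show "integrable branch (\<lambda>x. 3 * cmod (f x))" using L12_integrable[OF f] by simp
    have "integrable branch (\<lambda>x. 9 * (cmod (f x))\<^sup>2)" using L2_integrable[OF L12_L2[OF f]] by simp
    then show "integrable branch (\<lambda>x. (3 * cmod (f x))\<^sup>2)" by (simp add: power_mult_distrib)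
    fix x :: real assume x: "x > 0"
    show "cmod (F i x - f x) \<le> 3 * cmod (f x)" for i
    proof -
      have "cmod (F i x) \<le> 2 * cmod (f x)" using s(3)[OF x, of i] by (simp add: Feq[OF x] norm_mult indicator_def)
      then show ?thesis using norm_triangle_ineq4[of "F i x" "f x"] by linarith
    qed
    show "(\<lambda>i. F i x) \<longlonglongrightarrow> f x"
    proof (rule Lim_transform_eventually[OF s(2)[OF x]])
      obtain m where "x \<le> real m" using real_arch_simple by blast
      then have "s i x = F i x" if "i \<ge> m" for i using that x by (simp add: Feq indicator_def)
      then show "\<forall>\<^sub>F i in sequentially. s i x = F i x" unfolding eventually_sequentially by blast
    qed
  qed
qed

lemma L12_test_sequence:
  assumes "f \<in> L12"
  obtains \<phi> where "\<And>i::nat. \<phi> i \<in> test_functions" "(\<lambda>i. l2norm branch (\<lambda>x. \<phi> i x - f x)) \<longlonglongrightarrow> 0"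
    "(\<lambda>i. l1norm (\<lambda>x. \<phi> i x - f x)) \<longlonglongrightarrow> 0"
proof -
  have "\<forall>i. \<exists>\<phi>\<in>test_functions. approx_dist (\<lambda>x. \<phi> x - f x) < inverse (real (Suc i))"
    using L12_subset_test_closure[OF assms] by (simp add: test_closure_def)
  then obtain \<phi> where \<phi>: "\<And>i. \<phi> i \<in> test_functions" "\<And>i. approx_dist (\<lambda>x. \<phi> i x - f x) < inverse (real (Suc i))"
    by metis
  have "l2norm branch (\<lambda>x. \<phi> i x - f x) \<le> inverse (real (Suc i))" "l1norm (\<lambda>x. \<phi> i x - f x) \<le> inverse (real (Suc i))" for i
    using \<phi>(2)[of i] l2norm_nonneg[of branch "\<lambda>x. \<phi> i x - f x"] l1norm_nonneg[of "\<lambda>x. \<phi> i x - f x"]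
    unfolding approx_dist_def by linarith+
  then have "(\<lambda>i. l2norm branch (\<lambda>x. \<phi> i x - f x)) \<longlonglongrightarrow> 0" "(\<lambda>i. l1norm (\<lambda>x. \<phi> i x - f x)) \<longlonglongrightarrow> 0"
    by (auto intro!: tendsto_sandwich[OF _ _ tendsto_const LIMSEQ_inverse_real_of_nat] always_eventually)
  with \<phi>(1) show ?thesis by (rule that)
qed

lemma L2_truncate:
  assumes "f \<in> L2 branch"
  shows "(\<lambda>x. cindicator {0..N} x * f x) \<in> L12"
proof -
  have "cindicator {0..N} \<in> L2 branch" by (intro L12_L2 cindicator_L12[of _ "N"]) auto
  then have "integrable branch (\<lambda>x. cindicator {0..N} x * f x)" using assms by (rule L2_mult_integrable)
  moreover have "(\<lambda>x. cindicator {0..N} x * f x) \<in> L2 branch"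
    by (rule L2_mult_bounded[OF assms, where C=1]) (auto intro!: borel_measurable_branch simp: indicator_def)
  ultimately show ?thesis by (simp add: L12_def)
qed

text \<open>Truncation to \<open>{0..N}\<close> makes a square-integrable function integrable as
  well, so a diagonal choice reduces the claim to the class \<open>L12\<close>.\<close>

lemma L2_test_sequence:
  assumes f: "f \<in> L2 branch"
  obtains \<phi> where "\<And>i::nat. \<phi> i \<in> test_functions" "(\<lambda>i. l2norm branch (\<lambda>x. \<phi> i x - f x)) \<longlonglongrightarrow> 0"
proof -
  define g where "g N x = cindicator {0..real N} x * f x" for N x
  have g: "g N \<in> L12" for N unfolding g_def using L2_truncate[OF f] .
  have [measurable]: "f \<in> borel_measurable branch" "g N \<in> borel_measurable branch" for N
    using f L12_L2[OF g[of N]] by (auto simp: L2_def)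
  have lim: "(\<lambda>N. l2norm branch (\<lambda>x. g N x - f x)) \<longlonglongrightarrow> 0"
  proof (rule l2norm_dominated)
    show "integrable branch (\<lambda>x. (cmod (f x))\<^sup>2)" using f by (rule L2_integrable)
    show "AE x in branch. cmod (g N x - f x) \<le> cmod (f x)" for N
      by (intro AE_branchI) (auto simp: g_def indicator_def)
    show "AE x in branch. (\<lambda>N. g N x) \<longlonglongrightarrow> f x"
    proof (rule AE_branchI)
      fix x :: real assume "x > 0"
      obtain m where "x \<le> real m" using real_arch_simple by blast
      then have "g N x = f x" if "N \<ge> m" for N using that \<open>x > 0\<close> by (simp add: g_def indicator_def)
      then show "(\<lambda>N. g N x) \<longlonglongrightarrow> f x" by (intro tendsto_eventually) (auto simp: eventually_sequentially)
    qed
  qed auto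
  have "\<forall>N. \<exists>\<phi>\<in>test_functions. approx_dist (\<lambda>x. \<phi> x - g N x) < inverse (real (Suc N))"
    using L12_subset_test_closure[OF g] by (simp add: test_closure_def)
  then obtain \<phi> where \<phi>: "\<And>N. \<phi> N \<in> test_functions" "\<And>N. approx_dist (\<lambda>x. \<phi> N x - g N x) < inverse (real (Suc N))"
    by metis
  have "(\<lambda>i. l2norm branch (\<lambda>x. \<phi> i x - f x)) \<longlonglongrightarrow> 0"
  proof (rule tendsto_sandwich[OF always_eventually always_eventually tendsto_const])
    show "(\<lambda>i. inverse (real (Suc i)) + l2norm branch (\<lambda>x. g i x - f x)) \<longlonglongrightarrow> 0"
      using tendsto_add[OF LIMSEQ_inverse_real_of_nat lim] by simp
    show "\<forall>i. l2norm branch (\<lambda>x. \<phi> i x - f x) \<le> inverse (real (Suc i)) + l2norm branch (\<lambda>x. g i x - f x)"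
    proof
      fix i
      show "l2norm branch (\<lambda>x. \<phi> i x - f x) \<le> inverse (real (Suc i)) + l2norm branch (\<lambda>x. g i x - f x)"
        using l2norm_triangle_diff[OF test_functions_L2[OF \<phi>(1)[of i]] L12_L2[OF g[of i]] f] \<phi>(2)[of i] l1norm_nonneg[of "\<lambda>x. \<phi> i x - g i x"]
        unfolding approx_dist_def by linarith
    qed
  qed simp
  with \<phi>(1) show ?thesis by (rule that)
qed

lemma L2_integral_tendsto:
  assumes "\<And>i. F i \<in> L2 M" "f \<in> L2 M" "g \<in> L2 M" "(\<lambda>i. l2norm M (\<lambda>x. F i x - f x)) \<longlonglongrightarrow> 0"
  shows "(\<lambda>i. \<integral>x. F i x * g x \<partial>M) \<longlonglongrightarrow> (\<integral>x. f x * g x \<partial>M)"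
proof -
  have "(\<lambda>i. (\<integral>x. F i x * g x \<partial>M) - (\<integral>x. f x * g x \<partial>M)) \<longlonglongrightarrow> 0"
  proof (rule Lim_null_comparison)
    show "(\<lambda>i. l2norm M (\<lambda>x. F i x - f x) * l2norm M g) \<longlonglongrightarrow> 0"
      using tendsto_mult_right[OF assms(4), of "l2norm M g"] by simp
    have "(\<integral>x. F i x * g x \<partial>M) - (\<integral>x. f x * g x \<partial>M) = (\<integral>x. (F i x - f x) * g x \<partial>M)" for i
      using assms by (simp add: L2_mult_integrable left_diff_distrib)
    then show "\<forall>\<^sub>F i in sequentially. norm ((\<integral>x. F i x * g x \<partial>M) - (\<integral>x. f x * g x \<partial>M)) \<le> l2norm M (\<lambda>x. F i x - f x) * l2norm M g"
      using assms by (simp add: L2_Cauchy_Schwarz L2_diff)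
  qed
  then show ?thesis by (simp add: LIM_zero_iff)
qed

text \<open>Test functions approximating the conjugate of f turn the orthogonality into the
  vanishing of the norm of f.\<close>

lemma L2_fundamental_lemma:
  assumes f: "f \<in> L2 branch" and orth: "\<And>\<phi>. \<phi> \<in> test_functions \<Longrightarrow> (\<integral>x. f x * \<phi> x \<partial>branch) = 0"
  shows "AE x in branch. f x = 0"
proof -
  have "(\<lambda>x. cnj (f x)) \<in> borel_measurable branch"
    using L2_measurable[OF f] by (rule measurable_compose) (intro borel_measurable_continuous_onI continuous_intros)
  then have cnj: "(\<lambda>x. cnj (f x)) \<in> L2 branch" using f by (simp add: L2_def)
  obtain \<phi> where \<phi>: "\<And>i::nat. \<phi> i \<in> test_functions" "(\<lambda>i. l2norm branch (\<lambda>x. \<phi> i x - cnj (f x))) \<longlonglongrightarrow> 0"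
    by (rule L2_test_sequence[OF cnj], rule that)
  have "(\<lambda>i. \<integral>x. \<phi> i x * f x \<partial>branch) \<longlonglongrightarrow> (\<integral>x. cnj (f x) * f x \<partial>branch)"
    by (rule L2_integral_tendsto[OF test_functions_L2[OF \<phi>(1)] cnj f \<phi>(2)])
  moreover have "(\<integral>x. \<phi> i x * f x \<partial>branch) = 0" for i using orth[OF \<phi>(1)] by (simp add: mult.commute)
  ultimately have "(\<integral>x. cnj (f x) * f x \<partial>branch) = 0" by (simp add: LIMSEQ_const_iff)
  also have "(\<integral>x. cnj (f x) * f x \<partial>branch) = of_real ((l2norm branch f)\<^sup>2)"
    unfolding l2norm_power2 integral_complex_of_real[symmetric]
    by (intro Bochner_Integration.integral_cong) (simp_all only: complex_mult_cnj cmod_power2 mult.commute[of "cnj _"])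
  finally show ?thesis by (intro l2norm_eq_0_imp_AE f) simp
qed

section \<open>The Green kernel of the Dirichlet problem on a branch\<close>

text \<open>The entire function sin z / z. It keeps the Green kernel regular where a square root
  vanishes, that is, at the threshold of a branch.\<close>

definition csinc :: "complex \<Rightarrow> complex" where
  "csinc z = (if z = 0 then 1 else sin z / z)"

lemma csinc_holomorphic: "csinc holomorphic_on UNIV"
proof -
  have "(\<lambda>z. if z = 0 then deriv sin 0 else (sin z - sin 0) / (z - 0)) holomorphic_on (UNIV :: complex set)"
    by (rule pole_lemma) (auto intro: holomorphic_intros)
  also have "(\<lambda>z::complex. if z = 0 then deriv sin 0 else (sin z - sin 0) / (z - 0)) = csinc"
    by (auto simp: csinc_def DERIV_imp_deriv[OF DERIV_sin])
  finally show ?thesis .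
qed

lemma csinc_derivative: "(csinc has_field_derivative deriv csinc z) (at z within S)"
  using holomorphic_derivI[OF csinc_holomorphic open_UNIV UNIV_I] by (rule has_field_derivative_at_within)

lemma continuous_on_csinc [continuous_intros]:
  "continuous_on S f \<Longrightarrow> continuous_on S (\<lambda>x. csinc (f x))"
  by (rule continuous_on_compose2[OF holomorphic_on_imp_continuous_on[OF csinc_holomorphic]]) auto

lemma continuous_on_deriv_csinc [continuous_intros]:
  "continuous_on S f \<Longrightarrow> continuous_on S (\<lambda>x. deriv csinc (f x))"
  by (rule continuous_on_compose2[OF holomorphic_on_imp_continuous_on[OF holomorphic_deriv[OF csinc_holomorphic open_UNIV]]]) auto

lemma mult_csinc: "\<xi> * (of_real m * csinc (\<xi> * of_real m)) = sin (\<xi> * of_real m)"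
  by (auto simp: csinc_def)

lemma norm_sin_le_exp: "cmod (sin z) \<le> exp \<bar>Im z\<bar>"
proof -
  have "cmod (exp (\<i> * z) - exp (- (\<i> * z))) \<le> exp (- Im z) + exp (Im z)"
    using norm_triangle_ineq4[of "exp (\<i> * z)" "exp (- (\<i> * z))"] by simp
  also have "\<dots> \<le> 2 * exp \<bar>Im z\<bar>" by (auto simp: abs_if)
  finally show ?thesis by (simp add: sin_exp_eq norm_divide norm_mult)
qed

text \<open>The kernel of \<open>(- d\<^sup>2/dx\<^sup>2 - \<xi>\<^sup>2)\<^sup>-\<^sup>1\<close> with Dirichlet condition at \<open>0\<close>; written with \<open>csinc\<close> it is entire in \<open>\<xi>\<close>.\<close>

definition green :: "complex \<Rightarrow> real \<Rightarrow> real \<Rightarrow> complex" where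
  "green \<xi> x y = of_real (min x y) * csinc (\<xi> * of_real (min x y)) * exp (- \<i> * \<xi> * of_real (max x y))"

lemma green_commute: "green \<xi> x y = green \<xi> y x"
  by (simp add: green_def min.commute max.commute)

lemma green_eq: "\<xi> \<noteq> 0 \<Longrightarrow> green \<xi> x y = sin (\<xi> * of_real (min x y)) / \<xi> * exp (- \<i> * \<xi> * of_real (max x y))"
  using mult_csinc[of \<xi> "min x y"] by (simp add: green_def field_simps)

text \<open>The growth of the sine at the smaller argument is absorbed by the decay of the
  exponential at the larger one.\<close>

lemma norm_green_le:
  assumes "Im \<xi> \<le> 0" "0 \<le> x" "0 \<le> y" "\<xi> \<noteq> 0"
  shows "cmod (green \<xi> x y) \<le> 1 / cmod \<xi>"
proof -
  have "cmod (sin (\<xi> * of_real (min x y))) * cmod (exp (- \<i> * \<xi> * of_real (max x y)))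
      \<le> exp \<bar>Im (\<xi> * of_real (min x y))\<bar> * exp (Im \<xi> * max x y)"
    by (rule mult_mono[OF norm_sin_le_exp]) auto
  also have "\<dots> = exp (Im \<xi> * (max x y - min x y))"
    using assms by (simp add: abs_mult algebra_simps flip: exp_add)
  also have "\<dots> \<le> 1" using assms by (simp add: mult_nonpos_nonneg)
  finally show ?thesis using assms(4) by (simp add: green_eq norm_mult norm_divide divide_simps)
qed

lemma continuous_on_green [continuous_intros]:
  assumes "continuous_on S f" "continuous_on S g" "continuous_on S h"
  shows "continuous_on S (\<lambda>x. green (f x) (g x) (h x))"
  unfolding green_def using assms by (intro continuous_intros)

definition green_form :: "real \<Rightarrow> complex \<Rightarrow> (real \<Rightarrow> complex) \<Rightarrow> (real \<Rightarrow> complex) \<Rightarrow> complex" where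
  "green_form b \<xi> f g = integral {0..b} (\<lambda>x. integral {0..b} (\<lambda>y. green \<xi> x y * f y * g x))"

lemma continuous_on_compose_UNIV:
  "continuous_on UNIV f \<Longrightarrow> continuous_on S g \<Longrightarrow> continuous_on S (\<lambda>x. f (g x))"
  by (rule continuous_on_compose2) auto

text \<open>The double integral is treated as one integral over a square, where the integrand and
  its \<xi>-derivative are jointly continuous and differentiation under the integral sign is
  available; Fubini for continuous functions restores the iterated form.\<close>

lemma green_form_holomorphic:
  assumes "continuous_on UNIV f" "continuous_on UNIV g"
  shows "(\<lambda>\<xi>. green_form b \<xi> f g) holomorphic_on UNIV"
proof -
  note [continuous_intros] = assms[THEN continuous_on_compose_UNIV]
  define d where "d \<xi> x y = of_real (min x y) * (deriv csinc (\<xi> * of_real (min x y)) * of_real (min x y)) * exp (- \<i> * \<xi> * of_real (max x y))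
     + of_real (min x y) * csinc (\<xi> * of_real (min x y)) * (exp (- \<i> * \<xi> * of_real (max x y)) * (- \<i> * of_real (max x y)))"
    for \<xi> :: complex and x y :: real
  have d: "((\<lambda>\<xi>. green \<xi> x y) has_field_derivative d \<xi> x y) (at \<xi> within UNIV)" for \<xi> x y
    unfolding green_def d_def
    by (auto intro!: derivative_eq_intros DERIV_chain2[OF csinc_derivative])
  have "(\<lambda>\<xi>. integral (cbox (0, 0) (b, b)) (\<lambda>z. green \<xi> (fst z) (snd z) * f (snd z) * g (fst z))) holomorphic_on UNIV"
  proof (rule leibniz_rule_holomorphic)
    show "((\<lambda>\<xi>. green \<xi> (fst z) (snd z) * f (snd z) * g (fst z)) has_field_derivative
       d \<xi> (fst z) (snd z) * f (snd z) * g (fst z)) (at \<xi> within UNIV)" for \<xi> z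
      by (intro DERIV_cmult_right d)
    show "(\<lambda>z. green \<xi> (fst z) (snd z) * f (snd z) * g (fst z)) integrable_on cbox (0, 0) (b, b)" for \<xi>
      by (intro integrable_continuous continuous_intros assms)
    show "continuous_on (UNIV \<times> cbox (0, 0) (b, b)) (\<lambda>(\<xi>, z). d \<xi> (fst z) (snd z) * f (snd z) * g (fst z))"
      unfolding d_def split_beta by (intro continuous_intros assms)
  qed simp
  also have "(\<lambda>\<xi>. integral (cbox (0, 0) (b, b)) (\<lambda>z. green \<xi> (fst z) (snd z) * f (snd z) * g (fst z))) = (\<lambda>\<xi>. green_form b \<xi> f g)"
    unfolding green_form_def
    by (rule ext, subst integral_prod_continuous) (auto intro!: continuous_intros)
  finally show ?thesis .
qed

lemma green_form_swap:
  assumes "continuous_on UNIV f" "continuous_on UNIV g"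
  shows "green_form b \<xi> f g = green_form b \<xi> g f"
proof -
  note [continuous_intros] = assms[THEN continuous_on_compose_UNIV]
  have "green_form b \<xi> f g = integral (cbox 0 b) (\<lambda>y. integral (cbox 0 b) (\<lambda>x. green \<xi> x y * f y * g x))"
    unfolding green_form_def box_real[symmetric]
    by (rule integral_swap_continuous) (auto simp: split_beta intro!: continuous_intros assms)
  then show ?thesis by (simp add: green_form_def green_commute mult_ac)
qed

text \<open>The kernel inverts - d^2/dx^2 - \<xi>^2. On either side of y = x its product with
  \<xi>^2 g + g'' is the derivative of a Wronskian-type expression, and the kink of the kernel at y
  = x leaves - g x.\<close>

lemma green_form_parts_inner:
  assumes "smooth g" "\<And>x. x \<le> 0 \<or> x \<ge> b \<Longrightarrow> g x = 0" "x \<in> {0..b}" "\<xi> \<noteq> 0" "b > 0"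
  shows "\<xi>\<^sup>2 * integral {0..b} (\<lambda>y. green \<xi> x y * g y) = - g x - integral {0..b} (\<lambda>y. green \<xi> x y * vderiv 2 g y)"
proof -
  \<comment> \<open>The hypothesis covers \<open>b\<close> and the points to its right, so the
    derivative at \<open>b\<close> is read off from the one-sided interval
    \<open>{b..b + 1}\<close>.\<close>
  have g0: "vderiv 1 g b = 0" 
  proof -
    have "((\<lambda>x. 0) has_vector_derivative vderiv 1 g b) (at b within {b..b + 1})"
      by (rule has_vector_derivative_transform[where f=g])
         (use assms smooth_has_derivative in \<open>auto intro: has_vector_derivative_at_within\<close>)
    moreover have "((\<lambda>x. 0) has_vector_derivative 0) (at b within {b..b + 1})" by (rule has_vector_derivative_const)
    ultimately show ?thesis
      using vector_derivative_unique_within_closed_interval[of b "b + 1" b "\<lambda>x. 0" "vderiv 1 g b" 0] by (simp add: box_real)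
  qed
  have dg: "(vderiv m g has_vector_derivative vderiv (Suc m) g y) (at y within S)" for m y S
    using smooth_has_derivative'[OF assms(1)] by (rule has_vector_derivative_at_within)
  have dg0: "(g has_vector_derivative vderiv 1 g y) (at y within S)" for y S using dg[of 0] by (simp add: One_nat_def)
  have dg1: "(vderiv 1 g has_vector_derivative vderiv 2 g y) (at y within S)" for y S using dg[of 1] by (simp add: numeral_2_eq_2 One_nat_def)
  define P where "P y = sin (\<xi> * of_real y) / \<xi>" for y :: real
  define P' where "P' y = cos (\<xi> * of_real y)" for y :: real
  define Q where "Q y = exp (- \<i> * \<xi> * of_real y)" for y :: real
  have P: "(P has_vector_derivative P' y) (at y within S)" for y S
    unfolding P_def P'_def using assms(4)
    by (intro has_vector_derivative_real_field[where f="\<lambda>z. sin (\<xi> * z) / \<xi>"]) (auto intro!: derivative_eq_intros)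
  have P'': "(P' has_vector_derivative - \<xi>\<^sup>2 * P y) (at y within S)" for y S
    unfolding P_def P'_def using assms(4)
    by (intro has_vector_derivative_real_field[where f="\<lambda>z. cos (\<xi> * z)"]) (auto intro!: derivative_eq_intros simp: power2_eq_square)
  have Q: "(Q has_vector_derivative - \<i> * \<xi> * Q y) (at y within S)" for y S
    unfolding Q_def by (intro has_vector_derivative_real_field[where f="\<lambda>z. exp (- \<i> * \<xi> * z)"]) (auto intro!: derivative_eq_intros)
  \<comment> \<open>The integrand of the claim. It is integrated separately over
    \<open>{0..x}\<close> and \<open>{x..b}\<close>, where the kernel factors into a sine and an
    exponential.\<close>
  define W where "W y = \<xi>\<^sup>2 * (green \<xi> x y * g y) + green \<xi> x y * vderiv 2 g y" for y
  have contW: "W integrable_on {u..v}" for u v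
    unfolding W_def by (intro integrable_continuous_real continuous_intros assms smooth_continuous smooth_continuous_vderiv)
  have "(W has_integral (Q x * (P x * vderiv 1 g x - P' x * g x)) - (Q x * (P 0 * vderiv 1 g 0 - P' 0 * g 0))) {0..x}"
  proof (rule fundamental_theorem_of_calculus)
    fix y assume "y \<in> {0..x}"
    then have Kg: "green \<xi> x y = Q x * P y" using assms by (simp add: green_eq P_def Q_def min_absorb2 max_absorb1)
    show "((\<lambda>y. Q x * (P y * vderiv 1 g y - P' y * g y)) has_vector_derivative W y) (at y within {0..x})"
      unfolding W_def Kg
      by (rule has_vector_derivative_eq_rhs[OF has_vector_derivative_mult_right[OF has_vector_derivative_diff[OF
            has_vector_derivative_mult[OF P dg1] has_vector_derivative_mult[OF P'' dg0]]]]) (simp add: algebra_simps)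
  qed (use assms in auto)
  then have 1: "(W has_integral Q x * (P x * vderiv 1 g x - P' x * g x)) {0..x}"
    using assms(2)[of 0] by (simp add: P_def)
  have "(W has_integral (P x * (Q b * vderiv 1 g b - (- \<i> * \<xi> * Q b) * g b)) - (P x * (Q x * vderiv 1 g x - (- \<i> * \<xi> * Q x) * g x))) {x..b}"
  proof (rule fundamental_theorem_of_calculus)
    fix y assume "y \<in> {x..b}"
    then have Kg: "green \<xi> x y = P x * Q y" using assms by (simp add: green_eq P_def Q_def min_absorb1 max_absorb2)
    show "((\<lambda>y. P x * (Q y * vderiv 1 g y - (- \<i> * \<xi> * Q y) * g y)) has_vector_derivative W y) (at y within {x..b})"
      unfolding W_def Kg
      by (rule has_vector_derivative_eq_rhs[OF has_vector_derivative_mult_right[OF has_vector_derivative_diff[OF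
            has_vector_derivative_mult[OF Q dg1] has_vector_derivative_mult[OF has_vector_derivative_mult_right[OF Q] dg0]]]])
         (simp add: algebra_simps power2_eq_square)
  qed (use assms in auto)
  then have 2: "(W has_integral - (P x * (Q x * vderiv 1 g x + \<i> * \<xi> * Q x * g x))) {x..b}"
    using assms(2)[of b] by (simp add: g0)
  have "(W has_integral Q x * (P x * vderiv 1 g x - P' x * g x) + - (P x * (Q x * vderiv 1 g x + \<i> * \<xi> * Q x * g x))) {0..b}"
    by (rule has_integral_combine[OF _ _ 1 2]) (use assms in auto)
  \<comment> \<open>The terms with the derivative of g cancel; what remains is the Wronskian of sine
    and exponential, which is constant.\<close>
  also have "Q x * (P x * vderiv 1 g x - P' x * g x) + - (P x * (Q x * vderiv 1 g x + \<i> * \<xi> * Q x * g x))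
     = - (Q x * (P' x + \<i> * sin (\<xi> * of_real x))) * g x"
    using assms(4) by (simp add: P_def field_simps)
  also have "P' x + \<i> * sin (\<xi> * of_real x) = exp (\<i> * \<xi> * of_real x)"
    by (simp add: P'_def exp_Euler mult.assoc)
  also have "Q x * exp (\<i> * \<xi> * of_real x) = 1"
    by (simp add: Q_def flip: exp_add)
  finally have *: "integral {0..b} W = - g x" by (simp add: has_integral_iff)
  have "continuous_on {0..b} g" "continuous_on {0..b} (vderiv 2 g)"
    using assms(1) smooth_continuous smooth_continuous_vderiv by auto
  then have "integral {0..b} W = \<xi>\<^sup>2 * integral {0..b} (\<lambda>y. green \<xi> x y * g y) + integral {0..b} (\<lambda>y. green \<xi> x y * vderiv 2 g y)"
    unfolding W_def
    by (subst integral_add)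
       (auto intro!: integrable_continuous_real continuous_intros)
  with * show ?thesis by (simp add: algebra_simps)
qed

lemma continuous_on_green_integral:
  assumes "continuous_on UNIV h"
  shows "continuous_on {0..b} (\<lambda>x. integral {0..b} (\<lambda>y. green \<xi> x y * h y))"
  unfolding box_real[symmetric]
  by (rule integral_continuous_on_param)
     (auto simp: split_beta intro!: continuous_intros assms[THEN continuous_on_compose_UNIV])

text \<open>One step of the expansion in 1 / \<xi>^2: up to a form of the same kind with f'' in
  place of f, the form is the plain pairing divided by - \<xi>^2.\<close>

lemma green_form_parts:
  assumes "smooth f" "smooth g" "\<And>x. x \<le> 0 \<or> x \<ge> b \<Longrightarrow> f x = 0" "\<xi> \<noteq> 0" "b > 0"
  shows "\<xi>\<^sup>2 * green_form b \<xi> f g = - integral {0..b} (\<lambda>x. f x * g x) - green_form b \<xi> (vderiv 2 f) g"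
proof -
  have cont: "continuous_on UNIV f" "continuous_on UNIV g" "continuous_on UNIV (vderiv 2 f)"
    using assms smooth_continuous smooth_continuous_vderiv by auto
  have "\<xi>\<^sup>2 * green_form b \<xi> f g = integral {0..b} (\<lambda>x. \<xi>\<^sup>2 * integral {0..b} (\<lambda>y. green \<xi> x y * f y * g x))"
    by (simp add: green_form_def)
  also have "\<dots> = integral {0..b} (\<lambda>x. - (f x * g x) - integral {0..b} (\<lambda>y. green \<xi> x y * vderiv 2 f y * g x))"
  proof (rule Henstock_Kurzweil_Integration.integral_cong)
    fix x assume x: "x \<in> {0..b}"
    have "\<xi>\<^sup>2 * integral {0..b} (\<lambda>y. green \<xi> x y * f y * g x) = (\<xi>\<^sup>2 * integral {0..b} (\<lambda>y. green \<xi> x y * f y)) * g x"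
      by simp
    also have "\<dots> = (- f x - integral {0..b} (\<lambda>y. green \<xi> x y * vderiv 2 f y)) * g x"
      by (subst green_form_parts_inner[OF assms(1,3) x assms(4,5)]) auto
    finally show "\<xi>\<^sup>2 * integral {0..b} (\<lambda>y. green \<xi> x y * f y * g x) = - (f x * g x) - integral {0..b} (\<lambda>y. green \<xi> x y * vderiv 2 f y * g x)"
      by (simp add: algebra_simps)
  qed
  also have "\<dots> = - integral {0..b} (\<lambda>x. f x * g x) - green_form b \<xi> (vderiv 2 f) g"
    unfolding green_form_def
    by (subst integral_diff) (auto intro!: integrable_continuous_real continuous_on_green_integral continuous_intros cont(1,2)[THEN continuous_on_compose_UNIV] cont(3))
  finally show ?thesis .
qed

lemma norm_green_form_le:
  assumes "continuous_on UNIV f" "continuous_on UNIV g" "b > 0" "\<And>x. cmod (f x) \<le> F" "\<And>x. cmod (g x) \<le> G"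
    and "Im \<xi> \<le> 0" "\<xi> \<noteq> 0"
  shows "cmod (green_form b \<xi> f g) \<le> b * (b * (F * G)) / cmod \<xi>"
proof -
  have FG: "F \<ge> 0" "G \<ge> 0" using assms(4)[of 0] assms(5)[of 0] norm_ge_zero order_trans by blast+
  have "cmod (integral {0..b} (\<lambda>y. green \<xi> x y * f y * g x)) \<le> 1 / cmod \<xi> * F * G * (b - 0)" if "x \<in> {0..b}" for x
  proof (rule integral_bound)
    show "cmod (green \<xi> x y * f y * g x) \<le> 1 / cmod \<xi> * F * G" if "y \<in> {0..b}" for y
      unfolding norm_mult using that \<open>x \<in> {0..b}\<close> assms FG
      by (intro mult_mono norm_green_le) auto
  qed (use assms(3) in \<open>auto intro!: continuous_intros continuous_on_subset[OF assms(1)]\<close>)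
  note * = this
  have "continuous_on {0..b} (\<lambda>x. integral {0..b} (\<lambda>y. green \<xi> x y * f y * g x))"
    by (auto intro!: continuous_on_green_integral continuous_intros assms(1) continuous_on_subset[OF assms(2)])
  then have "cmod (green_form b \<xi> f g) \<le> (1 / cmod \<xi> * F * G) * (b - 0) * (b - 0)"
    unfolding green_form_def using assms(3) * by - (rule integral_bound, auto simp del: integral_mult_left)
  then show ?thesis by (simp add: mult_ac)
qed

section \<open>The square root on the closed lower half-plane\<close>

definition quadrant :: "complex set" where
  "quadrant = {z. Re z \<ge> 0 \<and> Im z \<le> 0}"

lemma lower_sqrt_power2 [simp]: "(lower_sqrt z)\<^sup>2 = z"
proof -
  have "rcis (cmod z) (lower_arg z) = z"
  proof (cases "z = 0 \<or> Arg z \<noteq> pi")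
    case True
    then show ?thesis using rcis_cmod_Arg[of z] by (cases "z = 0") (auto simp: lower_arg_def)
  next
    case False
    then have "rcis (cmod z) pi = z" using rcis_cmod_Arg[of z] by simp
    then show ?thesis using False by (simp add: lower_arg_def rcis_def cis.ctr)
  qed
  then show ?thesis by (simp add: lower_sqrt_def DeMoivre2)
qed

lemma norm_lower_sqrt [simp]: "cmod (lower_sqrt z) = sqrt (cmod z)"
  by (simp add: lower_sqrt_def)

lemma lower_sqrt_quadrant:
  assumes "Im z \<le> 0"
  shows "lower_sqrt z \<in> quadrant"
proof -
  have "- pi \<le> lower_arg z \<and> lower_arg z \<le> 0"
  proof (cases "Arg z = pi")
    case False
    have "\<not> 0 < Arg z"
    proof
      assume *: "0 < Arg z"
      then have "z \<noteq> 0" using Arg_zero by force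
      have "Arg z < pi" using False Arg_le_pi[of z] by simp
      then have "sin (Arg z) > 0" using * by (intro sin_gt_zero)
      then have "cmod z * sin (Arg z) > 0" using \<open>z \<noteq> 0\<close> by simp
      moreover have "Im z = cmod z * sin (Arg z)" using rcis_cmod_Arg[of z] by (metis Im_rcis)
      ultimately show False using assms by simp
    qed
    then show ?thesis using False mpi_less_Arg[of z] by (simp add: lower_arg_def)
  qed (simp add: lower_arg_def)
  then have "cos (lower_arg z / 2) \<ge> 0" "sin (- (lower_arg z / 2)) \<ge> 0"
    by (intro cos_ge_zero sin_ge_zero; simp)+
  then show ?thesis by (simp add: quadrant_def lower_sqrt_def mult_nonneg_nonpos)
qed

text \<open>Two square roots of the same number differ by a sign, and the quadrant meets its
  negative only in 0. This identifies values of \<open>lower_sqrt\<close> without any computation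
  with arguments.\<close>

lemma quadrant_unique:
  assumes "v \<in> quadrant" "y \<in> quadrant" "v\<^sup>2 = y\<^sup>2"
  shows "v = y"
proof -
  have "v = y \<or> v = - y" using assms(3) by (simp add: power2_eq_iff)
  then show ?thesis using assms(1,2) by (auto simp: quadrant_def complex_eq_iff)
qed

lemma Im_quadrant_power2: "\<zeta> \<in> quadrant \<Longrightarrow> Im (\<zeta>\<^sup>2) \<le> 0"
  by (auto simp: quadrant_def power2_eq_square mult_nonneg_nonpos mult_nonpos_nonneg)

lemma lower_sqrt_unique: "y \<in> quadrant \<Longrightarrow> y\<^sup>2 = z \<Longrightarrow> lower_sqrt z = y"
  using Im_quadrant_power2[of y] by (intro quadrant_unique[OF lower_sqrt_quadrant]) auto

lemma lower_sqrt_of_real: "r \<ge> 0 \<Longrightarrow> lower_sqrt (of_real r) = of_real (sqrt r)"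
  by (rule lower_sqrt_unique) (auto simp: quadrant_def simp flip: of_real_power)

text \<open>The argument - \<pi> is halved to - \<pi> / 2. This sign makes exp (- \<i> \<xi> x)
  bounded on the half-line: below its threshold a branch carries an exponential that does not
  grow.\<close>

lemma lower_sqrt_of_neg_real: "r \<le> 0 \<Longrightarrow> lower_sqrt (of_real r) = - \<i> * of_real (sqrt (- r))"
  by (rule lower_sqrt_unique) (auto simp: quadrant_def power_mult_distrib simp flip: of_real_power)

text \<open>Multiplication by \<i> turns the closed lower half-plane into the closed right
  half-plane, which meets the cut of \<open>csqrt\<close> only in 0; the factor
  \<open>cis (- pi / 4)\<close> turns the result back. Continuity and holomorphy are thereby
  inherited from \<open>csqrt\<close>.\<close>

lemma lower_sqrt_eq_csqrt:
  assumes "Im z \<le> 0"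
  shows "lower_sqrt z = cis (- pi / 4) * csqrt (\<i> * z)"
proof (rule lower_sqrt_unique)
  have "(cis (- pi / 4))\<^sup>2 = - \<i>" by (simp add: complex_eq_iff power2_eq_square cos_45 sin_45)
  then show "(cis (- pi / 4) * csqrt (\<i> * z))\<^sup>2 = z" by (simp add: power_mult_distrib)
  define p where "p = csqrt (\<i> * z)"
  have "Re (p\<^sup>2) \<ge> 0" using assms by (simp add: p_def)
  then have "(Im p)\<^sup>2 \<le> (Re p)\<^sup>2" by (simp add: power2_eq_square)
  then have "\<bar>Im p\<bar> \<le> Re p" using Re_csqrt[of "\<i> * z"] abs_le_square_iff[of "Im p" "Re p"] by (simp add: p_def)
  then have "0 \<le> sqrt 2 / 2 * (Re p + Im p)" "0 \<le> sqrt 2 / 2 * (Re p - Im p)" by auto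
  then show "cis (- pi / 4) * csqrt (\<i> * z) \<in> quadrant"
    unfolding p_def[symmetric] by (simp add: quadrant_def cos_45 sin_45 algebra_simps)
qed

lemma continuous_at_csqrt_0: "isCont csqrt 0"
proof -
  have "((\<lambda>z. sqrt (cmod z)) \<longlongrightarrow> sqrt (cmod 0)) (at (0::complex))" by (intro tendsto_intros)
  then have "(csqrt \<longlongrightarrow> 0) (at 0)"
    by (intro tendsto_norm_zero_cancel[of csqrt]) simp
  then show ?thesis by (simp add: isCont_def)
qed

lemma continuous_on_lower_sqrt: "continuous_on {z. Im z \<le> 0} lower_sqrt"
proof -
  have "continuous_on {z. Im z \<le> 0} (\<lambda>z. cis (- pi / 4) * csqrt (\<i> * z))"
  proof (intro continuous_on_mult continuous_on_const, rule continuous_on_compose2[where g=csqrt])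
    show "continuous_on {z. Re z \<ge> 0} csqrt"
    proof (rule continuous_at_imp_continuous_on, rule ballI)
      fix z assume "z \<in> {z. Re z \<ge> 0}"
      then show "isCont csqrt z"
        using continuous_at_csqrt_0 continuous_at_csqrt[of z] by (cases "z = 0") (force simp: complex_nonpos_Reals_iff complex_eq_iff)+
    qed
  qed (auto intro: continuous_intros)
  then show ?thesis by (rule continuous_on_eq) (simp add: lower_sqrt_eq_csqrt)
qed

lemma continuous_on_lower_sqrt':
  "continuous_on S f \<Longrightarrow> (\<And>z. z \<in> S \<Longrightarrow> Im (f z) \<le> 0) \<Longrightarrow> continuous_on S (\<lambda>z. lower_sqrt (f z))"
  by (rule continuous_on_compose2[OF continuous_on_lower_sqrt]) auto

lemma holomorphic_on_lower_sqrt: "lower_sqrt holomorphic_on {z. Im z < 0}"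
proof (rule holomorphic_transform)
  show "(\<lambda>z. cis (- pi / 4) * csqrt (\<i> * z)) holomorphic_on {z. Im z < 0}"
    by (intro holomorphic_intros) (auto simp: complex_nonpos_Reals_iff)
qed (simp add: lower_sqrt_eq_csqrt)

lemma quadrant_scale: "r \<ge> 0 \<Longrightarrow> z \<in> quadrant \<Longrightarrow> of_real r * z \<in> quadrant"
  by (simp add: quadrant_def mult_nonneg_nonpos)

lemma quadrant_sum: "(\<And>k. k \<in> K \<Longrightarrow> f k \<in> quadrant) \<Longrightarrow> sum f K \<in> quadrant"
  by (auto simp: quadrant_def intro: sum_nonneg sum_nonpos)

text \<open>Real parts and imaginary parts of two numbers in the quadrant have equal signs, so no
  cancellation occurs in sums. This is what bounds \<open>w\<close> from below by each single
  term.\<close>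

lemma norm_quadrant_add_ge:
  assumes "z \<in> quadrant" "y \<in> quadrant"
  shows "cmod z \<le> cmod (z + y)"
  unfolding cmod_def using assms
  by (intro real_sqrt_le_mono add_mono) (auto simp: quadrant_def abs_le_square_iff[symmetric])

section \<open>The network\<close>

locale star_network =
  fixes n :: nat and c a :: "nat \<Rightarrow> real"
  assumes n_ge_1: "n \<ge> 1"
    and c_pos: "\<And>k. k \<in> {1..n} \<Longrightarrow> c k > 0"
    and a_ge: "\<And>k. k \<in> {1..n} \<Longrightarrow> a 1 \<le> a k"
begin

text \<open>The spectral parameter is uniformized by \<open>\<lambda> = a 1 + \<zeta>\<^sup>2\<close> with \<open>\<zeta>\<close> in the closed fourth quadrant,
  which is mapped onto the closed lower half-plane; its real half-axis covers the spectrum.\<close>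

definition Xi :: "nat \<Rightarrow> complex \<Rightarrow> complex" where
  "Xi k \<zeta> = xi c a k (of_real (a 1) + \<zeta>\<^sup>2)"

text \<open>This is \<open>w\<close> up to the factor - \<i>, extended to complex \<zeta>. Its
  reciprocal carries the coupling of the branches at the vertex.\<close>

definition Xi_sum :: "complex \<Rightarrow> complex" where
  "Xi_sum \<zeta> = (\<Sum>k\<in>{1..n}. of_real (c k) * Xi k \<zeta>)"

lemma Xi_arg_Im:
  assumes "k \<in> {1..n}"
  shows "Im ((of_real (a 1) + \<zeta>\<^sup>2 - of_real (a k)) / of_real (c k)) = Im (\<zeta>\<^sup>2) / c k"
  by simp

lemma Xi_power2:
  assumes "k \<in> {1..n}"
  shows "of_real (c k) * (Xi k \<zeta>)\<^sup>2 = \<zeta>\<^sup>2 + of_real (a 1 - a k)"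
  using c_pos[OF assms] by (simp add: Xi_def xi_def)

lemma Xi_quadrant:
  assumes "k \<in> {1..n}" "\<zeta> \<in> quadrant"
  shows "Xi k \<zeta> \<in> quadrant"
  unfolding Xi_def xi_def
  by (rule lower_sqrt_quadrant, subst Xi_arg_Im)
     (use assms c_pos[OF assms(1)] Im_quadrant_power2 in \<open>auto simp: divide_nonpos_pos\<close>)

lemma Xi_continuous:
  assumes "k \<in> {1..n}"
  shows "continuous_on quadrant (Xi k)"
  unfolding Xi_def xi_def
proof (rule continuous_on_lower_sqrt')
  show "continuous_on quadrant (\<lambda>\<zeta>. (of_real (a 1) + \<zeta>\<^sup>2 - of_real (a k)) / complex_of_real (c k))"
    using c_pos[OF assms] by (intro continuous_intros) auto
  show "Im ((of_real (a 1) + \<zeta>\<^sup>2 - of_real (a k)) / complex_of_real (c k)) \<le> 0" if "\<zeta> \<in> quadrant" for \<zeta>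
    using c_pos[OF assms] Im_quadrant_power2[OF that] by (subst Xi_arg_Im[OF assms]) (auto simp: divide_nonpos_pos)
qed

lemma Xi_holomorphic:
  assumes "k \<in> {1..n}"
  shows "Xi k holomorphic_on {z. Re z > 0 \<and> Im z < 0}"
proof -
  have "lower_sqrt \<circ> (\<lambda>\<zeta>. (of_real (a 1) + \<zeta>\<^sup>2 - of_real (a k)) / complex_of_real (c k)) holomorphic_on {z. Re z > 0 \<and> Im z < 0}"
  proof (rule holomorphic_on_compose_gen[OF _ holomorphic_on_lower_sqrt])
    show "(\<lambda>\<zeta>. (of_real (a 1) + \<zeta>\<^sup>2 - of_real (a k)) / complex_of_real (c k)) ` {z. Re z > 0 \<and> Im z < 0} \<subseteq> {z. Im z < 0}"
    proof (rule image_subsetI)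
      fix z :: complex assume "z \<in> {z. Re z > 0 \<and> Im z < 0}"
      then have "Im (z\<^sup>2) < 0" by (simp add: power2_eq_square mult_pos_neg mult_neg_pos add_neg_neg)
      then show "(of_real (a 1) + z\<^sup>2 - of_real (a k)) / complex_of_real (c k) \<in> {z. Im z < 0}"
        using c_pos[OF assms] by (simp only: mem_Collect_eq Xi_arg_Im[OF assms]) (simp add: divide_neg_pos)
    qed
  qed (use c_pos[OF assms] in \<open>auto intro!: holomorphic_intros\<close>)
  then show ?thesis by (simp add: Xi_def[abs_def] xi_def o_def)
qed

lemma one_in: "1 \<in> {1..n}"
  using n_ge_1 by simp

lemma norm_Xi_1: "sqrt (c 1) * cmod (Xi 1 \<zeta>) = cmod \<zeta>"
proof -
  have "of_real (c 1) * (Xi 1 \<zeta>)\<^sup>2 = \<zeta>\<^sup>2" using Xi_power2[OF one_in] by simp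
  then have "c 1 * (cmod (Xi 1 \<zeta>))\<^sup>2 = (cmod \<zeta>)\<^sup>2"
    using c_pos[OF one_in] by (metis abs_of_pos norm_mult norm_of_real norm_power)
  then have "sqrt (c 1 * (cmod (Xi 1 \<zeta>))\<^sup>2) = cmod \<zeta>" by simp
  then show ?thesis by (simp add: real_sqrt_mult)
qed

lemma norm_Xi_sum_ge:
  assumes "\<zeta> \<in> quadrant" "k \<in> {1..n}"
  shows "c k * cmod (Xi k \<zeta>) \<le> cmod (Xi_sum \<zeta>)"
proof -
  have "cmod (of_real (c k) * Xi k \<zeta>) \<le> cmod (of_real (c k) * Xi k \<zeta> + (\<Sum>l\<in>{1..n} - {k}. of_real (c l) * Xi l \<zeta>))"
    using assms c_pos by (intro norm_quadrant_add_ge quadrant_sum quadrant_scale Xi_quadrant) (auto intro: less_imp_le)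
  also have "of_real (c k) * Xi k \<zeta> + (\<Sum>l\<in>{1..n} - {k}. of_real (c l) * Xi l \<zeta>) = Xi_sum \<zeta>"
    unfolding Xi_sum_def using assms by (subst sum.remove[of _ k]) auto
  finally show ?thesis using c_pos[OF assms(2)] by (simp add: norm_mult)
qed

lemma norm_Xi_sum_ge_zeta:
  assumes "\<zeta> \<in> quadrant"
  shows "sqrt (c 1) * cmod \<zeta> \<le> cmod (Xi_sum \<zeta>)"
proof -
  have "sqrt (c 1) * cmod \<zeta> = (sqrt (c 1) * sqrt (c 1)) * cmod (Xi 1 \<zeta>)"
    by (simp only: norm_Xi_1[of \<zeta>, symmetric] mult.assoc)
  also have "\<dots> = c 1 * cmod (Xi 1 \<zeta>)" using c_pos[OF one_in] by simp
  finally show ?thesis using norm_Xi_sum_ge[OF assms one_in] by simp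
qed

lemma Xi_sum_nonzero: "\<zeta> \<in> quadrant \<Longrightarrow> \<zeta> \<noteq> 0 \<Longrightarrow> Xi_sum \<zeta> \<noteq> 0"
  using norm_Xi_sum_ge_zeta[of \<zeta>] c_pos[OF one_in] by (auto simp: mult_le_0_iff)

text \<open>The shift a 1 - a k is at most half of |\<zeta>|^2 once |\<zeta>|^2 \<ge> 2 (a k - a 1),
  so at least half of |\<zeta>|^2 survives.\<close>

lemma norm_Xi_ge:
  assumes "k \<in> {1..n}" "(cmod \<zeta>)\<^sup>2 \<ge> 2 * (a k - a 1)"
  shows "(cmod \<zeta>)\<^sup>2 \<le> 2 * c k * (cmod (Xi k \<zeta>))\<^sup>2"
proof -
  have "c k * (cmod (Xi k \<zeta>))\<^sup>2 = cmod (\<zeta>\<^sup>2 + of_real (a 1 - a k))"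
    using Xi_power2[OF assms(1), of \<zeta>] c_pos[OF assms(1)] by (metis abs_of_pos norm_mult norm_of_real norm_power)
  then have "cmod (\<zeta>\<^sup>2) - \<bar>a 1 - a k\<bar> \<le> c k * (cmod (Xi k \<zeta>))\<^sup>2"
    using norm_diff_ineq[of "\<zeta>\<^sup>2" "of_real (a 1 - a k)"] by (simp only: norm_of_real)
  then show ?thesis using assms a_ge[OF assms(1)] by (simp add: norm_power)
qed

text \<open>The quotient has a removable singularity at \<open>0\<close> when all \<open>a k\<close> coincide.\<close>

definition rho :: "complex \<Rightarrow> complex" where
  "rho \<zeta> = (if \<zeta> = 0 \<and> Xi_sum 0 = 0 then 1 / (\<Sum>k\<in>{1..n}. of_real (sqrt (c k))) else \<zeta> / Xi_sum \<zeta>)"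

lemma Xi_sum_continuous: "continuous_on quadrant Xi_sum"
  unfolding Xi_sum_def using Xi_continuous by (intro continuous_intros) auto

text \<open>Only \<zeta> = 0 is in question. If \<open>Xi_sum 0 = 0\<close>, the absence of
  cancellation forces every \<open>Xi k 0\<close> to vanish, so all \<open>a k\<close> equal
  \<open>a 1\<close>; then each \<open>Xi k\<close> is \<zeta> / sqrt (c k) on the quadrant and the
  quotient is constant.\<close>

lemma rho_continuous: "continuous_on quadrant rho"
proof (cases "Xi_sum 0 = 0")
  case False
  then have "rho = (\<lambda>\<zeta>. \<zeta> / Xi_sum \<zeta>)" by (auto simp: rho_def fun_eq_iff)
  then show ?thesis
    using False Xi_sum_nonzero by (auto intro!: continuous_intros Xi_sum_continuous)
next
  case True
  have z: "(0::complex) \<in> quadrant" by (simp add: quadrant_def)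
  have eq: "Xi k \<zeta> = \<zeta> / of_real (sqrt (c k))" if "k \<in> {1..n}" "\<zeta> \<in> quadrant" for k \<zeta>
  proof -
    have "Xi k 0 = 0" using norm_Xi_sum_ge[OF z that(1)] True c_pos[OF that(1)] by (simp add: mult_le_0_iff)
    then have "a k = a 1" using Xi_power2[OF that(1), of 0] by simp
    then have "(Xi k \<zeta>)\<^sup>2 = (\<zeta> / of_real (sqrt (c k)))\<^sup>2"
      using Xi_power2[OF that(1), of \<zeta>] c_pos[OF that(1)] by (simp add: power_divide field_simps flip: of_real_power)
    moreover have "\<zeta> / of_real (sqrt (c k)) \<in> quadrant"
      using quadrant_scale[of "1 / sqrt (c k)" \<zeta>] that c_pos[OF that(1)] by simp
    ultimately show ?thesis using quadrant_unique Xi_quadrant that by blast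
  qed
  have pos: "(\<Sum>k\<in>{1..n}. sqrt (c k)) > 0" using c_pos n_ge_1 by (intro sum_pos) auto
  have "Xi_sum \<zeta> = \<zeta> * (\<Sum>k\<in>{1..n}. of_real (sqrt (c k)))" if "\<zeta> \<in> quadrant" for \<zeta>
    unfolding Xi_sum_def sum_distrib_left
  proof (rule sum.cong[OF refl])
    fix k assume k: "k \<in> {1..n}"
    have "complex_of_real (c k) = of_real (sqrt (c k)) * of_real (sqrt (c k))"
      using c_pos[OF k] by (simp flip: of_real_mult)
    then show "of_real (c k) * Xi k \<zeta> = \<zeta> * of_real (sqrt (c k))" using eq[OF k that] c_pos[OF k] by simp
  qed
  then have "rho \<zeta> = 1 / (\<Sum>k\<in>{1..n}. of_real (sqrt (c k)))" if "\<zeta> \<in> quadrant" for \<zeta>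
    using that True pos by (auto simp: rho_def simp flip: of_real_sum)
  then have "continuous_on quadrant rho \<longleftrightarrow> continuous_on quadrant (\<lambda>_. 1 / (\<Sum>k\<in>{1..n}. complex_of_real (sqrt (c k))))"
    by (intro continuous_on_cong) auto
  then show ?thesis by simp
qed

lemma rho_eq: "\<zeta> \<noteq> 0 \<Longrightarrow> rho \<zeta> = \<zeta> / Xi_sum \<zeta>"
  by (simp add: rho_def)

lemma rho_holomorphic: "rho holomorphic_on {z. Re z > 0 \<and> Im z < 0}"
proof (rule holomorphic_transform)
  show "(\<lambda>\<zeta>. \<zeta> / Xi_sum \<zeta>) holomorphic_on {z. Re z > 0 \<and> Im z < 0}"
  proof (intro holomorphic_intros)
    show "Xi_sum holomorphic_on {z. Re z > 0 \<and> Im z < 0}"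
      unfolding Xi_sum_def using Xi_holomorphic by (intro holomorphic_intros) auto
    show "Xi_sum z \<noteq> 0" if "z \<in> {z. Re z > 0 \<and> Im z < 0}" for z
      using that by (intro Xi_sum_nonzero) (auto simp: quadrant_def)
  qed
qed (auto simp: rho_def)

lemma norm_rho_le:
  assumes "\<zeta> \<in> quadrant" "\<zeta> \<noteq> 0"
  shows "cmod (rho \<zeta>) \<le> 1 / sqrt (c 1)"
  using norm_Xi_sum_ge_zeta[OF assms(1)] c_pos[OF one_in] Xi_sum_nonzero[OF assms] assms(2)
  by (simp add: rho_eq norm_divide divide_simps mult.commute)

end

section \<open>The resolvent form and its contour integral\<close>

definition expint :: "real \<Rightarrow> complex \<Rightarrow> (real \<Rightarrow> complex) \<Rightarrow> complex" where
  "expint b \<xi> f = integral {0..b} (\<lambda>x. exp (- \<i> * \<xi> * of_real x) * f x)"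

lemma expint_holomorphic:
  assumes "continuous_on UNIV f"
  shows "(\<lambda>\<xi>. expint b \<xi> f) holomorphic_on UNIV"
proof -
  note [continuous_intros] = assms[THEN continuous_on_compose_UNIV]
  have "(\<lambda>\<xi>. integral (cbox 0 b) (\<lambda>x. exp (- \<i> * \<xi> * of_real x) * f x)) holomorphic_on UNIV"
  proof (rule leibniz_rule_holomorphic)
    show "((\<lambda>\<xi>. exp (- \<i> * \<xi> * of_real x) * f x) has_field_derivative
       (exp (- \<i> * \<xi> * of_real x) * (- \<i> * of_real x)) * f x) (at \<xi> within UNIV)" for \<xi> x
      by (auto intro!: derivative_eq_intros)
    show "(\<lambda>x. exp (- \<i> * \<xi> * of_real x) * f x) integrable_on cbox 0 b" for \<xi>
      by (intro integrable_continuous continuous_intros)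
    show "continuous_on (UNIV \<times> cbox 0 b) (\<lambda>(\<xi>, x). (exp (- \<i> * \<xi> * of_real x) * (- \<i> * of_real x)) * f x)"
      unfolding split_beta by (intro continuous_intros)
  qed simp
  then show ?thesis by (simp add: expint_def)
qed

lemma norm_expint_le:
  assumes "continuous_on UNIV f" "\<And>x. cmod (f x) \<le> F" "b > 0" "Im \<xi> \<le> 0"
  shows "cmod (expint b \<xi> f) \<le> F * b"
proof -
  have "cmod (expint b \<xi> f) \<le> F * (b - 0)"
    unfolding expint_def
  proof (rule integral_bound)
    fix x assume "x \<in> {0..b}"
    then have "cmod (exp (- \<i> * \<xi> * of_real x)) \<le> 1" using assms(4) by (simp add: mult_nonpos_nonneg)
    from mult_mono[OF this assms(2)[of x]] show "cmod (exp (- \<i> * \<xi> * of_real x) * f x) \<le> F"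
      by (simp add: norm_mult)
  qed (use assms in \<open>auto intro!: continuous_intros continuous_on_subset[OF assms(1)]\<close>)
  then show ?thesis by simp
qed

text \<open>Integration by parts gains a factor 1 / \<xi>, since f vanishes at both ends; this is
  the only source of decay in the vertex term of the resolvent.\<close>

lemma expint_parts:
  assumes "smooth f" "f 0 = 0" "f b = 0" "b > 0"
  shows "\<i> * \<xi> * expint b \<xi> f = expint b \<xi> (vderiv 1 f)"
proof -
  define Q where "Q y = exp (- \<i> * \<xi> * of_real y)" for y :: real
  have Q: "(Q has_vector_derivative - \<i> * \<xi> * Q y) (at y within S)" for y S
    unfolding Q_def by (intro has_vector_derivative_real_field[where f="\<lambda>z. exp (- \<i> * \<xi> * z)"]) (auto intro!: derivative_eq_intros)
  have f: "(f has_vector_derivative vderiv 1 f x) (at x within S)" for x S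
    using smooth_has_derivative[OF assms(1)] by (rule has_vector_derivative_at_within)
  have "((\<lambda>x. Q x * vderiv 1 f x + - \<i> * \<xi> * Q x * f x) has_integral Q b * f b - Q 0 * f 0) {0..b}"
    by (rule fundamental_theorem_of_calculus) (use assms has_vector_derivative_mult[OF Q f] in auto)
  then have "integral {0..b} (\<lambda>x. Q x * vderiv 1 f x + (- \<i> * \<xi>) * (Q x * f x)) = 0"
    using assms by (simp add: has_integral_iff mult.assoc)
  moreover have "continuous_on {0..b} Q" unfolding Q_def by (intro continuous_intros)
  moreover have "continuous_on {0..b} f" "continuous_on {0..b} (vderiv 1 f)"
    using assms(1) smooth_continuous smooth_continuous_vderiv by auto
  ultimately have "expint b \<xi> (vderiv 1 f) + (- \<i> * \<xi>) * expint b \<xi> f = 0"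
    unfolding expint_def Q_def[symmetric]
    by (subst (asm) integral_add) (auto intro!: integrable_continuous_real continuous_intros)
  then show ?thesis by simp
qed

lemma cnj_csinc: "cnj (csinc z) = csinc (cnj z)"
  by (simp add: csinc_def cnj_sin)

lemma csinc_minus: "csinc (- z) = csinc z"
  by (simp add: csinc_def)

text \<open>Conjugation reflects \<xi> in the imaginary axis. Purely imaginary \<xi> are fixed,
  which yields reality below the spectrum; real \<xi> are sent to - \<xi>, which yields the jump
  across the spectrum.\<close>

lemma cnj_green: "cnj (green \<xi> x y) = green (- cnj \<xi>) x y"
  using csinc_minus[of "cnj \<xi> * of_real (min x y)"] by (simp add: green_def cnj_csinc exp_cnj)

lemma cnj_integral:
  assumes "continuous_on {u..v} f"
  shows "cnj (integral {u..v} f) = integral {u..v} (\<lambda>x::real. cnj (f x))"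
  using integral_linear[OF integrable_continuous_real[OF assms] bounded_linear_cnj] by (simp add: o_def)

lemma cnj_green_form:
  assumes "continuous_on UNIV f"
  shows "cnj (green_form b \<xi> f (\<lambda>x. cnj (f x))) = green_form b (- cnj \<xi>) f (\<lambda>x. cnj (f x))"
proof -
  have c: "continuous_on UNIV (\<lambda>x. cnj (f x))" "continuous_on {0..b} (\<lambda>x. cnj (f x))" "continuous_on {0..b} f"
    using assms by (auto intro!: continuous_intros continuous_on_subset[OF assms])
  have "cnj (green_form b \<xi> f (\<lambda>x. cnj (f x))) = green_form b (- cnj \<xi>) (\<lambda>x. cnj (f x)) f"
  proof -
    have "cnj (integral {0..b} (\<lambda>y. green \<xi> x y * f y)) = integral {0..b} (\<lambda>y. green (- cnj \<xi>) x y * cnj (f y))" for x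
      by (subst cnj_integral) (auto simp: cnj_green intro!: continuous_intros c)
    then show ?thesis
      unfolding green_form_def
      by (subst cnj_integral) (auto intro!: continuous_on_green_integral continuous_intros assms c)
  qed
  also have "\<dots> = green_form b (- cnj \<xi>) f (\<lambda>x. cnj (f x))"
    by (rule green_form_swap[OF c(1) assms])
  finally show ?thesis .
qed

lemma cnj_expint:
  assumes "continuous_on UNIV f"
  shows "cnj (expint b \<xi> f) = expint b (- cnj \<xi>) (\<lambda>x. cnj (f x))"
  unfolding expint_def
  by (subst cnj_integral)
     (auto intro!: continuous_intros continuous_on_subset[OF assms] simp: exp_cnj)

locale test_tuple = star_network +
  fixes b :: real and f :: "nat \<Rightarrow> real \<Rightarrow> complex"
  assumes b_pos: "b > 0"
    and f_smooth: "\<And>k. k \<in> {1..n} \<Longrightarrow> smooth (f k)"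
    and f_support: "\<And>k x. k \<in> {1..n} \<Longrightarrow> x \<le> 0 \<or> x \<ge> b \<Longrightarrow> f k x = 0"
begin

definition expsum :: "complex \<Rightarrow> (nat \<Rightarrow> real \<Rightarrow> complex) \<Rightarrow> complex" where
  "expsum \<zeta> g = (\<Sum>k\<in>{1..n}. expint b (Xi k \<zeta>) (g k))"

text \<open>\<open>V_test\<close> conjugates the eigenfunctions. Applied to \<open>fcnj\<close> it
  is the conjugate of the pairing of \<open>f\<close> with the unconjugated eigenfunctions, and that
  pairing is built from functions holomorphic in \<zeta>.\<close>

definition fcnj :: "nat \<Rightarrow> real \<Rightarrow> complex" where
  "fcnj k x = cnj (f k x)"

definition green_sum :: "complex \<Rightarrow> complex" where
  "green_sum \<zeta> = (\<Sum>k\<in>{1..n}. green_form b (Xi k \<zeta>) (f k) (fcnj k) / of_real (c k))"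

definition sqnorm :: "nat \<Rightarrow> real" where
  "sqnorm k = integral {0..b} (\<lambda>x. (cmod (f k x))\<^sup>2)"

text \<open>\<open>resolvent_form \<zeta>\<close> is \<open>2 \<zeta> ((A - \<lambda>)\<^sup>-\<^sup>1 f, f)\<close> at \<open>\<lambda> = a 1 + \<zeta>\<^sup>2\<close>.\<close>

definition resolvent_form :: "complex \<Rightarrow> complex" where
  "resolvent_form \<zeta> = 2 * \<zeta> * green_sum \<zeta> - 2 * \<i> * rho \<zeta> * (expsum \<zeta> f * expsum \<zeta> fcnj)"

lemma c_nonzero: "k \<in> {1..n} \<Longrightarrow> c k \<noteq> 0"
  using c_pos[of k] by simp

lemma f_continuous: "k \<in> {1..n} \<Longrightarrow> continuous_on S (f k)"
  using f_smooth smooth_continuous by blast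

lemma fcnj_smooth: "k \<in> {1..n} \<Longrightarrow> smooth (fcnj k)"
  unfolding fcnj_def[abs_def] using f_smooth smooth_cnj by blast

lemma fcnj_continuous: "k \<in> {1..n} \<Longrightarrow> continuous_on S (fcnj k)"
  using fcnj_smooth smooth_continuous by blast

lemma quadrant_Im: "k \<in> {1..n} \<Longrightarrow> \<zeta> \<in> quadrant \<Longrightarrow> Im (Xi k \<zeta>) \<le> 0"
  using Xi_quadrant[of k \<zeta>] by (simp add: quadrant_def)

lemma expint_Xi_continuous:
  assumes "k \<in> {1..n}" "continuous_on UNIV g"
  shows "continuous_on quadrant (\<lambda>\<zeta>. expint b (Xi k \<zeta>) g)"
  by (rule continuous_on_compose2[OF holomorphic_on_imp_continuous_on[OF expint_holomorphic[OF assms(2)]] Xi_continuous[OF assms(1)]]) auto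

lemma green_form_Xi_continuous:
  assumes "k \<in> {1..n}"
  shows "continuous_on quadrant (\<lambda>\<zeta>. green_form b (Xi k \<zeta>) (f k) (fcnj k))"
  by (rule continuous_on_compose2[OF holomorphic_on_imp_continuous_on[OF
        green_form_holomorphic[OF f_continuous[OF assms] fcnj_continuous[OF assms]]] Xi_continuous[OF assms(1)]]) auto

lemma resolvent_form_continuous: "continuous_on quadrant resolvent_form"
  unfolding resolvent_form_def green_sum_def expsum_def
  by (intro continuous_intros expint_Xi_continuous green_form_Xi_continuous rho_continuous f_continuous fcnj_continuous)
     (auto simp: c_nonzero)

lemma resolvent_form_holomorphic: "resolvent_form holomorphic_on {z. Re z > 0 \<and> Im z < 0}"
proof -
  have e: "(\<lambda>\<zeta>. expint b (Xi k \<zeta>) g) holomorphic_on {z. Re z > 0 \<and> Im z < 0}" if "k \<in> {1..n}" "continuous_on UNIV g" for k g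
    using holomorphic_on_compose_gen[OF Xi_holomorphic expint_holomorphic, of k g b] that by (simp add: o_def)
  have g: "(\<lambda>\<zeta>. green_form b (Xi k \<zeta>) (f k) (fcnj k)) holomorphic_on {z. Re z > 0 \<and> Im z < 0}" if "k \<in> {1..n}" for k
    using holomorphic_on_compose_gen[OF Xi_holomorphic green_form_holomorphic, of k "f k" "fcnj k" b]
      that f_continuous fcnj_continuous by (simp add: o_def)
  show ?thesis
    unfolding resolvent_form_def green_sum_def expsum_def
    by (intro holomorphic_intros e g rho_holomorphic f_continuous fcnj_continuous) (auto simp: c_nonzero)
qed

subsection \<open>Asymptotics\<close>

definition at_inf :: "complex filter" where
  "at_inf = inf at_infinity (principal quadrant)"

lemma eventually_at_infI:
  assumes "\<And>\<zeta>. \<zeta> \<in> quadrant \<Longrightarrow> cmod \<zeta> \<ge> R \<Longrightarrow> P \<zeta>"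
  shows "eventually P at_inf"
  unfolding at_inf_def eventually_inf_principal eventually_at_infinity using assms by blast

lemma eventually_quadrant: "eventually (\<lambda>\<zeta>. \<zeta> \<in> quadrant) at_inf"
  by (rule eventually_at_infI)

lemma eventually_nonzero: "eventually (\<lambda>\<zeta>. \<zeta> \<noteq> 0) at_inf"
  by (rule eventually_at_infI[of 1]) auto

lemma inverse_Xi_bigo:
  assumes "k \<in> {1..n}"
  shows "(\<lambda>\<zeta>. 1 / Xi k \<zeta>) \<in> O[at_inf](\<lambda>\<zeta>. 1 / \<zeta>)" "eventually (\<lambda>\<zeta>. Xi k \<zeta> \<noteq> 0) at_inf"
proof -
  \<comment> \<open>Beyond radius 1 the modulus is at most its square, so |\<zeta>| \<ge> 2 (a k - a
    1) already gives the hypothesis of \<open>norm_Xi_ge\<close>.\<close>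
  have *: "Xi k \<zeta> \<noteq> 0 \<and> cmod (1 / Xi k \<zeta>) \<le> sqrt (2 * c k) * cmod (1 / \<zeta>)"
    if \<zeta>: "\<zeta> \<in> quadrant" "cmod \<zeta> \<ge> max 1 (2 * (a k - a 1))" for \<zeta>
  proof -
    have "2 * (a k - a 1) \<le> cmod \<zeta>" "cmod \<zeta> \<ge> 1" using \<zeta> by auto
    moreover from this have "1 * cmod \<zeta> \<le> cmod \<zeta> * cmod \<zeta>" by (intro mult_right_mono) auto
    ultimately have "(cmod \<zeta>)\<^sup>2 \<ge> 2 * (a k - a 1)" unfolding power2_eq_square by linarith
    from norm_Xi_ge[OF assms this] have "sqrt ((cmod \<zeta>)\<^sup>2) \<le> sqrt (2 * c k * (cmod (Xi k \<zeta>))\<^sup>2)"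
      by (rule real_sqrt_le_mono)
    then have *: "cmod \<zeta> \<le> sqrt (2 * c k) * cmod (Xi k \<zeta>)" by (simp add: real_sqrt_mult)
    then have "Xi k \<zeta> \<noteq> 0" using \<open>cmod \<zeta> \<ge> 1\<close> by auto
    moreover have "\<zeta> \<noteq> 0" using \<open>cmod \<zeta> \<ge> 1\<close> by auto
    ultimately show ?thesis using * by (simp add: norm_divide field_simps)
  qed
  have "eventually (\<lambda>\<zeta>. cmod (1 / Xi k \<zeta>) \<le> sqrt (2 * c k) * cmod (1 / \<zeta>)) at_inf"
    using * by (intro eventually_at_infI[of "max 1 (2 * (a k - a 1))"]) blast
  then show "(\<lambda>\<zeta>. 1 / Xi k \<zeta>) \<in> O[at_inf](\<lambda>\<zeta>. 1 / \<zeta>)" by (rule bigoI)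
  show "eventually (\<lambda>\<zeta>. Xi k \<zeta> \<noteq> 0) at_inf"
    using * by (intro eventually_at_infI[of "max 1 (2 * (a k - a 1))"]) blast
qed

lemma continuous_support_bounded:
  assumes "continuous_on UNIV g" "\<And>x. x \<le> 0 \<or> x \<ge> b \<Longrightarrow> g x = (0::complex)"
  obtains F where "\<And>x. cmod (g x) \<le> F"
proof -
  have "compact (g ` {0..b})" using assms(1) by (intro compact_continuous_image continuous_on_subset[OF assms(1)]) auto
  then obtain B where B: "\<And>x. x \<in> {0..b} \<Longrightarrow> cmod (g x) \<le> B"
    by (force dest!: compact_imp_bounded simp: bounded_iff)
  have "cmod (g x) \<le> max B 0" for x using B[of x] assms(2)[of x] by (cases "x \<in> {0..b}") auto
  then show ?thesis by (rule that)
qed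

text \<open>Strictly outside the interval all derivatives vanish because the function is zero near
  such points; at the two end points they vanish by continuity from outside.\<close>

lemma vderiv_support:
  assumes "smooth g" "\<And>x. x \<le> 0 \<or> x \<ge> b \<Longrightarrow> g x = 0" "x \<le> 0 \<or> x \<ge> b"
  shows "vderiv m g x = 0"
proof -
  have 0: "vderiv m g y = 0" if "y < 0 \<or> y > b" for y
    using that assms(2) by (intro vderiv_eq_0_outside[OF assms(1), of 0 b]) auto
  have c: "isCont (vderiv m g) x" using smooth_continuous_vderiv[OF assms(1), of UNIV m] by (simp add: continuous_on_eq_continuous_at)
  show ?thesis
  proof (cases "x < 0 \<or> x > b")
    case False
    then consider "x = 0" | "x = b" using assms(3) b_pos by linarith
    then show ?thesis
    proof cases
      case 1
      have "(vderiv m g \<longlongrightarrow> vderiv m g x) (at_left x)" using c by (simp add: isCont_def filterlim_at_split)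
      moreover have "(vderiv m g \<longlongrightarrow> 0) (at_left x)"
        using 1 0 by (intro tendsto_eventually) (auto simp: eventually_at_filter)
      ultimately show ?thesis by (rule tendsto_unique[rotated]) simp
    next
      case 2
      have "(vderiv m g \<longlongrightarrow> vderiv m g x) (at_right x)" using c by (simp add: isCont_def filterlim_at_split)
      moreover have "(vderiv m g \<longlongrightarrow> 0) (at_right x)"
        using 2 0 by (intro tendsto_eventually) (auto simp: eventually_at_filter)
      ultimately show ?thesis by (rule tendsto_unique[rotated]) simp
    qed
  qed (use 0 in auto)
qed

lemma green_form_bigo:
  assumes "k \<in> {1..n}" "continuous_on UNIV g" "\<And>x. x \<le> 0 \<or> x \<ge> b \<Longrightarrow> g x = 0"
    "continuous_on UNIV h" "\<And>x. x \<le> 0 \<or> x \<ge> b \<Longrightarrow> h x = 0"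
  shows "(\<lambda>\<zeta>. green_form b (Xi k \<zeta>) g h) \<in> O[at_inf](\<lambda>\<zeta>. 1 / \<zeta>)"
proof -
  obtain F where F: "\<And>x. cmod (g x) \<le> F" by (rule continuous_support_bounded[OF assms(2,3)]) blast+
  obtain G where G: "\<And>x. cmod (h x) \<le> G" by (rule continuous_support_bounded[OF assms(4,5)]) blast+
  have "eventually (\<lambda>\<zeta>. cmod (green_form b (Xi k \<zeta>) g h) \<le> (b * (b * (F * G))) * cmod (1 / Xi k \<zeta>)) at_inf"
    using inverse_Xi_bigo(2)[OF assms(1)] eventually_quadrant
  proof eventually_elim
    case (elim \<zeta>)
    then show ?case
      using norm_green_form_le[OF assms(2,4) b_pos F G quadrant_Im[OF assms(1)] elim(1)] by (simp add: norm_divide)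
  qed
  then have "(\<lambda>\<zeta>. green_form b (Xi k \<zeta>) g h) \<in> O[at_inf](\<lambda>\<zeta>. 1 / Xi k \<zeta>)" by (rule bigoI)
  then show ?thesis using inverse_Xi_bigo(1)[OF assms(1)] landau_o.big_trans by blast
qed

lemma expint_bigo:
  assumes "k \<in> {1..n}" "smooth g" "\<And>x. x \<le> 0 \<or> x \<ge> b \<Longrightarrow> g x = 0"
  shows "(\<lambda>\<zeta>. expint b (Xi k \<zeta>) g) \<in> O[at_inf](\<lambda>\<zeta>. 1 / \<zeta>)"
proof -
  have g1: "continuous_on UNIV (vderiv 1 g)" using smooth_continuous_vderiv[OF assms(2)] .
  obtain F where F: "\<And>x. cmod (vderiv 1 g x) \<le> F"
    by (rule continuous_support_bounded[OF g1 vderiv_support[OF assms(2,3)]]) blast+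
  have "eventually (\<lambda>\<zeta>. cmod (expint b (Xi k \<zeta>) g) \<le> (F * b) * cmod (1 / Xi k \<zeta>)) at_inf"
    using inverse_Xi_bigo(2)[OF assms(1)] eventually_quadrant
  proof eventually_elim
    case (elim \<zeta>)
    have "cmod (\<i> * Xi k \<zeta> * expint b (Xi k \<zeta>) g) \<le> F * b"
      using norm_expint_le[OF g1 F b_pos quadrant_Im[OF assms(1) elim(2)]] assms b_pos by (subst expint_parts) auto
    then show ?case using elim(1) by (simp add: norm_mult norm_divide field_simps)
  qed
  then have "(\<lambda>\<zeta>. expint b (Xi k \<zeta>) g) \<in> O[at_inf](\<lambda>\<zeta>. 1 / Xi k \<zeta>)" by (rule bigoI)
  then show ?thesis using inverse_Xi_bigo(1)[OF assms(1)] landau_o.big_trans by blast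
qed

text \<open>Since c_k \<xi>_k^2 = \<zeta>^2 + (a 1 - a k), one integration step gives \<zeta>^2
  times the form as - \<open>sqnorm k\<close> plus a form in f'' and a multiple of the form itself.
  Both remainders are O(1/\<zeta>), and the factor 2 / \<zeta> adds another order.\<close>

lemma green_form_asymp:
  assumes "k \<in> {1..n}"
  shows "(\<lambda>\<zeta>. 2 * \<zeta> * (green_form b (Xi k \<zeta>) (f k) (fcnj k) / of_real (c k)) + 2 * of_real (sqnorm k) / \<zeta>) \<in> O[at_inf](\<lambda>\<zeta>. 1 / \<zeta>\<^sup>2)"
proof -
  let ?G = "\<lambda>\<zeta>. green_form b (Xi k \<zeta>) (f k) (fcnj k)"
  let ?G2 = "\<lambda>\<zeta>. green_form b (Xi k \<zeta>) (vderiv 2 (f k)) (fcnj k)"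
  have fs: "fcnj k x = 0" if "x \<le> 0 \<or> x \<ge> b" for x using f_support[OF assms that] by (simp add: fcnj_def)
  have N: "integral {0..b} (\<lambda>x. f k x * fcnj k x) = of_real (sqnorm k)"
  proof -
    have "continuous_on {0..b} (\<lambda>x. (cmod (f k x))\<^sup>2)" by (intro continuous_intros f_continuous assms)
    from integral_linear[OF integrable_continuous_real[OF this] bounded_linear_of_real[where 'a=complex]]
    have "integral {0..b} (\<lambda>x. complex_of_real ((cmod (f k x))\<^sup>2)) = of_real (sqnorm k)" by (simp add: o_def sqnorm_def)
    then show ?thesis by (simp only: fcnj_def complex_norm_square)
  qed
  have eq: "eventually (\<lambda>\<zeta>. 2 * \<zeta> * (?G \<zeta> / of_real (c k)) + 2 * of_real (sqnorm k) / \<zeta>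
      = 1 / \<zeta> * (-2 * ?G2 \<zeta> + (- 2 * of_real (a 1 - a k) / of_real (c k)) * ?G \<zeta>)) at_inf"
    using inverse_Xi_bigo(2)[OF assms] eventually_nonzero
  proof eventually_elim
    case (elim \<zeta>)
    have "(\<zeta>\<^sup>2 + of_real (a 1 - a k)) * (?G \<zeta> / of_real (c k)) = (Xi k \<zeta>)\<^sup>2 * ?G \<zeta>"
      unfolding Xi_power2[OF assms, symmetric] using c_nonzero[OF assms] by simp
    also have "\<dots> = - of_real (sqnorm k) - ?G2 \<zeta>"
      using green_form_parts[OF f_smooth[OF assms] fcnj_smooth[OF assms] f_support[OF assms] elim(1) b_pos] N by simp
    finally have *: "(\<zeta>\<^sup>2 + of_real (a 1 - a k)) * (?G \<zeta> / of_real (c k)) = - of_real (sqnorm k) - ?G2 \<zeta>" .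
    have "2 * z * p + 2 * q / z = 1 / z * (- 2 * r + (- 2 * d) * p)"
      if "(z\<^sup>2 + d) * p = - q - r" "z \<noteq> 0" for z d p q r :: complex
    proof -
      have "z\<^sup>2 * p + q = - r - d * p" using that(1) by algebra
      then have "2 / z * (z\<^sup>2 * p + q) = 2 / z * (- r - d * p)" by simp
      then show ?thesis using that(2) by (simp add: field_simps power2_eq_square)
    qed
    from this[OF * elim(2)] show ?case by simp
  qed
  have "(\<lambda>\<zeta>. 1 / \<zeta> * (-2 * ?G2 \<zeta> + (- 2 * of_real (a 1 - a k) / of_real (c k)) * ?G \<zeta>)) \<in> O[at_inf](\<lambda>\<zeta>. 1 / \<zeta> * (1 / \<zeta>))"
  proof (intro landau_o.big.mult landau_o.big_refl sum_in_bigo)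
    have m: "(\<lambda>\<zeta>. d * g \<zeta>) \<in> O[at_inf](\<lambda>\<zeta>. 1 / \<zeta>)" if "g \<in> O[at_inf](\<lambda>\<zeta>. 1 / \<zeta>)" for d g
      using that by (cases "d = 0") (auto simp: landau_o.big.cmult_in_iff)
    show "(\<lambda>\<zeta>. -2 * ?G2 \<zeta>) \<in> O[at_inf](\<lambda>\<zeta>. 1 / \<zeta>)"
      by (intro m green_form_bigo assms vderiv_support[OF f_smooth[OF assms]] f_support[OF assms] fs
          smooth_continuous_vderiv[OF f_smooth[OF assms]] fcnj_continuous[OF assms])
    show "(\<lambda>\<zeta>. (- 2 * of_real (a 1 - a k) / of_real (c k)) * ?G \<zeta>) \<in> O[at_inf](\<lambda>\<zeta>. 1 / \<zeta>)"
      by (intro m green_form_bigo assms f_support[OF assms] fs f_continuous[OF assms] fcnj_continuous[OF assms])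
  qed
  then show ?thesis by (subst landau_o.big.in_cong[OF eq]) (simp add: power2_eq_square)
qed

text \<open>The vertex term stays below the leading order: each of the two exponential sums is
  O(1/\<zeta>) because f vanishes near the vertex, and \<open>rho\<close> is bounded.\<close>

lemma resolvent_form_asymp:
  "(\<lambda>\<zeta>. resolvent_form \<zeta> + 2 * of_real (\<Sum>k\<in>{1..n}. sqnorm k) / \<zeta>) \<in> O[at_inf](\<lambda>\<zeta>. 1 / \<zeta>\<^sup>2)"
proof -
  have fs: "fcnj k x = 0" if "k \<in> {1..n}" "x \<le> 0 \<or> x \<ge> b" for k x using f_support[OF that] by (simp add: fcnj_def)
  have e: "(\<lambda>\<zeta>. expsum \<zeta> f) \<in> O[at_inf](\<lambda>\<zeta>. 1 / \<zeta>)" "(\<lambda>\<zeta>. expsum \<zeta> fcnj) \<in> O[at_inf](\<lambda>\<zeta>. 1 / \<zeta>)"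
    unfolding expsum_def
    by (intro big_sum_in_bigo expint_bigo f_smooth fcnj_smooth f_support fs; assumption)+
  have r: "rho \<in> O[at_inf](\<lambda>_. 1)"
  proof (rule bigoI)
    show "eventually (\<lambda>\<zeta>. cmod (rho \<zeta>) \<le> 1 / sqrt (c 1) * cmod 1) at_inf"
      by (rule eventually_at_infI[of 1]) (use norm_rho_le in force)
  qed
  have "(\<lambda>\<zeta>. 2 * \<i> * rho \<zeta> * (expsum \<zeta> f * expsum \<zeta> fcnj)) \<in> O[at_inf](\<lambda>\<zeta>. 1 * (1 / \<zeta> * (1 / \<zeta>)))"
    using landau_o.big.mult[OF r landau_o.big.mult[OF e]] by (simp add: mult.assoc)
  then have 1: "(\<lambda>\<zeta>. 2 * \<i> * rho \<zeta> * (expsum \<zeta> f * expsum \<zeta> fcnj)) \<in> O[at_inf](\<lambda>\<zeta>. 1 / \<zeta>\<^sup>2)"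
    by (simp add: power2_eq_square)
  have "(\<lambda>\<zeta>. (\<Sum>k\<in>{1..n}. 2 * \<zeta> * (green_form b (Xi k \<zeta>) (f k) (fcnj k) / of_real (c k)) + 2 * of_real (sqnorm k) / \<zeta>)) \<in> O[at_inf](\<lambda>\<zeta>. 1 / \<zeta>\<^sup>2)"
    by (intro big_sum_in_bigo green_form_asymp)
  from sum_in_bigo(2)[OF this 1] show ?thesis
    by (simp add: resolvent_form_def green_sum_def sum.distrib sum_distrib_left sum_divide_distrib algebra_simps)
qed

section \<open>Cauchy's theorem on the triangle with vertices 0, R, - \<i> R\<close>

text \<open>At \<zeta> = - \<i> \<tau> the spectral parameter is a 1 - \<tau>^2, which exceeds no
  \<open>a k\<close>; hence every square root is purely imaginary.\<close>

lemma Xi_imag_axis: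
  assumes "k \<in> {1..n}" "\<tau> \<ge> 0"
  obtains \<kappa> where "Xi k (- \<i> * of_real \<tau>) = - \<i> * of_real \<kappa>" "\<kappa> \<ge> 0"
proof -
  have "(of_real (a 1) + (- \<i> * of_real \<tau>)\<^sup>2 - of_real (a k)) / complex_of_real (c k) = of_real ((a 1 - \<tau>\<^sup>2 - a k) / c k)"
    by (simp add: power_mult_distrib)
  moreover have "(a 1 - \<tau>\<^sup>2 - a k) / c k \<le> 0"
    using c_pos[OF assms(1)] a_ge[OF assms(1)] by (intro divide_nonpos_pos) (auto intro: order_trans[of _ "a 1"])
  ultimately have "Xi k (- \<i> * of_real \<tau>) = - \<i> * of_real (sqrt (- ((a 1 - \<tau>\<^sup>2 - a k) / c k)))"
    by (simp only: Xi_def xi_def lower_sqrt_of_neg_real)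
  then show ?thesis using \<open>(a 1 - \<tau>\<^sup>2 - a k) / c k \<le> 0\<close> by (intro that) auto
qed

text \<open>For a spectral parameter not exceeding \<open>a 1\<close> the form of the resolvent is
  real, and \<zeta> is imaginary: the Green forms are invariant under conjugation, the two
  exponential sums are conjugate to each other, and \<open>rho\<close> is a quotient of two
  imaginary numbers or its real limit value.\<close>

lemma resolvent_form_imag_axis:
  assumes "\<tau> \<ge> 0"
  shows "Re (resolvent_form (- \<i> * of_real \<tau>)) = 0"
proof -
  let ?z = "- \<i> * complex_of_real \<tau>"
  have X: "- cnj (Xi k ?z) = Xi k ?z" if k: "k \<in> {1..n}" for k
    by (rule Xi_imag_axis[OF k assms]) (simp only: complex_cnj_mult complex_cnj_minus complex_cnj_i complex_cnj_complex_of_real mult_minus_left minus_minus)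
  have g: "Im (green_form b (Xi k ?z) (f k) (fcnj k)) = 0" if k: "k \<in> {1..n}" for k
  proof -
    have "cnj (green_form b (Xi k ?z) (f k) (fcnj k)) = green_form b (Xi k ?z) (f k) (fcnj k)"
      unfolding fcnj_def[abs_def] using cnj_green_form[OF f_continuous[OF k]] X[OF k] by simp
    then show ?thesis by (metis Reals_cnj_iff complex_is_Real_iff)
  qed
  have gs: "Im (green_sum ?z) = 0" unfolding green_sum_def Im_sum
    by (intro sum.neutral ballI) (simp only: Im_divide_of_real g div_0)
  have "expsum ?z fcnj = cnj (expsum ?z f)"
    unfolding expsum_def cnj_sum
  proof (rule sum.cong[OF refl])
    fix k assume k: "k \<in> {1..n}"
    show "expint b (Xi k ?z) (fcnj k) = cnj (expint b (Xi k ?z) (f k))"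
      unfolding cnj_expint[OF f_continuous[OF k]] X[OF k] fcnj_def[abs_def] ..
  qed
  then have es: "expsum ?z f * expsum ?z fcnj = of_real ((cmod (expsum ?z f))\<^sup>2)"
    by (simp only: complex_norm_square)
  have rh: "Im (rho ?z) = 0"
  proof (cases "\<tau> = 0 \<and> Xi_sum 0 = 0")
    case True
    then show ?thesis by (simp add: rho_def Im_divide_of_real flip: of_real_sum)
  next
    case False
    have "Re (Xi_sum ?z) = 0"
      unfolding Xi_sum_def Re_sum
    proof (rule sum.neutral, rule ballI)
      fix k assume k: "k \<in> {1..n}"
      show "Re (of_real (c k) * Xi k ?z) = 0"
        by (rule Xi_imag_axis[OF k assms]) simp
    qed
    then obtain \<kappa> where "Xi_sum ?z = - \<i> * of_real \<kappa>" 
      by (metis complex_eq add_0 mult_minus_left mult_minus_right minus_minus of_real_0 of_real_minus)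
    then have "rho ?z = of_real (\<tau> / \<kappa>)" using False by (auto simp: rho_def)
    then show ?thesis by simp
  qed
  show ?thesis
    unfolding resolvent_form_def es using gs rh by (simp add: complex_eq_iff)
qed

text \<open>After the leading term is split off, the integrand is O(1/R^2) on a segment of length
  O(R). The leading term - 2 N / \<zeta> is integrated by the logarithm, whose argument changes by -
  \<pi> / 2 from R to - \<i> R.\<close>

lemma resolvent_form_segment_tendsto:
  "((\<lambda>R. contour_integral (linepath (of_real R) (- \<i> * of_real R)) resolvent_form) \<longlongrightarrow> \<i> * of_real (pi * (\<Sum>k\<in>{1..n}. sqnorm k))) at_top"
proof -
  define N where "N = (\<Sum>k\<in>{1..n}. sqnorm k)"
  obtain C where "eventually (\<lambda>\<zeta>. cmod (resolvent_form \<zeta> + 2 * of_real N / \<zeta>) \<le> C * cmod (1 / \<zeta>\<^sup>2)) at_inf"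
    using landau_o.bigE[OF resolvent_form_asymp[folded N_def]] by blast
  then obtain R0 where R0: "\<And>\<zeta>. \<zeta> \<in> quadrant \<Longrightarrow> cmod \<zeta> \<ge> R0 \<Longrightarrow> cmod (resolvent_form \<zeta> + 2 * of_real N / \<zeta>) \<le> C * cmod (1 / \<zeta>\<^sup>2)"
    unfolding at_inf_def eventually_inf_principal eventually_at_infinity by blast
  \<comment> \<open>Points of the segment have modulus at least R / 2, so R \<ge> 2
    \<open>R0\<close> puts all of it into the range of the asymptotic bound. The 8 is 4, from (R /
    2)^2 in the denominator, times 2, from the length bound 2 R.\<close>
  have bound: "cmod (contour_integral (linepath (of_real R) (- \<i> * of_real R)) resolvent_form - \<i> * of_real (pi * N)) \<le> 8 * \<bar>C\<bar> / R"
    if R: "R \<ge> max 1 (2 * R0)" for R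
  proof -
    define p where "p = linepath (complex_of_real R) (- \<i> * of_real R)"
    have Rpos: "R > 0" using R by simp
    have seg: "z \<in> quadrant" "cmod z \<ge> R / 2" "z \<notin> \<real>\<^sub>\<le>\<^sub>0" if z: "z \<in> closed_segment (complex_of_real R) (- \<i> * of_real R)" for z
    proof -
      obtain u where u: "0 \<le> u" "u \<le> 1" "z = (1 - u) *\<^sub>R of_real R + u *\<^sub>R (- \<i> * of_real R)"
        using z by (auto simp: closed_segment_def)
      have re: "Re z = (1 - u) * R" "Im z = - (u * R)" using u(3) by simp_all
      show "z \<in> quadrant" using u Rpos by (simp add: quadrant_def re)
      have "\<bar>Re z\<bar> + \<bar>Im z\<bar> = R" unfolding re using u(1,2) Rpos by (simp add: abs_mult algebra_simps)
      then show "cmod z \<ge> R / 2" using abs_Re_le_cmod[of z] abs_Im_le_cmod[of z] by linarith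
      show "z \<notin> \<real>\<^sub>\<le>\<^sub>0" using u(1,2) Rpos by (auto simp: complex_nonpos_Reals_iff re mult_le_0_iff)
    qed
    have nz: "z \<noteq> 0" if "z \<in> closed_segment (complex_of_real R) (- \<i> * of_real R)" for z
      using seg(2)[OF that] Rpos by auto
    have i1: "(resolvent_form has_contour_integral contour_integral p resolvent_form) p"
      unfolding p_def
      by (intro has_contour_integral_integral contour_integrable_continuous_linepath continuous_on_subset[OF resolvent_form_continuous])
         (use seg in auto)
    have "((\<lambda>z. 1 / z) has_contour_integral Ln (pathfinish p) - Ln (pathstart p)) p"
      by (rule contour_integral_primitive[where S="closed_segment (complex_of_real R) (- \<i> * of_real R)"])
         (use seg nz in \<open>auto simp: p_def inverse_eq_divide intro!: derivative_eq_intros\<close>)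
    also have "Ln (pathfinish p) - Ln (pathstart p) = - \<i> * of_real (pi / 2)"
    proof -
      have "Ln (complex_of_real R * - \<i>) = of_real (ln R) + Ln (- \<i>)"
        using Ln_times_of_real[OF Rpos, of "- \<i>"] Rpos by (simp add: Ln_of_real)
      then show ?thesis using Rpos by (simp add: p_def Ln_of_real mult.commute)
    qed
    finally have "((\<lambda>z. 2 * of_real N * (1 / z)) has_contour_integral 2 * of_real N * (- \<i> * of_real (pi / 2))) p"
      by (rule has_contour_integral_lmul)
    from has_contour_integral_add[OF i1 this]
    have i2: "((\<lambda>z. resolvent_form z + 2 * of_real N / z) has_contour_integral contour_integral p resolvent_form - \<i> * of_real (pi * N)) p"
      by (simp add: mult_ac)
    have "cmod (contour_integral p resolvent_form - \<i> * of_real (pi * N)) \<le> (\<bar>C\<bar> * (4 / R\<^sup>2)) * cmod (- \<i> * of_real R - of_real R)"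
      unfolding p_def
    proof (rule has_contour_integral_bound_linepath[OF i2[unfolded p_def]])
      fix z assume z: "z \<in> closed_segment (complex_of_real R) (- \<i> * of_real R)"
      have "cmod (resolvent_form z + 2 * of_real N / z) \<le> C * cmod (1 / z\<^sup>2)"
        using seg(1,2)[OF z] R by (intro R0) auto
      also have "\<dots> \<le> \<bar>C\<bar> * (1 / (cmod z)\<^sup>2)" by (simp add: norm_divide norm_power divide_right_mono)
      also have "\<dots> \<le> \<bar>C\<bar> * (1 / (R / 2)\<^sup>2)"
        using seg(2)[OF z] Rpos by (intro mult_left_mono divide_left_mono power_mono mult_pos_pos zero_less_power) auto
      finally show "cmod (resolvent_form z + 2 * of_real N / z) \<le> \<bar>C\<bar> * (4 / R\<^sup>2)" by (simp add: power_divide)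
    qed auto
    also have "\<dots> \<le> (\<bar>C\<bar> * (4 / R\<^sup>2)) * (2 * R)"
    proof (intro mult_left_mono)
      show "cmod (- \<i> * of_real R - of_real R) \<le> 2 * R"
        using norm_triangle_ineq4[of "- \<i> * of_real R" "of_real R"] Rpos by (simp add: norm_mult)
    qed auto
    also have "\<dots> = 8 * \<bar>C\<bar> / R" using Rpos by (simp add: power2_eq_square)
    finally show ?thesis by (simp add: p_def)
  qed
  have "((\<lambda>R. contour_integral (linepath (of_real R) (- \<i> * of_real R)) resolvent_form - \<i> * of_real (pi * N)) \<longlongrightarrow> 0) at_top"
  proof (rule Lim_null_comparison)
    show "eventually (\<lambda>R. cmod (contour_integral (linepath (of_real R) (- \<i> * of_real R)) resolvent_form - \<i> * of_real (pi * N)) \<le> 8 * \<bar>C\<bar> / R) at_top"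
      using bound by (intro eventually_at_top_linorderI)
    show "((\<lambda>R. 8 * \<bar>C\<bar> / R) \<longlongrightarrow> 0) at_top" by (rule tendsto_divide_0[OF tendsto_const filterlim_at_top_imp_at_infinity[OF filterlim_ident]])
  qed
  then show ?thesis by (simp add: LIM_zero_iff N_def)
qed

text \<open>The form is holomorphic inside the triangle and only continuous on its boundary, so
  Cauchy's theorem is used in the version with boundary continuity. On the imaginary side the values
  and the direction are both imaginary, so that side contributes a real number.\<close>

lemma Im_resolvent_form_integral:
  assumes "R > 0"
  shows "integral {0..R} (\<lambda>t. Im (resolvent_form (of_real t))) = - Im (contour_integral (linepath (of_real R) (- \<i> * of_real R)) resolvent_form)"
proof -
  let ?R = "complex_of_real R"
  have quad: "convex quadrant"
    unfolding quadrant_def by (auto simp: convex_def intro!: add_nonneg_nonneg add_nonpos_nonpos mult_nonneg_nonpos)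
  have vert: "{0, ?R, - \<i> * ?R} \<subseteq> quadrant" using assms by (auto simp: quadrant_def)
  have hull: "convex hull {0, ?R, - \<i> * ?R} \<subseteq> quadrant" by (rule hull_minimal[of _ _ convex, OF vert quad])
  have int: "interior (convex hull {0, ?R, - \<i> * ?R}) \<subseteq> {z. Re z > 0 \<and> Im z < 0}"
  proof
    fix z assume "z \<in> interior (convex hull {0, ?R, - \<i> * ?R})"
    then have "z \<in> interior quadrant" using interior_mono[OF hull] by blast
    then obtain e where e: "e > 0" "cball z e \<subseteq> quadrant" by (meson mem_interior_cball)
    \<comment> \<open>Moving left and moving up by e stays in the closed quadrant, which makes both
      inequalities strict at z.\<close>
    have "z - of_real e \<in> cball z e" "z + \<i> * of_real e \<in> cball z e" using e(1) by (auto simp: dist_norm norm_mult)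
    with e show "z \<in> {z. Re z > 0 \<and> Im z < 0}" by (fastforce simp: quadrant_def)
  qed
  have "(resolvent_form has_contour_integral 0) (linepath 0 ?R +++ linepath ?R (- \<i> * ?R) +++ linepath (- \<i> * ?R) 0)"
  proof (rule Cauchy_theorem_triangle_cofinite[where S="{}"])
    show "continuous_on (convex hull {0, ?R, - \<i> * ?R}) resolvent_form"
      by (rule continuous_on_subset[OF resolvent_form_continuous hull])
    have "open {z. Re z > 0 \<and> Im z < 0}"
      by (intro open_Collect_conj open_halfspace_Re_gt open_halfspace_Im_lt)
    then show "resolvent_form field_differentiable at x" if "x \<in> interior (convex hull {0, ?R, - \<i> * ?R}) - {}" for x
      using that int resolvent_form_holomorphic holomorphic_on_imp_differentiable_at by blast
  qed simp
  moreover have seg: "closed_segment u v \<subseteq> quadrant" if "u \<in> {0, ?R, - \<i> * ?R}" "v \<in> {0, ?R, - \<i> * ?R}" for u v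
    using that vert quad closed_segment_subset by blast
  have I: "(resolvent_form has_contour_integral contour_integral (linepath u v) resolvent_form) (linepath u v)"
    if "u \<in> {0, ?R, - \<i> * ?R}" "v \<in> {0, ?R, - \<i> * ?R}" for u v
    using seg[OF that] by (intro has_contour_integral_integral contour_integrable_continuous_linepath continuous_on_subset[OF resolvent_form_continuous])
  have "(resolvent_form has_contour_integral (contour_integral (linepath 0 ?R) resolvent_form
      + (contour_integral (linepath ?R (- \<i> * ?R)) resolvent_form + contour_integral (linepath (- \<i> * ?R) 0) resolvent_form)))
      (linepath 0 ?R +++ linepath ?R (- \<i> * ?R) +++ linepath (- \<i> * ?R) 0)"
    by (intro has_contour_integral_join I valid_path_join valid_path_linepath) auto
  ultimately have sum0: "contour_integral (linepath 0 ?R) resolvent_form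
      + (contour_integral (linepath ?R (- \<i> * ?R)) resolvent_form + contour_integral (linepath (- \<i> * ?R) 0) resolvent_form) = 0"
    using has_contour_integral_unique by blast
  have im: "Im (contour_integral (linepath (- \<i> * ?R) 0) resolvent_form) = 0"
  proof -
    have "((\<lambda>x. Im (resolvent_form (linepath (- \<i> * ?R) 0 x) * (0 - - \<i> * ?R))) has_integral Im (contour_integral (linepath (- \<i> * ?R) 0) resolvent_form)) {0..1}"
      using I[of "- \<i> * ?R" 0] unfolding has_contour_integral_linepath
      by (auto dest: has_integral_linear[OF _ bounded_linear_Im] simp: o_def)
    moreover have "((\<lambda>x. Im (resolvent_form (linepath (- \<i> * ?R) 0 x) * (0 - - \<i> * ?R))) has_integral 0) {0..1}"
    proof (rule has_integral_is_0)
      fix x :: real assume "x \<in> {0..1}"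
      then have "Re (resolvent_form (- \<i> * of_real ((1 - x) * R))) = 0" using assms by (intro resolvent_form_imag_axis) auto
      moreover have "linepath (- \<i> * ?R) 0 x = - \<i> * of_real ((1 - x) * R)" by (simp add: linepath_def scaleR_conv_of_real)
      ultimately show "Im (resolvent_form (linepath (- \<i> * ?R) 0 x) * (0 - - \<i> * ?R)) = 0" by (simp add: mult.assoc)
    qed
    ultimately show ?thesis by (rule has_integral_unique)
  qed
  have "((\<lambda>t. resolvent_form (of_real t)) has_integral contour_integral (linepath 0 ?R) resolvent_form) {0..R}"
    using I[of 0 ?R] has_contour_integral_linepath_Reals_iff[of 0 ?R resolvent_form] assms by simp
  from has_integral_linear[OF this bounded_linear_Im]
  have "integral {0..R} (\<lambda>t. Im (resolvent_form (of_real t))) = Im (contour_integral (linepath 0 ?R) resolvent_form)"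
    by (simp add: o_def has_integral_iff)
  moreover have "Im (contour_integral (linepath 0 ?R) resolvent_form) + Im (contour_integral (linepath ?R (- \<i> * ?R)) resolvent_form) = 0"
    using arg_cong[OF sum0, of Im] im by simp
  ultimately show ?thesis by linarith
qed

lemma Im_resolvent_form_integral_tendsto:
  "((\<lambda>R. integral {0..R} (\<lambda>t. Im (resolvent_form (of_real t)))) \<longlongrightarrow> - (pi * (\<Sum>k\<in>{1..n}. sqnorm k))) at_top"
proof -
  have "((\<lambda>R. - Im (contour_integral (linepath (of_real R) (- \<i> * of_real R)) resolvent_form)) \<longlongrightarrow>
      - Im (\<i> * of_real (pi * (\<Sum>k\<in>{1..n}. sqnorm k)))) at_top"
    by (intro tendsto_intros resolvent_form_segment_tendsto)
  moreover have "eventually (\<lambda>R. - Im (contour_integral (linepath (of_real R) (- \<i> * of_real R)) resolvent_form) =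
      integral {0..R} (\<lambda>t. Im (resolvent_form (of_real t)))) at_top"
    by (intro eventually_at_top_linorderI[of 1]) (simp add: Im_resolvent_form_integral)
  ultimately show ?thesis
    using Lim_transform_eventually by (fastforce simp del: of_real_mult of_real_sum)
qed

end

section \<open>Boundary values on the spectrum\<close>

lemma integral_branch_eq:
  fixes g :: "real \<Rightarrow> 'a::euclidean_space"
  assumes "continuous_on {0..b} g" "\<And>x. x \<ge> b \<Longrightarrow> g x = 0"
  shows "(\<integral>x. g x \<partial>branch) = integral {0..b} g"
proof -
  have out: "g x = 0" if "\<not> x \<le> b" for x using assms(2)[of x] that by simp
  have "(\<integral>x. g x \<partial>branch) = (LINT x:{0<..}|lborel. g x)" by (rule integral_branch)
  also have "\<dots> = (LINT x:{0..b}|lborel. g x)"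
    unfolding set_lebesgue_integral_def
  proof (rule integral_cong_AE)
    show m: "(\<lambda>x. indicat_real {0..b} x *\<^sub>R g x) \<in> borel_measurable lborel"
      using borel_measurable_continuous_on_indicator[OF _ assms(1)] by simp
    have ae: "AE x in lborel. x \<noteq> 0" by (rule AE_lborel_singleton)
    have "(\<lambda>x. indicat_real {0<..} x *\<^sub>R g x) = (\<lambda>x. indicat_real {0<..} x *\<^sub>R (indicat_real {0..b} x *\<^sub>R g x))"
      using out by (auto simp: indicator_def fun_eq_iff)
    moreover have "(\<lambda>x. indicat_real {0<..} x *\<^sub>R (indicat_real {0..b} x *\<^sub>R g x)) \<in> borel_measurable lborel"
      by (intro borel_measurable_scaleR m) auto
    ultimately show "(\<lambda>x. indicat_real {0<..} x *\<^sub>R g x) \<in> borel_measurable lborel" by simp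
    show "AE x in lborel. indicat_real {0<..} x *\<^sub>R g x = indicat_real {0..b} x *\<^sub>R g x"
      using ae by eventually_elim (use out in \<open>auto simp: indicator_def\<close>)
  qed
  also have "\<dots> = integral {0..b} g"
    using set_borel_integral_eq_integral(2)[OF borel_integrable_atLeastAtMost'[OF assms(1)]] .
  finally show ?thesis .
qed

text \<open>The sine transform, written through \<open>expint\<close> so that the passage from \<xi>
  to - \<xi> in an exponential integral appears as a multiple of it.\<close>

definition sinint :: "real \<Rightarrow> complex \<Rightarrow> (real \<Rightarrow> complex) \<Rightarrow> complex" where
  "sinint b \<xi> f = (expint b (- \<xi>) f - expint b \<xi> f) / (2 * \<i>)"

lemma exp_minus_exp_uminus: "exp (\<i> * z) - exp (- (\<i> * z)) = 2 * \<i> * sin z"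
  by (simp add: sin_exp_eq)

lemma sinint_eq:
  assumes "continuous_on UNIV f"
  shows "sinint b \<xi> f = integral {0..b} (\<lambda>x. sin (\<xi> * of_real x) * f x)"
proof -
  have f: "continuous_on {0..b} f" by (rule continuous_on_subset[OF assms]) simp
  have e: "exp (- \<i> * - \<xi> * of_real x) * f x - exp (- \<i> * \<xi> * of_real x) * f x = 2 * \<i> * (sin (\<xi> * of_real x) * f x)" for x :: real
    using exp_minus_exp_uminus[of "\<xi> * of_real x"] by (simp add: mult.assoc flip: left_diff_distrib)
  have "expint b (- \<xi>) f - expint b \<xi> f = integral {0..b} (\<lambda>x. exp (- \<i> * - \<xi> * of_real x) * f x - exp (- \<i> * \<xi> * of_real x) * f x)"
    unfolding expint_def
    by (subst integral_diff) (auto intro!: integrable_continuous_real continuous_intros f)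
  also have "\<dots> = 2 * \<i> * integral {0..b} (\<lambda>x. sin (\<xi> * of_real x) * f x)"
    unfolding e by simp
  finally have "expint b (- \<xi>) f - expint b \<xi> f = 2 * \<i> * integral {0..b} (\<lambda>x. sin (\<xi> * of_real x) * f x)" .
  then show ?thesis by (simp add: sinint_def)
qed

text \<open>For real \<xi> conjugation changes the sign of \<xi>, and the difference of the two
  kernels has rank one: a multiple of sin (\<xi> y) sin (\<xi> z). The imaginary part is therefore a
  multiple of the squared modulus of one sine transform.\<close>

lemma Im_green_form_real:
  assumes "continuous_on UNIV f" "x \<noteq> 0"
  shows "Im (green_form b (of_real x) f (\<lambda>x. cnj (f x))) = - (cmod (sinint b (of_real x) f))\<^sup>2 / x"
proof -
  have f: "continuous_on {0..b} f" by (rule continuous_on_subset[OF assms(1)]) simp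
  let ?g = "\<lambda>x. cnj (f x)" and ?s = "\<lambda>y::real. sin (of_real x * complex_of_real y)"
  have cg: "continuous_on {0..b} ?g" by (intro continuous_intros f)
  have green: "green (of_real x) y z - green (- of_real x) y z = - 2 * \<i> / of_real x * (?s y * ?s z)" for y z
  proof -
    have *: "exp (- \<i> * of_real x * of_real (max y z)) - exp (\<i> * of_real x * of_real (max y z)) = - 2 * \<i> * ?s (max y z)"
    proof -
      have "exp (- (\<i> * (of_real x * of_real (max y z)))) - exp (\<i> * (of_real x * of_real (max y z))) = - (2 * \<i> * ?s (max y z))"
        unfolding exp_minus_exp_uminus[symmetric] by simp
      then show ?thesis by (simp add: mult.assoc)
    qed
    have "green (of_real x) y z - green (- of_real x) y z
       = ?s (min y z) / of_real x * (exp (- \<i> * of_real x * of_real (max y z)) - exp (\<i> * of_real x * of_real (max y z)))"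
      using assms(2) by (simp add: green_eq algebra_simps)
    also have "\<dots> = - 2 * \<i> / of_real x * (?s (min y z) * ?s (max y z))" unfolding * by simp
    also have "?s (min y z) * ?s (max y z) = ?s y * ?s z" by (simp add: min_def max_def)
    finally show ?thesis .
  qed
  have inner: "integral {0..b} (\<lambda>z. green (of_real x) y z * f z * ?g y) - integral {0..b} (\<lambda>z. green (- of_real x) y z * f z * ?g y)
     = - 2 * \<i> / of_real x * sinint b (of_real x) f * (?s y * ?g y)" for y
  proof -
    have p: "green (of_real x) y z * f z * ?g y - green (- of_real x) y z * f z * ?g y = (- 2 * \<i> / of_real x * (?s y * ?g y)) * (?s z * f z)" for z
    proof -
      have "green (of_real x) y z * f z * ?g y - green (- of_real x) y z * f z * ?g y = (green (of_real x) y z - green (- of_real x) y z) * (f z * ?g y)"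
        by (simp add: algebra_simps)
      then show ?thesis unfolding green by simp
    qed
    have "integral {0..b} (\<lambda>z. green (of_real x) y z * f z * ?g y) - integral {0..b} (\<lambda>z. green (- of_real x) y z * f z * ?g y)
       = integral {0..b} (\<lambda>z. (- 2 * \<i> / of_real x * (?s y * ?g y)) * (?s z * f z))"
      unfolding p[symmetric]
      by (subst integral_diff) (auto intro!: integrable_continuous_real continuous_intros f)
    also have "\<dots> = (- 2 * \<i> / of_real x * (?s y * ?g y)) * integral {0..b} (\<lambda>z. ?s z * f z)"
      by (rule integral_mult_right)
    finally show ?thesis by (simp only: sinint_eq[OF assms(1)] mult_ac)
  qed
  have "green_form b (of_real x) f ?g - cnj (green_form b (of_real x) f ?g)
      = green_form b (of_real x) f ?g - green_form b (- of_real x) f ?g"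
    by (simp add: cnj_green_form[OF assms(1)])
  also have "\<dots> = integral {0..b} (\<lambda>y. - 2 * \<i> / of_real x * sinint b (of_real x) f * (?s y * ?g y))"
    unfolding green_form_def inner[symmetric]
    by (subst integral_diff) (auto intro!: integrable_continuous_real continuous_on_green_integral continuous_intros assms(1) cg)
  also have "\<dots> = - 2 * \<i> / of_real x * sinint b (of_real x) f * cnj (sinint b (of_real x) f)"
  proof -
    have "cnj (sinint b (of_real x) f) = integral {0..b} (\<lambda>y. ?s y * ?g y)"
      unfolding sinint_eq[OF assms(1)]
      by (subst cnj_integral) (auto intro!: continuous_intros f simp: cnj_sin)
    then show ?thesis by simp
  qed
  also have "\<dots> = - 2 * \<i> * of_real ((cmod (sinint b (of_real x) f))\<^sup>2 / x)"
    by (simp add: complex_norm_square del: of_real_power)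
  finally have "Im (green_form b (of_real x) f ?g - cnj (green_form b (of_real x) f ?g)) = - 2 * ((cmod (sinint b (of_real x) f))\<^sup>2 / x)"
    by simp
  then show ?thesis by simp
qed

text \<open>Read from right to left it completes the square: the three contributions of a branch to
  the imaginary part of the resolvent form become one squared modulus.\<close>

lemma norm_square_expand:
  assumes "r > 0"
  shows "r * (cmod (e + \<i> * y / of_real r))\<^sup>2 = r * (cmod e)\<^sup>2 + (cmod y)\<^sup>2 / r + 2 * Im (e * cnj y)"
proof -
  have "Re (e + \<i> * y / of_real r) = Re e - Im y / r" "Im (e + \<i> * y / of_real r) = Im e + Re y / r" by simp_all
  then show ?thesis
    unfolding cmod_power2 using assms by (simp add: field_simps power2_eq_square)
qed

context star_network
begin

lemma Xi_of_real: "Xi k (of_real t) = xi c a k (of_real (a 1 + t\<^sup>2))"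
  by (simp add: Xi_def)

lemma xi_real_pos:
  assumes "k \<in> {1..n}" "a k < \<mu>"
  shows "xi c a k (of_real \<mu>) = of_real (sqrt ((\<mu> - a k) / c k))" "sqrt ((\<mu> - a k) / c k) > 0"
proof -
  have "(of_real \<mu> - of_real (a k)) / of_real (c k) = complex_of_real ((\<mu> - a k) / c k)" by simp
  then show "xi c a k (of_real \<mu>) = of_real (sqrt ((\<mu> - a k) / c k))"
    unfolding xi_def using assms c_pos[OF assms(1)] by (simp only: lower_sqrt_of_real divide_nonneg_pos less_imp_le diff_ge_0_iff_ge)
  show "sqrt ((\<mu> - a k) / c k) > 0" using assms c_pos[OF assms(1)] by simp
qed

lemma xi_real_neg:
  assumes "k \<in> {1..n}" "\<mu> \<le> a k"
  shows "xi c a k (of_real \<mu>) = - \<i> * of_real (sqrt ((a k - \<mu>) / c k))"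
proof -
  have e: "(of_real \<mu> - of_real (a k)) / of_real (c k) = complex_of_real ((\<mu> - a k) / c k)" by simp
  have "(\<mu> - a k) / c k \<le> 0" using assms c_pos[OF assms(1)] by (simp add: divide_nonpos_pos)
  moreover have "- ((\<mu> - a k) / c k) = (a k - \<mu>) / c k" by (simp add: minus_divide_left)
  ultimately show ?thesis unfolding xi_def e using lower_sqrt_of_neg_real by metis
qed

lemma xi_continuous_real: "continuous_on UNIV (\<lambda>\<mu>. xi c a k (complex_of_real \<mu>))"
proof -
  have "Im ((complex_of_real \<mu> - of_real (a k)) / of_real (c k)) = 0" for \<mu> by simp
  \<comment> \<open>The index is not restricted to \<open>{1..n}\<close> here, so
    \<open>c k = 0\<close> has to be treated; the quotient is then constantly 0.\<close>
  then show ?thesis unfolding xi_def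
    by (intro continuous_on_lower_sqrt') (cases "c k = 0", auto intro!: continuous_intros)
qed

lemma norm_w: "cmod (w n c a (a 1 + t\<^sup>2)) = cmod (Xi_sum (of_real t))"
  by (simp add: w_def Xi_sum_def Xi_of_real norm_mult)

lemma sigma_measurable [measurable]: "sigma n c a k \<in> borel_measurable borel"
proof -
  have [measurable]: "(\<lambda>\<mu>. xi c a k (complex_of_real \<mu>)) \<in> borel_measurable borel" for k
    by (rule borel_measurable_continuous_onI[OF xi_continuous_real])
  show ?thesis unfolding sigma_def[abs_def] w_def by measurable
qed

lemma sigma_nonneg:
  assumes "k \<in> {1..n}"
  shows "sigma n c a k \<mu> \<ge> 0"
proof -
  have "Re (xi c a k (of_real \<mu>)) \<ge> 0"
  proof (cases "a k < \<mu>")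
    case True
    from less_imp_le[OF xi_real_pos(2)[OF assms True]] show ?thesis unfolding xi_real_pos(1)[OF assms True] by (simp only: Re_complex_of_real)
  qed (simp add: xi_real_neg[OF assms])
  then show ?thesis using c_pos[OF assms] by (simp add: sigma_def)
qed

text \<open>The exponentials exp (- \<i> \<xi>_m x) form one tuple common to all k; the correction
  lives on branch k only and vanishes at the vertex. Its coefficient is \<i> (1 - s_k), and 1 - s_k
  is the full sum of the c_l \<xi>_l over c_k \<xi>_k.\<close>

lemma F_minus_eq:
  assumes "xi c a k z \<noteq> 0" "k \<in> {1..n}"
  shows "F_minus n c a z k m x = exp (- \<i> * xi c a m z * of_real x) +
    (if m = k then \<i> * (\<Sum>l\<in>{1..n}. of_real (c l) * xi c a l z) / (of_real (c k) * xi c a k z) * sin (xi c a k z * of_real x) else 0)"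
proof (cases "m = k")
  case True
  have S: "(\<Sum>l\<in>{1..n}. of_real (c l) * xi c a l z) = of_real (c k) * xi c a k z + (\<Sum>l\<in>{1..n} - {k}. of_real (c l) * xi c a l z)"
    using assms(2) by (subst sum.remove[of _ k]) auto
  have e: "exp (- \<i> * xi c a k z * of_real x) = cos (xi c a k z * of_real x) - \<i> * sin (xi c a k z * of_real x)"
    using exp_Euler[of "- (xi c a k z * of_real x)"] by (simp add: mult.assoc)
  have alg: "C - \<i> * (- r / (d * q)) * y = C - \<i> * y + \<i> * (d * q + r) / (d * q) * y" if "d \<noteq> 0" "q \<noteq> 0" for C r d q y :: complex
    using that by (simp add: field_simps)
  have "c k \<noteq> 0" using c_pos[OF assms(2)] by simp
  then show ?thesis using True assms(1)
    unfolding F_minus_def s_def S True e by (simp only: simp_thms if_True) (rule alg, auto)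
qed (simp add: F_minus_def)

end

context test_tuple
begin

definition sin_sum :: "real \<Rightarrow> complex" where
  "sin_sum t = (\<Sum>k | k \<in> {1..n} \<and> a k < a 1 + t\<^sup>2. sinint b (Xi k (of_real t)) (f k))"

definition V_pre :: "nat \<Rightarrow> complex \<Rightarrow> complex" where
  "V_pre k \<zeta> = expsum \<zeta> f + \<i> * Xi_sum \<zeta> / (of_real (c k) * Xi k \<zeta>) * sinint b (Xi k \<zeta>) (f k)"

lemma V_test_eq:
  assumes k: "k \<in> {1..n}" and "a k < a 1 + t\<^sup>2"
  shows "V_test n c a fcnj k (a 1 + t\<^sup>2) = cnj (V_pre k (of_real t))"
proof -
  define \<mu> where "\<mu> = a 1 + t\<^sup>2"
  let ?z = "complex_of_real t"
  define d where "d = \<i> * Xi_sum ?z / (of_real (c k) * Xi k ?z)"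
  have nz: "xi c a k (of_real \<mu>) \<noteq> 0" using xi_real_pos[OF assms] unfolding \<mu>_def by (metis less_irrefl of_real_eq_0_iff)
  have F: "F_minus n c a (of_real \<mu>) k m x = exp (- \<i> * Xi m ?z * of_real x) +
     (if m = k then d * sin (Xi k ?z * of_real x) else 0)" for m x
    using F_minus_eq[OF nz k, of m x] unfolding Xi_of_real Xi_sum_def d_def \<mu>_def by (simp only:)
  have "(\<integral>x. fcnj m x * cnj (F_minus n c a (of_real \<mu>) k m x) \<partial>branch)
      = cnj (expint b (Xi m ?z) (f m) + (if m = k then d * sinint b (Xi k ?z) (f k) else 0))" if m: "m \<in> {1..n}" for m
  proof -
    have c: "continuous_on {0..b} (\<lambda>x. F_minus n c a (of_real \<mu>) k m x)"
      unfolding F by (cases "m = k") (auto intro!: continuous_intros)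
    have "(\<integral>x. fcnj m x * cnj (F_minus n c a (of_real \<mu>) k m x) \<partial>branch) = integral {0..b} (\<lambda>x. fcnj m x * cnj (F_minus n c a (of_real \<mu>) k m x))"
      by (rule integral_branch_eq) (use f_support[OF m] in \<open>auto simp: fcnj_def intro!: continuous_intros c f_continuous m\<close>)
    also have "\<dots> = cnj (integral {0..b} (\<lambda>x. f m x * F_minus n c a (of_real \<mu>) k m x))"
      by (subst cnj_integral) (auto simp: fcnj_def intro!: continuous_intros c f_continuous m)
    also have "integral {0..b} (\<lambda>x. f m x * F_minus n c a (of_real \<mu>) k m x)
        = expint b (Xi m ?z) (f m) + (if m = k then d * sinint b (Xi k ?z) (f k) else 0)"
    proof (cases "m = k")
      case True
      have fc: "continuous_on {0..b} (f k)" "continuous_on UNIV (f k)" using f_continuous[OF k] by auto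
      have "integral {0..b} (\<lambda>x. f m x * F_minus n c a (of_real \<mu>) k m x) =
         integral {0..b} (\<lambda>x. exp (- \<i> * Xi k ?z * of_real x) * f k x + d * (sin (Xi k ?z * of_real x) * f k x))"
        unfolding F using True by (simp add: algebra_simps)
      also have "\<dots> = expint b (Xi k ?z) (f k) + d * sinint b (Xi k ?z) (f k)"
        unfolding expint_def sinint_eq[OF fc(2)]
        by (subst integral_add) (auto intro!: integrable_continuous_real continuous_intros fc)
      finally show ?thesis using True by simp
    qed (simp add: F expint_def mult.commute)
    finally show ?thesis .
  qed
  then have "V_test n c a fcnj k \<mu> = (\<Sum>m\<in>{1..n}. cnj (expint b (Xi m ?z) (f m) + (if m = k then d * sinint b (Xi k ?z) (f k) else 0)))"
    unfolding V_test_def by (intro sum.cong) auto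
  also have "\<dots> = cnj (V_pre k ?z)"
    using k unfolding V_pre_def d_def[symmetric] expsum_def cnj_sum[symmetric] sum.distrib by (subst sum.delta) auto
  finally show ?thesis unfolding \<mu>_def .
qed

text \<open>Branches with a k < \<mu> have real \<xi>_k, the others imaginary ones. The latter
  contribute neither to the real part of S nor to the imaginary part of the Green forms. With e = E
  / S and r = c_k \<xi>_k, the rest is a sum of r |e|^2 + |y|^2 / r + 2 Im (e cnj y) over the
  former, which is the complete square \<pi> \<sigma>_k |V_k|^2.\<close>

lemma Im_resolvent_form_real:
  assumes t: "t > 0"
  shows "- Im (resolvent_form (of_real t)) = pi * (2 * t * (\<Sum>k | k \<in> {1..n} \<and> a k < a 1 + t\<^sup>2.
     sigma n c a k (a 1 + t\<^sup>2) * (cmod (V_test n c a fcnj k (a 1 + t\<^sup>2)))\<^sup>2))"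
proof -
  let ?\<mu> = "a 1 + t\<^sup>2" and ?z = "complex_of_real t"
  \<comment> \<open>The open channels: the branches on which the eigenfunctions at this \<mu>
    oscillate.\<close>
  define O' where "O' = {k \<in> {1..n}. a k < ?\<mu>}"
  have fin: "finite O'" by (simp add: O'_def)
  define x where "x k = sqrt ((?\<mu> - a k) / c k)" for k
  have X: "Xi k ?z = of_real (x k)" "x k > 0" "c k > 0" if "k \<in> O'" for k
    using xi_real_pos[of k ?\<mu>] that c_pos[of k] by (auto simp: O'_def Xi_of_real x_def)
  have X': "- cnj (Xi k ?z) = Xi k ?z" "Re (Xi k ?z) = 0" if "k \<in> {1..n} - O'" for k
    using xi_real_neg[of k ?\<mu>] that by (auto simp: O'_def Xi_of_real)
  define S where "S = Xi_sum ?z"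
  have S0: "S \<noteq> 0" unfolding S_def using t by (intro Xi_sum_nonzero) (auto simp: quadrant_def)
  define E where "E = expsum ?z f"
  \<comment> \<open>Division by S brings \<open>V_pre k\<close> into the form S (e + \<i> y / r),
    and |S|^2 then cancels against |w|^2 in \<open>sigma\<close>.\<close>
  define e where "e = E / S"
  define y where "y k = sinint b (Xi k ?z) (f k)" for k
  define T where "T = (\<Sum>k\<in>O'. y k)"
  define r where "r k = c k * x k" for k
  have r: "r k > 0" if "k \<in> O'" for k using X[OF that] by (simp add: r_def)
  have ReS: "Re S = (\<Sum>k\<in>O'. r k)"
  proof -
    have "Re S = (\<Sum>k\<in>{1..n}. c k * Re (Xi k ?z))" by (simp add: S_def Xi_sum_def)
    also have "\<dots> = (\<Sum>k\<in>O'. c k * Re (Xi k ?z))"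
      by (rule sum.mono_neutral_right) (use X' in \<open>auto simp: O'_def\<close>)
    finally show ?thesis using X by (simp add: r_def)
  qed
  have green: "Im (green_sum ?z) = - (\<Sum>k\<in>O'. (cmod (y k))\<^sup>2 / r k)"
  proof -
    have fc: "fcnj k = (\<lambda>x. cnj (f k x))" for k by (simp add: fcnj_def fun_eq_iff)
    have 0: "Im (green_form b (Xi k ?z) (f k) (fcnj k)) = 0" if k: "k \<in> {1..n} - O'" for k
    proof -
      have "cnj (green_form b (Xi k ?z) (f k) (fcnj k)) = green_form b (Xi k ?z) (f k) (fcnj k)"
        unfolding fc using k cnj_green_form[OF f_continuous] X'[OF k] by simp
      then show ?thesis by (metis Reals_cnj_iff complex_is_Real_iff)
    qed
    have "Im (green_sum ?z) = (\<Sum>k\<in>{1..n}. Im (green_form b (Xi k ?z) (f k) (fcnj k)) / c k)"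
      by (simp add: green_sum_def)
    also have "\<dots> = (\<Sum>k\<in>O'. Im (green_form b (Xi k ?z) (f k) (fcnj k)) / c k)"
      by (rule sum.mono_neutral_right) (use 0 in \<open>auto simp: O'_def\<close>)
    also have "\<dots> = (\<Sum>k\<in>O'. - ((cmod (y k))\<^sup>2 / r k))"
    proof (rule sum.cong[OF refl])
      fix k assume k: "k \<in> O'"
      have "Im (green_form b (of_real (x k)) (f k) (fcnj k)) = - (cmod (sinint b (of_real (x k)) (f k)))\<^sup>2 / x k"
        unfolding fc using X[OF k] k by (intro Im_green_form_real f_continuous) (auto simp: O'_def)
      then show "Im (green_form b (Xi k ?z) (f k) (fcnj k)) / c k = - ((cmod (y k))\<^sup>2 / r k)"
        using X[OF k] by (simp add: y_def r_def)
    qed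
    finally show ?thesis by (simp add: sum_negf)
  qed
  \<comment> \<open>Conjugation replaces \<xi>_k by - \<xi>_k on open channels and fixes it on the
    others, so the two exponential sums differ exactly by the sine transforms of the open
    channels.\<close>
  have E': "expsum ?z fcnj = cnj (E + 2 * \<i> * T)"
  proof -
    have "expint b (Xi k ?z) (fcnj k) = cnj (expint b (Xi k ?z) (f k) + (if k \<in> O' then 2 * \<i> * y k else 0))" if k: "k \<in> {1..n}" for k
    proof -
      have "cnj (expint b (- cnj (Xi k ?z)) (f k)) = expint b (Xi k ?z) (fcnj k)"
        using cnj_expint[OF f_continuous[OF k], of b "- cnj (Xi k ?z)"] by (simp add: fcnj_def[abs_def])
      moreover have "expint b (- cnj (Xi k ?z)) (f k) = expint b (Xi k ?z) (f k) + (if k \<in> O' then 2 * \<i> * y k else 0)"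
        using X(1)[of k] X'(1)[of k] k by (auto simp: y_def sinint_def)
      ultimately show ?thesis by metis
    qed
    then have *: "expsum ?z fcnj = cnj (\<Sum>k\<in>{1..n}. expint b (Xi k ?z) (f k) + (if k \<in> O' then 2 * \<i> * y k else 0))"
      unfolding expsum_def cnj_sum by (rule sum.cong[OF refl])
    have "(\<Sum>k\<in>{1..n}. if k \<in> O' then 2 * \<i> * y k else 0) = (\<Sum>k\<in>O'. 2 * \<i> * y k)"
      by (subst sum.inter_restrict[symmetric]) (auto simp: O'_def intro!: sum.cong)
    then have "(\<Sum>k\<in>{1..n}. if k \<in> O' then 2 * \<i> * y k else 0) = 2 * \<i> * T"
      by (simp add: T_def sum_distrib_left)
    with * show ?thesis by (simp add: sum.distrib E_def expsum_def)
  qed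
  have "- Im (resolvent_form ?z) = 2 * t * (\<Sum>k\<in>O'. (cmod (y k))\<^sup>2 / r k) + Im (2 * \<i> * (of_real t / S) * (E * cnj (E + 2 * \<i> * T)))"
    using t green by (simp add: resolvent_form_def E' rho_eq S_def[symmetric] E_def[symmetric])
  also have "2 * \<i> * (of_real t / S) * (E * cnj (E + 2 * \<i> * T)) = of_real (2 * t) * (\<i> * (e * cnj (e * S + 2 * \<i> * T)))"
    using S0 by (simp add: e_def)
  also have "Im \<dots> = 2 * t * (Re S * (cmod e)\<^sup>2 + 2 * Im (e * cnj T))"
    unfolding cmod_power2 by (simp add: power2_eq_square algebra_simps)
  finally have L: "- Im (resolvent_form ?z) = 2 * t * ((\<Sum>k\<in>O'. (cmod (y k))\<^sup>2 / r k) + (Re S * (cmod e)\<^sup>2 + 2 * Im (e * cnj T)))"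
    by (simp add: distrib_left)
  have trm: "pi * (sigma n c a k ?\<mu> * (cmod (V_test n c a fcnj k ?\<mu>))\<^sup>2) = r k * (cmod e)\<^sup>2 + (cmod (y k))\<^sup>2 / r k + 2 * Im (e * cnj (y k))"
    if k: "k \<in> O'" for k
  proof -
    have kn: "k \<in> {1..n}" "a k < ?\<mu>" using k by (auto simp: O'_def)
    have "V_pre k ?z = S * (e + \<i> * y k / of_real (r k))"
      using S0 X[OF k] by (simp add: V_pre_def e_def E_def y_def r_def S_def[symmetric] field_simps)
    then have "cmod (V_test n c a fcnj k ?\<mu>) = cmod S * cmod (e + \<i> * y k / of_real (r k))"
      by (simp only: V_test_eq[OF kn] complex_mod_cnj norm_mult)
    moreover have "pi * sigma n c a k ?\<mu> = r k / (cmod S)\<^sup>2"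
      using X[OF k] unfolding sigma_def norm_w Xi_of_real[symmetric] by (simp add: S_def r_def)
    ultimately have "pi * (sigma n c a k ?\<mu> * (cmod (V_test n c a fcnj k ?\<mu>))\<^sup>2)
        = r k * (cmod (e + \<i> * y k / of_real (r k)))\<^sup>2"
      using S0 by (simp add: power_mult_distrib mult.assoc[symmetric])
    then show ?thesis by (simp add: norm_square_expand[OF r[OF k]])
  qed
  have "pi * (\<Sum>k\<in>O'. sigma n c a k ?\<mu> * (cmod (V_test n c a fcnj k ?\<mu>))\<^sup>2)
      = (\<Sum>k\<in>O'. r k * (cmod e)\<^sup>2 + (cmod (y k))\<^sup>2 / r k + 2 * Im (e * cnj (y k)))"
    unfolding sum_distrib_left by (rule sum.cong[OF refl trm])
  also have "\<dots> = Re S * (cmod e)\<^sup>2 + (\<Sum>k\<in>O'. (cmod (y k))\<^sup>2 / r k) + 2 * Im (e * cnj T)"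
    by (simp only: sum.distrib ReS sum_distrib_right[symmetric] T_def cnj_sum sum_distrib_left Im_sum)
  finally have F: "pi * (\<Sum>k\<in>O'. sigma n c a k ?\<mu> * (cmod (V_test n c a fcnj k ?\<mu>))\<^sup>2)
      = Re S * (cmod e)\<^sup>2 + (\<Sum>k\<in>O'. (cmod (y k))\<^sup>2 / r k) + 2 * Im (e * cnj T)" .
  have "pi * (2 * t * (\<Sum>k\<in>O'. sigma n c a k ?\<mu> * (cmod (V_test n c a fcnj k ?\<mu>))\<^sup>2))
      = 2 * t * (pi * (\<Sum>k\<in>O'. sigma n c a k ?\<mu> * (cmod (V_test n c a fcnj k ?\<mu>))\<^sup>2))" by (simp only: mult_ac)
  also have "\<dots> = - Im (resolvent_form ?z)" unfolding L F by (simp only: add_ac)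
  finally show ?thesis unfolding O'_def ..
qed

end

section \<open>Isometry on test functions\<close>

context star_network
begin

lemma space_sigma_measure [simp]: "space (sigma_measure n c a k) = {a k..}"
  by (simp add: sigma_measure_def space_restrict_space)

lemma measurable_sigma_measure:
  "f \<in> borel_measurable (sigma_measure n c a k) \<longleftrightarrow> f \<in> borel_measurable (restrict_space lborel {a k..})"
  by (simp add: sigma_measure_def)

lemma borel_measurable_sigma_measure:
  "f \<in> borel_measurable borel \<Longrightarrow> f \<in> borel_measurable (sigma_measure n c a k)"
  unfolding measurable_sigma_measure by (rule measurable_restrict_space1) simp

lemma sigma_measurable_restrict:
  "(\<lambda>\<mu>. ennreal (sigma n c a k \<mu>)) \<in> borel_measurable (restrict_space lborel {a k..})"
  by (rule measurable_restrict_space1) measurable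

text \<open>The threshold \<mu> = a k is a null set. It has to be left out because \<xi>_k vanishes
  there and s_k has \<xi>_k in the denominator.\<close>

lemma AE_sigma_measureI:
  assumes "\<And>\<mu>. a k < \<mu> \<Longrightarrow> P \<mu>"
  shows "AE \<mu> in sigma_measure n c a k. P \<mu>"
proof -
  have "AE \<mu> in lborel. \<mu> \<noteq> a k" by (rule AE_lborel_singleton)
  then have "AE \<mu> in lborel. \<mu> \<in> {a k..} \<longrightarrow> 0 < ennreal (sigma n c a k \<mu>) \<longrightarrow> P \<mu>"
    by eventually_elim (auto intro!: assms)
  then show ?thesis
    unfolding sigma_measure_def by (subst AE_density[OF sigma_measurable_restrict]) (subst AE_restrict_space_iff, auto)
qed

lemma continuous_imp_measurable_sigma_measure:
  fixes f :: "real \<Rightarrow> complex"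
  assumes "continuous_on {a k<..} f"
  shows "f \<in> borel_measurable (sigma_measure n c a k)"
proof -
  have "(\<lambda>x. if x \<in> {a k<..} then f x else f (a k)) \<in> borel_measurable borel"
    by (rule borel_measurable_continuous_on_if[OF _ assms]) auto
  from borel_measurable_sigma_measure[OF this, of k] show ?thesis
    by (rule measurable_cong[THEN iffD1, rotated]) auto
qed

lemma nn_integral_sigma_measure:
  assumes "g \<in> borel_measurable (sigma_measure n c a k)" "k \<in> {1..n}" "\<And>\<mu>. g \<mu> \<ge> 0"
  shows "(\<integral>\<^sup>+\<mu>. ennreal (g \<mu>) \<partial>sigma_measure n c a k) =
    (\<integral>\<^sup>+\<mu>. ennreal (if a k < \<mu> then sigma n c a k \<mu> * g \<mu> else 0) \<partial>lborel)"
proof -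
  have "(\<integral>\<^sup>+\<mu>. ennreal (g \<mu>) \<partial>sigma_measure n c a k) =
      (\<integral>\<^sup>+\<mu>. ennreal (sigma n c a k \<mu>) * ennreal (g \<mu>) \<partial>restrict_space lborel {a k..})"
    using assms(1) unfolding sigma_measure_def
    by (subst nn_integral_density[OF sigma_measurable_restrict]) (auto simp: measurable_sigma_measure[unfolded sigma_measure_def])
  also have "\<dots> = (\<integral>\<^sup>+\<mu>. ennreal (sigma n c a k \<mu>) * ennreal (g \<mu>) * indicator {a k..} \<mu> \<partial>lborel)"
    by (subst nn_integral_restrict_space) auto
  also have "\<dots> = (\<integral>\<^sup>+\<mu>. ennreal (if a k < \<mu> then sigma n c a k \<mu> * g \<mu> else 0) \<partial>lborel)"
  proof (rule nn_integral_cong_AE)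
    have "AE \<mu> in lborel. \<mu> \<noteq> a k" by (rule AE_lborel_singleton)
    then show "AE \<mu> in lborel. ennreal (sigma n c a k \<mu>) * ennreal (g \<mu>) * indicator {a k..} \<mu> =
        ennreal (if a k < \<mu> then sigma n c a k \<mu> * g \<mu> else 0)"
      by eventually_elim (auto simp: indicator_def ennreal_mult assms(3) sigma_nonneg[OF assms(2)])
  qed
  finally show ?thesis .
qed

end

context test_tuple
begin

lemma expsum_continuous: "continuous_on quadrant (\<lambda>\<zeta>. expsum \<zeta> f)"
  unfolding expsum_def by (intro continuous_intros expint_Xi_continuous f_continuous)

text \<open>Continuity is inherited from \<open>V_pre\<close> along \<zeta> = sqrt (\<mu> - a 1).
  The zeros of \<open>Xi k\<close> are removed from the quadrant, which on this path removes only
  the threshold. The purpose is measurability.\<close>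

lemma V_test_continuous:
  assumes k: "k \<in> {1..n}"
  shows "continuous_on {a k<..} (V_test n c a fcnj k)"
proof -
  have "continuous_on ({z \<in> quadrant. Xi k z \<noteq> 0}) (V_pre k)"
    unfolding V_pre_def sinint_def
  proof (intro continuous_intros)
    show "continuous_on {z \<in> quadrant. Xi k z \<noteq> 0} (\<lambda>x. expint b (- Xi k x) (f k))"
      by (rule continuous_on_compose_UNIV[where f="\<lambda>\<xi>. expint b \<xi> (f k)", OF holomorphic_on_imp_continuous_on[OF expint_holomorphic[OF f_continuous[OF k]]]])
         (auto intro!: continuous_intros continuous_on_subset[OF Xi_continuous[OF k]])
  qed (use k in \<open>auto simp: c_nonzero intro!: continuous_on_subset[OF expsum_continuous] continuous_on_subset[OF Xi_sum_continuous]
        continuous_on_subset[OF Xi_continuous] continuous_on_subset[OF expint_Xi_continuous] f_continuous\<close>)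
  then have "continuous_on {a k<..} (\<lambda>\<mu>. V_pre k (complex_of_real (sqrt (\<mu> - a 1))))"
  proof (rule continuous_on_compose2)
    show "(\<lambda>\<mu>. complex_of_real (sqrt (\<mu> - a 1))) ` {a k<..} \<subseteq> {z \<in> quadrant. Xi k z \<noteq> 0}"
    proof (rule image_subsetI)
      fix \<mu> assume "\<mu> \<in> {a k<..}"
      then have \<mu>: "a k < \<mu>" "\<mu> - a 1 \<ge> 0" using a_ge[OF k] by auto
      have "Xi k (complex_of_real (sqrt (\<mu> - a 1))) \<noteq> 0"
        unfolding Xi_of_real using \<mu> xi_real_pos[OF k \<mu>(1)] by auto
      then show "complex_of_real (sqrt (\<mu> - a 1)) \<in> {z \<in> quadrant. Xi k z \<noteq> 0}" using \<mu> by (simp add: quadrant_def)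
    qed
  qed (auto intro!: continuous_intros)
  then have "continuous_on {a k<..} (\<lambda>\<mu>. cnj (V_pre k (complex_of_real (sqrt (\<mu> - a 1)))))" by (intro continuous_intros)
  then show ?thesis
  proof (rule continuous_on_eq)
    fix \<mu> assume "\<mu> \<in> {a k<..}"
    then have "a k < a 1 + (sqrt (\<mu> - a 1))\<^sup>2" "a 1 + (sqrt (\<mu> - a 1))\<^sup>2 = \<mu>" using a_ge[OF k] by auto
    then show "cnj (V_pre k (complex_of_real (sqrt (\<mu> - a 1)))) = V_test n c a fcnj k \<mu>"
      using V_test_eq[OF k, of "sqrt (\<mu> - a 1)"] by simp
  qed
qed

text \<open>Extension by zero below the threshold lets all branches be integrated over one and the
  same interval starting at \<open>a 1\<close>.\<close>

definition spectral_density :: "nat \<Rightarrow> real \<Rightarrow> real" where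
  "spectral_density k \<mu> = (if a k < \<mu> then sigma n c a k \<mu> * (cmod (V_test n c a fcnj k \<mu>))\<^sup>2 else 0)"

lemma spectral_density_nonneg: "k \<in> {1..n} \<Longrightarrow> spectral_density k \<mu> \<ge> 0"
  by (simp add: spectral_density_def sigma_nonneg)

lemma spectral_density_measurable:
  assumes "k \<in> {1..n}"
  shows "spectral_density k \<in> borel_measurable borel"
proof -
  have "(\<lambda>\<mu>. if \<mu> \<in> {a k<..} then V_test n c a fcnj k \<mu> else 0) \<in> borel_measurable borel"
    by (rule borel_measurable_continuous_on_if[OF _ V_test_continuous[OF assms]]) auto
  then have "(\<lambda>\<mu>. sigma n c a k \<mu> * (cmod (if \<mu> \<in> {a k<..} then V_test n c a fcnj k \<mu> else 0))\<^sup>2) \<in> borel_measurable borel"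
    by measurable
  also have "(\<lambda>\<mu>. sigma n c a k \<mu> * (cmod (if \<mu> \<in> {a k<..} then V_test n c a fcnj k \<mu> else 0))\<^sup>2) = spectral_density k"
    by (auto simp: spectral_density_def fun_eq_iff)
  finally show ?thesis .
qed

lemma nn_integral_spectral_density_substitution:
  assumes k: "k \<in> {1..n}" and "R \<ge> 0"
  shows "(\<integral>\<^sup>+\<mu>. ennreal (spectral_density k \<mu> * indicator {a 1..a 1 + R\<^sup>2} \<mu>) \<partial>lborel) =
    (\<integral>\<^sup>+t. ennreal (spectral_density k (a 1 + t\<^sup>2) * (2 * t) * indicator {0..R} t) \<partial>lborel)"
proof -
  have "(\<integral>\<^sup>+\<mu>. ennreal (spectral_density k \<mu> * indicator {a 1 + 0\<^sup>2..a 1 + R\<^sup>2} \<mu>) \<partial>lborel) =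
    (\<integral>\<^sup>+t. ennreal (spectral_density k (a 1 + t\<^sup>2) * (2 * t) * indicator {0..R} t) \<partial>lborel)"
  proof (rule nn_integral_substitution)
    note [measurable] = spectral_density_measurable[OF k]
    show "set_borel_measurable borel {a 1 + 0\<^sup>2..a 1 + R\<^sup>2} (spectral_density k)"
      unfolding set_borel_measurable_def by measurable
    show "((\<lambda>t. a 1 + t\<^sup>2) has_real_derivative 2 * x) (at x)" for x by (auto intro!: derivative_eq_intros)
  qed (use assms in \<open>auto intro!: continuous_intros\<close>)
  then show ?thesis by simp
qed

text \<open>Under \<mu> = a 1 + t^2 the densities of all branches add up, except at t = 0, to the
  continuous function - Im \<open>resolvent_form\<close> / \<pi>. Nonnegative integrals are used
  because integrability of the single densities is a consequence, not a premise.\<close>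

lemma nn_integral_spectral_density_bounded:
  assumes "R > 0"
  shows "(\<Sum>k\<in>{1..n}. \<integral>\<^sup>+\<mu>. ennreal (spectral_density k \<mu> * indicator {a 1..a 1 + R\<^sup>2} \<mu>) \<partial>lborel)
    = ennreal (- integral {0..R} (\<lambda>t. Im (resolvent_form (of_real t))) / pi)"
proof -
  note [measurable] = spectral_density_measurable
  define q where "q t = (\<Sum>k\<in>{1..n}. spectral_density k (a 1 + t\<^sup>2) * (2 * t) * indicator {0..R} t)" for t
  have q: "q \<in> borel_measurable borel" unfolding q_def by measurable
  have q0: "q t \<ge> 0" for t
    unfolding q_def using spectral_density_nonneg by (intro sum_nonneg) (auto simp: indicator_def)
  have cont: "continuous_on {0..R} (\<lambda>t. Im (resolvent_form (of_real t)))"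
    by (intro continuous_intros continuous_on_compose2[OF resolvent_form_continuous]) (auto simp: quadrant_def)
  have "((\<lambda>t. - Im (resolvent_form (of_real t)) / pi) has_integral - integral {0..R} (\<lambda>t. Im (resolvent_form (of_real t))) / pi) {0..R}"
    using has_integral_mult_left[OF integrable_integral[OF integrable_continuous_real[OF cont]], of "- 1 / pi"] by simp
  then have "(q has_integral - integral {0..R} (\<lambda>t. Im (resolvent_form (of_real t))) / pi) {0..R}"
  proof (rule has_integral_spike_finite[rotated 2])
    fix t assume t: "t \<in> {0..R} - {0}"
    have "q t = 2 * t * (\<Sum>k\<in>{1..n}. spectral_density k (a 1 + t\<^sup>2))"
      using t by (simp add: q_def sum_distrib_left mult_ac)
    also have "(\<Sum>k\<in>{1..n}. spectral_density k (a 1 + t\<^sup>2)) =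
        (\<Sum>k | k \<in> {1..n} \<and> a k < a 1 + t\<^sup>2. sigma n c a k (a 1 + t\<^sup>2) * (cmod (V_test n c a fcnj k (a 1 + t\<^sup>2)))\<^sup>2)"
      unfolding spectral_density_def by (subst sum.inter_filter[symmetric]) auto
    finally show "q t = - Im (resolvent_form (of_real t)) / pi"
      using Im_resolvent_form_real[of t] t by simp
  qed simp
  then have "(q has_integral - integral {0..R} (\<lambda>t. Im (resolvent_form (of_real t))) / pi) UNIV"
    by (rule has_integral_on_superset) (auto simp: q_def)
  then have "(\<integral>\<^sup>+t. ennreal (q t) \<partial>lborel) = ennreal (- integral {0..R} (\<lambda>t. Im (resolvent_form (of_real t))) / pi)"
    by (rule nn_integral_has_integral_lborel[OF q q0])
  moreover have "(\<integral>\<^sup>+t. ennreal (q t) \<partial>lborel) =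
      (\<Sum>k\<in>{1..n}. \<integral>\<^sup>+t. ennreal (spectral_density k (a 1 + t\<^sup>2) * (2 * t) * indicator {0..R} t) \<partial>lborel)"
    unfolding q_def
    by (subst nn_integral_sum[symmetric])
       (auto intro!: nn_integral_cong sum_ennreal[symmetric] simp: spectral_density_nonneg indicator_def)
  ultimately show ?thesis
    using assms by (simp add: nn_integral_spectral_density_substitution)
qed

text \<open>The same sequence of bounded integrals has two limits: monotone convergence gives the
  full integrals, the contour argument gives the norm.\<close>

lemma nn_integral_spectral_density:
  "(\<Sum>k\<in>{1..n}. \<integral>\<^sup>+\<mu>. ennreal (spectral_density k \<mu>) \<partial>lborel) = ennreal (\<Sum>k\<in>{1..n}. sqnorm k)"
proof -
  note [measurable] = spectral_density_measurable
  have top: "filterlim (\<lambda>i. real (Suc i)) at_top sequentially"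
    by (rule filterlim_compose[OF filterlim_real_sequentially filterlim_Suc])
  have "(\<lambda>i. \<Sum>k\<in>{1..n}. \<integral>\<^sup>+\<mu>. ennreal (spectral_density k \<mu> * indicator {a 1..a 1 + (real (Suc i))\<^sup>2} \<mu>) \<partial>lborel)
      \<longlonglongrightarrow> (\<Sum>k\<in>{1..n}. \<integral>\<^sup>+\<mu>. ennreal (spectral_density k \<mu>) \<partial>lborel)"
  proof (intro tendsto_sum nn_integral_LIMSEQ)
    fix k assume k: "k \<in> {1..n}"
    show "incseq (\<lambda>i \<mu>. ennreal (spectral_density k \<mu> * indicator {a 1..a 1 + (real (Suc i))\<^sup>2} \<mu>))"
    proof (rule incseq_SucI, rule le_funI)
      fix i \<mu>
      have "(real (Suc i))\<^sup>2 \<le> (real (Suc (Suc i)))\<^sup>2" by (intro power_mono) auto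
      then have "indicat_real {a 1..a 1 + (real (Suc i))\<^sup>2} \<mu> \<le> indicator {a 1..a 1 + (real (Suc (Suc i)))\<^sup>2} \<mu>"
        unfolding indicator_def of_bool_less_eq_iff atLeastAtMost_iff by linarith
      then show "ennreal (spectral_density k \<mu> * indicator {a 1..a 1 + (real (Suc i))\<^sup>2} \<mu>) \<le>
           ennreal (spectral_density k \<mu> * indicator {a 1..a 1 + (real (Suc (Suc i)))\<^sup>2} \<mu>)"
        by (intro ennreal_leI mult_left_mono spectral_density_nonneg k)
    qed
    show "(\<lambda>\<mu>. ennreal (spectral_density k \<mu> * indicator {a 1..a 1 + (real (Suc i))\<^sup>2} \<mu>)) \<in> borel_measurable lborel" for i
      using k by measurable
    show "(\<lambda>i. ennreal (spectral_density k \<mu> * indicator {a 1..a 1 + (real (Suc i))\<^sup>2} \<mu>)) \<longlonglongrightarrow> ennreal (spectral_density k \<mu>)" for \<mu>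
    proof (rule tendsto_eventually)
      obtain m where m: "\<mu> - a 1 \<le> real m" using real_arch_simple by blast
      have "\<mu> \<le> a 1 + (real (Suc i))\<^sup>2" if "i \<ge> m" for i
      proof -
        define r where "r = real (Suc i)"
        have "real m \<le> r" "1 \<le> r" using that by (auto simp: r_def)
        moreover from this have "r * 1 \<le> r * r" by (intro mult_left_mono) auto
        ultimately show ?thesis using m unfolding r_def[symmetric] power2_eq_square by linarith
      qed
      moreover have "spectral_density k \<mu> = 0" if "\<mu> < a 1" using that a_ge[OF k] by (simp add: spectral_density_def)
      ultimately show "\<forall>\<^sub>F i in sequentially. ennreal (spectral_density k \<mu> * indicator {a 1..a 1 + (real (Suc i))\<^sup>2} \<mu>) = ennreal (spectral_density k \<mu>)"
        by (cases "\<mu> < a 1") (auto simp: eventually_sequentially indicator_def intro!: exI[of _ m])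
    qed
  qed
  moreover have "(\<lambda>i. \<Sum>k\<in>{1..n}. \<integral>\<^sup>+\<mu>. ennreal (spectral_density k \<mu> * indicator {a 1..a 1 + (real (Suc i))\<^sup>2} \<mu>) \<partial>lborel)
      \<longlonglongrightarrow> ennreal (\<Sum>k\<in>{1..n}. sqnorm k)"
  proof -
    have "((\<lambda>R. - integral {0..R} (\<lambda>t. Im (resolvent_form (of_real t))) / pi) \<longlongrightarrow> - (- (pi * (\<Sum>k\<in>{1..n}. sqnorm k))) / pi) at_top"
      by (intro tendsto_intros Im_resolvent_form_integral_tendsto) simp
    from filterlim_compose[OF this top]
    have "(\<lambda>i. - integral {0..real (Suc i)} (\<lambda>t. Im (resolvent_form (of_real t))) / pi) \<longlonglongrightarrow> (\<Sum>k\<in>{1..n}. sqnorm k)" by simp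
    from tendsto_ennrealI[OF this] show ?thesis
      by (subst nn_integral_spectral_density_bounded) auto
  qed
  ultimately show ?thesis by (rule LIMSEQ_unique)
qed

lemma V_test_isometry:
  shows "k \<in> {1..n} \<Longrightarrow> V_test n c a fcnj k \<in> L2 (sigma_measure n c a k)"
    and "prod_L2_norm n (sigma_measure n c a) (V_test n c a fcnj) = sqrt (\<Sum>k\<in>{1..n}. sqnorm k)"
proof -
  have m: "V_test n c a fcnj k \<in> borel_measurable (sigma_measure n c a k)" if "k \<in> {1..n}" for k
    by (rule continuous_imp_measurable_sigma_measure[OF V_test_continuous[OF that]])
  have nn: "(\<integral>\<^sup>+\<mu>. ennreal ((cmod (V_test n c a fcnj k \<mu>))\<^sup>2) \<partial>sigma_measure n c a k) = (\<integral>\<^sup>+\<mu>. ennreal (spectral_density k \<mu>) \<partial>lborel)"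
    if k: "k \<in> {1..n}" for k
    using m[OF k] unfolding spectral_density_def by (intro nn_integral_sigma_measure k) auto
  have fin: "(\<integral>\<^sup>+\<mu>. ennreal ((cmod (V_test n c a fcnj k \<mu>))\<^sup>2) \<partial>sigma_measure n c a k) < \<infinity>" if k: "k \<in> {1..n}" for k
  proof -
    have "(\<integral>\<^sup>+\<mu>. ennreal (spectral_density k \<mu>) \<partial>lborel) \<le> (\<Sum>k\<in>{1..n}. \<integral>\<^sup>+\<mu>. ennreal (spectral_density k \<mu>) \<partial>lborel)"
      by (rule member_le_sum[OF k]) auto
    also have "\<dots> < \<infinity>" unfolding nn_integral_spectral_density by simp
    finally show ?thesis unfolding nn[OF k] .
  qed
  show L: "V_test n c a fcnj k \<in> L2 (sigma_measure n c a k)" if k: "k \<in> {1..n}" for k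
    unfolding L2_def using m[OF k] fin[OF k] by (auto intro!: integrableI_bounded)
  have "ennreal (\<Sum>k\<in>{1..n}. \<integral>\<mu>. (cmod (V_test n c a fcnj k \<mu>))\<^sup>2 \<partial>sigma_measure n c a k)
     = (\<Sum>k\<in>{1..n}. \<integral>\<^sup>+\<mu>. ennreal ((cmod (V_test n c a fcnj k \<mu>))\<^sup>2) \<partial>sigma_measure n c a k)"
  proof -
    have "(\<integral>\<^sup>+\<mu>. ennreal ((cmod (V_test n c a fcnj k \<mu>))\<^sup>2) \<partial>sigma_measure n c a k) =
        ennreal (\<integral>\<mu>. (cmod (V_test n c a fcnj k \<mu>))\<^sup>2 \<partial>sigma_measure n c a k)" if "k \<in> {1..n}" for k
      by (rule nn_integral_eq_integral[OF L2_integrable[OF L[OF that]]]) simp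
    then show ?thesis by simp
  qed
  also have "\<dots> = (\<Sum>k\<in>{1..n}. \<integral>\<^sup>+\<mu>. ennreal (spectral_density k \<mu>) \<partial>lborel)"
    by (rule sum.cong[OF refl nn])
  finally have "ennreal (\<Sum>k\<in>{1..n}. \<integral>\<mu>. (cmod (V_test n c a fcnj k \<mu>))\<^sup>2 \<partial>sigma_measure n c a k) = ennreal (\<Sum>k\<in>{1..n}. sqnorm k)"
    by (simp only: nn_integral_spectral_density)
  moreover have "(\<Sum>k\<in>{1..n}. sqnorm k) \<ge> 0"
    unfolding sqnorm_def by (intro sum_nonneg Henstock_Kurzweil_Integration.integral_nonneg integrable_continuous_real continuous_intros f_continuous) auto
  ultimately have "(\<Sum>k\<in>{1..n}. \<integral>\<mu>. (cmod (V_test n c a fcnj k \<mu>))\<^sup>2 \<partial>sigma_measure n c a k) = (\<Sum>k\<in>{1..n}. sqnorm k)"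
    by (subst (asm) ennreal_inj) (auto intro: sum_nonneg)
  then show "prod_L2_norm n (sigma_measure n c a) (V_test n c a fcnj) = sqrt (\<Sum>k\<in>{1..n}. sqnorm k)"
    by (simp add: prod_L2_norm_def)
qed

end

definition test_tuples :: "nat \<Rightarrow> (nat \<Rightarrow> real \<Rightarrow> complex) set" where
  "test_tuples n = {\<phi>. \<forall>k\<in>{1..n}. \<phi> k \<in> test_functions}"

context star_network
begin

lemma V_test_isometric:
  assumes "\<phi> \<in> test_tuples n"
  shows "V_test n c a \<phi> \<in> L2_sigma n c a"
    and "prod_L2_norm n (sigma_measure n c a) (V_test n c a \<phi>) = prod_L2_norm n (\<lambda>k. branch) \<phi>"
proof -
  have "\<forall>k\<in>{1..n}. \<exists>\<beta>. \<forall>x. x \<le> 0 \<or> x \<ge> \<beta> \<longrightarrow> \<phi> k x = 0"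
  proof
    fix k assume "k \<in> {1..n}"
    then have "\<phi> k \<in> test_functions" using assms by (simp add: test_tuples_def)
    then obtain \<alpha> \<beta> where "0 < \<alpha>" "\<alpha> \<le> \<beta>" "\<And>x. x \<notin> {\<alpha>..\<beta>} \<Longrightarrow> \<phi> k x = 0" using test_functions_support by metis
    \<comment> \<open>The value at \<beta> itself may be nonzero, and vanishing is required from the
      bound on; hence \<beta> + 1.\<close>
    then show "\<exists>\<beta>. \<forall>x. x \<le> 0 \<or> x \<ge> \<beta> \<longrightarrow> \<phi> k x = 0" by (intro exI[of _ "\<beta> + 1"]) auto
  qed
  then obtain \<beta> where \<beta>: "\<And>k x. k \<in> {1..n} \<Longrightarrow> x \<le> 0 \<or> x \<ge> \<beta> k \<Longrightarrow> \<phi> k x = 0" by metis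
  define b where "b = 1 + (\<Sum>k\<in>{1..n}. \<bar>\<beta> k\<bar>)"
  have b: "\<beta> k \<le> b" if "k \<in> {1..n}" for k
    using member_le_sum[of k "{1..n}" "\<lambda>k. \<bar>\<beta> k\<bar>"] that by (simp add: b_def)
  have bpos: "b > 0" unfolding b_def by (intro add_pos_nonneg sum_nonneg) auto
  \<comment> \<open>The locale is entered with the conjugated tuple, so that its \<open>fcnj\<close>
    is \<phi> itself.\<close>
  interpret test_tuple n c a b "\<lambda>k x. cnj (\<phi> k x)"
  proof
    show "smooth (\<lambda>x. cnj (\<phi> k x))" if "k \<in> {1..n}" for k
      using that assms by (intro smooth_cnj test_functions_smooth) (simp add: test_tuples_def)
    show "cnj (\<phi> k x) = 0" if "k \<in> {1..n}" "x \<le> 0 \<or> b \<le> x" for k x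
      using \<beta>[OF that(1), of x] b[OF that(1)] that(2) by auto
  qed (rule bpos)
  have f: "fcnj = \<phi>" by (simp add: fcnj_def fun_eq_iff)
  show "V_test n c a \<phi> \<in> L2_sigma n c a"
    using V_test_isometry(1) unfolding f by (simp add: L2_sigma_def prod_L2_def)
  have "sqnorm k = (\<integral>x. (cmod (\<phi> k x))\<^sup>2 \<partial>branch)" if k: "k \<in> {1..n}" for k
  proof -
    have "continuous_on {0..b} (\<lambda>x. (cmod (\<phi> k x))\<^sup>2)"
      using f_continuous[OF k, of "{0..b}"] by (intro continuous_intros) (use fcnj_continuous[OF k] f in auto)
    then show ?thesis
      unfolding sqnorm_def using \<beta>[OF k] b[OF k] by (subst integral_branch_eq) (auto intro: order_trans)
  qed
  then show "prod_L2_norm n (sigma_measure n c a) (V_test n c a \<phi>) = prod_L2_norm n (\<lambda>k. branch) \<phi>"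
    using V_test_isometry(2) unfolding f by (simp add: prod_L2_norm_def)
qed

end

section \<open>The inner product of tuples\<close>

definition prod_inner :: "nat \<Rightarrow> (nat \<Rightarrow> real measure) \<Rightarrow> (nat \<Rightarrow> real \<Rightarrow> complex) \<Rightarrow> (nat \<Rightarrow> real \<Rightarrow> complex) \<Rightarrow> complex" where
  "prod_inner n M F G = (\<Sum>k\<in>{1..n}. \<integral>x. F k x * cnj (G k x) \<partial>M k)"

lemma L2_cnj: "f \<in> L2 M \<Longrightarrow> (\<lambda>x. cnj (f x)) \<in> L2 M"
proof -
  assume f: "f \<in> L2 M"
  have "(\<lambda>x. cnj (f x)) \<in> borel_measurable M"
    using L2_measurable[OF f] by (rule measurable_compose) (intro borel_measurable_continuous_onI continuous_intros)
  then show ?thesis using f by (simp add: L2_def)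
qed

lemma L2_inner_integrable: "f \<in> L2 M \<Longrightarrow> g \<in> L2 M \<Longrightarrow> integrable M (\<lambda>x. f x * cnj (g x))"
  by (intro L2_mult_integrable L2_cnj)

lemma prod_L2_cmult: "F \<in> prod_L2 n M \<Longrightarrow> (\<lambda>k x. z * F k x) \<in> prod_L2 n M"
  by (simp add: prod_L2_def L2_cmult)

lemma prod_inner_diff_left:
  assumes "F \<in> prod_L2 n M" "G \<in> prod_L2 n M" "K \<in> prod_L2 n M"
  shows "prod_inner n M (\<lambda>k x. F k x - G k x) K = prod_inner n M F K - prod_inner n M G K"
  using assms unfolding prod_inner_def prod_L2_def sum_subtractf[symmetric]
  by (intro sum.cong) (auto simp: left_diff_distrib L2_inner_integrable)

lemma prod_inner_cmult_left: "prod_inner n M (\<lambda>k x. z * F k x) G = z * prod_inner n M F G"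
  by (simp add: prod_inner_def sum_distrib_left mult.assoc)

lemma prod_inner_cmult_right: "prod_inner n M F (\<lambda>k x. z * G k x) = cnj z * prod_inner n M F G"
  by (simp add: prod_inner_def sum_distrib_left mult.left_commute)

lemma prod_L2_norm_cmult: "prod_L2_norm n M (\<lambda>k x. z * F k x) = cmod z * prod_L2_norm n M F"
  by (simp add: prod_L2_norm_def norm_mult power_mult_distrib real_sqrt_mult flip: sum_distrib_left)

lemma prod_L2_norm_power2: "(prod_L2_norm n M F)\<^sup>2 = (\<Sum>k\<in>{1..n}. \<integral>x. (cmod (F k x))\<^sup>2 \<partial>M k)"
  by (simp add: prod_L2_norm_def sum_nonneg)

lemma prod_L2_norm_add_power2:
  assumes "F \<in> prod_L2 n M" "G \<in> prod_L2 n M"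
  shows "(prod_L2_norm n M (\<lambda>k x. F k x + G k x))\<^sup>2 = (prod_L2_norm n M F)\<^sup>2 + 2 * Re (prod_inner n M F G) + (prod_L2_norm n M G)\<^sup>2"
proof -
  have "(\<integral>x. (cmod (F k x + G k x))\<^sup>2 \<partial>M k) = (\<integral>x. (cmod (F k x))\<^sup>2 \<partial>M k) + 2 * Re (\<integral>x. F k x * cnj (G k x) \<partial>M k) + (\<integral>x. (cmod (G k x))\<^sup>2 \<partial>M k)"
    if k: "k \<in> {1..n}" for k
  proof -
    have L: "F k \<in> L2 (M k)" "G k \<in> L2 (M k)" using assms k by (auto simp: prod_L2_def)
    define r where "r x = Re (F k x * cnj (G k x))" for x
    have r: "integrable (M k) r" "(\<integral>x. r x \<partial>M k) = Re (\<integral>x. F k x * cnj (G k x) \<partial>M k)"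
      unfolding r_def using integrable_Re[OF L2_inner_integrable[OF L]] integral_Re[OF L2_inner_integrable[OF L]] by auto
    have "(cmod (F k x + G k x))\<^sup>2 = (cmod (F k x))\<^sup>2 + 2 * r x + (cmod (G k x))\<^sup>2" for x
      unfolding cmod_power2 r_def by (simp add: power2_eq_square algebra_simps)
    then show ?thesis
      using L2_integrable[OF L(1)] L2_integrable[OF L(2)] r by simp
  qed
  then show ?thesis
    unfolding prod_L2_norm_power2 prod_inner_def by (simp add: sum.distrib sum_distrib_left)
qed

lemma prod_L2_norm_parallelogram:
  assumes "F \<in> prod_L2 n M" "G \<in> prod_L2 n M"
  shows "(prod_L2_norm n M (\<lambda>k x. F k x + G k x))\<^sup>2 + (prod_L2_norm n M (\<lambda>k x. F k x - G k x))\<^sup>2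
    = 2 * (prod_L2_norm n M F)\<^sup>2 + 2 * (prod_L2_norm n M G)\<^sup>2"
  using prod_L2_norm_add_power2[OF assms] prod_L2_norm_add_power2[OF assms(1) prod_L2_cmult[OF assms(2), of "-1"]]
    prod_L2_norm_cmult[of n M "-1" G] prod_inner_cmult_right[of n M F "-1" G]
  by simp

lemma prod_L2_norm_cong_AE:
  assumes "F \<in> prod_L2 n M" "G \<in> prod_L2 n M" "\<And>k. k \<in> {1..n} \<Longrightarrow> AE x in M k. F k x = G k x"
  shows "prod_L2_norm n M F = prod_L2_norm n M G"
  unfolding prod_L2_norm_eq
  using assms by (intro L2_set_cong refl l2norm_cong_AE) (auto simp: prod_L2_def L2_def)

lemma prod_L2_norm_eq_0:
  assumes "\<And>k. k \<in> {1..n} \<Longrightarrow> AE x in M k. F k x = 0"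
  shows "prod_L2_norm n M F = 0"
proof -
  have "(\<integral>x. (cmod (F k x))\<^sup>2 \<partial>M k) = 0" if "k \<in> {1..n}" for k
    using assms[OF that] by (intro integral_eq_zero_AE) auto
  then show ?thesis by (simp add: prod_L2_norm_def)
qed

lemma prod_inner_cong_AE:
  assumes "F \<in> prod_L2 n M" "F' \<in> prod_L2 n M" "G \<in> prod_L2 n M" "G' \<in> prod_L2 n M"
    and "\<And>k. k \<in> {1..n} \<Longrightarrow> AE x in M k. F k x = F' k x" "\<And>k. k \<in> {1..n} \<Longrightarrow> AE x in M k. G k x = G' k x"
  shows "prod_inner n M F G = prod_inner n M F' G'"
  unfolding prod_inner_def
proof (intro sum.cong refl integral_cong_AE)
  fix k assume k: "k \<in> {1..n}"
  show "AE x in M k. F k x * cnj (G k x) = F' k x * cnj (G' k x)"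
    using assms(5,6)[OF k] by eventually_elim auto
  show "(\<lambda>x. F k x * cnj (G k x)) \<in> borel_measurable (M k)" "(\<lambda>x. F' k x * cnj (G' k x)) \<in> borel_measurable (M k)"
    using assms(1-4) k by (auto simp: prod_L2_def intro!: borel_measurable_integrable L2_inner_integrable)
qed

text \<open>The projection is found as the limit of a minimizing sequence.\<close>

lemma prod_L2_projection:
  assumes sub: "W \<subseteq> prod_L2 n M" and ne: "W \<noteq> {}"
    and add: "\<And>F G. F \<in> W \<Longrightarrow> G \<in> W \<Longrightarrow> (\<lambda>k x. F k x + G k x) \<in> W"
    and cmult: "\<And>F z. F \<in> W \<Longrightarrow> (\<lambda>k x. z * F k x) \<in> W"
    and closed: "\<And>F f. (\<And>i::nat. F i \<in> W) \<Longrightarrow> f \<in> prod_L2 n M \<Longrightarrow>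
      (\<lambda>i. prod_L2_norm n M (\<lambda>k x. F i k x - f k x)) \<longlonglongrightarrow> 0 \<Longrightarrow> f \<in> W"
    and G: "G \<in> prod_L2 n M"
  shows "\<exists>g\<in>W. \<forall>h\<in>W. prod_inner n M (\<lambda>k x. G k x - g k x) h = 0"
proof -
  let ?N = "prod_L2_norm n M"
  define D where "D F = ?N (\<lambda>k x. F k x - G k x)" for F
  define d where "d = (INF F\<in>W. D F)"
  have bdd: "bdd_below (D ` W)" by (intro bdd_belowI[of _ 0]) (auto simp: D_def)
  have d_le: "d \<le> D F" if "F \<in> W" for F unfolding d_def by (rule cINF_lower[OF bdd that])
  have d0: "d \<ge> 0" unfolding d_def using ne by (intro cINF_greatest) (auto simp: D_def)
  have "\<exists>F\<in>W. D F < d + inverse (real (Suc i))" for i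
    using cINF_less_iff[OF ne bdd, of "d + inverse (real (Suc i))"] by (simp add: d_def)
  then obtain F where F: "\<And>i. F i \<in> W" "\<And>i. D (F i) < d + inverse (real (Suc i))" by metis
  have FL: "F i \<in> prod_L2 n M" for i using F(1) sub by blast
  have lim: "(\<lambda>i. D (F i)) \<longlonglongrightarrow> d"
  proof (rule tendsto_sandwich[OF always_eventually always_eventually tendsto_const])
    show "(\<lambda>i. d + inverse (real (Suc i))) \<longlonglongrightarrow> d" using tendsto_add[OF tendsto_const LIMSEQ_inverse_real_of_nat, of d] by simp
  qed (use F d_le in \<open>auto intro: less_imp_le\<close>)
  \<comment> \<open>The midpoint of two members lies in W and has distance at least d from G, so the
    parallelogram identity makes two near-minimizers close to each other.\<close>
  have par: "(?N (\<lambda>k x. F i k x - F j k x))\<^sup>2 \<le> 2 * (D (F i))\<^sup>2 + 2 * (D (F j))\<^sup>2 - 4 * d\<^sup>2" for i j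
  proof -
    have mid: "(\<lambda>k x. (1/2) * (F i k x + F j k x)) \<in> W" by (rule cmult[OF add[OF F(1) F(1)]])
    have "(\<lambda>k x. (F i k x - G k x) + (F j k x - G k x)) = (\<lambda>k x. 2 * ((1/2) * (F i k x + F j k x) - G k x))"
      by (simp add: fun_eq_iff algebra_simps)
    then have "?N (\<lambda>k x. (F i k x - G k x) + (F j k x - G k x)) = 2 * D (\<lambda>k x. (1/2) * (F i k x + F j k x))"
      unfolding D_def by (simp only: prod_L2_norm_cmult) simp
    moreover have "d\<^sup>2 \<le> (D (\<lambda>k x. (1/2) * (F i k x + F j k x)))\<^sup>2" by (rule power_mono[OF d_le[OF mid] d0])
    moreover have "(?N (\<lambda>k x. (F i k x - G k x) + (F j k x - G k x)))\<^sup>2 + (?N (\<lambda>k x. (F i k x - G k x) - (F j k x - G k x)))\<^sup>2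
        = 2 * (D (F i))\<^sup>2 + 2 * (D (F j))\<^sup>2"
      unfolding D_def by (rule prod_L2_norm_parallelogram) (intro prod_L2_diff FL G)+
    ultimately show ?thesis by (simp add: power_mult_distrib)
  qed
  have "\<exists>f\<in>prod_L2 n M. (\<lambda>i. ?N (\<lambda>k x. F i k x - f k x)) \<longlonglongrightarrow> 0"
  proof (rule prod_L2_complete[OF FL])
    fix e :: real assume "e > 0"
    have "(\<lambda>i. 2 * (D (F i))\<^sup>2 - 2 * d\<^sup>2) \<longlonglongrightarrow> 2 * d\<^sup>2 - 2 * d\<^sup>2" by (intro tendsto_intros lim)
    then have "\<forall>\<^sub>F i in sequentially. 2 * (D (F i))\<^sup>2 - 2 * d\<^sup>2 < e\<^sup>2 / 2"
      using \<open>e > 0\<close> by (intro order_tendstoD(2)[of _ 0]) auto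
    then obtain N where N: "\<And>i. i \<ge> N \<Longrightarrow> 2 * (D (F i))\<^sup>2 - 2 * d\<^sup>2 < e\<^sup>2 / 2" by (auto simp: eventually_sequentially)
    have "?N (\<lambda>k x. F i k x - F j k x) < e" if "i \<ge> N" "j \<ge> N" for i j
    proof (rule power2_less_imp_less)
      show "(?N (\<lambda>k x. F i k x - F j k x))\<^sup>2 < e\<^sup>2" using par[of i j] N[OF that(1)] N[OF that(2)] by linarith
    qed (use \<open>e > 0\<close> in auto)
    then show "\<exists>N. \<forall>i\<ge>N. \<forall>j\<ge>N. ?N (\<lambda>k x. F i k x - F j k x) < e" by blast
  qed
  then obtain g where g: "g \<in> prod_L2 n M" "(\<lambda>i. ?N (\<lambda>k x. F i k x - g k x)) \<longlonglongrightarrow> 0" by blast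
  have gW: "g \<in> W" by (rule closed[OF F(1) g])
  have "D g \<le> d"
  proof (rule tendsto_lowerbound)
    show "(\<lambda>i. ?N (\<lambda>k x. F i k x - g k x) + D (F i)) \<longlonglongrightarrow> d" using tendsto_add[OF g(2) lim] by simp
    have "D g \<le> ?N (\<lambda>k x. g k x - F i k x) + D (F i)" for i
      unfolding D_def by (rule prod_L2_norm_triangle_diff[OF g(1) FL G])
    then show "\<forall>\<^sub>F i in sequentially. D g \<le> ?N (\<lambda>k x. F i k x - g k x) + D (F i)"
      by (simp add: prod_L2_norm_minus_commute[of n M g])
  qed simp
  then have Dg: "D g = d" using d_le[OF gW] by simp
  define p where "p k x = g k x - G k x" for k x
  have p: "p \<in> prod_L2 n M" unfolding p_def by (rule prod_L2_diff[OF g(1) G])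
  have re: "Re (prod_inner n M p h) = 0" if h: "h \<in> W" for h
  proof -
    have hL: "h \<in> prod_L2 n M" using h sub by blast
    define q where "q = Re (prod_inner n M p h)"
    define r where "r = (?N h)\<^sup>2"
    have ineq: "0 \<le> 2 * t * q + t\<^sup>2 * r" for t :: real
    proof -
      have W: "(\<lambda>k x. g k x + of_real t * h k x) \<in> W" by (rule add[OF gW cmult[OF h]])
      have "d\<^sup>2 \<le> (D (\<lambda>k x. g k x + of_real t * h k x))\<^sup>2" by (rule power_mono[OF d_le[OF W] d0])
      also have "D (\<lambda>k x. g k x + of_real t * h k x) = ?N (\<lambda>k x. p k x + of_real t * h k x)"
        unfolding D_def p_def by (simp add: algebra_simps)
      also have "(\<dots>)\<^sup>2 = (?N p)\<^sup>2 + 2 * Re (prod_inner n M p (\<lambda>k x. of_real t * h k x)) + (?N (\<lambda>k x. of_real t * h k x))\<^sup>2"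
        by (rule prod_L2_norm_add_power2[OF p prod_L2_cmult[OF hL]])
      also have "\<dots> = (?N p)\<^sup>2 + 2 * t * q + t\<^sup>2 * r"
        unfolding prod_inner_cmult_right prod_L2_norm_cmult by (simp add: q_def r_def power_mult_distrib)
      also have "?N p = d" using Dg by (simp add: D_def p_def[abs_def])
      finally show ?thesis by simp
    qed
    have "r \<ge> 0" by (simp add: r_def)
    show ?thesis
    proof (rule ccontr)
      assume "Re (prod_inner n M p h) \<noteq> 0"
      then have q0: "q \<noteq> 0" by (simp add: q_def)
      \<comment> \<open>A value of t near the minimizer - q / r; the added 1 also covers h of norm
        zero. A nonzero q would make the expression negative.\<close>
      have "0 \<le> 2 * (- q / (r + 1)) * q + (- q / (r + 1))\<^sup>2 * r" by (rule ineq)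
      also have "\<dots> = q\<^sup>2 / (r + 1)\<^sup>2 * (r - 2 * (r + 1))"
      proof -
        have "2 * (- q / R) * q + (- q / R)\<^sup>2 * r = q\<^sup>2 / R\<^sup>2 * (r - 2 * R)" if "R \<noteq> 0" for R
          using that by (simp add: field_simps power2_eq_square)
        then show ?thesis using \<open>r \<ge> 0\<close> by (metis add_nonneg_pos less_irrefl zero_less_one)
      qed
      also have "\<dots> < 0" using q0 \<open>r \<ge> 0\<close> by (intro mult_pos_neg) auto
      finally show False by simp
    qed
  qed
  have "prod_inner n M p h = 0" if h: "h \<in> W" for h
  proof (rule complex_eqI)
    show "Re (prod_inner n M p h) = Re 0" using re[OF h] by simp
    have "Re (prod_inner n M p (\<lambda>k x. \<i> * h k x)) = 0" by (rule re[OF cmult[OF h]])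
    then show "Im (prod_inner n M p h) = Im 0" unfolding prod_inner_cmult_right by simp
  qed
  moreover have "prod_inner n M (\<lambda>k x. G k x - g k x) h = - prod_inner n M p h" for h
    using prod_inner_cmult_left[of n M "-1" p h] by (simp add: p_def)
  ultimately have "\<forall>h\<in>W. prod_inner n M (\<lambda>k x. G k x - g k x) h = 0" by simp
  then show ?thesis using gW by (rule rev_bexI[rotated])
qed

section \<open>The extension of the transform\<close>

context star_network
begin

abbreviation normS :: "(nat \<Rightarrow> real \<Rightarrow> complex) \<Rightarrow> real" where
  "normS \<equiv> prod_L2_norm n (sigma_measure n c a)"

abbreviation normH :: "(nat \<Rightarrow> real \<Rightarrow> complex) \<Rightarrow> real" where
  "normH \<equiv> prod_L2_norm n (\<lambda>k. branch)"

lemma norm_exp_Xi_le: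
  assumes "m \<in> {1..n}" "x \<ge> 0"
  shows "cmod (exp (- \<i> * xi c a m (of_real \<mu>) * of_real x)) \<le> 1"
proof -
  have "Im (xi c a m (of_real \<mu>)) \<le> 0"
    using xi_real_pos(1)[OF assms(1)] xi_real_neg[OF assms(1)] c_pos[OF assms(1)] by (cases "a m < \<mu>") auto
  then show ?thesis using assms(2) by (simp add: mult_nonpos_nonneg)
qed

text \<open>On branch k the root is real because a k < \<mu>, so the sine is bounded; the
  exponentials do not grow on any branch. The bound depends on \<mu>, which suffices for statements
  at fixed \<mu>.\<close>

lemma F_minus_bounded:
  assumes k: "k \<in> {1..n}" and m: "m \<in> {1..n}" and "a k < \<mu>"
  shows "\<exists>C. \<forall>x\<ge>0. cmod (F_minus n c a (of_real \<mu>) k m x) \<le> C"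
proof -
  have nz: "xi c a k (of_real \<mu>) \<noteq> 0" using xi_real_pos[OF k assms(3)] by (metis less_irrefl of_real_eq_0_iff)
  define d where "d = \<i> * (\<Sum>l\<in>{1..n}. of_real (c l) * xi c a l (of_real \<mu>)) / (of_real (c k) * xi c a k (of_real \<mu>))"
  have "cmod (F_minus n c a (of_real \<mu>) k m x) \<le> 1 + cmod d" if x: "x \<ge> 0" for x
  proof -
    have "cmod (sin (xi c a k (of_real \<mu>) * of_real x)) \<le> 1"
      unfolding xi_real_pos(1)[OF k assms(3)] using norm_sin_le_exp[of "of_real (sqrt ((\<mu> - a k) / c k)) * of_real x"] by simp
    then have "cmod (d * sin (xi c a k (of_real \<mu>) * of_real x)) \<le> cmod d"
      unfolding norm_mult by (intro mult_left_le) auto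
    then have "cmod (exp (- \<i> * xi c a m (of_real \<mu>) * of_real x) + (if m = k then d * sin (xi c a k (of_real \<mu>) * of_real x) else 0)) \<le> 1 + cmod d"
      using norm_exp_Xi_le[OF m x, of \<mu>] by (intro norm_triangle_mono) auto
    then show ?thesis unfolding F_minus_eq[OF nz k] d_def .
  qed
  then show ?thesis by blast
qed

lemma continuous_F_minus: "continuous_on S (F_minus n c a z k m)"
  unfolding F_minus_def by (cases "m = k") (auto intro!: continuous_intros)

lemma V_test_integrable:
  assumes "k \<in> {1..n}" "m \<in> {1..n}" "a k < \<mu>" "f \<in> L12"
  shows "integrable branch (\<lambda>x. f x * cnj (F_minus n c a (of_real \<mu>) k m x))"
proof -
  obtain C where C: "\<And>x. x \<ge> 0 \<Longrightarrow> cmod (F_minus n c a (of_real \<mu>) k m x) \<le> C"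
    using F_minus_bounded[OF assms(1-3)] by blast
  have m: "(\<lambda>x. cnj (F_minus n c a (of_real \<mu>) k m x)) \<in> borel_measurable branch"
    by (intro borel_measurable_branch borel_measurable_continuous_onI continuous_intros continuous_F_minus)
  show ?thesis
  proof (rule Bochner_Integration.integrable_bound)
    show "integrable branch (\<lambda>x. of_real C * f x)" using L12_integrable[OF assms(4)] by simp
    show "AE x in branch. norm (f x * cnj (F_minus n c a (of_real \<mu>) k m x)) \<le> norm (of_real C * f x)"
    proof (rule AE_branchI)
      fix x :: real assume "x > 0"
      then have "cmod (F_minus n c a (of_real \<mu>) k m x) \<le> \<bar>C\<bar>" using C[of x] by linarith
      then show "norm (f x * cnj (F_minus n c a (of_real \<mu>) k m x)) \<le> norm (of_real C * f x)"
        using mult_left_mono[of _ "\<bar>C\<bar>" "cmod (f x)"] by (simp add: norm_mult mult.commute[of "\<bar>C\<bar>"])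
    qed
  qed (use m L12_integrable[OF assms(4)] in auto)
qed

definition L12_tuples :: "(nat \<Rightarrow> real \<Rightarrow> complex) set" where
  "L12_tuples = {f. \<forall>k\<in>{1..n}. f k \<in> L12}"

lemma test_tuples_L12_tuples: "\<phi> \<in> test_tuples n \<Longrightarrow> \<phi> \<in> L12_tuples"
  by (simp add: test_tuples_def L12_tuples_def test_functions_L12)

lemma L12_tuples_H: "f \<in> L12_tuples \<Longrightarrow> f \<in> H n"
  by (simp add: L12_tuples_def H_def prod_L2_def L12_L2)

lemmas test_tuples_H = test_tuples_L12_tuples[THEN L12_tuples_H]

lemma V_test_add:
  assumes "f \<in> L12_tuples" "g \<in> L12_tuples" "k \<in> {1..n}" "a k < \<mu>"
  shows "V_test n c a (\<lambda>m x. f m x + g m x) k \<mu> = V_test n c a f k \<mu> + V_test n c a g k \<mu>"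
  unfolding V_test_def sum.distrib[symmetric] using assms
  by (intro sum.cong refl) (auto simp: distrib_right L12_tuples_def intro!: Bochner_Integration.integral_add V_test_integrable)

lemma V_test_cmult:
  "V_test n c a (\<lambda>m x. z * f m x) k \<mu> = z * V_test n c a f k \<mu>"
  by (simp add: V_test_def sum_distrib_left mult.assoc)

lemma V_test_diff:
  assumes "f \<in> L12_tuples" "g \<in> L12_tuples" "k \<in> {1..n}" "a k < \<mu>"
  shows "V_test n c a (\<lambda>m x. f m x - g m x) k \<mu> = V_test n c a f k \<mu> - V_test n c a g k \<mu>"
proof -
  have "(\<lambda>m x. -1 * g m x) \<in> L12_tuples" using assms(2) L12_cmult[of _ "-1"] unfolding L12_tuples_def by blast
  from V_test_add[OF assms(1) this assms(3,4)] show ?thesis unfolding V_test_cmult by simp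
qed

lemma test_tuples_add: "\<phi> \<in> test_tuples n \<Longrightarrow> \<psi> \<in> test_tuples n \<Longrightarrow> (\<lambda>k x. \<phi> k x + \<psi> k x) \<in> test_tuples n"
  by (simp add: test_tuples_def test_functions_add)

lemma test_tuples_cmult: "\<phi> \<in> test_tuples n \<Longrightarrow> (\<lambda>k x. z * \<phi> k x) \<in> test_tuples n"
  by (simp add: test_tuples_def test_functions_cmult)

lemma test_tuples_diff: "\<phi> \<in> test_tuples n \<Longrightarrow> \<psi> \<in> test_tuples n \<Longrightarrow> (\<lambda>k x. \<phi> k x - \<psi> k x) \<in> test_tuples n"
  using test_tuples_add[OF _ test_tuples_cmult, of \<phi> \<psi> "-1"] by simp

lemma V_test_dist:
  assumes "\<phi> \<in> test_tuples n" "\<psi> \<in> test_tuples n"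
  shows "normS (\<lambda>k \<mu>. V_test n c a \<phi> k \<mu> - V_test n c a \<psi> k \<mu>) = normH (\<lambda>k x. \<phi> k x - \<psi> k x)"
proof -
  have "normS (\<lambda>k \<mu>. V_test n c a \<phi> k \<mu> - V_test n c a \<psi> k \<mu>) = normS (V_test n c a (\<lambda>k x. \<phi> k x - \<psi> k x))"
  proof (rule prod_L2_norm_cong_AE)
    show "AE \<mu> in sigma_measure n c a k. V_test n c a \<phi> k \<mu> - V_test n c a \<psi> k \<mu> = V_test n c a (\<lambda>k x. \<phi> k x - \<psi> k x) k \<mu>"
      if "k \<in> {1..n}" for k
      by (intro AE_sigma_measureI V_test_diff[symmetric] test_tuples_L12_tuples assms that)
  qed (use V_test_isometric(1)[OF assms(1)] V_test_isometric(1)[OF assms(2)] V_test_isometric(1)[OF test_tuples_diff[OF assms]]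
        in \<open>auto simp: L2_sigma_def intro: prod_L2_diff\<close>)
  then show ?thesis by (simp add: V_test_isometric(2)[OF test_tuples_diff[OF assms]])
qed

lemma H_test_sequence:
  assumes "u \<in> H n"
  obtains \<phi> where "\<And>i::nat. \<phi> i \<in> test_tuples n" "(\<lambda>i. normH (\<lambda>k x. \<phi> i k x - u k x)) \<longlonglongrightarrow> 0"
proof -
  have "\<forall>k\<in>{1..n}. \<exists>\<phi>. (\<forall>i::nat. \<phi> i \<in> test_functions) \<and> (\<lambda>i. l2norm branch (\<lambda>x. \<phi> i x - u k x)) \<longlonglongrightarrow> 0"
  proof
    fix k assume "k \<in> {1..n}"
    then have uk: "u k \<in> L2 branch" using assms by (simp add: H_def prod_L2_def)
    obtain \<phi> where "\<And>i::nat. \<phi> i \<in> test_functions" "(\<lambda>i. l2norm branch (\<lambda>x. \<phi> i x - u k x)) \<longlonglongrightarrow> 0"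
      by (rule L2_test_sequence[OF uk], rule that)
    then show "\<exists>\<phi>. (\<forall>i::nat. \<phi> i \<in> test_functions) \<and> (\<lambda>i. l2norm branch (\<lambda>x. \<phi> i x - u k x)) \<longlonglongrightarrow> 0" by blast
  qed
  from bchoice[OF this] obtain \<phi> where \<phi>: "\<And>k i. k \<in> {1..n} \<Longrightarrow> \<phi> k (i::nat) \<in> test_functions"
      "\<And>k. k \<in> {1..n} \<Longrightarrow> (\<lambda>i. l2norm branch (\<lambda>x. \<phi> k i x - u k x)) \<longlonglongrightarrow> 0" by blast
  show ?thesis
  proof (rule that[of "\<lambda>i k. \<phi> k i"])
    show "(\<lambda>i. normH (\<lambda>k x. \<phi> k i x - u k x)) \<longlonglongrightarrow> 0"
      unfolding prod_L2_norm_tendsto_0_iff using \<phi>(2) by simp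
  qed (use \<phi>(1) in \<open>auto simp: test_tuples_def\<close>)
qed

text \<open>The isometry carries the Cauchy property of an approximating sequence of test tuples
  over to their transforms, and the weighted space is complete. Only this makes the choice in
  \<open>V\<close> meaningful.\<close>

lemma V_ex:
  assumes "u \<in> H n"
  shows "\<exists>G. G \<in> L2_sigma n c a \<and> (\<exists>\<phi> :: nat \<Rightarrow> nat \<Rightarrow> real \<Rightarrow> complex.
        (\<forall>i. \<forall>k\<in>{1..n}. \<phi> i k \<in> test_functions) \<and> (\<lambda>i. normH (\<lambda>k x. \<phi> i k x - u k x)) \<longlonglongrightarrow> 0 \<and>
        (\<lambda>i. normS (\<lambda>k \<mu>. V_test n c a (\<phi> i) k \<mu> - G k \<mu>)) \<longlonglongrightarrow> 0)"
proof -
  obtain \<phi> where \<phi>: "\<And>i::nat. \<phi> i \<in> test_tuples n" "(\<lambda>i. normH (\<lambda>k x. \<phi> i k x - u k x)) \<longlonglongrightarrow> 0"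
    by (rule H_test_sequence[OF assms], rule that)
  have "\<exists>G\<in>prod_L2 n (sigma_measure n c a). (\<lambda>i. normS (\<lambda>k \<mu>. V_test n c a (\<phi> i) k \<mu> - G k \<mu>)) \<longlonglongrightarrow> 0"
  proof (rule prod_L2_complete)
    show "V_test n c a (\<phi> i) \<in> prod_L2 n (sigma_measure n c a)" for i
      using V_test_isometric(1)[OF \<phi>(1)] by (simp add: L2_sigma_def)
    show "\<exists>N. \<forall>i\<ge>N. \<forall>j\<ge>N. normS (\<lambda>k \<mu>. V_test n c a (\<phi> i) k \<mu> - V_test n c a (\<phi> j) k \<mu>) < e" if "e > 0" for e
      unfolding V_test_dist[OF \<phi>(1) \<phi>(1)]
      by (rule prod_L2_norm_tendsto_Cauchy[OF _ _ \<phi>(2) that]) (use test_tuples_H[OF \<phi>(1)] assms in \<open>auto simp: H_def\<close>)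
  qed
  then show ?thesis using \<phi> by (auto simp: L2_sigma_def test_tuples_def)
qed

lemma V_in_L2_sigma: "u \<in> H n \<Longrightarrow> V n c a u \<in> prod_L2 n (sigma_measure n c a)"
  and V_sequence: "u \<in> H n \<Longrightarrow> \<exists>\<phi>. (\<forall>i::nat. \<phi> i \<in> test_tuples n) \<and> (\<lambda>i. normH (\<lambda>k x. \<phi> i k x - u k x)) \<longlonglongrightarrow> 0 \<and>
        (\<lambda>i. normS (\<lambda>k \<mu>. V_test n c a (\<phi> i) k \<mu> - V n c a u k \<mu>)) \<longlonglongrightarrow> 0"
  using someI_ex[OF V_ex] unfolding V_def L2_sigma_def test_tuples_def by auto

text \<open>The choices behind two values of \<open>V\<close> rest on unrelated sequences; the
  isometry is applied to the differences of their members and passes to the limit. In particular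
  \<open>V\<close> respects equality almost everywhere.\<close>

lemma V_dist:
  assumes "u \<in> H n" "v \<in> H n"
  shows "normS (\<lambda>k \<mu>. V n c a u k \<mu> - V n c a v k \<mu>) = normH (\<lambda>k x. u k x - v k x)"
proof -
  obtain \<phi> where \<phi>: "\<And>i::nat. \<phi> i \<in> test_tuples n" "(\<lambda>i. normH (\<lambda>k x. \<phi> i k x - u k x)) \<longlonglongrightarrow> 0"
      "(\<lambda>i. normS (\<lambda>k \<mu>. V_test n c a (\<phi> i) k \<mu> - V n c a u k \<mu>)) \<longlonglongrightarrow> 0" using V_sequence[OF assms(1)] by blast
  obtain \<psi> where \<psi>: "\<And>i::nat. \<psi> i \<in> test_tuples n" "(\<lambda>i. normH (\<lambda>k x. \<psi> i k x - v k x)) \<longlonglongrightarrow> 0"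
      "(\<lambda>i. normS (\<lambda>k \<mu>. V_test n c a (\<psi> i) k \<mu> - V n c a v k \<mu>)) \<longlonglongrightarrow> 0" using V_sequence[OF assms(2)] by blast
  \<comment> \<open>Joint continuity of the distance, stated for arbitrary measures because it is
    used in both spaces.\<close>
  have aux: "(\<lambda>i. prod_L2_norm n M (\<lambda>k x. F i k x - G i k x)) \<longlonglongrightarrow> prod_L2_norm n M (\<lambda>k x. f k x - g k x)"
    if "\<And>i::nat. F i \<in> prod_L2 n M" "\<And>i. G i \<in> prod_L2 n M" "f \<in> prod_L2 n M" "g \<in> prod_L2 n M"
      "(\<lambda>i. prod_L2_norm n M (\<lambda>k x. F i k x - f k x)) \<longlonglongrightarrow> 0" "(\<lambda>i. prod_L2_norm n M (\<lambda>k x. G i k x - g k x)) \<longlonglongrightarrow> 0" for F G f g M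
  proof -
    have "(\<lambda>i. prod_L2_norm n M (\<lambda>k x. F i k x - G i k x) - prod_L2_norm n M (\<lambda>k x. f k x - g k x)) \<longlonglongrightarrow> 0"
    proof (rule Lim_null_comparison)
      show "(\<lambda>i. prod_L2_norm n M (\<lambda>k x. F i k x - f k x) + prod_L2_norm n M (\<lambda>k x. G i k x - g k x)) \<longlonglongrightarrow> 0"
        using tendsto_add[OF that(5,6)] by simp
      have "\<bar>prod_L2_norm n M (\<lambda>k x. F i k x - G i k x) - prod_L2_norm n M (\<lambda>k x. f k x - g k x)\<bar>
          \<le> prod_L2_norm n M (\<lambda>k x. F i k x - f k x) + prod_L2_norm n M (\<lambda>k x. G i k x - g k x)" for i
      proof -
        have "\<bar>prod_L2_norm n M (\<lambda>k x. F i k x - G i k x) - prod_L2_norm n M (\<lambda>k x. f k x - g k x)\<bar>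
            \<le> prod_L2_norm n M (\<lambda>k x. (F i k x - G i k x) - (f k x - g k x))"
          by (rule prod_L2_norm_abs_diff_le) (intro prod_L2_diff that)+
        also have "(\<lambda>k x. (F i k x - G i k x) - (f k x - g k x)) = (\<lambda>k x. (F i k x - f k x) + (g k x - G i k x))"
          by (simp add: fun_eq_iff)
        also have "prod_L2_norm n M \<dots> \<le> prod_L2_norm n M (\<lambda>k x. F i k x - f k x) + prod_L2_norm n M (\<lambda>k x. g k x - G i k x)"
          by (rule prod_L2_norm_triangle) (intro prod_L2_diff that)+
        finally show ?thesis by (simp add: prod_L2_norm_minus_commute[of n M g])
      qed
      then show "\<forall>\<^sub>F i in sequentially. norm (prod_L2_norm n M (\<lambda>k x. F i k x - G i k x) - prod_L2_norm n M (\<lambda>k x. f k x - g k x))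
          \<le> prod_L2_norm n M (\<lambda>k x. F i k x - f k x) + prod_L2_norm n M (\<lambda>k x. G i k x - g k x)" by simp
    qed
    then show ?thesis by (simp add: LIM_zero_iff)
  qed
  have VL: "V_test n c a \<phi> \<in> prod_L2 n (sigma_measure n c a)" if "\<phi> \<in> test_tuples n" for \<phi>
    using V_test_isometric(1)[OF that] by (simp add: L2_sigma_def)
  have HL: "f \<in> prod_L2 n (\<lambda>k. branch)" if "f \<in> H n" for f using that by (simp add: H_def)
  have "(\<lambda>i. normS (\<lambda>k \<mu>. V_test n c a (\<phi> i) k \<mu> - V_test n c a (\<psi> i) k \<mu>)) \<longlonglongrightarrow> normS (\<lambda>k \<mu>. V n c a u k \<mu> - V n c a v k \<mu>)"
    by (rule aux[OF VL[OF \<phi>(1)] VL[OF \<psi>(1)] V_in_L2_sigma[OF assms(1)] V_in_L2_sigma[OF assms(2)] \<phi>(3) \<psi>(3)])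
  moreover have "(\<lambda>i. normH (\<lambda>k \<mu>. \<phi> i k \<mu> - \<psi> i k \<mu>)) \<longlonglongrightarrow> normH (\<lambda>k \<mu>. u k \<mu> - v k \<mu>)"
    by (rule aux[OF HL[OF test_tuples_H[OF \<phi>(1)]] HL[OF test_tuples_H[OF \<psi>(1)]] HL[OF assms(1)] HL[OF assms(2)] \<phi>(2) \<psi>(2)])
  ultimately show ?thesis unfolding V_test_dist[OF \<phi>(1) \<psi>(1)] by (rule LIMSEQ_unique)
qed

lemma AE_eq_of_normS_eq_0:
  assumes "F \<in> prod_L2 n (sigma_measure n c a)" "G \<in> prod_L2 n (sigma_measure n c a)"
    "normS (\<lambda>k \<mu>. F k \<mu> - G k \<mu>) = 0" "k \<in> {1..n}"
  shows "AE \<mu> in sigma_measure n c a k. F k \<mu> = G k \<mu>"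
  using prod_L2_norm_eq_0_imp_AE[OF prod_L2_diff[OF assms(1,2)] assms(3,4)] by simp

text \<open>\<open>V\<close> preserves distances, so a limit of transforms can only be the transform
  of the limit. This is the tool for identifying values of \<open>V\<close>: linearity and the
  closedness of its range rest on it.\<close>

lemma V_unique_limit:
  assumes "\<And>i::nat. u i \<in> H n" "v \<in> H n" "(\<lambda>i. normH (\<lambda>k x. u i k x - v k x)) \<longlonglongrightarrow> 0"
    "G \<in> prod_L2 n (sigma_measure n c a)" "(\<lambda>i. normS (\<lambda>k \<mu>. V n c a (u i) k \<mu> - G k \<mu>)) \<longlonglongrightarrow> 0" "k \<in> {1..n}"
  shows "AE \<mu> in sigma_measure n c a k. V n c a v k \<mu> = G k \<mu>"
proof (rule AE_eq_of_normS_eq_0[OF V_in_L2_sigma[OF assms(2)] assms(4) _ assms(6)])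
  have "normS (\<lambda>k \<mu>. V n c a v k \<mu> - G k \<mu>) \<le> 0"
  proof (rule tendsto_lowerbound)
    show "(\<lambda>i. normH (\<lambda>k x. u i k x - v k x) + normS (\<lambda>k \<mu>. V n c a (u i) k \<mu> - G k \<mu>)) \<longlonglongrightarrow> 0"
      using tendsto_add[OF assms(3,5)] by simp
    have "normS (\<lambda>k \<mu>. V n c a v k \<mu> - G k \<mu>) \<le> normS (\<lambda>k \<mu>. V n c a v k \<mu> - V n c a (u i) k \<mu>) + normS (\<lambda>k \<mu>. V n c a (u i) k \<mu> - G k \<mu>)" for i
      by (rule prod_L2_norm_triangle_diff) (intro V_in_L2_sigma assms)+
    then show "\<forall>\<^sub>F i in sequentially. normS (\<lambda>k \<mu>. V n c a v k \<mu> - G k \<mu>) \<le> normH (\<lambda>k x. u i k x - v k x) + normS (\<lambda>k \<mu>. V n c a (u i) k \<mu> - G k \<mu>)"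
      by (simp add: V_dist assms prod_L2_norm_minus_commute[of _ _ v])
  qed simp
  then show "normS (\<lambda>k \<mu>. V n c a v k \<mu> - G k \<mu>) = 0" using prod_L2_norm_nonneg by (metis order_antisym)
qed

text \<open>The sequence hidden in \<open>V\<close> is compared with \<phi> itself: by the isometry
  the distance of their transforms is the distance in H, which tends to zero.\<close>

lemma V_eq_V_test_on_test_tuples:
  assumes "\<phi> \<in> test_tuples n" "k \<in> {1..n}"
  shows "AE \<mu> in sigma_measure n c a k. V n c a \<phi> k \<mu> = V_test n c a \<phi> k \<mu>"
proof -
  obtain \<psi> where \<psi>: "\<And>i::nat. \<psi> i \<in> test_tuples n" "(\<lambda>i. normH (\<lambda>k x. \<psi> i k x - \<phi> k x)) \<longlonglongrightarrow> 0"
      "(\<lambda>i. normS (\<lambda>k \<mu>. V_test n c a (\<psi> i) k \<mu> - V n c a \<phi> k \<mu>)) \<longlonglongrightarrow> 0" using V_sequence[OF test_tuples_H[OF assms(1)]] by blast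
  have VL: "V_test n c a \<phi> \<in> prod_L2 n (sigma_measure n c a)" if "\<phi> \<in> test_tuples n" for \<phi>
    using V_test_isometric(1)[OF that] by (simp add: L2_sigma_def)
  have "normS (\<lambda>k \<mu>. V n c a \<phi> k \<mu> - V_test n c a \<phi> k \<mu>) \<le> 0"
  proof (rule tendsto_lowerbound)
    show "(\<lambda>i. normS (\<lambda>k \<mu>. V_test n c a (\<psi> i) k \<mu> - V n c a \<phi> k \<mu>) + normH (\<lambda>k x. \<psi> i k x - \<phi> k x)) \<longlonglongrightarrow> 0"
      using tendsto_add[OF \<psi>(3,2)] by simp
    have "normS (\<lambda>k \<mu>. V n c a \<phi> k \<mu> - V_test n c a \<phi> k \<mu>) \<le> normS (\<lambda>k \<mu>. V n c a \<phi> k \<mu> - V_test n c a (\<psi> i) k \<mu>)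
        + normS (\<lambda>k \<mu>. V_test n c a (\<psi> i) k \<mu> - V_test n c a \<phi> k \<mu>)" for i
      by (rule prod_L2_norm_triangle_diff) (intro V_in_L2_sigma VL \<psi> assms test_tuples_H)+
    then show "\<forall>\<^sub>F i in sequentially. normS (\<lambda>k \<mu>. V n c a \<phi> k \<mu> - V_test n c a \<phi> k \<mu>)
        \<le> normS (\<lambda>k \<mu>. V_test n c a (\<psi> i) k \<mu> - V n c a \<phi> k \<mu>) + normH (\<lambda>k x. \<psi> i k x - \<phi> k x)"
      by (simp add: V_test_dist \<psi> assms prod_L2_norm_minus_commute[of _ _ "V n c a \<phi>"])
  qed simp
  then have "normS (\<lambda>k \<mu>. V n c a \<phi> k \<mu> - V_test n c a \<phi> k \<mu>) = 0" using prod_L2_norm_nonneg by (metis order_antisym)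
  then show ?thesis by (rule AE_eq_of_normS_eq_0[OF V_in_L2_sigma[OF test_tuples_H[OF assms(1)]] VL[OF assms(1)] _ assms(2)])
qed

lemma HD: "u \<in> H n \<Longrightarrow> u \<in> prod_L2 n (\<lambda>k. branch)"
  by (simp add: H_def)

lemma H_add: "u \<in> H n \<Longrightarrow> v \<in> H n \<Longrightarrow> (\<lambda>k x. u k x + v k x) \<in> H n"
  unfolding H_def by (rule prod_L2_add)

lemma H_cmult: "u \<in> H n \<Longrightarrow> (\<lambda>k x. z * u k x) \<in> H n"
  unfolding H_def by (rule prod_L2_cmult)

lemma V_test_in_L2: "\<phi> \<in> test_tuples n \<Longrightarrow> V_test n c a \<phi> \<in> prod_L2 n (sigma_measure n c a)"
  using V_test_isometric(1) by (simp add: L2_sigma_def)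

text \<open>The transform of a sum is a choice of its own, so additivity holds only almost
  everywhere. It follows from adding approximating sequences, on which \<open>V\<close> agrees with
  the additive \<open>V_test\<close>.\<close>

lemma V_add:
  assumes u: "u \<in> H n" and v: "v \<in> H n" and k: "k \<in> {1..n}"
  shows "AE \<mu> in sigma_measure n c a k. V n c a (\<lambda>k x. u k x + v k x) k \<mu> = V n c a u k \<mu> + V n c a v k \<mu>"
proof -
  obtain \<phi> where \<phi>: "\<And>i::nat. \<phi> i \<in> test_tuples n" "(\<lambda>i. normH (\<lambda>k x. \<phi> i k x - u k x)) \<longlonglongrightarrow> 0"
      "(\<lambda>i. normS (\<lambda>k \<mu>. V_test n c a (\<phi> i) k \<mu> - V n c a u k \<mu>)) \<longlonglongrightarrow> 0" using V_sequence[OF u] by blast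
  obtain \<psi> where \<psi>: "\<And>i::nat. \<psi> i \<in> test_tuples n" "(\<lambda>i. normH (\<lambda>k x. \<psi> i k x - v k x)) \<longlonglongrightarrow> 0"
      "(\<lambda>i. normS (\<lambda>k \<mu>. V_test n c a (\<psi> i) k \<mu> - V n c a v k \<mu>)) \<longlonglongrightarrow> 0" using V_sequence[OF v] by blast
  define \<theta> where "\<theta> i k x = \<phi> i k x + \<psi> i k x" for i k x
  have \<theta>: "\<theta> i \<in> test_tuples n" for i unfolding \<theta>_def[abs_def] by (intro test_tuples_add \<phi> \<psi>)
  have split: "prod_L2_norm n M (\<lambda>k x. (F k x + G k x) - (f k x + g k x)) \<le> prod_L2_norm n M (\<lambda>k x. F k x - f k x) + prod_L2_norm n M (\<lambda>k x. G k x - g k x)"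
    if "F \<in> prod_L2 n M" "G \<in> prod_L2 n M" "f \<in> prod_L2 n M" "g \<in> prod_L2 n M" for F G f g M
  proof -
    have "(\<lambda>k x. (F k x + G k x) - (f k x + g k x)) = (\<lambda>k x. (F k x - f k x) + (G k x - g k x))" by (simp add: fun_eq_iff)
    then show ?thesis using prod_L2_norm_triangle[OF prod_L2_diff[OF that(1,3)] prod_L2_diff[OF that(2,4)]] by simp
  qed
  show ?thesis
  proof (rule V_unique_limit[OF test_tuples_H[OF \<theta>] H_add[OF u v] _ _ _ k])
    show "(\<lambda>k \<mu>. V n c a u k \<mu> + V n c a v k \<mu>) \<in> prod_L2 n (sigma_measure n c a)"
      by (intro prod_L2_add V_in_L2_sigma u v)
    show "(\<lambda>i. normH (\<lambda>k x. \<theta> i k x - (u k x + v k x))) \<longlonglongrightarrow> 0"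
    proof (rule tendsto_sandwich[OF always_eventually always_eventually tendsto_const])
      show "(\<lambda>i. normH (\<lambda>k x. \<phi> i k x - u k x) + normH (\<lambda>k x. \<psi> i k x - v k x)) \<longlonglongrightarrow> 0" using tendsto_add[OF \<phi>(2) \<psi>(2)] by simp
      show "\<forall>i. normH (\<lambda>k x. \<theta> i k x - (u k x + v k x)) \<le> normH (\<lambda>k x. \<phi> i k x - u k x) + normH (\<lambda>k x. \<psi> i k x - v k x)"
        unfolding \<theta>_def by (intro allI split HD test_tuples_H \<phi> \<psi> u v)
    qed simp
    show "(\<lambda>i. normS (\<lambda>k \<mu>. V n c a (\<theta> i) k \<mu> - (V n c a u k \<mu> + V n c a v k \<mu>))) \<longlonglongrightarrow> 0"
    proof (rule tendsto_sandwich[OF always_eventually always_eventually tendsto_const])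
      show "(\<lambda>i. normS (\<lambda>k \<mu>. V_test n c a (\<phi> i) k \<mu> - V n c a u k \<mu>) + normS (\<lambda>k \<mu>. V_test n c a (\<psi> i) k \<mu> - V n c a v k \<mu>)) \<longlonglongrightarrow> 0"
        using tendsto_add[OF \<phi>(3) \<psi>(3)] by simp
      show "\<forall>i. normS (\<lambda>k \<mu>. V n c a (\<theta> i) k \<mu> - (V n c a u k \<mu> + V n c a v k \<mu>))
        \<le> normS (\<lambda>k \<mu>. V_test n c a (\<phi> i) k \<mu> - V n c a u k \<mu>) + normS (\<lambda>k \<mu>. V_test n c a (\<psi> i) k \<mu> - V n c a v k \<mu>)"
      proof
        fix i
        have "normS (\<lambda>k \<mu>. V n c a (\<theta> i) k \<mu> - (V n c a u k \<mu> + V n c a v k \<mu>))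
            = normS (\<lambda>k \<mu>. (V_test n c a (\<phi> i) k \<mu> + V_test n c a (\<psi> i) k \<mu>) - (V n c a u k \<mu> + V n c a v k \<mu>))"
        proof (rule prod_L2_norm_cong_AE)
          fix k assume k: "k \<in> {1..n}"
          have "AE \<mu> in sigma_measure n c a k. V_test n c a (\<theta> i) k \<mu> = V_test n c a (\<phi> i) k \<mu> + V_test n c a (\<psi> i) k \<mu>"
            unfolding \<theta>_def[abs_def] by (intro AE_sigma_measureI V_test_add test_tuples_L12_tuples \<phi> \<psi> k)
          then show "AE \<mu> in sigma_measure n c a k. V n c a (\<theta> i) k \<mu> - (V n c a u k \<mu> + V n c a v k \<mu>)
             = (V_test n c a (\<phi> i) k \<mu> + V_test n c a (\<psi> i) k \<mu>) - (V n c a u k \<mu> + V n c a v k \<mu>)"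
            using V_eq_V_test_on_test_tuples[OF \<theta> k, of i] by eventually_elim simp
        qed (intro prod_L2_diff prod_L2_add V_in_L2_sigma V_test_in_L2 test_tuples_H \<theta> \<phi> \<psi> u v)+
        then show "normS (\<lambda>k \<mu>. V n c a (\<theta> i) k \<mu> - (V n c a u k \<mu> + V n c a v k \<mu>))
          \<le> normS (\<lambda>k \<mu>. V_test n c a (\<phi> i) k \<mu> - V n c a u k \<mu>) + normS (\<lambda>k \<mu>. V_test n c a (\<psi> i) k \<mu> - V n c a v k \<mu>)"
          using split[OF V_test_in_L2[OF \<phi>(1)] V_test_in_L2[OF \<psi>(1)] V_in_L2_sigma[OF u] V_in_L2_sigma[OF v], of i i] by simp
      qed
    qed simp
  qed
qed

lemma V_cmult:
  assumes u: "u \<in> H n" and k: "k \<in> {1..n}"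
  shows "AE \<mu> in sigma_measure n c a k. V n c a (\<lambda>k x. z * u k x) k \<mu> = z * V n c a u k \<mu>"
proof -
  obtain \<phi> where \<phi>: "\<And>i::nat. \<phi> i \<in> test_tuples n" "(\<lambda>i. normH (\<lambda>k x. \<phi> i k x - u k x)) \<longlonglongrightarrow> 0"
      "(\<lambda>i. normS (\<lambda>k \<mu>. V_test n c a (\<phi> i) k \<mu> - V n c a u k \<mu>)) \<longlonglongrightarrow> 0" using V_sequence[OF u] by blast
  define \<theta> where "\<theta> i k x = z * \<phi> i k x" for i k x
  have \<theta>: "\<theta> i \<in> test_tuples n" for i unfolding \<theta>_def[abs_def] by (intro test_tuples_cmult \<phi>)
  have scale: "prod_L2_norm n M (\<lambda>k x. z * F k x - z * f k x) = cmod z * prod_L2_norm n M (\<lambda>k x. F k x - f k x)" for F f M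
    unfolding prod_L2_norm_cmult[symmetric] by (simp add: right_diff_distrib)
  show ?thesis
  proof (rule V_unique_limit[OF test_tuples_H[OF \<theta>] H_cmult[OF u] _ _ _ k])
    show "(\<lambda>k \<mu>. z * V n c a u k \<mu>) \<in> prod_L2 n (sigma_measure n c a)"
      by (intro prod_L2_cmult V_in_L2_sigma u)
    show "(\<lambda>i. normH (\<lambda>k x. \<theta> i k x - z * u k x)) \<longlonglongrightarrow> 0"
      unfolding \<theta>_def scale using tendsto_mult_left[OF \<phi>(2), of "cmod z"] by simp
    have "normS (\<lambda>k \<mu>. V n c a (\<theta> i) k \<mu> - z * V n c a u k \<mu>) = normS (\<lambda>k \<mu>. z * V_test n c a (\<phi> i) k \<mu> - z * V n c a u k \<mu>)" for i
    proof (rule prod_L2_norm_cong_AE)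
      fix k assume k: "k \<in> {1..n}"
      show "AE \<mu> in sigma_measure n c a k. V n c a (\<theta> i) k \<mu> - z * V n c a u k \<mu> = z * V_test n c a (\<phi> i) k \<mu> - z * V n c a u k \<mu>"
        using V_eq_V_test_on_test_tuples[OF \<theta> k, of i] by eventually_elim (simp add: \<theta>_def[abs_def] V_test_cmult)
    qed (intro prod_L2_diff prod_L2_cmult V_in_L2_sigma V_test_in_L2 test_tuples_H \<theta> \<phi> u)+
    then show "(\<lambda>i. normS (\<lambda>k \<mu>. V n c a (\<theta> i) k \<mu> - z * V n c a u k \<mu>)) \<longlonglongrightarrow> 0"
      unfolding scale using tendsto_mult_left[OF \<phi>(3), of "cmod z"] by simp
  qed
qed

lemma V_norm:
  assumes "u \<in> H n"
  shows "normS (V n c a u) = normH u"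
proof -
  have z: "(\<lambda>k x. 0) \<in> test_tuples n" by (simp add: test_tuples_def test_functions_zero)
  have "normS (\<lambda>k \<mu>. V n c a u k \<mu> - V n c a (\<lambda>k x. 0) k \<mu>) = normS (V n c a u)"
  proof (rule prod_L2_norm_cong_AE)
    fix k assume k: "k \<in> {1..n}"
    show "AE \<mu> in sigma_measure n c a k. V n c a u k \<mu> - V n c a (\<lambda>k x. 0) k \<mu> = V n c a u k \<mu>"
      using V_eq_V_test_on_test_tuples[OF z k] by eventually_elim (simp add: V_test_def)
  qed (intro prod_L2_diff V_in_L2_sigma assms test_tuples_H z)+
  then show ?thesis using V_dist[OF assms test_tuples_H[OF z]] by simp
qed

text \<open>Polarization: norms of sums determine the real part, and replacing v by \<i> v gives the
  imaginary part.\<close>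

lemma V_inner:
  assumes u: "u \<in> H n" and v: "v \<in> H n"
  shows "prod_inner n (sigma_measure n c a) (V n c a u) (V n c a v) = prod_inner n (\<lambda>k. branch) u v"
proof -
  have re: "Re (prod_inner n (sigma_measure n c a) (V n c a u) (V n c a v)) = Re (prod_inner n (\<lambda>k. branch) u v)" if v: "v \<in> H n" for v
  proof -
    have "normH (\<lambda>k x. u k x + v k x) = normS (V n c a (\<lambda>k x. u k x + v k x))" by (rule V_norm[OF H_add[OF u v], symmetric])
    also have "\<dots> = normS (\<lambda>k \<mu>. V n c a u k \<mu> + V n c a v k \<mu>)"
      by (rule prod_L2_norm_cong_AE) (intro V_in_L2_sigma H_add u v prod_L2_add V_add; assumption)+
    finally have "(normH (\<lambda>k x. u k x + v k x))\<^sup>2 = (normS (\<lambda>k \<mu>. V n c a u k \<mu> + V n c a v k \<mu>))\<^sup>2" by simp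
    then show ?thesis
      using prod_L2_norm_add_power2[OF HD[OF u] HD[OF v]] prod_L2_norm_add_power2[OF V_in_L2_sigma[OF u] V_in_L2_sigma[OF v]] V_norm[OF u] V_norm[OF v]
      by simp
  qed
  show ?thesis
  proof (rule complex_eqI)
    have iv: "(\<lambda>k x. \<i> * v k x) \<in> H n" by (rule H_cmult[OF v])
    have "prod_inner n (sigma_measure n c a) (V n c a u) (V n c a (\<lambda>k x. \<i> * v k x)) =
        prod_inner n (sigma_measure n c a) (V n c a u) (\<lambda>k \<mu>. \<i> * V n c a v k \<mu>)"
      by (rule prod_inner_cong_AE) (intro V_in_L2_sigma iv u v prod_L2_cmult V_cmult AE_I2 refl; assumption?)+
    then show "Im (prod_inner n (sigma_measure n c a) (V n c a u) (V n c a v)) = Im (prod_inner n (\<lambda>k. branch) u v)"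
      using re[OF iv] by (simp add: prod_inner_cmult_right)
  qed (rule re[OF v])
qed

text \<open>At fixed \<mu> the eigenfunction is bounded, so convergence in the L^1 norm alone gives
  convergence of the integrals.\<close>

lemma V_test_tendsto:
  assumes "\<And>i::nat. \<phi> i \<in> L12_tuples" "f \<in> L12_tuples" "\<And>m. m \<in> {1..n} \<Longrightarrow> (\<lambda>i. l1norm (\<lambda>x. \<phi> i m x - f m x)) \<longlonglongrightarrow> 0"
    and k: "k \<in> {1..n}" and "a k < \<mu>"
  shows "(\<lambda>i. V_test n c a (\<phi> i) k \<mu>) \<longlonglongrightarrow> V_test n c a f k \<mu>"
  unfolding V_test_def
proof (rule tendsto_sum)
  fix m assume m: "m \<in> {1..n}"
  obtain C where C: "\<And>x. x \<ge> 0 \<Longrightarrow> cmod (F_minus n c a (of_real \<mu>) k m x) \<le> C" using F_minus_bounded[OF k m assms(5)] by blast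
  have L: "\<phi> i m \<in> L12" "f m \<in> L12" for i using assms(1)[of i] assms(2) m by (auto simp: L12_tuples_def)
  note int = V_test_integrable[OF k m assms(5)]
  let ?I = "\<lambda>g. \<integral>x. g x * cnj (F_minus n c a (of_real \<mu>) k m x) \<partial>branch"
  have "cmod (?I (\<phi> i m) - ?I (f m)) \<le> C * l1norm (\<lambda>x. \<phi> i m x - f m x)" for i
  proof -
    have "?I (\<phi> i m) - ?I (f m) = ?I (\<lambda>x. \<phi> i m x - f m x)"
      using int[OF L(1)] int[OF L(2)] by (simp add: left_diff_distrib)
    also have "cmod \<dots> \<le> (\<integral>x. C * cmod (\<phi> i m x - f m x) \<partial>branch)"
    proof (rule Bochner_Integration.integral_norm_bound_integral)
      show "integrable branch (\<lambda>x. (\<phi> i m x - f m x) * cnj (F_minus n c a (of_real \<mu>) k m x))" by (rule int[OF L12_diff[OF L]])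
      show "integrable branch (\<lambda>x. C * cmod (\<phi> i m x - f m x))" using L12_integrable[OF L12_diff[OF L]] by simp
      show "norm ((\<phi> i m x - f m x) * cnj (F_minus n c a (of_real \<mu>) k m x)) \<le> C * cmod (\<phi> i m x - f m x)" if "x \<in> space branch" for x
        using mult_left_mono[OF C[of x], of "cmod (\<phi> i m x - f m x)"] that by (simp add: norm_mult mult.commute)
    qed
    finally show ?thesis by (simp add: l1norm_def)
  qed
  then have le: "\<forall>\<^sub>F i in sequentially. cmod (?I (\<phi> i m) - ?I (f m)) \<le> C * l1norm (\<lambda>x. \<phi> i m x - f m x)"
    by (rule always_eventually[OF allI])
  have "(\<lambda>i. C * l1norm (\<lambda>x. \<phi> i m x - f m x)) \<longlonglongrightarrow> 0"
    using tendsto_mult_left[OF assms(3)[OF m], of C] by (simp only: mult_zero_right)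
  from Lim_null_comparison[OF le this] have "(\<lambda>i. ?I (\<phi> i m) - ?I (f m)) \<longlonglongrightarrow> 0" .
  then show "(\<lambda>i. ?I (\<phi> i m)) \<longlonglongrightarrow> ?I (f m)" by (simp only: LIM_zero_iff)
qed

lemma V_AE_subsequence:
  assumes "\<And>i::nat. u i \<in> H n" "v \<in> H n" "(\<lambda>i. normH (\<lambda>k x. u i k x - v k x)) \<longlonglongrightarrow> 0" "k \<in> {1..n}"
  shows "\<exists>r :: nat \<Rightarrow> nat. strict_mono r \<and> (AE \<mu> in sigma_measure n c a k. (\<lambda>i. V n c a (u (r i)) k \<mu>) \<longlonglongrightarrow> V n c a v k \<mu>)"
proof (rule l2norm_tendsto_AE_subseq)
  have L: "V n c a u k \<in> L2 (sigma_measure n c a k)" if "u \<in> H n" for u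
    using V_in_L2_sigma[OF that] assms(4) by (simp add: prod_L2_def)
  show "V n c a (u i) k \<in> L2 (sigma_measure n c a k)" "V n c a v k \<in> L2 (sigma_measure n c a k)" for i
    by (intro L assms)+
  have "(\<lambda>i. normS (\<lambda>k \<mu>. V n c a (u i) k \<mu> - V n c a v k \<mu>)) \<longlonglongrightarrow> 0"
    using assms(3) by (simp add: V_dist assms)
  then show "(\<lambda>i. l2norm (sigma_measure n c a k) (\<lambda>\<mu>. V n c a (u i) k \<mu> - V n c a v k \<mu>)) \<longlonglongrightarrow> 0"
    using assms(4) unfolding prod_L2_norm_tendsto_0_iff by blast
qed

text \<open>Let test tuples tend to f in both norms. Their integrals \<open>V_test\<close> converge
  at each \<mu> above the threshold by the L^1 norm, their transforms \<open>V\<close> almost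
  everywhere along a subsequence by the L^2 norm; for test tuples the two agree, hence so do the
  limits. The truncations of elements of H are handled by this.\<close>

lemma V_eq_V_test:
  assumes f: "f \<in> L12_tuples" and k: "k \<in> {1..n}"
  shows "AE \<mu> in sigma_measure n c a k. V n c a f k \<mu> = V_test n c a f k \<mu>"
proof -
  have "\<forall>m\<in>{1..n}. \<exists>\<phi>. (\<forall>i::nat. \<phi> i \<in> test_functions) \<and> (\<lambda>i. l2norm branch (\<lambda>x. \<phi> i x - f m x)) \<longlonglongrightarrow> 0 \<and> (\<lambda>i. l1norm (\<lambda>x. \<phi> i x - f m x)) \<longlonglongrightarrow> 0"
  proof
    fix m assume "m \<in> {1..n}"
    then have fm: "f m \<in> L12" using f by (simp add: L12_tuples_def)
    show "\<exists>\<phi>. (\<forall>i::nat. \<phi> i \<in> test_functions) \<and> (\<lambda>i. l2norm branch (\<lambda>x. \<phi> i x - f m x)) \<longlonglongrightarrow> 0 \<and> (\<lambda>i. l1norm (\<lambda>x. \<phi> i x - f m x)) \<longlonglongrightarrow> 0"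
      by (rule L12_test_sequence[OF fm]) blast
  qed
  from bchoice[OF this] obtain \<Phi> where \<Phi>: "\<And>m i. m \<in> {1..n} \<Longrightarrow> \<Phi> m (i::nat) \<in> test_functions"
      "\<And>m. m \<in> {1..n} \<Longrightarrow> (\<lambda>i. l2norm branch (\<lambda>x. \<Phi> m i x - f m x)) \<longlonglongrightarrow> 0"
      "\<And>m. m \<in> {1..n} \<Longrightarrow> (\<lambda>i. l1norm (\<lambda>x. \<Phi> m i x - f m x)) \<longlonglongrightarrow> 0" by blast
  define \<phi> where "\<phi> i m = \<Phi> m i" for i m
  have \<phi>: "\<phi> i \<in> test_tuples n" for i using \<Phi>(1) by (simp add: test_tuples_def \<phi>_def)
  have "(\<lambda>i. normH (\<lambda>k x. \<phi> i k x - f k x)) \<longlonglongrightarrow> 0"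
    unfolding prod_L2_norm_tendsto_0_iff \<phi>_def using \<Phi>(2) by blast
  from V_AE_subsequence[OF test_tuples_H[OF \<phi>] L12_tuples_H[OF f] this k]
  obtain r :: "nat \<Rightarrow> nat" where r: "strict_mono r" "AE \<mu> in sigma_measure n c a k. (\<lambda>i. V n c a (\<phi> (r i)) k \<mu>) \<longlonglongrightarrow> V n c a f k \<mu>" by blast
  have "AE \<mu> in sigma_measure n c a k. \<forall>i. V n c a (\<phi> i) k \<mu> = V_test n c a (\<phi> i) k \<mu>"
    unfolding AE_all_countable using V_eq_V_test_on_test_tuples[OF \<phi> k] by blast
  moreover have "AE \<mu> in sigma_measure n c a k. (\<lambda>i. V_test n c a (\<phi> i) k \<mu>) \<longlonglongrightarrow> V_test n c a f k \<mu>"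
    by (intro AE_sigma_measureI V_test_tendsto test_tuples_L12_tuples \<phi> f k) (use \<Phi>(3) in \<open>simp add: \<phi>_def\<close>)
  ultimately show ?thesis using r(2)
  proof eventually_elim
    case (elim \<mu>)
    have "(\<lambda>i. V_test n c a (\<phi> (r i)) k \<mu>) \<longlonglongrightarrow> V_test n c a f k \<mu>"
      using LIMSEQ_subseq_LIMSEQ[OF elim(2) r(1)] by (simp add: o_def)
    moreover have "(\<lambda>i. V_test n c a (\<phi> (r i)) k \<mu>) \<longlonglongrightarrow> V n c a f k \<mu>" using elim(1,3) by simp
    ultimately show ?case by (rule LIMSEQ_unique[rotated])
  qed
qed

end

section \<open>Primitives and weak derivatives on the half-line\<close>

lemma continuous_truncate_L12:
  fixes q :: "real \<Rightarrow> complex"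
  assumes "continuous_on {0..N} q"
  shows "(\<lambda>x. cindicator {0..N} x * q x) \<in> L12"
proof -
  have "compact (q ` {0..N})" using assms by (intro compact_continuous_image) auto
  then obtain B where B: "\<And>x. x \<in> {0..N} \<Longrightarrow> cmod (q x) \<le> B"
    by (force dest!: compact_imp_bounded simp: bounded_iff)
  have "(\<lambda>x. indicator {0..N} x *\<^sub>R q x) \<in> borel_measurable borel"
    by (rule borel_measurable_continuous_on_indicator[OF _ assms]) simp
  then have "(\<lambda>x. cindicator {0..N} x * q x) \<in> borel_measurable borel" by (simp add: scaleR_conv_of_real)
  then show ?thesis
  proof (rule bounded_support_L12)
    show "cmod (cindicator {0..N} x * q x) \<le> \<bar>B\<bar>" if "x > 0" for x
      using B[of x] by (cases "x \<in> {0..N}") auto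
    show "cindicator {0..N} x * q x = 0" if "x > N" for x using that by (simp add: indicator_def)
  qed
qed

lemma integral_branch_indicator:
  fixes g :: "real \<Rightarrow> complex"
  assumes "continuous_on {0..b} g"
  shows "(\<integral>x. cindicator {0..b} x * g x \<partial>branch) = integral {0..b} g"
proof -
  have m: "(\<lambda>x. indicat_real {0..b} x *\<^sub>R g x) \<in> borel_measurable lborel"
    using borel_measurable_continuous_on_indicator[OF _ assms] by simp
  have "(\<integral>x. cindicator {0..b} x * g x \<partial>branch) = (\<integral>x. indicat_real {0..b} x *\<^sub>R g x \<partial>branch)"
    by (simp add: scaleR_conv_of_real)
  also have "\<dots> = (LINT x:{0<..}|lborel. indicat_real {0..b} x *\<^sub>R g x)" by (rule integral_branch)
  also have "\<dots> = (LINT x:{0..b}|lborel. g x)"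
    unfolding set_lebesgue_integral_def
  proof (rule integral_cong_AE[OF _ m])
    show "(\<lambda>x. indicat_real {0<..} x *\<^sub>R (indicat_real {0..b} x *\<^sub>R g x)) \<in> borel_measurable lborel"
      by (intro borel_measurable_scaleR m) auto
    have ae: "AE x in lborel. x \<noteq> 0" by (rule AE_lborel_singleton)
    show "AE x in lborel. indicat_real {0<..} x *\<^sub>R (indicat_real {0..b} x *\<^sub>R g x) = indicat_real {0..b} x *\<^sub>R g x"
      using ae by eventually_elim (auto simp: indicator_def)
  qed
  also have "\<dots> = integral {0..b} g"
    using set_borel_integral_eq_integral(2)[OF borel_integrable_atLeastAtMost'[OF assms]] .
  finally show ?thesis .
qed

lemma has_integral_0_on_all_intervals:
  fixes q :: "real \<Rightarrow> complex"
  assumes "continuous_on {0..} q" "\<And>x. x \<ge> 0 \<Longrightarrow> integral {0..x} q = 0" "x \<ge> 0"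
  shows "q x = 0"
proof -
  have "((\<lambda>y. integral {0..y} q) has_vector_derivative q x) (at x within {0..x + 1})"
    by (rule integral_has_vector_derivative) (use assms in \<open>auto intro: continuous_on_subset\<close>)
  then have "((\<lambda>y. 0) has_vector_derivative q x) (at x within {0..x + 1})"
    by (rule has_vector_derivative_transform[rotated 2]) (use assms in auto)
  then show ?thesis
    using vector_derivative_unique_within_closed_interval[of 0 "x + 1" x "\<lambda>y. 0" "q x" 0] assms(3) by (simp add: box_real)
qed

lemma continuous_AE_zero:
  fixes q :: "real \<Rightarrow> complex"
  assumes "continuous_on {0..} q" "AE x in branch. q x = 0" "x \<ge> 0"
  shows "q x = 0"
proof (rule has_integral_0_on_all_intervals[OF assms(1) _ assms(3)])
  fix x :: real
  have c: "continuous_on {0..x} q" by (rule continuous_on_subset[OF assms(1)]) auto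
  have "(\<integral>y. cindicator {0..x} y * q y \<partial>branch) = 0"
    using assms(2) by (intro integral_eq_zero_AE) (auto elim: eventually_mono)
  then show "integral {0..x} q = 0" using integral_branch_indicator[OF c] by simp
qed

text \<open>The primitive starting at the vertex, written as a Lebesgue integral because g is only
  square integrable.\<close>

definition prim :: "(real \<Rightarrow> complex) \<Rightarrow> real \<Rightarrow> complex" where
  "prim g x = (\<integral>y. cindicator {0..x} y * g y \<partial>branch)"

lemma prim_0 [simp]: "prim g 0 = 0"
proof -
  have "(\<integral>y. cindicator {0..0} y * g y \<partial>branch) = (\<integral>y. 0 \<partial>branch)"
    by (intro Bochner_Integration.integral_cong) auto
  then show ?thesis by (simp add: prim_def)
qed

lemma L12_bounded_mult:
  assumes "h \<in> L12" "\<And>x. x > 0 \<Longrightarrow> cmod (F x) \<le> C" "F \<in> borel_measurable branch"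
  shows "integrable branch (\<lambda>x. h x * F x)" "cmod (\<integral>x. h x * F x \<partial>branch) \<le> C * l1norm h"
proof -
  have h: "integrable branch h" using L12_integrable[OF assms(1)] .
  have b: "cmod (h x * F x) \<le> C * cmod (h x)" if "x > 0" for x
    using mult_left_mono[OF assms(2)[OF that], of "cmod (h x)"] by (simp add: norm_mult mult.commute)
  show i: "integrable branch (\<lambda>x. h x * F x)"
  proof (rule Bochner_Integration.integrable_bound)
    show "integrable branch (\<lambda>x. of_real C * h x)" using h by simp
    show "AE x in branch. norm (h x * F x) \<le> norm (of_real C * h x)"
    proof (rule AE_branchI)
      fix x :: real assume "x > 0"
      have "C * cmod (h x) \<le> \<bar>C\<bar> * cmod (h x)" by (intro mult_right_mono) auto
      then show "norm (h x * F x) \<le> norm (of_real C * h x)" using b[OF \<open>x > 0\<close>] by (simp add: norm_mult)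
    qed
  qed (use h assms(3) in auto)
  have "cmod (\<integral>x. h x * F x \<partial>branch) \<le> (\<integral>x. C * cmod (h x) \<partial>branch)"
    by (rule Bochner_Integration.integral_norm_bound_integral[OF i]) (use h b in auto)
  then show "cmod (\<integral>x. h x * F x \<partial>branch) \<le> C * l1norm h" by (simp add: l1norm_def)
qed

text \<open>For test functions both claims are the fundamental theorem of calculus. Approximation of
  the truncated g in the L^1 norm makes the primitives converge uniformly on \<open>{0..N}\<close>,
  which carries continuity and integration by parts over to g.\<close>

lemma prim_continuous_parts:
  assumes g: "g \<in> L2 branch" and N: "N \<ge> 0"
    and F: "\<And>x. x \<in> {0..N} \<Longrightarrow> (F has_vector_derivative F' x) (at x within {0..N})" and F': "continuous_on {0..N} F'"
  shows "continuous_on {0..N} (prim g)"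
    and "(\<integral>x. cindicator {0..N} x * (g x * F x) \<partial>branch) = prim g N * F N - integral {0..N} (\<lambda>x. prim g x * F' x)"
proof -
  define h where "h x = cindicator {0..N} x * g x" for x
  have h: "h \<in> L12" unfolding h_def[abs_def] by (rule L2_truncate[OF g])
  obtain \<phi> where \<phi>: "\<And>i::nat. \<phi> i \<in> test_functions" "(\<lambda>i. l1norm (\<lambda>x. \<phi> i x - h x)) \<longlonglongrightarrow> 0"
    by (rule L12_test_sequence[OF h], rule that)
  define e where "e i = l1norm (\<lambda>x. \<phi> i x - h x)" for i
  have e: "e \<longlonglongrightarrow> 0" using \<phi>(2) by (simp add: e_def[abs_def])
  have d: "(\<lambda>x. \<phi> i x - h x) \<in> L12" for i by (rule L12_diff[OF test_functions_L12[OF \<phi>(1)] h])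
  have \<phi>c: "continuous_on S (\<phi> i)" for i S using test_functions_smooth[OF \<phi>(1)] smooth_continuous by blast
  have Fc: "continuous_on {0..N} F" using F has_vector_derivative_continuous continuous_on_eq_continuous_within by blast
  define P where "P i x = integral {0..x} (\<phi> i)" for i x
  have Pdist: "cmod (P i x - prim g x) \<le> e i" if x: "x \<in> {0..N}" for i x
  proof -
    have m: "cindicator {0..x} \<in> borel_measurable branch" by (intro borel_measurable_branch) auto
    have "P i x = (\<integral>y. \<phi> i y * cindicator {0..x} y \<partial>branch)"
      using integral_branch_indicator[OF \<phi>c, of x i] by (simp add: P_def mult.commute)
    moreover have "prim g x = (\<integral>y. h y * cindicator {0..x} y \<partial>branch)"
      unfolding prim_def using x by (intro Bochner_Integration.integral_cong) (auto simp: h_def indicator_def)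
    moreover have "integrable branch (\<lambda>y. \<phi> i y * cindicator {0..x} y)" "integrable branch (\<lambda>y. h y * cindicator {0..x} y)"
      using m by (auto intro!: L12_bounded_mult(1)[where C=1] test_functions_L12 \<phi> h simp: indicator_def)
    ultimately have "P i x - prim g x = (\<integral>y. (\<phi> i y - h y) * cindicator {0..x} y \<partial>branch)"
      by (simp add: left_diff_distrib)
    also have "cmod \<dots> \<le> 1 * l1norm (\<lambda>x. \<phi> i x - h x)"
      using m by (intro L12_bounded_mult(2) d) (auto simp: indicator_def)
    finally show ?thesis by (simp add: e_def)
  qed
  have Pd: "(P i has_vector_derivative \<phi> i x) (at x within {0..N})" if "x \<in> {0..N}" for i x
    unfolding P_def[abs_def] using that by (intro integral_has_vector_derivative \<phi>c) auto
  have Pc: "continuous_on {0..N} (P i)" for i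
    using Pd has_vector_derivative_continuous continuous_on_eq_continuous_within by blast
  show cont: "continuous_on {0..N} (prim g)"
  proof (rule uniform_limit_theorem)
    show "\<forall>\<^sub>F i in sequentially. continuous_on {0..N} (P i)" using Pc by simp
    show "uniform_limit {0..N} P (prim g) sequentially"
      unfolding uniform_limit_iff
    proof (intro allI impI)
      fix r :: real assume "r > 0"
      then have "\<forall>\<^sub>F i in sequentially. e i < r" using order_tendstoD(2)[OF e] by blast
      then show "\<forall>\<^sub>F i in sequentially. \<forall>x\<in>{0..N}. dist (P i x) (prim g x) < r"
      proof eventually_elim
        case (elim i)
        show ?case
        proof
          fix x assume "x \<in> {0..N}"
          from le_less_trans[OF Pdist[OF this] elim] show "dist (P i x) (prim g x) < r" by (simp add: dist_norm)
        qed
      qed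
    qed
  qed simp
  obtain C where C: "\<And>x. x \<in> {0..N} \<Longrightarrow> cmod (F x) \<le> C" 
    using compact_imp_bounded[OF compact_continuous_image[OF Fc compact_Icc]] by (force simp: bounded_iff)
  obtain C' where C': "\<And>x. x \<in> {0..N} \<Longrightarrow> cmod (F' x) \<le> C'"
    using compact_imp_bounded[OF compact_continuous_image[OF F' compact_Icc]] by (force simp: bounded_iff)
  have C0: "C \<ge> 0" using order_trans[OF norm_ge_zero C[of 0]] N by simp
  define T where "T x = cindicator {0..N} x * F x" for x
  have T: "T \<in> borel_measurable branch" unfolding T_def[abs_def] using L12_L2[OF continuous_truncate_L12[OF Fc]] by (simp add: L2_def)
  have TC: "cmod (T x) \<le> C" for x using C[of x] C0 by (cases "x \<in> {0..N}") (auto simp: T_def)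
  have parts: "(\<integral>x. \<phi> i x * T x \<partial>branch) = P i N * F N - integral {0..N} (\<lambda>x. P i x * F' x)" for i
  proof -
    have "((\<lambda>x. P i x * F' x + \<phi> i x * F x) has_integral P i N * F N - P i 0 * F 0) {0..N}"
      by (rule fundamental_theorem_of_calculus[OF N]) (rule has_vector_derivative_mult[OF Pd F], auto)
    then have "integral {0..N} (\<lambda>x. P i x * F' x + \<phi> i x * F x) = P i N * F N" by (simp add: has_integral_iff P_def)
    also have "integral {0..N} (\<lambda>x. P i x * F' x + \<phi> i x * F x) = integral {0..N} (\<lambda>x. P i x * F' x) + integral {0..N} (\<lambda>x. \<phi> i x * F x)"
      by (intro integral_add integrable_continuous_real continuous_intros Pc F' Fc \<phi>c)
    also have "integral {0..N} (\<lambda>x. \<phi> i x * F x) = (\<integral>x. cindicator {0..N} x * (\<phi> i x * F x) \<partial>branch)"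
      by (rule integral_branch_indicator[symmetric]) (intro continuous_intros \<phi>c Fc)
    also have "\<dots> = (\<integral>x. \<phi> i x * T x \<partial>branch)" by (simp add: T_def mult_ac)
    finally show ?thesis by (simp add: algebra_simps)
  qed
  have lim1: "(\<lambda>i. \<integral>x. \<phi> i x * T x \<partial>branch) \<longlonglongrightarrow> (\<integral>x. h x * T x \<partial>branch)"
  proof -
    have "cmod ((\<integral>x. \<phi> i x * T x \<partial>branch) - (\<integral>x. h x * T x \<partial>branch)) \<le> C * e i" for i
    proof -
      have "(\<integral>x. \<phi> i x * T x \<partial>branch) - (\<integral>x. h x * T x \<partial>branch) = (\<integral>x. (\<phi> i x - h x) * T x \<partial>branch)"
        using L12_bounded_mult(1)[OF test_functions_L12[OF \<phi>(1)] TC T] L12_bounded_mult(1)[OF h TC T] by (simp add: left_diff_distrib)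
      then show ?thesis using L12_bounded_mult(2)[OF d TC T] by (simp add: e_def)
    qed
    then have "\<forall>\<^sub>F i in sequentially. cmod ((\<integral>x. \<phi> i x * T x \<partial>branch) - (\<integral>x. h x * T x \<partial>branch)) \<le> C * e i" by simp
    moreover have "(\<lambda>i. C * e i) \<longlonglongrightarrow> 0" using tendsto_mult_left[OF e, of C] by simp
    ultimately show ?thesis by (rule LIM_zero_cancel[OF Lim_null_comparison])
  qed
  have lim2: "(\<lambda>i. integral {0..N} (\<lambda>x. P i x * F' x)) \<longlonglongrightarrow> integral {0..N} (\<lambda>x. prim g x * F' x)"
  proof -
    have "cmod (integral {0..N} (\<lambda>x. P i x * F' x) - integral {0..N} (\<lambda>x. prim g x * F' x)) \<le> e i * C' * (N - 0)" for i
    proof -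
      have "integral {0..N} (\<lambda>x. P i x * F' x) - integral {0..N} (\<lambda>x. prim g x * F' x) = integral {0..N} (\<lambda>x. (P i x - prim g x) * F' x)"
        by (subst integral_diff[symmetric]) (auto simp: left_diff_distrib intro!: integrable_continuous_real continuous_intros Pc F' cont)
      also have "cmod \<dots> \<le> e i * C' * (N - 0)"
      proof (rule integral_bound[OF N])
        show "cmod ((P i x - prim g x) * F' x) \<le> e i * C'" if "x \<in> {0..N}" for x
          unfolding norm_mult using Pdist[OF that] C'[OF that] by (intro mult_mono) (auto simp: e_def)
      qed (intro continuous_intros Pc cont F')
      finally show ?thesis .
    qed
    then have "\<forall>\<^sub>F i in sequentially. cmod (integral {0..N} (\<lambda>x. P i x * F' x) - integral {0..N} (\<lambda>x. prim g x * F' x)) \<le> e i * C' * (N - 0)" by simp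
    moreover have "(\<lambda>i. e i * C' * (N - 0)) \<longlonglongrightarrow> 0" using tendsto_mult_right[OF e, of "C' * (N - 0)"] by (simp add: mult.assoc)
    ultimately show ?thesis by (rule LIM_zero_cancel[OF Lim_null_comparison])
  qed
  have lim3: "(\<lambda>i. P i N) \<longlonglongrightarrow> prim g N"
  proof -
    have "\<forall>\<^sub>F i in sequentially. cmod (P i N - prim g N) \<le> e i" using Pdist[of N] N by simp
    then show ?thesis using e by (rule LIM_zero_cancel[OF Lim_null_comparison])
  qed
  have "(\<lambda>i. \<integral>x. \<phi> i x * T x \<partial>branch) \<longlonglongrightarrow> prim g N * F N - integral {0..N} (\<lambda>x. prim g x * F' x)"
    unfolding parts by (intro tendsto_intros lim2 lim3)
  with lim1 have "(\<integral>x. h x * T x \<partial>branch) = prim g N * F N - integral {0..N} (\<lambda>x. prim g x * F' x)" by (rule LIMSEQ_unique)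
  moreover have "(\<integral>x. h x * T x \<partial>branch) = (\<integral>x. cindicator {0..N} x * (g x * F x) \<partial>branch)"
    by (intro Bochner_Integration.integral_cong) (auto simp: h_def T_def indicator_def)
  ultimately show "(\<integral>x. cindicator {0..N} x * (g x * F x) \<partial>branch) = prim g N * F N - integral {0..N} (\<lambda>x. prim g x * F' x)" by simp
qed

lemma prim_continuous:
  assumes "g \<in> L2 branch"
  shows "continuous_on {0..} (prim g)"
  unfolding continuous_on_eq_continuous_within
proof (rule ballI)
  fix x :: real assume x: "x \<in> {0..}"
  have "continuous_on {0..x + 1} (prim g)"
    by (rule prim_continuous_parts(1)[OF assms, of "x + 1" "\<lambda>_. 0" "\<lambda>_. 0"]) (use x in \<open>auto intro: continuous_intros\<close>)
  then have "continuous (at x within {0..x + 1}) (prim g)" using x by (simp add: continuous_on_eq_continuous_within)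
  moreover have "at x within {0..} = at x within {0..x + 1}"
    by (rule at_within_nhd[where S="{..<x + 1}"]) (use x in auto)
  ultimately show "continuous (at x within {0..}) (prim g)" by simp
qed

lemmas prim_parts = prim_continuous_parts(2)

section \<open>Lemmas of du Bois-Reymond type\<close>

text \<open>By the product rule, finite sums of products of derivatives of f and g form a class
  closed under differentiation. The index lists allow repetitions, so no binomial coefficients
  appear.\<close>

lemma smooth_mult:
  assumes "smooth f" "smooth g"
  shows "smooth (\<lambda>x. f x * g x)"
proof (rule smooth_coinduct[where P="\<lambda>h. \<exists>I :: (nat \<times> nat) list. h = (\<lambda>x. \<Sum>(i, j)\<leftarrow>I. vderiv i f x * vderiv j g x)"])
  show "\<exists>I. (\<lambda>x. f x * g x) = (\<lambda>x. \<Sum>(i, j)\<leftarrow>I. vderiv i f x * vderiv j g x)"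
    by (intro exI[of _ "[(0, 0)]"]) simp
next
  fix h assume "\<exists>I. h = (\<lambda>x. \<Sum>(i, j)\<leftarrow>I. vderiv i f x * vderiv j g x)"
  then obtain I where h: "h = (\<lambda>x. \<Sum>(i, j)\<leftarrow>I. vderiv i f x * vderiv j g x)" by blast
  have "\<exists>J. \<forall>x. ((\<lambda>x. \<Sum>(i, j)\<leftarrow>I. vderiv i f x * vderiv j g x) has_vector_derivative (\<Sum>(i, j)\<leftarrow>J. vderiv i f x * vderiv j g x)) (at x)"
  proof (induction I)
    case Nil
    show ?case by (intro exI[of _ "[]"]) simp
  next
    case (Cons p I)
    obtain i j where p: "p = (i, j)" by fastforce
    obtain J where J: "\<And>x. ((\<lambda>x. \<Sum>(i, j)\<leftarrow>I. vderiv i f x * vderiv j g x) has_vector_derivative (\<Sum>(i, j)\<leftarrow>J. vderiv i f x * vderiv j g x)) (at x)"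
      using Cons by blast
    have "((\<lambda>x. vderiv i f x * vderiv j g x + (\<Sum>(i, j)\<leftarrow>I. vderiv i f x * vderiv j g x)) has_vector_derivative
        (vderiv i f x * vderiv (Suc j) g x + vderiv (Suc i) f x * vderiv j g x) + (\<Sum>(i, j)\<leftarrow>J. vderiv i f x * vderiv j g x)) (at x)" for x
      by (intro has_vector_derivative_add has_vector_derivative_mult smooth_has_derivative' assms J)
    then show ?case by (intro exI[of _ "(i, Suc j) # (Suc i, j) # J"]) (simp add: p add.assoc)
  qed
  then show "\<exists>h'. (\<exists>I. h' = (\<lambda>x. \<Sum>(i, j)\<leftarrow>I. vderiv i f x * vderiv j g x)) \<and> (\<forall>x. (h has_vector_derivative h' x) (at x))"
    unfolding h by blast
qed

lemma test_functions_mult: "f \<in> test_functions \<Longrightarrow> smooth g \<Longrightarrow> (\<lambda>x. g x * f x) \<in> test_functions"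
  unfolding test_functions_iff using smooth_mult[of g f] by fastforce

text \<open>Local up to and including the vertex, so that constants, affine functions and primitives
  belong to the class although they need not be in L^2.\<close>

definition L2_loc :: "(real \<Rightarrow> complex) \<Rightarrow> bool" where
  "L2_loc f \<longleftrightarrow> (\<forall>N. (\<lambda>x. cindicator {0..N} x * f x) \<in> L2 branch)"

lemma L2_L2_loc: "f \<in> L2 branch \<Longrightarrow> L2_loc f"
  unfolding L2_loc_def using L2_truncate L12_L2 by blast

lemma continuous_L2_loc: "continuous_on {0..} f \<Longrightarrow> L2_loc f"
  unfolding L2_loc_def by (intro allI L12_L2 continuous_truncate_L12) (rule continuous_on_subset, auto)

lemma L2_loc_add: "L2_loc f \<Longrightarrow> L2_loc g \<Longrightarrow> L2_loc (\<lambda>x. f x + g x)"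
  unfolding L2_loc_def using L2_add by (fastforce simp: distrib_left)

lemma L2_loc_diff: "L2_loc f \<Longrightarrow> L2_loc g \<Longrightarrow> L2_loc (\<lambda>x. f x - g x)"
  unfolding L2_loc_def using L2_diff by (fastforce simp: right_diff_distrib)

lemma L2_loc_test_integrable:
  assumes "L2_loc f" "\<phi> \<in> test_functions"
  shows "integrable branch (\<lambda>x. f x * \<phi> x)"
proof -
  obtain \<alpha> \<beta> where s: "0 < \<alpha>" "\<alpha> \<le> \<beta>" "\<And>x. x \<notin> {\<alpha>..\<beta>} \<Longrightarrow> \<phi> x = 0" using test_functions_support[OF assms(2)] by metis
  have "integrable branch (\<lambda>x. (cindicator {0..\<beta>} x * f x) * \<phi> x)"
    using assms(1) by (intro L2_mult_integrable test_functions_L2[OF assms(2)]) (simp add: L2_loc_def)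
  also have "(\<lambda>x. (cindicator {0..\<beta>} x * f x) * \<phi> x) = (\<lambda>x. f x * \<phi> x)"
  proof
    fix x show "(cindicator {0..\<beta>} x * f x) * \<phi> x = f x * \<phi> x"
      using s(3)[of x] s(1) by (cases "x \<in> {\<alpha>..\<beta>}") auto
  qed
  finally show ?thesis .
qed

text \<open>The restriction of f to \<open>{0..N}\<close> lies in L^2, but the sharp indicator is no
  admissible multiplier of test functions. Smooth windows tending to it are, and dominated
  convergence transfers the orthogonality.\<close>

lemma L2_loc_fundamental_lemma:
  assumes f: "L2_loc f" and orth: "\<And>\<phi>. \<phi> \<in> test_functions \<Longrightarrow> (\<integral>x. f x * \<phi> x \<partial>branch) = 0"
  shows "AE x in branch. f x = 0"
proof -
  have "AE x in branch. cindicator {0..real N} x * f x = 0" for N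
  proof (rule L2_fundamental_lemma)
    show "(\<lambda>x. cindicator {0..real N} x * f x) \<in> L2 branch" using f by (simp add: L2_loc_def)
    fix \<phi> assume \<phi>: "\<phi> \<in> test_functions"
    have int: "integrable branch (\<lambda>x. f x * \<phi> x)" by (rule L2_loc_test_integrable[OF f \<phi>])
    have w: "(\<lambda>x. of_real (window (real (Suc i)) 0 (real N) x) * \<phi> x) \<in> test_functions" for i
      by (rule test_functions_mult[OF \<phi> smooth_window])
    have "(\<lambda>i. \<integral>x. f x * (of_real (window (real (Suc i)) 0 (real N) x) * \<phi> x) \<partial>branch) \<longlonglongrightarrow> (\<integral>x. cindicator {0..real N} x * f x * \<phi> x \<partial>branch)"
    proof (rule integral_dominated_convergence)
      show "integrable branch (\<lambda>x. cmod (f x * \<phi> x))" using int by simp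
      show "AE x in branch. (\<lambda>i. f x * (of_real (window (real (Suc i)) 0 (real N) x) * \<phi> x)) \<longlonglongrightarrow> cindicator {0..real N} x * f x * \<phi> x"
      proof (rule AE_branchI)
        fix x :: real assume "x > 0"
        have "(\<lambda>i. f x * (complex_of_real (window (real (Suc i)) 0 (real N) x) * \<phi> x)) \<longlonglongrightarrow> f x * (of_real (indicator {0<..real N} x) * \<phi> x)"
          by (intro tendsto_intros window_tendsto) auto
        then show "(\<lambda>i. f x * (complex_of_real (window (real (Suc i)) 0 (real N) x) * \<phi> x)) \<longlonglongrightarrow> cindicator {0..real N} x * f x * \<phi> x"
          using \<open>x > 0\<close> by (simp add: indicator_def mult_ac)
      qed
      show "AE x in branch. norm (f x * (of_real (window (real (Suc i)) 0 (real N) x) * \<phi> x)) \<le> cmod (f x * \<phi> x)" for i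
      proof (rule AE_branchI)
        fix x :: real
        have "\<bar>window (real (Suc i)) 0 (real N) x\<bar> * cmod (\<phi> x) \<le> 1 * cmod (\<phi> x)" by (intro mult_right_mono window_abs_le_1) auto
        then show "norm (f x * (of_real (window (real (Suc i)) 0 (real N) x) * \<phi> x)) \<le> cmod (f x * \<phi> x)"
          by (simp add: norm_mult mult_left_mono del: mult_cancel_right2)
      qed
      show "(\<lambda>x. cindicator {0..real N} x * f x * \<phi> x) \<in> borel_measurable branch"
      proof -
        have "cindicator {0..real N} \<in> borel_measurable branch" by (intro borel_measurable_branch) auto
        from borel_measurable_times[OF this borel_measurable_integrable[OF int]] show ?thesis by (simp add: mult.assoc)
      qed
      show "(\<lambda>x. f x * (of_real (window (real (Suc i)) 0 (real N) x) * \<phi> x)) \<in> borel_measurable branch" for i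
        by (rule borel_measurable_integrable[OF L2_loc_test_integrable[OF f w]])
    qed
    then show "(\<integral>x. cindicator {0..real N} x * f x * \<phi> x \<partial>branch) = 0"
      unfolding orth[OF w] by (simp add: LIMSEQ_const_iff)
  qed
  then have "AE x in branch. \<forall>N. cindicator {0..real N} x * f x = 0" unfolding AE_all_countable by blast
  moreover have "AE x in branch. x > 0" by (rule AE_branchI)
  ultimately show ?thesis
  proof eventually_elim
    case (elim x)
    obtain m where "x \<le> real m" using real_arch_simple by blast
    then show ?case using elim(1)[rule_format, of m] elim(2) by simp
  qed
qed

text \<open>If all test functions had integral zero, the constant 1 would be orthogonal to all of
  them and would vanish almost everywhere.\<close>

lemma test_function_integral_1:
  obtains \<eta> where "\<eta> \<in> test_functions" "(\<integral>x. \<eta> x \<partial>branch) = 1"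
proof -
  have "\<exists>\<psi>\<in>test_functions. (\<integral>x. \<psi> x \<partial>branch) \<noteq> 0"
  proof (rule ccontr)
    assume "\<not> ?thesis"
    then have "(\<integral>x. 1 * \<psi> x \<partial>branch) = 0" if "\<psi> \<in> test_functions" for \<psi> using that by auto
    then have "AE x::real in branch. (1::complex) = 0"
      by (intro L2_loc_fundamental_lemma[of "\<lambda>x. 1"] continuous_L2_loc continuous_on_const)
    then show False
      using continuous_AE_zero[of "\<lambda>x. 1" 0] by simp
  qed
  then obtain \<psi> where \<psi>: "\<psi> \<in> test_functions" "(\<integral>x. \<psi> x \<partial>branch) \<noteq> 0" by blast
  show ?thesis
    by (rule that[OF test_functions_cmult[OF \<psi>(1), of "1 / (\<integral>x. \<psi> x \<partial>branch)"]]) (use \<psi>(2) in simp)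
qed

lemma integral_branch_test:
  assumes "\<phi> \<in> test_functions" "continuous_on {0..} q"
  obtains b where "b > 0" "\<And>x m. x \<le> 0 \<or> x \<ge> b \<Longrightarrow> vderiv m \<phi> x = 0"
    "\<And>m. (\<integral>x. q x * vderiv m \<phi> x \<partial>branch) = integral {0..b} (\<lambda>x. q x * vderiv m \<phi> x)"
proof -
  obtain \<alpha> \<beta> where s: "0 < \<alpha>" "\<alpha> \<le> \<beta>" "\<And>x. x \<notin> {\<alpha>..\<beta>} \<Longrightarrow> \<phi> x = 0" using test_functions_support[OF assms(1)] by metis
  have out: "vderiv m \<phi> x = 0" if "x \<le> 0 \<or> x \<ge> \<beta> + 1" for m x
    using that s(1) by (intro vderiv_eq_0_outside[OF test_functions_smooth[OF assms(1)] s(3)]) auto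
  have "(\<integral>x. q x * vderiv m \<phi> x \<partial>branch) = integral {0..\<beta> + 1} (\<lambda>x. q x * vderiv m \<phi> x)" for m
    by (rule integral_branch_eq)
       (use out in \<open>auto intro!: continuous_intros smooth_continuous_vderiv test_functions_smooth assms(1) continuous_on_subset[OF assms(2)]\<close>)
  then show ?thesis using s out by (intro that[of "\<beta> + 1"]) auto
qed

text \<open>Mean zero is exactly what makes the primitive vanish again beyond the support.\<close>

lemma test_function_primitive:
  assumes \<psi>: "\<psi> \<in> test_functions" and "(\<integral>x. \<psi> x \<partial>branch) = 0"
  obtains \<phi> where "\<phi> \<in> test_functions" "vderiv 1 \<phi> = \<psi>"
proof -
  obtain \<alpha> \<beta> where s: "0 < \<alpha>" "\<alpha> \<le> \<beta>" "\<And>x. x \<notin> {\<alpha>..\<beta>} \<Longrightarrow> \<psi> x = 0" using test_functions_support[OF \<psi>] by metis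
  have c: "continuous_on S \<psi>" for S using test_functions_smooth[OF \<psi>] smooth_continuous by blast
  define \<phi> where "\<phi> x = integral {0..x} \<psi>" for x
  \<comment> \<open>For negative x the interval \<open>{0..x}\<close> is empty and its integral is
    0; between 0 and \<alpha> the integrand vanishes.\<close>
  have left: "\<phi> x = 0" if "x < \<alpha>" for x
    unfolding \<phi>_def using that s(3) by (intro integral_eq_0_iff[THEN iffD2] | subst Henstock_Kurzweil_Integration.integral_cong[where g="\<lambda>_. 0"])+ auto
  have right: "\<phi> x = 0" if "x \<ge> \<beta> + 1" for x
  proof -
    have "(\<integral>x. \<psi> x \<partial>branch) = integral {0..x} \<psi>"
      using that s(3) by (intro integral_branch_eq c) auto
    then show ?thesis using assms(2) by (simp add: \<phi>_def)
  qed
  have d: "(\<phi> has_vector_derivative \<psi> x) (at x)" for x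
  proof (cases "x < \<alpha>")
    case True
    then have "((\<lambda>x. 0) has_vector_derivative \<psi> x) (at x)" using s(3)[of x] by simp
    then show ?thesis
      by (rule has_vector_derivative_transform_within_open[of _ _ _ "{..<\<alpha>}"]) (use True left in auto)
  next
    case False
    have "((\<lambda>y. integral {0..y} \<psi>) has_vector_derivative \<psi> x) (at x within {0..x + 1})"
      by (rule integral_has_vector_derivative[OF c]) (use False s in auto)
    moreover have "at x within {0..x + 1} = at x" by (rule at_within_Icc_at) (use False s in auto)
    ultimately show ?thesis unfolding \<phi>_def[abs_def] by simp
  qed
  have "vderiv (Suc 0) \<phi> = vderiv 0 \<psi>" by (rule vderiv_eq[OF d])
  moreover have "\<phi> \<in> test_functions"
    unfolding test_functions_iff
  proof (intro conjI exI)
    show "smooth \<phi>" by (rule smooth_antiderivative[OF test_functions_smooth[OF \<psi>] d])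
    show "0 < \<alpha>" "\<alpha> \<le> \<beta> + 1" using s by auto
    show "\<forall>x. x \<notin> {\<alpha>..\<beta> + 1} \<longrightarrow> \<phi> x = 0" using left right by force
  qed
  ultimately show ?thesis using that by (simp add: One_nat_def)
qed

text \<open>Subtracting a multiple of a fixed \<eta> of integral 1 gives any test function mean
  zero, hence makes it a derivative. The constant is the pairing of f with \<eta>.\<close>

lemma du_Bois_Reymond:
  assumes f: "L2_loc f" and orth: "\<And>\<phi>. \<phi> \<in> test_functions \<Longrightarrow> (\<integral>x. f x * vderiv 1 \<phi> x \<partial>branch) = 0"
  shows "\<exists>\<alpha>. AE x in branch. f x = \<alpha>"
proof -
  obtain \<eta> where \<eta>: "\<eta> \<in> test_functions" "(\<integral>x. \<eta> x \<partial>branch) = 1" by (rule test_function_integral_1)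
  define \<alpha> where "\<alpha> = (\<integral>x. f x * \<eta> x \<partial>branch)"
  have "AE x in branch. f x - \<alpha> = 0"
  proof (rule L2_loc_fundamental_lemma)
    show "L2_loc (\<lambda>x. f x - \<alpha>)" by (intro L2_loc_diff f continuous_L2_loc continuous_intros)
    fix \<psi> assume \<psi>: "\<psi> \<in> test_functions"
    define I where "I = (\<integral>x. \<psi> x \<partial>branch)"
    have t: "(\<lambda>x. \<psi> x + (- I) * \<eta> x) \<in> test_functions" by (intro test_functions_add test_functions_cmult \<psi> \<eta>)
    have int: "integrable branch \<psi>" "integrable branch \<eta>" using L12_integrable test_functions_L12 \<psi> \<eta> by auto
    have "(\<integral>x. \<psi> x + (- I) * \<eta> x \<partial>branch) = 0"
      using int \<eta>(2) by (simp add: I_def)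
    then obtain \<phi> where \<phi>: "\<phi> \<in> test_functions" "vderiv 1 \<phi> = (\<lambda>x. \<psi> x + (- I) * \<eta> x)"
      using test_function_primitive[OF t] by metis
    have "0 = (\<integral>x. f x * (\<psi> x + (- I) * \<eta> x) \<partial>branch)" using orth[OF \<phi>(1)] \<phi>(2) by simp
    also have "\<dots> = (\<integral>x. f x * \<psi> x - I * (f x * \<eta> x) \<partial>branch)" by (simp add: algebra_simps)
    also have "\<dots> = (\<integral>x. f x * \<psi> x \<partial>branch) - I * \<alpha>"
      using L2_loc_test_integrable[OF f \<psi>] L2_loc_test_integrable[OF f \<eta>(1)] by (simp add: \<alpha>_def)
    finally have *: "0 = (\<integral>x. f x * \<psi> x \<partial>branch) - I * \<alpha>" .
    have "(\<integral>x. (f x - \<alpha>) * \<psi> x \<partial>branch) = (\<integral>x. f x * \<psi> x - \<alpha> * \<psi> x \<partial>branch)"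
      unfolding left_diff_distrib ..
    also have "\<dots> = (\<integral>x. f x * \<psi> x \<partial>branch) - I * \<alpha>"
      using L2_loc_test_integrable[OF f \<psi>] int by (simp add: I_def)
    finally show "(\<integral>x. (f x - \<alpha>) * \<psi> x \<partial>branch) = 0" using * by simp
  qed
  then show ?thesis by auto
qed

lemma du_Bois_Reymond_continuous:
  assumes c: "continuous_on {0..} q" and orth: "\<And>\<phi>. \<phi> \<in> test_functions \<Longrightarrow> (\<integral>x. q x * vderiv 1 \<phi> x \<partial>branch) = 0" and "x \<ge> 0"
  shows "q x = q 0"
proof -
  obtain \<alpha> where "AE x in branch. q x = \<alpha>" using du_Bois_Reymond[OF continuous_L2_loc[OF c] orth] by blast
  then have "AE x in branch. q x - \<alpha> = 0" by simp
  then have "q x - \<alpha> = 0" if "x \<ge> 0" for x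
    using that by (intro continuous_AE_zero[where q="\<lambda>x. q x - \<alpha>"] continuous_intros c)
  from this[of x] this[of 0] show ?thesis using assms(3) by simp
qed

text \<open>Reduction to first order: with t the pairing of f with the derivative of \<eta>, the
  function f + t x is orthogonal to all first derivatives of test functions, since the pairing of x
  with \<psi>' is minus the integral of \<psi>.\<close>

lemma du_Bois_Reymond_second:
  assumes f: "L2_loc f" and orth: "\<And>\<phi>. \<phi> \<in> test_functions \<Longrightarrow> (\<integral>x. f x * vderiv 2 \<phi> x \<partial>branch) = 0"
  shows "\<exists>\<alpha> \<beta>. AE x in branch. f x = \<alpha> + \<beta> * of_real x"
proof -
  obtain \<eta> where \<eta>: "\<eta> \<in> test_functions" "(\<integral>x. \<eta> x \<partial>branch) = 1" by (rule test_function_integral_1)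
  define t where "t = (\<integral>x. f x * vderiv 1 \<eta> x \<partial>branch)"
  have id: "L2_loc (\<lambda>x. t * of_real x)" by (intro continuous_L2_loc continuous_intros)
  have "\<exists>\<alpha>. AE x in branch. f x + t * of_real x = \<alpha>"
  proof (rule du_Bois_Reymond[OF L2_loc_add[OF f id]])
    fix \<psi> assume \<psi>: "\<psi> \<in> test_functions"
    define I where "I = (\<integral>x. \<psi> x \<partial>branch)"
    have tt: "(\<lambda>x. \<psi> x + (- I) * \<eta> x) \<in> test_functions" by (intro test_functions_add test_functions_cmult \<psi> \<eta>)
    have int: "integrable branch \<psi>" "integrable branch \<eta>" using L12_integrable test_functions_L12 \<psi> \<eta> by auto
    have "(\<integral>x. \<psi> x + (- I) * \<eta> x \<partial>branch) = 0" using int \<eta>(2) by (simp add: I_def)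
    then obtain \<phi> where \<phi>: "\<phi> \<in> test_functions" "vderiv 1 \<phi> = (\<lambda>x. \<psi> x + (- I) * \<eta> x)"
      using test_function_primitive[OF tt] by metis
    have "vderiv 2 \<phi> = vderiv 1 (\<lambda>x. \<psi> x + (- I) * \<eta> x)"
      unfolding \<phi>(2)[symmetric] vderiv_vderiv by simp
    also have "\<dots> = (\<lambda>x. vderiv 1 \<psi> x + (- I) * vderiv 1 \<eta> x)"
    proof -
      have "((\<lambda>x. \<psi> x + (- I) * \<eta> x) has_vector_derivative vderiv 1 \<psi> x + (- I) * vderiv 1 \<eta> x) (at x)" for x
        by (intro has_vector_derivative_add has_vector_derivative_mult_right smooth_has_derivative test_functions_smooth \<psi> \<eta>)
      from vderiv_eq[OF this, of 0] show ?thesis by (simp add: One_nat_def)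
    qed
    finally have "0 = (\<integral>x. f x * (vderiv 1 \<psi> x + (- I) * vderiv 1 \<eta> x) \<partial>branch)" using orth[OF \<phi>(1)] by simp
    also have "\<dots> = (\<integral>x. f x * vderiv 1 \<psi> x - I * (f x * vderiv 1 \<eta> x) \<partial>branch)" by (simp add: algebra_simps)
    also have "\<dots> = (\<integral>x. f x * vderiv 1 \<psi> x \<partial>branch) - I * t"
      using L2_loc_test_integrable[OF f test_functions_vderiv[OF \<psi>]] L2_loc_test_integrable[OF f test_functions_vderiv[OF \<eta>(1)]] by (simp add: t_def)
    finally have 1: "(\<integral>x. f x * vderiv 1 \<psi> x \<partial>branch) = I * t" by simp
    have 2: "(\<integral>x. of_real x * vderiv 1 \<psi> x \<partial>branch) = - I"
    proof -
      have ci: "continuous_on {0..} (\<lambda>x. complex_of_real x)" by (intro continuous_intros)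
      obtain b where b: "b > 0" "\<And>x m. x \<le> 0 \<or> x \<ge> b \<Longrightarrow> vderiv m \<psi> x = 0"
        "\<And>m. (\<integral>x. of_real x * vderiv m \<psi> x \<partial>branch) = integral {0..b} (\<lambda>x. of_real x * vderiv m \<psi> x)"
        by (rule integral_branch_test[OF \<psi> ci]) blast
      have c: "continuous_on S (vderiv m \<psi>)" for S m using test_functions_smooth[OF \<psi>] smooth_continuous_vderiv by blast
      have c0: "continuous_on S \<psi>" for S using c[of S 0] by simp
      have "((\<lambda>x. of_real x * vderiv 1 \<psi> x + 1 * \<psi> x) has_integral of_real b * \<psi> b - of_real 0 * \<psi> 0) {0..b}"
      proof (rule fundamental_theorem_of_calculus)
        have r: "(complex_of_real has_vector_derivative 1) (at x within {0..b})" for x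
          using has_vector_derivative_real_field[of "\<lambda>z. z" 1 x "{0..b}"] by simp
        show "((\<lambda>x. of_real x * \<psi> x) has_vector_derivative of_real x * vderiv 1 \<psi> x + 1 * \<psi> x) (at x within {0..b})" for x
          by (intro has_vector_derivative_mult r has_vector_derivative_at_within[OF smooth_has_derivative] test_functions_smooth \<psi>)
      qed (use b in auto)
      then have "integral {0..b} (\<lambda>x. of_real x * vderiv 1 \<psi> x + \<psi> x) = 0" using b(2)[of b 0] by (simp add: has_integral_iff)
      also have "integral {0..b} (\<lambda>x. of_real x * vderiv 1 \<psi> x + \<psi> x) = integral {0..b} (\<lambda>x. of_real x * vderiv 1 \<psi> x) + integral {0..b} \<psi>"
        by (intro integral_add integrable_continuous_real continuous_intros c c0)
      also have "integral {0..b} \<psi> = I"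
        unfolding I_def using b(2)[of _ 0] by (intro integral_branch_eq[symmetric] c0) auto
      finally show ?thesis using b(3)[of 1] by (simp add: add_eq_0_iff)
    qed
    have "(\<integral>x. (f x + t * of_real x) * vderiv 1 \<psi> x \<partial>branch) = (\<integral>x. f x * vderiv 1 \<psi> x + t * (of_real x * vderiv 1 \<psi> x) \<partial>branch)"
      by (simp add: algebra_simps)
    also have "\<dots> = I * t + t * (- I)"
      using L2_loc_test_integrable[OF f test_functions_vderiv[OF \<psi>]]
        L2_loc_test_integrable[OF continuous_L2_loc test_functions_vderiv[OF \<psi>], of complex_of_real] 1 2
      by (simp add: continuous_on_of_real_id)
    finally show "(\<integral>x. (f x + t * of_real x) * vderiv 1 \<psi> x \<partial>branch) = 0" by simp
  qed
  then obtain \<alpha> where "AE x in branch. f x + t * of_real x = \<alpha>" by blast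
  then have "AE x in branch. f x = \<alpha> + (- t) * of_real x" by eventually_elim (simp add: eq_diff_eq)
  then show ?thesis by blast
qed

section \<open>Functions with a square-integrable second derivative\<close>

lemma measurable_branch_continuous:
  fixes v :: "real \<Rightarrow> complex"
  assumes "continuous_on {0..} v"
  shows "v \<in> borel_measurable branch"
proof -
  have "(\<lambda>x. if x \<in> {0..} then v x else 0) \<in> borel_measurable borel"
    by (rule borel_measurable_continuous_on_if[OF _ assms]) auto
  from borel_measurable_branch[OF this] show ?thesis
    by (rule measurable_cong[THEN iffD1, rotated]) auto
qed

text \<open>A nonnegative function bounded below by e on a half-line has infinite integral. It
  supplies arbitrarily distant points at which boundary terms are small.\<close>

lemma integrable_small_value:
  fixes h :: "real \<Rightarrow> real"
  assumes "integrable branch h" "\<And>x. h x \<ge> 0" "e > 0" "N \<ge> 0"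
  shows "\<exists>x\<ge>N. h x < e"
proof (rule ccontr)
  assume "\<not> ?thesis"
  then have ge: "h x \<ge> e" if "x \<ge> N" for x using that by force
  \<comment> \<open>A length for which the lower bound alone already exceeds the whole integral by
    1.\<close>
  define M where "M = ((\<integral>x. h x \<partial>branch) + 1) / e"
  have M: "M \<ge> 0" unfolding M_def using assms by (intro divide_nonneg_pos add_nonneg_nonneg integral_nonneg_AE) auto
  have s: "{N<..N + M} \<in> sets branch" using assms(4) by (auto simp: sets_branch)
  have em: "emeasure branch {N<..N + M} = ennreal M" using M s by (simp add: emeasure_branch)
  have "integrable branch (\<lambda>x. e * indicat_real {N<..N + M} x)"
    using em s by (intro integrable_mult_right integrable_real_indicator) auto
  then have "(\<integral>x. e * indicat_real {N<..N + M} x \<partial>branch) \<le> (\<integral>x. h x \<partial>branch)"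
    by (rule integral_mono[OF _ assms(1)]) (use ge assms(2) in \<open>auto simp: indicator_def\<close>)
  also have "(\<integral>x. e * indicat_real {N<..N + M} x \<partial>branch) = e * M"
  proof -
    have "{N<..N + M} \<inter> {0<..} = {N<..N + M}" using assms(4) by auto
    then show ?thesis using em s M by (simp add: measure_def)
  qed
  also have "e * M = (\<integral>x. h x \<partial>branch) + 1" using assms(3) by (simp add: M_def)
  finally show False by simp
qed

definition C1_on_halfline :: "(real \<Rightarrow> complex) \<Rightarrow> (real \<Rightarrow> complex) \<Rightarrow> bool" where
  "C1_on_halfline v v' \<longleftrightarrow> continuous_on {0..} v' \<and> (\<forall>x\<ge>0. (v has_vector_derivative v' x) (at x within {0..}))"

text \<open>\<open>regular v v' g\<close>: \<open>v\<close> is the regular representative of an element of \<open>H\<^sup>2\<close>, and \<open>v'\<close>, \<open>g\<close> are its derivatives.\<close>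

definition regular :: "(real \<Rightarrow> complex) \<Rightarrow> (real \<Rightarrow> complex) \<Rightarrow> (real \<Rightarrow> complex) \<Rightarrow> bool" where
  "regular v v' g \<longleftrightarrow> C1_on_halfline v v' \<and> v \<in> L2 branch \<and> v' \<in> L2 branch \<and> g \<in> L2 branch \<and> (\<forall>x\<ge>0. v' x = v' 0 + prim g x)"

lemma C1_on_halfline_continuous:
  assumes "C1_on_halfline v v'"
  shows "continuous_on {0..} v" "continuous_on {0..} v'"
  using assms
  by (auto simp: C1_on_halfline_def continuous_on_eq_continuous_within intro: has_vector_derivative_continuous)

lemma C1_on_halfline_parts:
  assumes v: "C1_on_halfline v v'" and N: "N \<ge> 0"
    and F: "\<And>x. x \<in> {0..N} \<Longrightarrow> (F has_vector_derivative F' x) (at x within {0..N})" and F': "continuous_on {0..N} F'"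
  shows "integral {0..N} (\<lambda>x. v x * F' x) = v N * F N - v 0 * F 0 - integral {0..N} (\<lambda>x. v' x * F x)"
proof -
  have Fc: "continuous_on {0..N} F" using F has_vector_derivative_continuous continuous_on_eq_continuous_within by blast
  have vc: "continuous_on {0..N} v" "continuous_on {0..N} v'"
    using C1_on_halfline_continuous[OF v] by (auto intro: continuous_on_subset)
  have vd: "(v has_vector_derivative v' x) (at x within {0..N})" if "x \<in> {0..N}" for x
    using v that unfolding C1_on_halfline_def by (auto intro: has_vector_derivative_within_subset[of _ _ _ "{0..}"])
  have "((\<lambda>x. v x * F' x + v' x * F x) has_integral v N * F N - v 0 * F 0) {0..N}"
    by (rule fundamental_theorem_of_calculus[OF N]) (rule has_vector_derivative_mult[OF vd F], auto)
  then have "v N * F N - v 0 * F 0 = integral {0..N} (\<lambda>x. v x * F' x + v' x * F x)" by (simp add: has_integral_iff)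
  also have "\<dots> = integral {0..N} (\<lambda>x. v x * F' x) + integral {0..N} (\<lambda>x. v' x * F x)"
    by (intro integral_add integrable_continuous_real continuous_intros vc F' Fc)
  finally show ?thesis by simp
qed

lemma C1_on_halfline_weak:
  assumes v: "C1_on_halfline v v'" and \<phi>: "\<phi> \<in> test_functions"
  shows "(\<integral>x. v x * vderiv (Suc m) \<phi> x \<partial>branch) = - (\<integral>x. v' x * vderiv m \<phi> x \<partial>branch)"
proof -
  obtain b where b: "b > 0" "\<And>x m. x \<le> 0 \<or> x \<ge> b \<Longrightarrow> vderiv m \<phi> x = 0"
    "\<And>m. (\<integral>x. v x * vderiv m \<phi> x \<partial>branch) = integral {0..b} (\<lambda>x. v x * vderiv m \<phi> x)"
    by (rule integral_branch_test[OF \<phi> C1_on_halfline_continuous(1)[OF v]]) blast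
  have c: "continuous_on S (vderiv m \<phi>)" for S m using test_functions_smooth[OF \<phi>] smooth_continuous_vderiv by blast
  have "(\<integral>x. v' x * vderiv m \<phi> x \<partial>branch) = integral {0..b} (\<lambda>x. v' x * vderiv m \<phi> x)"
    using b(2) by (intro integral_branch_eq continuous_intros c continuous_on_subset[OF C1_on_halfline_continuous(2)[OF v]]) auto
  moreover have "integral {0..b} (\<lambda>x. v x * vderiv (Suc m) \<phi> x) = v b * vderiv m \<phi> b - v 0 * vderiv m \<phi> 0 - integral {0..b} (\<lambda>x. v' x * vderiv m \<phi> x)"
    using b(1) smooth_has_derivative'[OF test_functions_smooth[OF \<phi>]]
    by (intro C1_on_halfline_parts[OF v] c) (auto intro: has_vector_derivative_at_within)
  ultimately show ?thesis using b by simp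
qed

lemma prim_weak:
  assumes g: "g \<in> L2 branch" and \<phi>: "\<phi> \<in> test_functions"
  shows "(\<integral>x. g x * \<phi> x \<partial>branch) = - (\<integral>x. prim g x * vderiv 1 \<phi> x \<partial>branch)"
proof -
  obtain b where b: "b > 0" "\<And>x m. x \<le> 0 \<or> x \<ge> b \<Longrightarrow> vderiv m \<phi> x = 0"
    "\<And>m. (\<integral>x. prim g x * vderiv m \<phi> x \<partial>branch) = integral {0..b} (\<lambda>x. prim g x * vderiv m \<phi> x)"
    by (rule integral_branch_test[OF \<phi> prim_continuous[OF g]]) blast
  have c: "continuous_on S (vderiv m \<phi>)" for S m using test_functions_smooth[OF \<phi>] smooth_continuous_vderiv by blast
  have "(\<integral>x. g x * \<phi> x \<partial>branch) = (\<integral>x. cindicator {0..b} x * (g x * \<phi> x) \<partial>branch)"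
    by (intro Bochner_Integration.integral_cong) (use b(2)[of _ 0] in \<open>auto simp: indicator_def\<close>)
  also have "\<dots> = prim g b * \<phi> b - integral {0..b} (\<lambda>x. prim g x * vderiv 1 \<phi> x)"
    using b(1) smooth_has_derivative[OF test_functions_smooth[OF \<phi>]]
    by (intro prim_parts[OF g] c) (auto intro: has_vector_derivative_at_within)
  finally show ?thesis using b(2)[of b 0] b(3)[of 1] by simp
qed

text \<open>v' and the primitive of g have the same pairing with derivatives of test functions, so
  they differ by a constant; at the vertex the primitive is 0.\<close>

lemma weak_second_derivative_prim:
  assumes v: "C1_on_halfline v v'" and g: "g \<in> L2 branch"
    and weak: "\<And>\<phi>. \<phi> \<in> test_functions \<Longrightarrow> (\<integral>x. v x * vderiv 2 \<phi> x \<partial>branch) = (\<integral>x. g x * \<phi> x \<partial>branch)"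
    and "x \<ge> 0"
  shows "v' x = v' 0 + prim g x"
proof -
  have c: "continuous_on {0..} (\<lambda>x. v' x - prim g x)"
    by (intro continuous_intros C1_on_halfline_continuous(2)[OF v] prim_continuous[OF g])
  have "v' x - prim g x = v' 0 - prim g 0"
  proof (rule du_Bois_Reymond_continuous[OF c _ assms(4)])
    fix \<phi> assume \<phi>: "\<phi> \<in> test_functions"
    note int = L2_loc_test_integrable[OF continuous_L2_loc test_functions_vderiv[OF \<phi>, of 1]]
    have "(\<integral>x. v x * vderiv (Suc 1) \<phi> x \<partial>branch) = - (\<integral>x. v' x * vderiv 1 \<phi> x \<partial>branch)" by (rule C1_on_halfline_weak[OF v \<phi>])
    moreover have "(\<integral>x. v x * vderiv (Suc 1) \<phi> x \<partial>branch) = - (\<integral>x. prim g x * vderiv 1 \<phi> x \<partial>branch)"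
      using weak[OF \<phi>] prim_weak[OF g \<phi>] by (simp add: numeral_2_eq_2 One_nat_def)
    ultimately show "(\<integral>x. (v' x - prim g x) * vderiv 1 \<phi> x \<partial>branch) = 0"
      using int[OF C1_on_halfline_continuous(2)[OF v]] int[OF prim_continuous[OF g]] by (simp add: left_diff_distrib)
  qed
  then show ?thesis by (simp add: algebra_simps)
qed

text \<open>Integration by parts for a second derivative that exists only in L^2: the primitive of g
  is replaced by v' - v' 0, and the constant v' 0 is absorbed by the fundamental theorem for
  F.\<close>

lemma regular_parts:
  assumes v: "C1_on_halfline v v'" and g: "g \<in> L2 branch" and vg: "\<And>x. x \<ge> 0 \<Longrightarrow> v' x = v' 0 + prim g x" and N: "N \<ge> 0"
    and F: "\<And>x. x \<in> {0..N} \<Longrightarrow> (F has_vector_derivative F' x) (at x within {0..N})" and F': "continuous_on {0..N} F'"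
  shows "(\<integral>x. cindicator {0..N} x * (g x * F x) \<partial>branch) = v' N * F N - v' 0 * F 0 - integral {0..N} (\<lambda>x. v' x * F' x)"
proof -
  have vc: "continuous_on {0..N} v'" using C1_on_halfline_continuous[OF v] by (auto intro: continuous_on_subset)
  have "(\<integral>x. cindicator {0..N} x * (g x * F x) \<partial>branch) = prim g N * F N - integral {0..N} (\<lambda>x. prim g x * F' x)"
    by (rule prim_parts[OF g N F F'])
  also have "integral {0..N} (\<lambda>x. prim g x * F' x) = integral {0..N} (\<lambda>x. v' x * F' x - v' 0 * F' x)"
  proof (rule Henstock_Kurzweil_Integration.integral_cong)
    fix x assume "x \<in> {0..N}"
    then have "prim g x = v' x - v' 0" using vg[of x] by simp
    then show "prim g x * F' x = v' x * F' x - v' 0 * F' x" by (simp add: left_diff_distrib)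
  qed
  also have "\<dots> = integral {0..N} (\<lambda>x. v' x * F' x) - v' 0 * integral {0..N} F'"
    by (subst integral_diff) (auto intro!: integrable_continuous_real continuous_intros vc F')
  also have "integral {0..N} F' = F N - F 0"
    using fundamental_theorem_of_calculus[OF N F] by (simp add: has_integral_iff)
  also have "prim g N = v' N - v' 0" using vg[OF N] by simp
  finally show ?thesis by (simp add: algebra_simps)
qed

text \<open>If \<open>v'\<close> were not square integrable, the identity \<open>|v'|\<^sup>2 = (v' cnj v)' - g cnj v\<close> would make \<open>(|v|\<^sup>2)'\<close> bounded below by a positive constant.\<close>

lemma regularI:
  assumes v: "C1_on_halfline v v'" and vL: "v \<in> L2 branch" and g: "g \<in> L2 branch" and vg: "\<And>x. x \<ge> 0 \<Longrightarrow> v' x = v' 0 + prim g x"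
  shows "regular v v' g"
proof -
  have vc: "continuous_on {0..} v" "continuous_on {0..} v'" using C1_on_halfline_continuous[OF v] by auto
  have vd: "(v has_vector_derivative v' x) (at x within S)" if "x \<ge> 0" "S \<subseteq> {0..}" for x S
    using v that unfolding C1_on_halfline_def by (auto intro: has_vector_derivative_within_subset[of _ _ _ "{0..}"])
  define J where "J N = integral {0..N} (\<lambda>x. (cmod (v' x))\<^sup>2)" for N
  \<comment> \<open>Bounds what integration by parts leaves besides the term at N: the term at 0,
    and by Cauchy-Schwarz the integral of g times the conjugate of v.\<close>
  define K where "K = cmod (v' 0 * cnj (v 0)) + l2norm branch g * l2norm branch v"
  have Jc: "continuous_on {0..N} (\<lambda>x. (cmod (v' x))\<^sup>2)" for N
    by (intro continuous_intros continuous_on_subset[OF vc(2)]) auto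
  have J: "J N \<le> Re (v' N * cnj (v N)) + K" if N: "N \<ge> 0" for N
  proof -
    have F: "((\<lambda>x. cnj (v x)) has_vector_derivative cnj (v' x)) (at x within {0..N})" if "x \<in> {0..N}" for x
      using bounded_linear.has_vector_derivative[OF bounded_linear_cnj vd] that by auto
    have F': "continuous_on {0..N} (\<lambda>x. cnj (v' x))" by (intro continuous_intros continuous_on_subset[OF vc(2)]) auto
    have e: "(\<integral>x. cindicator {0..N} x * (g x * cnj (v x)) \<partial>branch) = v' N * cnj (v N) - v' 0 * cnj (v 0) - integral {0..N} (\<lambda>x. v' x * cnj (v' x))"
      by (rule regular_parts[OF v g vg N F F'])
    have "integral {0..N} (\<lambda>x. v' x * cnj (v' x)) = of_real (J N)"
    proof -
      from integral_linear[OF integrable_continuous_real[OF Jc] bounded_linear_of_real[where 'a=complex]]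
      have "integral {0..N} (\<lambda>x. complex_of_real ((cmod (v' x))\<^sup>2)) = of_real (J N)" by (simp add: o_def J_def)
      then show ?thesis by (simp only: complex_norm_square)
    qed
    then have "of_real (J N) = v' N * cnj (v N) - v' 0 * cnj (v 0) - (\<integral>x. cindicator {0..N} x * (g x * cnj (v x)) \<partial>branch)"
      using e by simp
    then have "J N = Re (v' N * cnj (v N)) - Re (v' 0 * cnj (v 0)) - Re (\<integral>x. cindicator {0..N} x * (g x * cnj (v x)) \<partial>branch)"
      by (metis Re_complex_of_real minus_complex.simps(1))
    moreover have "cmod (\<integral>x. cindicator {0..N} x * (g x * cnj (v x)) \<partial>branch) \<le> l2norm branch g * l2norm branch v"
    proof -
      have "cmod (\<integral>x. (cindicator {0..N} x * g x) * cnj (v x) \<partial>branch) \<le> (\<integral>x. cmod (g x) * cmod (v x) \<partial>branch)"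
      proof (rule Bochner_Integration.integral_norm_bound_integral)
        show "integrable branch (\<lambda>x. (cindicator {0..N} x * g x) * cnj (v x))"
          by (rule L2_inner_integrable[OF L12_L2[OF L2_truncate[OF g]] vL])
      qed (use L2_mult_norm_integrable[OF g vL] in \<open>auto simp: norm_mult indicator_def\<close>)
      also have "\<dots> \<le> l2norm branch g * l2norm branch v" by (rule L2_Cauchy_Schwarz_norm[OF g vL])
      finally show ?thesis by (simp add: mult.assoc)
    qed
    ultimately show ?thesis
      using complex_Re_le_cmod[of "- (v' 0 * cnj (v 0))"] complex_Re_le_cmod[of "- (\<integral>x. cindicator {0..N} x * (g x * cnj (v x)) \<partial>branch)"]
      unfolding K_def by simp
  qed
  have Jmono: "J M \<le> J N" if "0 \<le> M" "M \<le> N" for M N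
    unfolding J_def using that by (intro integral_subset_le integrable_continuous_real Jc) auto
  have bounded: "J N \<le> K + 1" if N: "N \<ge> 0" for N
  proof (rule ccontr)
    assume "\<not> J N \<le> K + 1"
    then have JN: "J M \<ge> K + 1" if "M \<ge> N" for M using Jmono[OF N that] by linarith
    define f where "f x = (cmod (v x))\<^sup>2" for x
    have fd: "(f has_real_derivative 2 * Re (v' x * cnj (v x))) (at x within {N..M})" if "x \<in> {N..M}" for x M
    proof -
      have "((\<lambda>x. v x * cnj (v x)) has_vector_derivative (v x * cnj (v' x) + v' x * cnj (v x))) (at x within {N..M})"
        using that N by (intro has_vector_derivative_mult bounded_linear.has_vector_derivative[OF bounded_linear_cnj] vd) auto
      from bounded_linear.has_vector_derivative[OF bounded_linear_Re this]
      have "((\<lambda>x. Re (v x * cnj (v x))) has_vector_derivative Re (v x * cnj (v' x) + v' x * cnj (v x))) (at x within {N..M})" .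
      moreover have "(\<lambda>x. Re (v x * cnj (v x))) = f" unfolding f_def cmod_power2 by (simp add: fun_eq_iff power2_eq_square)
      ultimately show ?thesis by (simp add: has_real_derivative_iff_has_vector_derivative algebra_simps)
    qed
    \<comment> \<open>Beyond N the derivative of |v|^2 is at least 2, so one unit further on the
      value stays above 1.\<close>
    have grow: "f M \<ge> 1" if M: "M \<ge> N + 1" for M
    proof -
      have "f N + 2 * (M - N) \<le> f M"
      proof -
        have "\<exists>z\<in>{N<..<M}. f M - f N = (2 * Re (v' z * cnj (v z))) * (M - N)"
        proof (rule mvt_simple)
          show "N < M" using M by simp
          fix x assume "N \<le> x" "x \<le> M"
          then have "(f has_real_derivative 2 * Re (v' x * cnj (v x))) (at x within {N..M})" by (intro fd) auto
          then show "(f has_derivative (*) (2 * Re (v' x * cnj (v x)))) (at x within {N..M})" by (rule has_field_derivative_imp_has_derivative)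
        qed
        then obtain z where z: "N < z" "z < M" "f M - f N = (M - N) * (2 * Re (v' z * cnj (v z)))" by (auto simp: mult.commute)
        have "Re (v' z * cnj (v z)) \<ge> 1" using J[of z] JN[of z] z N by linarith
        then have "(M - N) * 2 \<le> (M - N) * (2 * Re (v' z * cnj (v z)))" using M by (intro mult_left_mono) auto
        then show ?thesis using z(3) by simp
      qed
      then show ?thesis using M by (simp add: f_def) (smt (verit) zero_le_power2)
    qed
    obtain x where "x \<ge> N + 1" "f x < 1"
      using integrable_small_value[OF L2_integrable[OF vL], of 1 "N + 1"] N unfolding f_def by auto
    then show False using grow[of x] by simp
  qed
  have "v' \<in> L2 branch \<and> l2norm branch v' \<le> sqrt (K + 1)"
  proof (rule l2norm_Fatou)
    show L: "(\<lambda>x. cindicator {0..real i} x * v' x) \<in> L2 branch" for i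
      by (rule L12_L2[OF continuous_truncate_L12]) (rule continuous_on_subset[OF vc(2)], auto)
    show "v' \<in> borel_measurable branch" by (rule measurable_branch_continuous[OF vc(2)])
    show "AE x in branch. (\<lambda>i. cindicator {0..real i} x * v' x) \<longlonglongrightarrow> v' x"
    proof (rule AE_branchI)
      fix x :: real assume "x > 0"
      obtain m where "x \<le> real m" using real_arch_simple by blast
      then have "cindicator {0..real i} x * v' x = v' x" if "i \<ge> m" for i using that \<open>x > 0\<close> by (simp add: indicator_def)
      then show "(\<lambda>i. cindicator {0..real i} x * v' x) \<longlonglongrightarrow> v' x"
        by (intro tendsto_eventually) (auto simp: eventually_sequentially)
    qed
    show "l2norm branch (\<lambda>x. cindicator {0..real i} x * v' x) \<le> sqrt (K + 1)" for i
    proof -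
      have "complex_of_real (\<integral>x. (cmod (cindicator {0..real i} x * v' x))\<^sup>2 \<partial>branch) = (\<integral>x. of_real ((cmod (cindicator {0..real i} x * v' x))\<^sup>2) \<partial>branch)"
        by (rule integral_complex_of_real[symmetric])
      also have "\<dots> = (\<integral>x. cindicator {0..real i} x * of_real ((cmod (v' x))\<^sup>2) \<partial>branch)"
        by (intro Bochner_Integration.integral_cong) (auto simp: indicator_def)
      also have "\<dots> = integral {0..real i} (\<lambda>x. of_real ((cmod (v' x))\<^sup>2))"
        by (rule integral_branch_indicator) (intro continuous_on_of_real Jc)
      also have "\<dots> = of_real (J (real i))"
        using integral_linear[OF integrable_continuous_real[OF Jc] bounded_linear_of_real[where 'a=complex], of "real i"] by (simp add: o_def J_def)
      finally have "(\<integral>x. (cmod (cindicator {0..real i} x * v' x))\<^sup>2 \<partial>branch) = J (real i)" by (simp only: of_real_eq_iff)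
      then show ?thesis unfolding l2norm_def using bounded[of "real i"] by (simp only: real_sqrt_le_iff of_nat_0_le_iff)
    qed
  qed
  then show ?thesis unfolding regular_def using v vL g vg by blast
qed

lemma regular_weak_derivs:
  assumes "regular v v' g"
  shows "is_weak_deriv 1 v v'" "is_weak_deriv 2 v g"
proof -
  have v: "C1_on_halfline v v'" and g: "g \<in> L2 branch" and vg: "\<And>x. x \<ge> 0 \<Longrightarrow> v' x = v' 0 + prim g x" using assms unfolding regular_def by blast+
  have 1: "(\<integral>x. v x * vderiv (Suc m) \<phi> x \<partial>branch) = - (\<integral>x. v' x * vderiv m \<phi> x \<partial>branch)" if "\<phi> \<in> test_functions" for \<phi> m
    by (rule C1_on_halfline_weak[OF v that])
  show "is_weak_deriv 1 v v'"
    using 1[of _ 0] by (simp add: is_weak_deriv_def One_nat_def)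
  have "(\<integral>x. v' x * vderiv 1 \<phi> x \<partial>branch) = - (\<integral>x. g x * \<phi> x \<partial>branch)" if \<phi>: "\<phi> \<in> test_functions" for \<phi>
  proof -
    have int: "integrable branch (\<lambda>x. prim g x * vderiv 1 \<phi> x)" "integrable branch (\<lambda>x. v' 0 * vderiv 1 \<phi> x)"
      by (intro L2_loc_test_integrable continuous_L2_loc prim_continuous g test_functions_vderiv \<phi> continuous_on_const)+
    have "(\<integral>x. v' x * vderiv 1 \<phi> x \<partial>branch) = (\<integral>x. v' 0 * vderiv 1 \<phi> x + prim g x * vderiv 1 \<phi> x \<partial>branch)"
    proof (rule Bochner_Integration.integral_cong[OF refl])
      fix x :: real assume "x \<in> space branch"
      then have "v' x = v' 0 + prim g x" by (intro vg) simp
      then show "v' x * vderiv 1 \<phi> x = v' 0 * vderiv 1 \<phi> x + prim g x * vderiv 1 \<phi> x" by (simp only: distrib_right)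
    qed
    also have "\<dots> = (\<integral>x. v' 0 * vderiv 1 \<phi> x \<partial>branch) + (\<integral>x. prim g x * vderiv 1 \<phi> x \<partial>branch)"
      by (rule Bochner_Integration.integral_add[OF int(2,1)])
    also have "(\<integral>x. prim g x * vderiv 1 \<phi> x \<partial>branch) = - (\<integral>x. g x * \<phi> x \<partial>branch)" using prim_weak[OF g \<phi>] by simp
    also have "(\<integral>x. v' 0 * vderiv 1 \<phi> x \<partial>branch) = 0"
      using C1_on_halfline_weak[of "\<lambda>x. v' 0" "\<lambda>x. 0" \<phi> 0] \<phi> by (simp add: C1_on_halfline_def One_nat_def)
    finally show ?thesis by simp
  qed
  then show "is_weak_deriv 2 v g"
    using 1[of _ 1] by (simp add: is_weak_deriv_def numeral_2_eq_2 One_nat_def)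
qed

section \<open>The transform diagonalizes the operator\<close>

context star_network
begin

definition F_deriv :: "real \<Rightarrow> nat \<Rightarrow> nat \<Rightarrow> real \<Rightarrow> complex" where
  "F_deriv \<mu> k m x = (let q = xi c a m (of_real \<mu>) in
     if m = k then - q * sin (q * of_real x) - \<i> * s n c a k (of_real \<mu>) * (q * cos (q * of_real x))
     else - \<i> * q * exp (- \<i> * q * of_real x))"

lemma F_minus_has_derivative:
  "(F_minus n c a (of_real \<mu>) k m has_vector_derivative F_deriv \<mu> k m x) (at x within S)"
proof (cases "m = k")
  case True
  show ?thesis
    unfolding F_minus_def[abs_def] F_deriv_def Let_def using True
    by (intro has_vector_derivative_real_field[where f="\<lambda>x. if m = k then cos (xi c a k (of_real \<mu>) * x) - \<i> * s n c a k (of_real \<mu>) * sin (xi c a k (of_real \<mu>) * x) else exp (- \<i> * xi c a m (of_real \<mu>) * x)"])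
       (auto intro!: derivative_eq_intros)
next
  case False
  show ?thesis
    unfolding F_minus_def[abs_def] F_deriv_def Let_def using False
    by (intro has_vector_derivative_real_field[where f="\<lambda>x. if m = k then cos (xi c a k (of_real \<mu>) * x) - \<i> * s n c a k (of_real \<mu>) * sin (xi c a k (of_real \<mu>) * x) else exp (- \<i> * xi c a m (of_real \<mu>) * x)"])
       (auto intro!: derivative_eq_intros)
qed

lemma F_deriv_has_derivative:
  "(F_deriv \<mu> k m has_vector_derivative - ((xi c a m (of_real \<mu>))\<^sup>2 * F_minus n c a (of_real \<mu>) k m x)) (at x within S)"
proof (cases "m = k")
  case True
  define q where "q = xi c a k (of_real \<mu>)"
  define t where "t = s n c a k (of_real \<mu>)"
  have "((\<lambda>x. - q * sin (q * of_real x) - \<i> * t * (q * cos (q * of_real x))) has_vector_derivative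
     - (q\<^sup>2 * (cos (q * of_real x) - \<i> * t * sin (q * of_real x)))) (at x within S)"
    by (intro has_vector_derivative_real_field[where f="\<lambda>x. - q * sin (q * x) - \<i> * t * (q * cos (q * x))"])
       (auto intro!: derivative_eq_intros simp: power2_eq_square algebra_simps)
  then show ?thesis using True by (simp add: F_deriv_def[abs_def] F_minus_def q_def t_def Let_def)
next
  case False
  define q where "q = xi c a m (of_real \<mu>)"
  have "((\<lambda>x. - \<i> * q * exp (- \<i> * q * of_real x)) has_vector_derivative - (q\<^sup>2 * exp (- \<i> * q * of_real x))) (at x within S)"
    by (intro has_vector_derivative_real_field[where f="\<lambda>x. - \<i> * q * exp (- \<i> * q * x)"])
       (auto intro!: derivative_eq_intros simp: power2_eq_square algebra_simps)
  then show ?thesis using False by (simp add: F_deriv_def[abs_def] F_minus_def q_def Let_def)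
qed

lemma F_deriv_continuous: "continuous_on S (F_deriv \<mu> k m)"
  using F_deriv_has_derivative has_vector_derivative_continuous by (blast intro: continuous_at_imp_continuous_on)

lemma F_deriv_bounded:
  assumes k: "k \<in> {1..n}" and m: "m \<in> {1..n}" and "a k < \<mu>"
  shows "\<exists>C. \<forall>x\<ge>0. cmod (F_deriv \<mu> k m x) \<le> C"
proof (cases "m = k")
  case True
  define q where "q = sqrt ((\<mu> - a k) / c k)"
  define t where "t = s n c a k (of_real \<mu>)"
  have "cmod (F_deriv \<mu> k m x) \<le> cmod q + cmod t * cmod q" for x
  proof -
    have "cmod (sin (of_real q * complex_of_real x)) \<le> 1"
      using norm_sin_le_exp[of "of_real q * of_real x"] by simp
    moreover have "cmod (cos (of_real q * complex_of_real x)) \<le> 1"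
      unfolding of_real_mult[symmetric] cos_of_real norm_of_real by (rule abs_cos_le_one)
    ultimately have "cmod (of_real q * sin (of_real q * complex_of_real x)) \<le> cmod q * 1" "cmod (t * (of_real q * cos (of_real q * complex_of_real x))) \<le> cmod t * (cmod q * 1)"
      unfolding norm_mult norm_of_real real_norm_def by (intro mult_left_mono; simp)+
    then show ?thesis
      using norm_triangle_ineq4[of "- of_real q * sin (of_real q * complex_of_real x)" "\<i> * t * (of_real q * cos (of_real q * complex_of_real x))"] True
      by (simp add: F_deriv_def Let_def xi_real_pos(1)[OF k assms(3)] q_def[symmetric] t_def[symmetric] norm_mult)
  qed
  then show ?thesis by blast
next
  case False
  have "cmod (F_deriv \<mu> k m x) \<le> cmod (xi c a m (of_real \<mu>)) * 1" if "x \<ge> 0" for x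
    using mult_left_mono[OF norm_exp_Xi_le[OF m that, of \<mu>], of "cmod (xi c a m (of_real \<mu>))"] False
    by (simp add: F_deriv_def Let_def norm_mult)
  then show ?thesis by blast
qed

lemma F_minus_0: "F_minus n c a z k m 0 = 1"
  by (simp add: F_minus_def)

text \<open>The coefficient s_k is made for this: the derivatives at the vertex are - \<i> s_k
  \<xi>_k on branch k and - \<i> \<xi>_m on the others, and s_k balances the weighted sum.\<close>

lemma F_deriv_flux:
  assumes k: "k \<in> {1..n}" and "a k < \<mu>"
  shows "(\<Sum>m\<in>{1..n}. of_real (c m) * F_deriv \<mu> k m 0) = 0"
proof -
  have nz: "of_real (c k) * xi c a k (of_real \<mu>) \<noteq> 0" using xi_real_pos[OF assms] c_pos[OF k] by (metis less_irrefl mult_eq_0_iff of_real_eq_0_iff)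
  have "(\<Sum>m\<in>{1..n}. of_real (c m) * F_deriv \<mu> k m 0) = of_real (c k) * F_deriv \<mu> k k 0 + (\<Sum>m\<in>{1..n} - {k}. of_real (c m) * F_deriv \<mu> k m 0)"
    using k by (subst sum.remove[of _ k]) auto
  also have "(\<Sum>m\<in>{1..n} - {k}. of_real (c m) * F_deriv \<mu> k m 0) = - \<i> * (\<Sum>m\<in>{1..n} - {k}. of_real (c m) * xi c a m (of_real \<mu>))"
    unfolding sum_distrib_left by (intro sum.cong) (auto simp: F_deriv_def Let_def)
  also have "of_real (c k) * F_deriv \<mu> k k 0 = - \<i> * (s n c a k (of_real \<mu>) * (of_real (c k) * xi c a k (of_real \<mu>)))"
    by (simp add: F_deriv_def Let_def)
  also have "s n c a k (of_real \<mu>) * (of_real (c k) * xi c a k (of_real \<mu>)) = - (\<Sum>m\<in>{1..n} - {k}. of_real (c m) * xi c a m (of_real \<mu>))"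
    unfolding s_def using nz by simp
  finally show ?thesis by simp
qed

text \<open>Two integrations by parts on \<open>{0..N}\<close>. The conjugated eigenfunction solves
  - c_m F'' + a_m F = \<mu> F for real \<mu>, so all interior terms cancel and the Wronskians at 0
  and N remain.\<close>

lemma Green_identity:
  fixes \<mu> :: real and k :: nat
  assumes reg: "regular v v' g" and m: "m \<in> {1..n}" and N: "N \<ge> 0"
  defines "F \<equiv> (\<lambda>x. cnj (F_minus n c a (of_real \<mu>) k m x))" and "F' \<equiv> (\<lambda>x. cnj (F_deriv \<mu> k m x))"
  shows "(\<integral>x. cindicator {0..N} x * (- of_real (c m) * g x + of_real (a m) * v x) * F x \<partial>branch)
      - of_real \<mu> * (\<integral>x. cindicator {0..N} x * v x * F x \<partial>branch)
    = of_real (c m) * (v' 0 * F 0 - v 0 * F' 0) - of_real (c m) * (v' N * F N - v N * F' N)"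
proof -
  have v: "C1_on_halfline v v'" and vL: "v \<in> L2 branch" and g: "g \<in> L2 branch" and vg: "\<And>x. x \<ge> 0 \<Longrightarrow> v' x = v' 0 + prim g x"
    using reg unfolding regular_def by blast+
  have Fd: "(F has_vector_derivative F' x) (at x within S)" for x S
    unfolding F_def F'_def by (rule bounded_linear.has_vector_derivative[OF bounded_linear_cnj F_minus_has_derivative])
  have c0: "c m \<noteq> 0" using c_pos[OF m] by simp
  have xi2: "(xi c a m (of_real \<mu>))\<^sup>2 = of_real ((\<mu> - a m) / c m)" by (simp add: xi_def)
  have F'd: "(F' has_vector_derivative - (of_real ((\<mu> - a m) / c m) * F x)) (at x within S)" for x S
  proof -
    have "cnj (- ((xi c a m (of_real \<mu>))\<^sup>2 * F_minus n c a (of_real \<mu>) k m x)) = - (of_real ((\<mu> - a m) / c m) * F x)"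
      unfolding xi2 F_def by simp
    then show ?thesis
      using bounded_linear.has_vector_derivative[OF bounded_linear_cnj F_deriv_has_derivative[of \<mu> k m x S]] unfolding F'_def by simp
  qed
  have Fc: "continuous_on S F" "continuous_on S F'" for S
    unfolding F_def F'_def by (intro continuous_intros continuous_F_minus F_deriv_continuous)+
  have vc: "continuous_on {0..N} v" using C1_on_halfline_continuous[OF v] by (auto intro: continuous_on_subset)
  define I where "I = (\<integral>x. cindicator {0..N} x * (v x * F x) \<partial>branch)"
  have I: "I = integral {0..N} (\<lambda>x. v x * F x)" unfolding I_def by (intro integral_branch_indicator continuous_intros vc Fc)
  define G where "G = (\<integral>x. cindicator {0..N} x * (g x * F x) \<partial>branch)"
  have "G = v' N * F N - v' 0 * F 0 - integral {0..N} (\<lambda>x. v' x * F' x)"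
    unfolding G_def by (rule regular_parts[OF v g vg N Fd Fc(2)])
  also have "integral {0..N} (\<lambda>x. v' x * F' x) = v N * F' N - v 0 * F' 0 - integral {0..N} (\<lambda>x. v x * - (of_real ((\<mu> - a m) / c m) * F x))"
  proof -
    have cf: "continuous_on {0..N} (\<lambda>x. - (of_real ((\<mu> - a m) / c m) * F x))" by (intro continuous_intros Fc)
    show ?thesis unfolding C1_on_halfline_parts[OF v N F'd cf] by simp
  qed
  also have "integral {0..N} (\<lambda>x. v x * - (of_real ((\<mu> - a m) / c m) * F x)) = integral {0..N} (\<lambda>x. (- of_real ((\<mu> - a m) / c m)) * (v x * F x))"
    by (simp add: mult_ac)
  also have "\<dots> = (- of_real ((\<mu> - a m) / c m)) * I" unfolding I by (rule integral_mult_right)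
  finally have G0: "G = v' N * F N - v' 0 * F 0 - (v N * F' N - v 0 * F' 0 - - of_real ((\<mu> - a m) / c m) * I)" .
  have gen: "C * (A - B - (P - Q - - (d / C) * J)) = C * (A - P) - C * (B - Q) - d * J" if "C \<noteq> 0" for A B C P Q d J :: complex
    using that by (simp add: field_simps)
  have G: "of_real (c m) * G = of_real (c m) * (v' N * F N - v N * F' N) - of_real (c m) * (v' 0 * F 0 - v 0 * F' 0) - of_real (\<mu> - a m) * I"
    unfolding G0 of_real_divide by (rule gen) (use c0 in simp)
  have Fb: "F \<in> borel_measurable branch" by (intro borel_measurable_branch borel_measurable_continuous_onI Fc)
  obtain C where "\<And>x. x \<in> {0..N} \<Longrightarrow> cmod (F x) \<le> C"
    using compact_imp_bounded[OF compact_continuous_image[OF Fc(1) compact_Icc[of 0 N]]] by (force simp: bounded_iff)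
  then have C: "cmod (cindicator {0..N} x * F x) \<le> \<bar>C\<bar>" for x by (cases "x \<in> {0..N}") force+
  have T: "(\<lambda>x. cindicator {0..N} x * F x) \<in> borel_measurable branch"
    by (intro borel_measurable_times Fb borel_measurable_branch) auto
  have int: "integrable branch (\<lambda>x. cindicator {0..N} x * (h x * F x))" if "h \<in> L2 branch" for h
  proof -
    have "integrable branch (\<lambda>x. (cindicator {0..N} x * h x) * (cindicator {0..N} x * F x))"
      by (rule L12_bounded_mult(1)[OF L2_truncate[OF that] C T])
    moreover have "(\<lambda>x. (cindicator {0..N} x * h x) * (cindicator {0..N} x * F x)) = (\<lambda>x. cindicator {0..N} x * (h x * F x))"
      by (auto simp: fun_eq_iff indicator_def)
    ultimately show ?thesis by simp
  qed
  have "(\<integral>x. cindicator {0..N} x * (- of_real (c m) * g x + of_real (a m) * v x) * F x \<partial>branch)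
      = (\<integral>x. (- of_real (c m)) * (cindicator {0..N} x * (g x * F x)) + of_real (a m) * (cindicator {0..N} x * (v x * F x)) \<partial>branch)"
    by (simp add: algebra_simps)
  also have "\<dots> = (- of_real (c m)) * G + of_real (a m) * I"
    unfolding G_def I_def using int[OF g] int[OF vL] by simp
  finally have E: "(\<integral>x. cindicator {0..N} x * (- of_real (c m) * g x + of_real (a m) * v x) * F x \<partial>branch) = (- of_real (c m)) * G + of_real (a m) * I" .
  have I': "(\<integral>x. cindicator {0..N} x * v x * F x \<partial>branch) = I" by (simp add: I_def mult.assoc)
  show ?thesis unfolding E I' using G by (simp add: algebra_simps)
qed

definition truncate :: "real \<Rightarrow> (nat \<Rightarrow> real \<Rightarrow> complex) \<Rightarrow> nat \<Rightarrow> real \<Rightarrow> complex" where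
  "truncate N f m x = cindicator {0..N} x * f m x"

lemma truncate_L12_tuples: "f \<in> H n \<Longrightarrow> truncate N f \<in> L12_tuples"
  by (auto simp: truncate_def[abs_def] L12_tuples_def H_def prod_L2_def intro!: L2_truncate)

lemma truncate_tendsto:
  assumes f: "f \<in> H n" and N: "\<And>i::nat. N i \<ge> real i"
  shows "(\<lambda>i. normH (\<lambda>k x. truncate (N i) f k x - f k x)) \<longlonglongrightarrow> 0"
  unfolding prod_L2_norm_tendsto_0_iff
proof
  fix k assume k: "k \<in> {1..n}"
  then have fk: "f k \<in> L2 branch" using f by (simp add: H_def prod_L2_def)
  show "(\<lambda>i. l2norm branch (\<lambda>x. truncate (N i) f k x - f k x)) \<longlonglongrightarrow> 0"
  proof (rule l2norm_dominated)
    show "truncate (N i) f k \<in> borel_measurable branch" for i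
      using truncate_L12_tuples[OF f, of "N i"] k L12_L2 L2_measurable unfolding L12_tuples_def by blast
    show "AE x in branch. cmod (truncate (N i) f k x - f k x) \<le> cmod (f k x)" for i
      by (intro AE_branchI) (auto simp: truncate_def indicator_def)
    show "AE x in branch. (\<lambda>i. truncate (N i) f k x) \<longlonglongrightarrow> f k x"
    proof (rule AE_branchI)
      fix x :: real assume x: "x > 0"
      obtain m where m: "x \<le> real m" using real_arch_simple by blast
      have "truncate (N i) f k x = f k x" if "i \<ge> m" for i
      proof -
        have "real m \<le> real i" using that by simp
        then have "x \<le> N i" using m N[of i] by linarith
        then show ?thesis using x by (simp add: truncate_def)
      qed
      then show "(\<lambda>i. truncate (N i) f k x) \<longlonglongrightarrow> f k x"
        by (intro tendsto_eventually) (auto simp: eventually_sequentially)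
    qed
  qed (use L2_measurable[OF fk] L2_integrable[OF fk] in auto)
qed

lemma V_cong_AE:
  assumes "u \<in> H n" "v \<in> H n" "\<And>k. k \<in> {1..n} \<Longrightarrow> AE x in branch. u k x = v k x" "k \<in> {1..n}"
  shows "AE \<mu> in sigma_measure n c a k. V n c a u k \<mu> = V n c a v k \<mu>"
proof (rule AE_eq_of_normS_eq_0[OF V_in_L2_sigma[OF assms(1)] V_in_L2_sigma[OF assms(2)] _ assms(4)])
  have "normH (\<lambda>k x. u k x - v k x) = 0"
    using assms(3) by (intro prod_L2_norm_eq_0) (auto elim: eventually_mono)
  then show "normS (\<lambda>k \<mu>. V n c a u k \<mu> - V n c a v k \<mu>) = 0" by (simp add: V_dist assms)
qed

text \<open>The squares of all v k and v' k are added to one integrable function; far out it takes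
  small values, so a single sequence serves all branches and both terms.\<close>

lemma vanishing_sequence:
  assumes "\<And>k. k \<in> {1..n} \<Longrightarrow> regular (v k) (v' k) (g k)"
  obtains N where "\<And>i::nat. N i \<ge> real i"
    "\<And>k. k \<in> {1..n} \<Longrightarrow> (\<lambda>i. v k (N i)) \<longlonglongrightarrow> 0" "\<And>k. k \<in> {1..n} \<Longrightarrow> (\<lambda>i. v' k (N i)) \<longlonglongrightarrow> 0"
proof -
  define h where "h x = (\<Sum>k\<in>{1..n}. (cmod (v k x))\<^sup>2 + (cmod (v' k x))\<^sup>2)" for x
  have "integrable branch h"
    unfolding h_def using assms by (intro Bochner_Integration.integrable_sum Bochner_Integration.integrable_add L2_integrable) (auto simp: regular_def)
  moreover have "h x \<ge> 0" for x unfolding h_def by (intro sum_nonneg) auto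
  ultimately have "\<exists>x\<ge>real i. h x < inverse (real (Suc i))" for i by (intro integrable_small_value) auto
  then obtain N where N: "\<And>i. N i \<ge> real i" "\<And>i. h (N i) < inverse (real (Suc i))" by metis
  have lim: "(\<lambda>i. f (N i)) \<longlonglongrightarrow> 0" if le: "\<And>x. (cmod (f x))\<^sup>2 \<le> h x" for f :: "real \<Rightarrow> complex"
  proof -
    have "(\<lambda>i. (cmod (f (N i)))\<^sup>2) \<longlonglongrightarrow> 0"
    proof (rule tendsto_sandwich[OF always_eventually always_eventually tendsto_const LIMSEQ_inverse_real_of_nat])
      show "\<forall>i. (cmod (f (N i)))\<^sup>2 \<le> inverse (real (Suc i))" using le N(2) by (meson less_imp_le order_trans)
    qed simp
    from tendsto_real_sqrt[OF this] show ?thesis by (simp add: tendsto_norm_zero_iff)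
  qed
  have le: "(cmod (v k x))\<^sup>2 + (cmod (v' k x))\<^sup>2 \<le> h x" if "k \<in> {1..n}" for k x
    unfolding h_def by (rule member_le_sum[OF that]) auto
  have 1: "(cmod (v k x))\<^sup>2 \<le> h x" if "k \<in> {1..n}" for k x
    using le[OF that, of x] zero_le_power2[of "cmod (v' k x)"] by linarith
  have 2: "(cmod (v' k x))\<^sup>2 \<le> h x" if "k \<in> {1..n}" for k x
    using le[OF that, of x] zero_le_power2[of "cmod (v k x)"] by linarith
  show ?thesis by (rule that[OF N(1) lim[OF 1] lim[OF 2]])
qed

text \<open>At the vertex the boundary terms cancel: the eigenfunctions equal 1 there, which leaves
  the flux of v, and the common value of v is a factor of the flux of the eigenfunction. At N the
  eigenfunctions and their derivatives are bounded for fixed \<mu> while v and v' tend to 0 along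
  the sequence.\<close>

lemma V_operator:
  assumes reg: "\<And>k. k \<in> {1..n} \<Longrightarrow> regular (v k) (v' k) (g k)"
    and T0: "\<And>i k. i \<in> {1..n} \<Longrightarrow> k \<in> {1..n} \<Longrightarrow> v i 0 = v k 0"
    and T1: "(\<Sum>k\<in>{1..n}. of_real (c k) * v' k 0) = 0" and k: "k \<in> {1..n}"
  shows "AE \<mu> in sigma_measure n c a k.
    V n c a (\<lambda>m x. - of_real (c m) * g m x + of_real (a m) * v m x) k \<mu> = of_real \<mu> * V n c a v k \<mu>"
proof -
  define y where "y m x = - of_real (c m) * g m x + of_real (a m) * v m x" for m x
  have L: "v m \<in> L2 branch" "g m \<in> L2 branch" if "m \<in> {1..n}" for m using reg[OF that] by (auto simp: regular_def)
  have v: "v \<in> H n" using L by (simp add: H_def prod_L2_def)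
  have yH: "y \<in> H n" unfolding y_def[abs_def] H_def prod_L2_def using L by (auto intro!: L2_diff L2_cmult)
  obtain N where N: "\<And>i::nat. N i \<ge> real i"
    "\<And>k. k \<in> {1..n} \<Longrightarrow> (\<lambda>i. v k (N i)) \<longlonglongrightarrow> 0" "\<And>k. k \<in> {1..n} \<Longrightarrow> (\<lambda>i. v' k (N i)) \<longlonglongrightarrow> 0"
    by (rule vanishing_sequence[OF reg]) blast+
  have N0: "N i \<ge> 0" for i using N(1)[of i] by (meson of_nat_0_le_iff order_trans)
  define B where "B \<mu> i = (\<Sum>m\<in>{1..n}. of_real (c m) * (v' m (N i) * cnj (F_minus n c a (of_real \<mu>) k m (N i)) - v m (N i) * cnj (F_deriv \<mu> k m (N i))))" for \<mu> i
  have diff: "V_test n c a (truncate (N i) y) k \<mu> - of_real \<mu> * V_test n c a (truncate (N i) v) k \<mu> = - B \<mu> i" if \<mu>: "a k < \<mu>" for i \<mu>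
  proof -
    have "V_test n c a (truncate (N i) y) k \<mu> - of_real \<mu> * V_test n c a (truncate (N i) v) k \<mu>
      = (\<Sum>m\<in>{1..n}. (\<integral>x. cindicator {0..N i} x * (- of_real (c m) * g m x + of_real (a m) * v m x) * cnj (F_minus n c a (of_real \<mu>) k m x) \<partial>branch)
          - of_real \<mu> * (\<integral>x. cindicator {0..N i} x * v m x * cnj (F_minus n c a (of_real \<mu>) k m x) \<partial>branch))"
      by (simp add: V_test_def truncate_def y_def sum_subtractf sum_distrib_left)
    also have "\<dots> = (\<Sum>m\<in>{1..n}. of_real (c m) * (v' m 0 * cnj (F_minus n c a (of_real \<mu>) k m 0) - v m 0 * cnj (F_deriv \<mu> k m 0))
        - of_real (c m) * (v' m (N i) * cnj (F_minus n c a (of_real \<mu>) k m (N i)) - v m (N i) * cnj (F_deriv \<mu> k m (N i))))"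
      by (intro sum.cong refl Green_identity reg N0)
    also have "\<dots> = (\<Sum>m\<in>{1..n}. of_real (c m) * v' m 0) - (\<Sum>m\<in>{1..n}. v m 0 * cnj (of_real (c m) * F_deriv \<mu> k m 0)) - B \<mu> i"
      unfolding B_def sum_subtractf[symmetric] by (intro sum.cong) (auto simp: F_minus_0 algebra_simps)
    also have "(\<Sum>m\<in>{1..n}. v m 0 * cnj (of_real (c m) * F_deriv \<mu> k m 0)) = (\<Sum>m\<in>{1..n}. v k 0 * cnj (of_real (c m) * F_deriv \<mu> k m 0))"
      by (intro sum.cong refl arg_cong2[where f="(*)"] T0 k)
    also have "\<dots> = v k 0 * cnj (\<Sum>m\<in>{1..n}. of_real (c m) * F_deriv \<mu> k m 0)"
      unfolding cnj_sum sum_distrib_left ..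
    finally show ?thesis by (simp only: T1 F_deriv_flux[OF k \<mu>]) simp
  qed
  have B0: "B \<mu> \<longlonglongrightarrow> 0" if \<mu>: "a k < \<mu>" for \<mu>
  proof -
    have z: "(\<lambda>i. f (N i) * cnj (G (N i))) \<longlonglongrightarrow> 0" if f: "(\<lambda>i. f (N i)) \<longlonglongrightarrow> 0" and G: "\<exists>C. \<forall>x\<ge>0. cmod (G x) \<le> C" for f G :: "real \<Rightarrow> complex"
    proof -
      obtain C where C: "\<And>x. x \<ge> 0 \<Longrightarrow> cmod (G x) \<le> C" using G by blast
      have "\<forall>\<^sub>F i in sequentially. cmod (f (N i) * cnj (G (N i))) \<le> cmod (f (N i)) * C"
        using C[OF N0] by (simp add: norm_mult mult_left_mono)
      moreover have "(\<lambda>i. cmod (f (N i)) * C) \<longlonglongrightarrow> 0"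
        using tendsto_mult_right[OF tendsto_norm_zero[OF f], of C] by simp
      ultimately show ?thesis by (rule Lim_null_comparison)
    qed
    have "B \<mu> \<longlonglongrightarrow> (\<Sum>m\<in>{1..n}. of_real (c m) * (0 - 0))"
      unfolding B_def[abs_def]
      by (intro tendsto_intros z N F_minus_bounded F_deriv_bounded k \<mu>)
    then show ?thesis by simp
  qed
  \<comment> \<open>The transforms of the truncations converge in norm only; two successive
    subsequences give convergence almost everywhere for both tuples simultaneously.\<close>
  obtain r1 :: "nat \<Rightarrow> nat" where r1: "strict_mono r1" "AE \<mu> in sigma_measure n c a k. (\<lambda>i. V n c a (truncate (N (r1 i)) y) k \<mu>) \<longlonglongrightarrow> V n c a y k \<mu>"
    using V_AE_subsequence[OF L12_tuples_H[OF truncate_L12_tuples[OF yH]] yH truncate_tendsto[OF yH, of N, OF N(1)] k] by blast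
  have "(\<lambda>i. normH (\<lambda>k x. truncate (N (r1 i)) v k x - v k x)) \<longlonglongrightarrow> 0"
    using LIMSEQ_subseq_LIMSEQ[OF truncate_tendsto[OF v, of N, OF N(1)] r1(1)] by (simp add: o_def)
  from V_AE_subsequence[OF L12_tuples_H[OF truncate_L12_tuples[OF v]] v this k]
  obtain r2 :: "nat \<Rightarrow> nat" where r2: "strict_mono r2" "AE \<mu> in sigma_measure n c a k. (\<lambda>i. V n c a (truncate (N (r1 (r2 i))) v) k \<mu>) \<longlonglongrightarrow> V n c a v k \<mu>" by blast
  have "AE \<mu> in sigma_measure n c a k. \<forall>i. V n c a (truncate (N i) y) k \<mu> = V_test n c a (truncate (N i) y) k \<mu>"
    unfolding AE_all_countable using V_eq_V_test[OF truncate_L12_tuples[OF yH] k] by blast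
  moreover have "AE \<mu> in sigma_measure n c a k. \<forall>i. V n c a (truncate (N i) v) k \<mu> = V_test n c a (truncate (N i) v) k \<mu>"
    unfolding AE_all_countable using V_eq_V_test[OF truncate_L12_tuples[OF v] k] by blast
  moreover have "AE \<mu> in sigma_measure n c a k. a k < \<mu>" by (rule AE_sigma_measureI)
  ultimately have "AE \<mu> in sigma_measure n c a k. V n c a y k \<mu> = of_real \<mu> * V n c a v k \<mu>"
    using r1(2) r2(2)
  proof eventually_elim
    case (elim \<mu>)
    have "(\<lambda>i. V n c a (truncate (N (r1 (r2 i))) y) k \<mu> - of_real \<mu> * V n c a (truncate (N (r1 (r2 i))) v) k \<mu>) \<longlonglongrightarrow> V n c a y k \<mu> - of_real \<mu> * V n c a v k \<mu>"
      using LIMSEQ_subseq_LIMSEQ[OF elim(4) r2(1)] by (intro tendsto_intros elim(5)) (simp add: o_def)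
    moreover have "(\<lambda>i. V n c a (truncate (N (r1 (r2 i))) y) k \<mu> - of_real \<mu> * V n c a (truncate (N (r1 (r2 i))) v) k \<mu>) = (\<lambda>i. - B \<mu> (r1 (r2 i)))"
      using diff[OF elim(3)] elim(1,2) by simp
    moreover have "(\<lambda>i. - B \<mu> (r1 (r2 i))) \<longlonglongrightarrow> 0"
      using tendsto_minus[OF LIMSEQ_subseq_LIMSEQ[OF LIMSEQ_subseq_LIMSEQ[OF B0[OF elim(3)] r1(1)] r2(1)]] by (simp add: o_def)
    ultimately have "V n c a y k \<mu> - of_real \<mu> * V n c a v k \<mu> = 0" using LIMSEQ_unique by metis
    then show ?case by simp
  qed
  then show ?thesis by (simp add: y_def[abs_def])
qed

lemma vector_derivative_at_0:
  fixes v v' :: "real \<Rightarrow> complex"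
  assumes "(v has_vector_derivative d) (at 0 within {0..})"
  shows "vector_derivative v (at 0 within {0..}) = d"
  using assms by (intro vector_derivative_within) (simp_all add: at_within_Ici_at_right)

text \<open>Replaces a class by functions to which integration by parts applies. The third component
  is the representative chosen by \<open>weak_deriv\<close>, since this is the one occurring in
  \<open>A\<close>.\<close>

lemma dom_A_regular:
  assumes "u \<in> dom_A n c"
  obtains v v' where "\<And>k. k \<in> {1..n} \<Longrightarrow> regular (v k) (v' k) (weak_deriv 2 (u k))"
    "\<And>k. k \<in> {1..n} \<Longrightarrow> AE x in branch. v k x = u k x"
    "\<And>i k. i \<in> {1..n} \<Longrightarrow> k \<in> {1..n} \<Longrightarrow> v i 0 = v k 0" "(\<Sum>k\<in>{1..n}. of_real (c k) * v' k 0) = 0"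
proof -
  obtain v where H2: "\<And>k. k \<in> {1..n} \<Longrightarrow> u k \<in> H2" and v: "\<And>k. k \<in> {1..n} \<Longrightarrow> AE x in branch. v k x = u k x" "T0 n v" "T1 n c v"
    using assms unfolding dom_A_def by blast
  have "\<forall>k\<in>{1..n}. \<exists>f'. C1_on_halfline (v k) f'"
    using v(3) unfolding T1_def C1_halfline_def C1_on_halfline_def by blast
  from bchoice[OF this] obtain v' where v': "\<And>k. k \<in> {1..n} \<Longrightarrow> C1_on_halfline (v k) (v' k)" by blast
  have r: "regular (v k) (v' k) (weak_deriv 2 (u k))" if k: "k \<in> {1..n}" for k
  proof -
    have u2: "u k \<in> L2 branch" using H2[OF k] by (simp add: H2_def)
    have "\<exists>g. g \<in> L2 branch \<and> is_weak_deriv 2 (u k) g" using H2[OF k] by (auto simp: H2_def)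
    from someI_ex[OF this] have g: "weak_deriv 2 (u k) \<in> L2 branch" "is_weak_deriv 2 (u k) (weak_deriv 2 (u k))"
      unfolding weak_deriv_def by auto
    have m: "v k \<in> borel_measurable branch" by (rule measurable_branch_continuous[OF C1_on_halfline_continuous(1)[OF v'[OF k]]])
    have ae: "AE x in branch. u k x = v k x" using v(1)[OF k] by eventually_elim simp
    have vL: "v k \<in> L2 branch" by (rule L2_cong_AE[OF u2 m ae])
    have weak: "(\<integral>x. v k x * vderiv 2 \<phi> x \<partial>branch) = (\<integral>x. weak_deriv 2 (u k) x * \<phi> x \<partial>branch)" if \<phi>: "\<phi> \<in> test_functions" for \<phi>
    proof -
      have mt: "vderiv 2 \<phi> \<in> borel_measurable branch" using L2_measurable[OF test_functions_L2[OF test_functions_vderiv[OF \<phi>]]] .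
      have "(\<integral>x. v k x * vderiv 2 \<phi> x \<partial>branch) = (\<integral>x. u k x * vderiv 2 \<phi> x \<partial>branch)"
        by (rule integral_cong_AE) (use m mt L2_measurable[OF u2] v(1)[OF k] in auto)
      then show ?thesis using g(2) \<phi> by (simp add: is_weak_deriv_def)
    qed
    show ?thesis by (rule regularI[OF v'[OF k] vL g(1) weak_second_derivative_prim[OF v'[OF k] g(1) weak]])
  qed
  have t0: "v i 0 = v k 0" if "i \<in> {1..n}" "k \<in> {1..n}" for i k using v(2) that unfolding T0_def by blast
  have t1: "(\<Sum>k\<in>{1..n}. of_real (c k) * v' k 0) = 0"
  proof -
    have "(\<Sum>k\<in>{1..n}. of_real (c k) * v' k 0) = (\<Sum>k\<in>{1..n}. of_real (c k) * vector_derivative (v k) (at 0 within {0..}))"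
    proof (rule sum.cong[OF refl])
      fix k assume k: "k \<in> {1..n}"
      have "(v k has_vector_derivative v' k 0) (at 0 within {0..})" using v'[OF k] unfolding C1_on_halfline_def by blast
      from vector_derivative_at_0[OF this] show "of_real (c k) * v' k 0 = of_real (c k) * vector_derivative (v k) (at 0 within {0..})" by simp
    qed
    also have "\<dots> = 0" using v(3) unfolding T1_def by blast
    finally show ?thesis .
  qed
  show ?thesis by (rule that[OF r v(1) t0 t1])
qed

lemma dom_A_transform:
  assumes u: "u \<in> dom_A n c"
  shows "u \<in> H n" "A c a u \<in> H n"
    "k \<in> {1..n} \<Longrightarrow> AE \<mu> in sigma_measure n c a k. V n c a (A c a u) k \<mu> = of_real \<mu> * V n c a u k \<mu>"
proof -
  obtain v v' where v: "\<And>k. k \<in> {1..n} \<Longrightarrow> regular (v k) (v' k) (weak_deriv 2 (u k))"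
    "\<And>k. k \<in> {1..n} \<Longrightarrow> AE x in branch. v k x = u k x"
    "\<And>i k. i \<in> {1..n} \<Longrightarrow> k \<in> {1..n} \<Longrightarrow> v i 0 = v k 0" "(\<Sum>k\<in>{1..n}. of_real (c k) * v' k 0) = 0"
    by (rule dom_A_regular[OF u]) blast
  show uH: "u \<in> H n" using u by (simp add: dom_A_def H_def prod_L2_def H2_def)
  have g: "weak_deriv 2 (u k) \<in> L2 branch" "v k \<in> L2 branch" if "k \<in> {1..n}" for k using v(1)[OF that] by (auto simp: regular_def)
  show AH: "A c a u \<in> H n"
    using uH g unfolding H_def prod_L2_def A_def[abs_def] by (auto intro!: L2_diff L2_cmult)
  have vH: "v \<in> H n" using g by (simp add: H_def prod_L2_def)
  have yH: "(\<lambda>m x. - of_real (c m) * weak_deriv 2 (u m) x + of_real (a m) * v m x) \<in> H n"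
    using g unfolding H_def prod_L2_def by (auto intro!: L2_diff L2_cmult)
  assume k: "k \<in> {1..n}"
  have "AE \<mu> in sigma_measure n c a k. V n c a u k \<mu> = V n c a v k \<mu>"
  proof (rule V_cong_AE[OF uH vH _ k])
    show "AE x in branch. u k x = v k x" if "k \<in> {1..n}" for k
      using v(2)[OF that] by eventually_elim simp
  qed
  moreover have "AE \<mu> in sigma_measure n c a k. V n c a (A c a u) k \<mu> = V n c a (\<lambda>m x. - of_real (c m) * weak_deriv 2 (u m) x + of_real (a m) * v m x) k \<mu>"
  proof (rule V_cong_AE[OF AH yH _ k])
    show "AE x in branch. A c a u k x = - of_real (c k) * weak_deriv 2 (u k) x + of_real (a k) * v k x" if "k \<in> {1..n}" for k
      using v(2)[OF that] by eventually_elim (simp add: A_def)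
  qed
  moreover have "AE \<mu> in sigma_measure n c a k. V n c a (\<lambda>m x. - of_real (c m) * weak_deriv 2 (u m) x + of_real (a m) * v m x) k \<mu> = of_real \<mu> * V n c a v k \<mu>"
    by (rule V_operator[OF v(1) v(3) v(4) k])
  ultimately show "AE \<mu> in sigma_measure n c a k. V n c a (A c a u) k \<mu> = of_real \<mu> * V n c a u k \<mu>"
    by eventually_elim simp
qed

end

section \<open>From the transform back to the domain of the operator\<close>

lemma regular_C2:
  assumes v: "C1_on_halfline v v'" and v': "C1_on_halfline v' g" and "v \<in> L2 branch" "g \<in> L2 branch"
  shows "regular v v' g"
proof (rule regularI[OF v assms(3,4)])
  fix x :: real assume x: "x \<ge> 0"
  have gc: "continuous_on {0..x} g" by (rule continuous_on_subset[OF C1_on_halfline_continuous(2)[OF v']]) auto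
  have "(g has_integral v' x - v' 0) {0..x}"
    using v' x unfolding C1_on_halfline_def
    by (intro fundamental_theorem_of_calculus) (auto intro: has_vector_derivative_within_subset[of _ _ _ "{0..}"])
  then show "v' x = v' 0 + prim g x"
    unfolding prim_def integral_branch_indicator[OF gc] by (simp add: has_integral_iff)
qed

lemma smooth_C1_on_halfline: "smooth f \<Longrightarrow> C1_on_halfline (vderiv m f) (vderiv (Suc m) f)"
  unfolding C1_on_halfline_def
  using smooth_has_derivative' smooth_continuous_vderiv by (blast intro: has_vector_derivative_at_within)

lemma cnj_C1_on_halfline: "C1_on_halfline f f' \<Longrightarrow> C1_on_halfline (\<lambda>x. cnj (f x)) (\<lambda>x. cnj (f' x))"
  unfolding C1_on_halfline_def by (auto intro!: continuous_intros bounded_linear.has_vector_derivative[OF bounded_linear_cnj])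

text \<open>Such functions may be nonzero at the vertex, unlike test functions; they are the trial
  functions for the transmission conditions.\<close>

lemma smooth_support_regular:
  assumes "smooth f" "\<And>x. x \<ge> N \<Longrightarrow> f x = 0"
  shows "regular f (vderiv 1 f) (vderiv 2 f)" "\<And>m x. x > N \<Longrightarrow> vderiv m f x = 0"
proof -
  show 0: "vderiv m f x = 0" if "x > N" for m x
    using that
  proof (induction m arbitrary: x)
    case (Suc m)
    have "((\<lambda>x. 0) has_vector_derivative vderiv (Suc m) f x) (at x)"
      by (rule has_vector_derivative_transform_within_open[OF smooth_has_derivative'[OF assms(1)], of "{N<..}"]) (use Suc in auto)
    then show ?case using vector_derivative_unique_at has_vector_derivative_const by blast
  qed (use assms(2) in auto)
  have L: "vderiv m f \<in> L2 branch" for m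
  proof -
    have "(\<lambda>x. cindicator {0..N} x * vderiv m f x) \<in> L2 branch"
      by (intro L12_L2 continuous_truncate_L12 smooth_continuous_vderiv assms)
    then show ?thesis
    proof (rule L2_cong_AE)
      show "vderiv m f \<in> borel_measurable branch" by (intro measurable_branch_continuous smooth_continuous_vderiv assms)
      show "AE x in branch. cindicator {0..N} x * vderiv m f x = vderiv m f x"
      proof (rule AE_branchI)
        fix x :: real assume "x > 0"
        then show "cindicator {0..N} x * vderiv m f x = vderiv m f x" using 0[of x m] by (cases "x \<le> N") auto
      qed
    qed
  qed
  show "regular f (vderiv 1 f) (vderiv 2 f)"
    using smooth_C1_on_halfline[OF assms(1), of 0] smooth_C1_on_halfline[OF assms(1), of 1] L[of 0] L[of 2]
    by (intro regular_C2) (simp_all add: numeral_2_eq_2 One_nat_def)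
qed

text \<open>Integrating g twice gives a particular solution p; the weak second derivative of u - p
  is zero, so u is p plus an affine function almost everywhere.\<close>

lemma weak_solution_regular:
  assumes u: "u \<in> L2 branch" and g: "g \<in> L2 branch"
    and weak: "\<And>\<phi>. \<phi> \<in> test_functions \<Longrightarrow> (\<integral>x. u x * vderiv 2 \<phi> x \<partial>branch) = (\<integral>x. g x * \<phi> x \<partial>branch)"
  shows "\<exists>v v'. regular v v' g \<and> (AE x in branch. v x = u x)"
proof -
  define p where "p x = integral {0..x} (prim g)" for x
  have gc: "continuous_on {0..} (prim g)" by (rule prim_continuous[OF g])
  have p: "C1_on_halfline p (prim g)"
    unfolding C1_on_halfline_def
  proof (intro conjI gc allI impI)
    fix x :: real assume x: "x \<ge> 0"
    have "(p has_vector_derivative prim g x) (at x within {0..x + 1})"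
      unfolding p_def[abs_def] by (rule integral_has_vector_derivative) (use x in \<open>auto intro: continuous_on_subset[OF gc]\<close>)
    moreover have "at x within {0..} = at x within {0..x + 1}" by (rule at_within_nhd[where S="{..<x + 1}"]) (use x in auto)
    ultimately show "(p has_vector_derivative prim g x) (at x within {0..})" by simp
  qed
  have ul: "L2_loc u" "L2_loc p" using L2_L2_loc[OF u] continuous_L2_loc[OF C1_on_halfline_continuous(1)[OF p]] by auto
  have "\<exists>\<alpha> \<beta>. AE x in branch. u x - p x = \<alpha> + \<beta> * of_real x"
  proof (rule du_Bois_Reymond_second[OF L2_loc_diff[OF ul]])
    fix \<phi> assume \<phi>: "\<phi> \<in> test_functions"
    have "(\<integral>x. p x * vderiv 2 \<phi> x \<partial>branch) = (\<integral>x. g x * \<phi> x \<partial>branch)"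
      using C1_on_halfline_weak[OF p \<phi>, of 1] prim_weak[OF g \<phi>] by (simp add: numeral_2_eq_2 One_nat_def)
    then show "(\<integral>x. (u x - p x) * vderiv 2 \<phi> x \<partial>branch) = 0"
      using weak[OF \<phi>] L2_loc_test_integrable[OF ul(1) test_functions_vderiv[OF \<phi>, of 2]] L2_loc_test_integrable[OF ul(2) test_functions_vderiv[OF \<phi>, of 2]]
      by (simp add: left_diff_distrib)
  qed
  then obtain \<alpha> \<beta> where ab: "AE x in branch. u x - p x = \<alpha> + \<beta> * of_real x" by blast
  define v where "v x = p x + (\<alpha> + \<beta> * of_real x)" for x
  define v' where "v' x = prim g x + \<beta>" for x
  have v: "C1_on_halfline v v'"
    unfolding C1_on_halfline_def
  proof (intro conjI allI impI)
    show "continuous_on {0..} v'" unfolding v'_def[abs_def] by (intro continuous_intros gc)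
    fix x :: real assume "x \<ge> 0"
    then have "(p has_vector_derivative prim g x) (at x within {0..})" using p by (simp add: C1_on_halfline_def)
    moreover have "((\<lambda>x. \<alpha> + \<beta> * of_real x) has_vector_derivative \<beta>) (at x within {0..})"
      by (intro has_vector_derivative_real_field[where f="\<lambda>z. \<alpha> + \<beta> * z"]) (auto intro!: derivative_eq_intros)
    ultimately show "(v has_vector_derivative v' x) (at x within {0..})"
      unfolding v_def[abs_def] v'_def by (rule has_vector_derivative_add)
  qed
  have ae: "AE x in branch. u x = v x" using ab by eventually_elim (simp add: v_def algebra_simps)
  have vL: "v \<in> L2 branch" by (rule L2_cong_AE[OF u measurable_branch_continuous[OF C1_on_halfline_continuous(1)[OF v]] ae])
  have "regular v v' g" by (rule regularI[OF v vL g]) (simp add: v'_def)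
  moreover have "AE x in branch. v x = u x" using ae by eventually_elim simp
  ultimately show ?thesis by blast
qed

context star_network
begin

text \<open>The range of \<open>V\<close> is closed, because \<open>V\<close> is isometric and H is
  complete. The projection of G onto it is the transform of some f, and this f represents the
  adjoint applied to G, since \<open>V\<close> preserves inner products.\<close>

lemma transform_adjoint:
  assumes G: "G \<in> prod_L2 n (sigma_measure n c a)"
  shows "\<exists>f\<in>H n. \<forall>\<psi>\<in>H n. prod_inner n (sigma_measure n c a) G (V n c a \<psi>) = prod_inner n (\<lambda>k. branch) f \<psi>"
proof -
  let ?M = "sigma_measure n c a"
  \<comment> \<open>Saturated under equality almost everywhere: \<open>V\<close> is linear only up
    to null sets, and W has to be a subspace of functions.\<close>
  define W where "W = {F \<in> prod_L2 n ?M. \<exists>f\<in>H n. \<forall>k\<in>{1..n}. AE \<mu> in ?M k. F k \<mu> = V n c a f k \<mu>}"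
  have WI: "F \<in> W" if "F \<in> prod_L2 n ?M" "f \<in> H n" "\<And>k. k \<in> {1..n} \<Longrightarrow> AE \<mu> in ?M k. F k \<mu> = V n c a f k \<mu>" for F f
    unfolding W_def using that by blast
  have WL: "F \<in> prod_L2 n ?M" if "F \<in> W" for F using that by (simp add: W_def)
  have WE: "\<exists>f. f \<in> H n \<and> (\<forall>k\<in>{1..n}. AE \<mu> in ?M k. F k \<mu> = V n c a f k \<mu>)" if "F \<in> W" for F
    using that unfolding W_def by blast
  have VW: "V n c a f \<in> W" if "f \<in> H n" for f using that V_in_L2_sigma by (intro WI[of _ f]) auto
  have "\<exists>g\<in>W. \<forall>h\<in>W. prod_inner n ?M (\<lambda>k x. G k x - g k x) h = 0"
  proof (rule prod_L2_projection[OF _ _ _ _ _ G])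
    show "W \<subseteq> prod_L2 n ?M" by (auto simp: W_def)
    have "(\<lambda>k x. 0) \<in> H n" by (simp add: H_def prod_L2_def)
    then show "W \<noteq> {}" using VW by blast
    show "(\<lambda>k x. F k x + F' k x) \<in> W" if FW: "F \<in> W" "F' \<in> W" for F F'
    proof -
      obtain f where f: "f \<in> H n" "\<And>k. k \<in> {1..n} \<Longrightarrow> AE \<mu> in ?M k. F k \<mu> = V n c a f k \<mu>" using WE[OF FW(1)] by blast
      obtain f' where f': "f' \<in> H n" "\<And>k. k \<in> {1..n} \<Longrightarrow> AE \<mu> in ?M k. F' k \<mu> = V n c a f' k \<mu>" using WE[OF FW(2)] by blast
      have "AE \<mu> in ?M k. F k \<mu> + F' k \<mu> = V n c a (\<lambda>k x. f k x + f' k x) k \<mu>" if k: "k \<in> {1..n}" for k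
        using f(2)[OF k] f'(2)[OF k] V_add[OF f(1) f'(1) k] by eventually_elim simp
      then show ?thesis by (rule WI[OF prod_L2_add[OF WL[OF FW(1)] WL[OF FW(2)]] H_add[OF f(1) f'(1)]])
    qed
    show "(\<lambda>k x. z * F k x) \<in> W" if FW: "F \<in> W" for F z
    proof -
      obtain f where f: "f \<in> H n" "\<And>k. k \<in> {1..n} \<Longrightarrow> AE \<mu> in ?M k. F k \<mu> = V n c a f k \<mu>" using WE[OF FW] by blast
      have "AE \<mu> in ?M k. z * F k \<mu> = V n c a (\<lambda>k x. z * f k x) k \<mu>" if k: "k \<in> {1..n}" for k
        using f(2)[OF k] V_cmult[OF f(1) k, of z] by eventually_elim simp
      then show ?thesis by (rule WI[OF prod_L2_cmult[OF WL[OF FW]] H_cmult[OF f(1)]])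
    qed
    show "F \<in> W" if FW: "\<And>i::nat. Fi i \<in> W" and F: "F \<in> prod_L2 n ?M" and lim: "(\<lambda>i. prod_L2_norm n ?M (\<lambda>k x. Fi i k x - F k x)) \<longlonglongrightarrow> 0" for Fi F
    proof -
      have "\<forall>i. \<exists>f. f \<in> H n \<and> (\<forall>k\<in>{1..n}. AE \<mu> in ?M k. Fi i k \<mu> = V n c a f k \<mu>)" using WE[OF FW] by blast
      from choice[OF this] obtain f where f: "\<And>i. f i \<in> H n" "\<And>i k. k \<in> {1..n} \<Longrightarrow> AE \<mu> in ?M k. Fi i k \<mu> = V n c a (f i) k \<mu>" by blast
      have FiL: "Fi i \<in> prod_L2 n ?M" for i by (rule WL[OF FW])
      have dist: "normH (\<lambda>k x. f i k x - f j k x) = normS (\<lambda>k x. Fi i k x - Fi j k x)" for i j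
      proof -
        have "normS (\<lambda>k x. Fi i k x - Fi j k x) = normS (\<lambda>k x. V n c a (f i) k x - V n c a (f j) k x)"
        proof (rule prod_L2_norm_cong_AE)
          show "AE x in ?M k. Fi i k x - Fi j k x = V n c a (f i) k x - V n c a (f j) k x" if "k \<in> {1..n}" for k
            using f(2)[OF that, of i] f(2)[OF that, of j] by eventually_elim simp
        qed (intro prod_L2_diff FiL V_in_L2_sigma f)+
        then show ?thesis by (simp add: V_dist f)
      qed
      have "\<exists>h\<in>prod_L2 n (\<lambda>k. branch). (\<lambda>i. normH (\<lambda>k x. f i k x - h k x)) \<longlonglongrightarrow> 0"
      proof (rule prod_L2_complete)
        show "f i \<in> prod_L2 n (\<lambda>k. branch)" for i by (rule HD[OF f(1)])
        show "\<exists>N. \<forall>i\<ge>N. \<forall>j\<ge>N. normH (\<lambda>k x. f i k x - f j k x) < e" if "e > 0" for e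
          unfolding dist by (rule prod_L2_norm_tendsto_Cauchy[OF FiL F lim that])
      qed
      then obtain h where h: "h \<in> H n" "(\<lambda>i. normH (\<lambda>k x. f i k x - h k x)) \<longlonglongrightarrow> 0" by (auto simp: H_def)
      have "normS (\<lambda>k \<mu>. V n c a (f i) k \<mu> - F k \<mu>) = normS (\<lambda>k \<mu>. Fi i k \<mu> - F k \<mu>)" for i
      proof (rule prod_L2_norm_cong_AE)
        show "AE \<mu> in ?M k. V n c a (f i) k \<mu> - F k \<mu> = Fi i k \<mu> - F k \<mu>" if "k \<in> {1..n}" for k
          using f(2)[OF that, of i] by eventually_elim simp
      qed (intro prod_L2_diff FiL V_in_L2_sigma f F)+
      then have "(\<lambda>i. normS (\<lambda>k \<mu>. V n c a (f i) k \<mu> - F k \<mu>)) \<longlonglongrightarrow> 0" using lim by simp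
      then have U: "AE \<mu> in ?M k. V n c a h k \<mu> = F k \<mu>" if "k \<in> {1..n}" for k
        using that by (rule V_unique_limit[OF f(1) h(1) h(2) F])
      have "AE \<mu> in ?M k. F k \<mu> = V n c a h k \<mu>" if "k \<in> {1..n}" for k
        using U[OF that] by eventually_elim simp
      then show ?thesis by (rule WI[OF F h(1)])
    qed
  qed
  then obtain g where g: "g \<in> W" "\<And>h. h \<in> W \<Longrightarrow> prod_inner n ?M (\<lambda>k x. G k x - g k x) h = 0" by blast
  obtain f where f: "f \<in> H n" "\<And>k. k \<in> {1..n} \<Longrightarrow> AE \<mu> in ?M k. g k \<mu> = V n c a f k \<mu>" using WE[OF g(1)] by blast
  have gL: "g \<in> prod_L2 n ?M" by (rule WL[OF g(1)])
  have "prod_inner n ?M G (V n c a \<psi>) = prod_inner n (\<lambda>k. branch) f \<psi>" if \<psi>: "\<psi> \<in> H n" for \<psi>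
  proof -
    have "prod_inner n ?M G (V n c a \<psi>) = prod_inner n ?M g (V n c a \<psi>)"
      using g(2)[OF VW[OF \<psi>]] prod_inner_diff_left[OF G gL V_in_L2_sigma[OF \<psi>]] by simp
    also have "\<dots> = prod_inner n ?M (V n c a f) (V n c a \<psi>)"
      by (rule prod_inner_cong_AE[OF gL V_in_L2_sigma[OF f(1)] V_in_L2_sigma[OF \<psi>] V_in_L2_sigma[OF \<psi>] f(2)]) auto
    also have "\<dots> = prod_inner n (\<lambda>k. branch) f \<psi>" by (rule V_inner[OF f(1) \<psi>])
    finally show ?thesis .
  qed
  then show ?thesis using f(1) by blast
qed

end

text \<open>Both pairings are reduced to the same integral of v' against the derivative of \<psi>;
  what differs is the boundary form at the vertex.\<close>

lemma regular_boundary_pairing: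
  assumes reg: "regular v v' g" and \<psi>: "smooth \<psi>" "\<And>x. x \<ge> b \<Longrightarrow> \<psi> x = 0" and "b \<ge> 0"
  shows "(\<integral>x. v x * cnj (vderiv 2 \<psi> x) \<partial>branch) - (\<integral>x. g x * cnj (\<psi> x) \<partial>branch) = v' 0 * cnj (\<psi> 0) - v 0 * cnj (vderiv 1 \<psi> 0)"
proof -
  have v: "C1_on_halfline v v'" and g: "g \<in> L2 branch" and vg: "\<And>x. x \<ge> 0 \<Longrightarrow> v' x = v' 0 + prim g x"
    using reg unfolding regular_def by blast+
  \<comment> \<open>Derivatives of \<psi> are known to vanish only strictly beyond \<open>b\<close>,
    so the cut is made further out.\<close>
  define N where "N = b + 1"
  have N: "N \<ge> 0" using assms(4) by (simp add: N_def)
  have z: "vderiv m \<psi> x = 0" if "x \<ge> N" for m x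
    by (rule smooth_support_regular(2)[OF \<psi>]) (use that in \<open>auto simp: N_def\<close>)
  have z0: "\<psi> x = 0" if "x \<ge> N" for x using z[OF that, of 0] by simp
  have d: "((\<lambda>x. cnj (vderiv m \<psi> x)) has_vector_derivative cnj (vderiv (Suc m) \<psi> x)) (at x within S)" for m x S
    by (intro bounded_linear.has_vector_derivative[OF bounded_linear_cnj] has_vector_derivative_at_within[OF smooth_has_derivative'] \<psi>)
  have c: "continuous_on S (\<lambda>x. cnj (vderiv m \<psi> x))" for S m by (intro continuous_intros smooth_continuous_vderiv \<psi>)
  have v1: "(\<integral>x. v x * cnj (vderiv 2 \<psi> x) \<partial>branch) = integral {0..N} (\<lambda>x. v x * cnj (vderiv 2 \<psi> x))"
    using z by (intro integral_branch_eq continuous_intros c continuous_on_subset[OF C1_on_halfline_continuous(1)[OF v]]) auto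
  have v2: "integral {0..N} (\<lambda>x. v x * cnj (vderiv 2 \<psi> x)) = v N * cnj (vderiv 1 \<psi> N) - v 0 * cnj (vderiv 1 \<psi> 0) - integral {0..N} (\<lambda>x. v' x * cnj (vderiv 1 \<psi> x))"
    using d[of 1] by (intro C1_on_halfline_parts[OF v N] c) (simp add: numeral_2_eq_2 One_nat_def)
  have g1: "(\<integral>x. g x * cnj (\<psi> x) \<partial>branch) = (\<integral>x. cindicator {0..N} x * (g x * cnj (\<psi> x)) \<partial>branch)"
    by (intro Bochner_Integration.integral_cong) (use z0 in \<open>auto simp: indicator_def\<close>)
  have g2: "(\<integral>x. cindicator {0..N} x * (g x * cnj (\<psi> x)) \<partial>branch) = v' N * cnj (\<psi> N) - v' 0 * cnj (\<psi> 0) - integral {0..N} (\<lambda>x. v' x * cnj (vderiv 1 \<psi> x))"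
    using d[of 0] by (intro regular_parts[OF v g vg N] c) (simp_all add: One_nat_def)
  show ?thesis unfolding v1 v2 g1 g2 using z[of N] z0[of N] by simp
qed

lemma smooth_linear: "smooth (\<lambda>x. \<alpha> + d * of_real x)"
proof (rule smooth_antiderivative)
  show "smooth (\<lambda>x. d)" by (rule smooth_antiderivative[OF smooth_zero]) simp
  show "((\<lambda>x. \<alpha> + d * of_real x) has_vector_derivative d) (at x)" for x
    by (intro has_vector_derivative_real_field[where f="\<lambda>z. \<alpha> + d * z"]) (auto intro!: derivative_eq_intros)
qed

text \<open>A linear function times a smooth cutoff that is 1 up to x = 1 and 0 from x = 2 on: value
  and slope at the vertex can be prescribed freely.\<close>

lemma cutoff_linear:
  obtains \<psi> where "smooth \<psi>" "\<And>x. x \<ge> 2 \<Longrightarrow> \<psi> x = 0" "\<psi> 0 = \<alpha>" "vderiv 1 \<psi> 0 = d"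
proof -
  \<comment> \<open>The redundant \<open>1 * x\<close> and \<open>+ - 1\<close> match the shape of
    \<open>smooth_affine\<close>, \<open>smooth_add\<close> and \<open>smooth_cmult\<close>.\<close>
  define \<eta> where "\<eta> x = 1 + (- 1) * complex_of_real (step (1 * x + - 1))" for x
  have "smooth (\<lambda>x. 1 + 0 * complex_of_real x)" by (rule smooth_linear)
  then have "smooth (\<lambda>x. 1 :: complex)" by simp
  then have \<eta>: "smooth \<eta>" unfolding \<eta>_def[abs_def] by (intro smooth_add smooth_cmult smooth_affine[OF smooth_step])
  define \<psi> where "\<psi> x = (\<alpha> + d * of_real x) * \<eta> x" for x
  have s: "smooth \<psi>" unfolding \<psi>_def[abs_def] by (rule smooth_mult[OF smooth_linear \<eta>])
  have near: "\<psi> x = \<alpha> + d * of_real x" if "x < 1" for x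
    using that by (simp add: \<psi>_def \<eta>_def step_0)
  have "((\<lambda>x. \<alpha> + d * of_real x) has_vector_derivative d) (at 0)"
    by (intro has_vector_derivative_real_field[where f="\<lambda>z. \<alpha> + d * z"]) (auto intro!: derivative_eq_intros)
  then have "(\<psi> has_vector_derivative d) (at 0)"
    by (rule has_vector_derivative_transform_within_open[of _ _ _ "{..<1}"]) (use near in auto)
  then have "vderiv 1 \<psi> 0 = d" using smooth_has_derivative[OF s] vector_derivative_unique_at by blast
  moreover have "\<psi> x = 0" if "x \<ge> 2" for x using that by (simp add: \<psi>_def \<eta>_def step_1)
  moreover have "\<psi> 0 = \<alpha>" using near[of 0] by simp
  ultimately show ?thesis using that s by blast
qed

context star_network
begin

text \<open>On the trial tuple \<psi> the operator acts as multiplication by \<mu> in the transform;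
  \<mu> is real and may be moved to \<open>V u\<close>, whose product with \<mu> is square
  integrable, and the adjoint then produces f.\<close>

lemma transform_weak_identity:
  assumes u: "u \<in> H n" and G: "(\<lambda>k \<mu>. of_real \<mu> * V n c a u k \<mu>) \<in> prod_L2 n (sigma_measure n c a)"
  shows "\<exists>f\<in>H n. \<forall>\<psi> \<psi>' \<gamma>. (\<forall>k\<in>{1..n}. regular (\<psi> k) (\<psi>' k) (\<gamma> k)) \<longrightarrow> (\<forall>i\<in>{1..n}. \<forall>k\<in>{1..n}. \<psi> i 0 = \<psi> k 0) \<longrightarrow>
      (\<Sum>k\<in>{1..n}. of_real (c k) * \<psi>' k 0) = 0 \<longrightarrow>
      (\<Sum>m\<in>{1..n}. \<integral>x. u m x * cnj (- of_real (c m) * \<gamma> m x + of_real (a m) * \<psi> m x) \<partial>branch) = (\<Sum>m\<in>{1..n}. \<integral>x. f m x * cnj (\<psi> m x) \<partial>branch)"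
proof -
  let ?M = "sigma_measure n c a"
  obtain f where f: "f \<in> H n" "\<And>\<psi>. \<psi> \<in> H n \<Longrightarrow> prod_inner n ?M (\<lambda>k \<mu>. of_real \<mu> * V n c a u k \<mu>) (V n c a \<psi>) = prod_inner n (\<lambda>k. branch) f \<psi>"
    using transform_adjoint[OF G] by blast
  have "(\<Sum>m\<in>{1..n}. \<integral>x. u m x * cnj (- of_real (c m) * \<gamma> m x + of_real (a m) * \<psi> m x) \<partial>branch) = (\<Sum>m\<in>{1..n}. \<integral>x. f m x * cnj (\<psi> m x) \<partial>branch)"
    if reg: "\<forall>k\<in>{1..n}. regular (\<psi> k) (\<psi>' k) (\<gamma> k)" and T0: "\<forall>i\<in>{1..n}. \<forall>k\<in>{1..n}. \<psi> i 0 = \<psi> k 0"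
      and T1: "(\<Sum>k\<in>{1..n}. of_real (c k) * \<psi>' k 0) = 0" for \<psi> \<psi>' \<gamma>
  proof -
    define y where "y m x = - of_real (c m) * \<gamma> m x + of_real (a m) * \<psi> m x" for m x
    have L: "\<psi> m \<in> L2 branch" "\<gamma> m \<in> L2 branch" if "m \<in> {1..n}" for m using reg that unfolding regular_def by blast+
    have \<psi>H: "\<psi> \<in> H n" using L by (simp add: H_def prod_L2_def)
    have yH: "y \<in> H n" using L unfolding H_def prod_L2_def y_def[abs_def] by (auto intro!: L2_diff L2_cmult)
    have "prod_inner n (\<lambda>k. branch) u y = prod_inner n ?M (V n c a u) (V n c a y)" by (rule V_inner[OF u yH, symmetric])
    also have "\<dots> = prod_inner n ?M (\<lambda>k \<mu>. of_real \<mu> * V n c a u k \<mu>) (V n c a \<psi>)"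
      unfolding prod_inner_def
    proof (intro sum.cong refl integral_cong_AE)
      fix k assume k: "k \<in> {1..n}"
      have V: "V n c a w k \<in> L2 (?M k)" if "w \<in> H n" for w using V_in_L2_sigma[OF that] k by (simp add: prod_L2_def)
      have GL: "(\<lambda>\<mu>. of_real \<mu> * V n c a u k \<mu>) \<in> L2 (?M k)" using G k by (simp add: prod_L2_def)
      show "(\<lambda>\<mu>. V n c a u k \<mu> * cnj (V n c a y k \<mu>)) \<in> borel_measurable (?M k)"
        by (rule borel_measurable_integrable[OF L2_inner_integrable[OF V[OF u] V[OF yH]]])
      show "(\<lambda>\<mu>. of_real \<mu> * V n c a u k \<mu> * cnj (V n c a \<psi> k \<mu>)) \<in> borel_measurable (?M k)"
        by (rule borel_measurable_integrable[OF L2_inner_integrable[OF GL V[OF \<psi>H]]])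
      have "AE \<mu> in ?M k. V n c a (\<lambda>m x. - of_real (c m) * \<gamma> m x + of_real (a m) * \<psi> m x) k \<mu> = of_real \<mu> * V n c a \<psi> k \<mu>"
        by (rule V_operator[of \<psi> \<psi>' \<gamma> k]) (use reg T0 T1 k in blast)+
      then show "AE \<mu> in ?M k. V n c a u k \<mu> * cnj (V n c a y k \<mu>) = of_real \<mu> * V n c a u k \<mu> * cnj (V n c a \<psi> k \<mu>)"
        unfolding y_def[abs_def] by eventually_elim simp
    qed
    also have "\<dots> = prod_inner n (\<lambda>k. branch) f \<psi>" by (rule f(2)[OF \<psi>H])
    finally show ?thesis by (simp only: prod_inner_def y_def)
  qed
  then show ?thesis using f(1) by blast
qed

text \<open>Trial tuples supported on one branch give u'' = g weakly, with g = (a u - f) / c, hence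
  a regular representative. With trial functions that are nonzero at the vertex the equation is used
  up in the interior, and only a boundary form at the vertex remains, which must vanish for all
  admissible vertex data.\<close>

lemma dom_A_if_transform:
  assumes u: "u \<in> H n" and G: "(\<lambda>k \<mu>. of_real \<mu> * V n c a u k \<mu>) \<in> prod_L2 n (sigma_measure n c a)"
  shows "u \<in> dom_A n c"
proof -
  obtain f where f: "f \<in> H n" and weak: "\<And>\<psi> \<psi>' \<gamma>. (\<And>k. k \<in> {1..n} \<Longrightarrow> regular (\<psi> k) (\<psi>' k) (\<gamma> k)) \<Longrightarrow>
      (\<And>i k. i \<in> {1..n} \<Longrightarrow> k \<in> {1..n} \<Longrightarrow> \<psi> i 0 = \<psi> k 0) \<Longrightarrow> (\<Sum>k\<in>{1..n}. of_real (c k) * \<psi>' k 0) = 0 \<Longrightarrow>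
      (\<Sum>m\<in>{1..n}. \<integral>x. u m x * cnj (- of_real (c m) * \<gamma> m x + of_real (a m) * \<psi> m x) \<partial>branch) = (\<Sum>m\<in>{1..n}. \<integral>x. f m x * cnj (\<psi> m x) \<partial>branch)"
    using transform_weak_identity[OF u G] by blast
  define g where "g k x = (of_real (a k) * u k x - f k x) / of_real (c k)" for k x
  have uL: "u k \<in> L2 branch" and fL: "f k \<in> L2 branch" if "k \<in> {1..n}" for k
    using u f that by (auto simp: H_def prod_L2_def)
  have gL: "g k \<in> L2 branch" if k: "k \<in> {1..n}" for k
  proof -
    have "(\<lambda>x. (1 / of_real (c k)) * (of_real (a k) * u k x - f k x)) \<in> L2 branch"
      by (intro L2_cmult L2_diff uL fL k)
    then show ?thesis by (simp add: g_def[abs_def])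
  qed
  have split: "(\<integral>x. u m x * cnj (- of_real (c m) * \<gamma> x + of_real (a m) * \<psi> x) \<partial>branch) - (\<integral>x. f m x * cnj (\<psi> x) \<partial>branch)
      = - of_real (c m) * ((\<integral>x. u m x * cnj (\<gamma> x) \<partial>branch) - (\<integral>x. g m x * cnj (\<psi> x) \<partial>branch))"
    if m: "m \<in> {1..n}" and L: "\<psi> \<in> L2 branch" "\<gamma> \<in> L2 branch" for m \<psi> \<gamma>
  proof -
    have c0: "c m \<noteq> 0" using c_pos[OF m] by simp
    note int = L2_inner_integrable[OF uL[OF m] L(1)] L2_inner_integrable[OF uL[OF m] L(2)] L2_inner_integrable[OF fL[OF m] L(1)]
    have "(\<integral>x. u m x * cnj (- of_real (c m) * \<gamma> x + of_real (a m) * \<psi> x) \<partial>branch)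
        = (\<integral>x. - of_real (c m) * (u m x * cnj (\<gamma> x)) + of_real (a m) * (u m x * cnj (\<psi> x)) \<partial>branch)"
      by (intro Bochner_Integration.integral_cong) (auto simp: algebra_simps)
    also have "\<dots> = - of_real (c m) * (\<integral>x. u m x * cnj (\<gamma> x) \<partial>branch) + of_real (a m) * (\<integral>x. u m x * cnj (\<psi> x) \<partial>branch)"
      using int by simp
    finally have 1: "(\<integral>x. u m x * cnj (- of_real (c m) * \<gamma> x + of_real (a m) * \<psi> x) \<partial>branch)
        = - of_real (c m) * (\<integral>x. u m x * cnj (\<gamma> x) \<partial>branch) + of_real (a m) * (\<integral>x. u m x * cnj (\<psi> x) \<partial>branch)" .
    have "of_real (c m) * (\<integral>x. g m x * cnj (\<psi> x) \<partial>branch) = (\<integral>x. of_real (c m) * (g m x * cnj (\<psi> x)) \<partial>branch)" by simp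
    also have "\<dots> = (\<integral>x. of_real (a m) * (u m x * cnj (\<psi> x)) - f m x * cnj (\<psi> x) \<partial>branch)"
      using c0 by (intro Bochner_Integration.integral_cong) (auto simp: g_def left_diff_distrib mult.assoc)
    also have "\<dots> = of_real (a m) * (\<integral>x. u m x * cnj (\<psi> x) \<partial>branch) - (\<integral>x. f m x * cnj (\<psi> x) \<partial>branch)"
      using int by simp
    finally have 2: "of_real (c m) * (\<integral>x. g m x * cnj (\<psi> x) \<partial>branch) = of_real (a m) * (\<integral>x. u m x * cnj (\<psi> x) \<partial>branch) - (\<integral>x. f m x * cnj (\<psi> x) \<partial>branch)" .
    show ?thesis unfolding 1 right_diff_distrib using 2 by simp
  qed
  have weak_eq: "(\<integral>x. u k x * vderiv 2 \<phi> x \<partial>branch) = (\<integral>x. g k x * \<phi> x \<partial>branch)" if k: "k \<in> {1..n}" and \<phi>: "\<phi> \<in> test_functions" for k \<phi>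
  proof -
    obtain \<alpha> \<beta> where s: "0 < \<alpha>" "\<alpha> \<le> \<beta>" "\<And>x. x \<notin> {\<alpha>..\<beta>} \<Longrightarrow> \<phi> x = 0" using test_functions_support[OF \<phi>] by metis
    have sm: "smooth \<phi>" by (rule test_functions_smooth[OF \<phi>])
    have L: "(\<lambda>x. cnj (vderiv j \<phi> x)) \<in> L2 branch" for j by (rule L2_cnj[OF test_functions_L2[OF test_functions_vderiv[OF \<phi>]]])
    \<comment> \<open>The trial function is the conjugate of \<phi>, because the inner product
      conjugates it once more.\<close>
    have r: "regular (\<lambda>x. cnj (\<phi> x)) (\<lambda>x. cnj (vderiv 1 \<phi> x)) (\<lambda>x. cnj (vderiv 2 \<phi> x))"
      using cnj_C1_on_halfline[OF smooth_C1_on_halfline[OF sm, of 0]] cnj_C1_on_halfline[OF smooth_C1_on_halfline[OF sm, of 1]] L[of 0] L[of 2]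
      by (intro regular_C2) (simp_all add: numeral_2_eq_2 One_nat_def)
    have r0: "regular (\<lambda>x. 0) (\<lambda>x. 0) (\<lambda>x. 0)"
      by (rule regular_C2) (auto simp: C1_on_halfline_def)
    define P where "P m = (if m = k then (\<lambda>x. cnj (\<phi> x)) else (\<lambda>x. 0))" for m
    define P' where "P' m = (if m = k then (\<lambda>x. cnj (vderiv 1 \<phi> x)) else (\<lambda>x. 0))" for m
    define P2 where "P2 m = (if m = k then (\<lambda>x. cnj (vderiv 2 \<phi> x)) else (\<lambda>x. 0))" for m
    have 0: "vderiv m \<phi> 0 = 0" for m
      by (rule vderiv_eq_0_outside[OF sm s(3)]) (use s(1) in auto)
    have "(\<Sum>m\<in>{1..n}. \<integral>x. u m x * cnj (- of_real (c m) * P2 m x + of_real (a m) * P m x) \<partial>branch) = (\<Sum>m\<in>{1..n}. \<integral>x. f m x * cnj (P m x) \<partial>branch)"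
    proof (rule weak[of P P' P2])
      show "regular (P m) (P' m) (P2 m)" for m unfolding P_def P'_def P2_def using r r0 by simp
      show "P i 0 = P j 0" for i j unfolding P_def using 0[of 0] by simp
      show "(\<Sum>k\<in>{1..n}. of_real (c k) * P' k 0) = 0" unfolding P'_def by (intro sum.neutral) (simp add: 0)
    qed
    then have "0 = (\<Sum>m\<in>{1..n}. (\<integral>x. u m x * cnj (- of_real (c m) * P2 m x + of_real (a m) * P m x) \<partial>branch) - (\<integral>x. f m x * cnj (P m x) \<partial>branch))"
      by (simp add: sum_subtractf)
    also have "\<dots> = (\<Sum>m\<in>{1..n}. if m = k then (\<integral>x. u k x * cnj (- of_real (c k) * P2 k x + of_real (a k) * P k x) \<partial>branch) - (\<integral>x. f k x * cnj (P k x) \<partial>branch) else 0)"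
      by (intro sum.cong) (auto simp: P_def P2_def)
    also have "\<dots> = (\<integral>x. u k x * cnj (- of_real (c k) * P2 k x + of_real (a k) * P k x) \<partial>branch) - (\<integral>x. f k x * cnj (P k x) \<partial>branch)"
      using k by simp
    also have "\<dots> = - of_real (c k) * ((\<integral>x. u k x * cnj (P2 k x) \<partial>branch) - (\<integral>x. g k x * cnj (P k x) \<partial>branch))"
      using L[of 0] L[of 2] by (intro split k) (simp_all add: P_def P2_def)
    finally show ?thesis using c_pos[OF k] by (simp add: P_def P2_def)
  qed
  have "\<forall>k\<in>{1..n}. \<exists>p. regular (fst p) (snd p) (g k) \<and> (AE x in branch. fst p x = u k x)"
    using weak_solution_regular[OF uL gL weak_eq] by fastforce
  from bchoice[OF this] obtain p where p: "\<And>k. k \<in> {1..n} \<Longrightarrow> regular (fst (p k)) (snd (p k)) (g k)"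
     "\<And>k. k \<in> {1..n} \<Longrightarrow> AE x in branch. fst (p k) x = u k x" by blast
  define v where "v k = fst (p k)" for k
  define v' where "v' k = snd (p k)" for k
  have v: "regular (v k) (v' k) (g k)" "AE x in branch. v k x = u k x" if "k \<in> {1..n}" for k
    using p[OF that] by (simp_all add: v_def v'_def)
  have cc: "C1_on_halfline (v k) (v' k)" and vL: "v k \<in> L2 branch" "v' k \<in> L2 branch" if "k \<in> {1..n}" for k
    using v(1)[OF that] unfolding regular_def by blast+
  \<comment> \<open>The admissible vertex data are a common value \<alpha> and slopes d of zero
    flux; any such data are realized by \<open>cutoff_linear\<close>.\<close>
  have trans: "(\<Sum>m\<in>{1..n}. of_real (c m) * (v' m 0 * cnj \<alpha> - v m 0 * cnj (d m))) = 0"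
    if flux: "(\<Sum>m\<in>{1..n}. of_real (c m) * d m) = 0" for \<alpha> and d :: "nat \<Rightarrow> complex"
  proof -
    have "\<forall>m. \<exists>\<psi>. smooth \<psi> \<and> (\<forall>x\<ge>2. \<psi> x = 0) \<and> \<psi> 0 = \<alpha> \<and> vderiv 1 \<psi> 0 = d m"
    proof
      fix m show "\<exists>\<psi>. smooth \<psi> \<and> (\<forall>x\<ge>2. \<psi> x = 0) \<and> \<psi> 0 = \<alpha> \<and> vderiv 1 \<psi> 0 = d m"
        by (rule cutoff_linear[of \<alpha> "d m"]) blast
    qed
    from choice[OF this] obtain \<psi> where \<psi>: "\<And>m. smooth (\<psi> m)" "\<And>m x. x \<ge> 2 \<Longrightarrow> \<psi> m x = 0" "\<And>m. \<psi> m 0 = \<alpha>" "\<And>m. vderiv 1 (\<psi> m) 0 = d m" by blast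
    have reg: "regular (\<psi> m) (vderiv 1 (\<psi> m)) (vderiv 2 (\<psi> m))" for m by (rule smooth_support_regular(1)[OF \<psi>(1,2)])
    have L: "\<psi> m \<in> L2 branch" "vderiv 2 (\<psi> m) \<in> L2 branch" for m using reg[of m] unfolding regular_def by blast+
    have "(\<Sum>m\<in>{1..n}. \<integral>x. u m x * cnj (- of_real (c m) * vderiv 2 (\<psi> m) x + of_real (a m) * \<psi> m x) \<partial>branch) = (\<Sum>m\<in>{1..n}. \<integral>x. f m x * cnj (\<psi> m x) \<partial>branch)"
      by (rule weak[OF reg]) (simp_all add: \<psi>(3,4) flux)
    then have "0 = (\<Sum>m\<in>{1..n}. (\<integral>x. u m x * cnj (- of_real (c m) * vderiv 2 (\<psi> m) x + of_real (a m) * \<psi> m x) \<partial>branch) - (\<integral>x. f m x * cnj (\<psi> m x) \<partial>branch))"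
      by (simp add: sum_subtractf)
    also have "\<dots> = (\<Sum>m\<in>{1..n}. - of_real (c m) * (v' m 0 * cnj \<alpha> - v m 0 * cnj (d m)))"
    proof (rule sum.cong[OF refl])
      fix m assume m: "m \<in> {1..n}"
      have "(\<integral>x. u m x * cnj (vderiv 2 (\<psi> m) x) \<partial>branch) = (\<integral>x. v m x * cnj (vderiv 2 (\<psi> m) x) \<partial>branch)"
      proof (rule integral_cong_AE)
        show "(\<lambda>x. u m x * cnj (vderiv 2 (\<psi> m) x)) \<in> borel_measurable branch" "(\<lambda>x. v m x * cnj (vderiv 2 (\<psi> m) x)) \<in> borel_measurable branch"
          by (intro borel_measurable_integrable L2_inner_integrable uL vL L m)+
        show "AE x in branch. u m x * cnj (vderiv 2 (\<psi> m) x) = v m x * cnj (vderiv 2 (\<psi> m) x)"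
          using v(2)[OF m] by eventually_elim simp
      qed
      then have "(\<integral>x. u m x * cnj (vderiv 2 (\<psi> m) x) \<partial>branch) - (\<integral>x. g m x * cnj (\<psi> m x) \<partial>branch) = v' m 0 * cnj \<alpha> - v m 0 * cnj (d m)"
      proof -
        have "(\<integral>x. v m x * cnj (vderiv 2 (\<psi> m) x) \<partial>branch) - (\<integral>x. g m x * cnj (\<psi> m x) \<partial>branch)
            = v' m 0 * cnj (\<psi> m 0) - v m 0 * cnj (vderiv 1 (\<psi> m) 0)"
          by (rule regular_boundary_pairing[where b=2, OF v(1)[OF m] \<psi>(1)]) (use \<psi>(2) in auto)
        then show ?thesis unfolding \<psi>(3,4) by (simp only: \<open>(\<integral>x. u m x * cnj (vderiv 2 (\<psi> m) x) \<partial>branch) = _\<close>)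
      qed
      then show "(\<integral>x. u m x * cnj (- of_real (c m) * vderiv 2 (\<psi> m) x + of_real (a m) * \<psi> m x) \<partial>branch) - (\<integral>x. f m x * cnj (\<psi> m x) \<partial>branch)
          = - of_real (c m) * (v' m 0 * cnj \<alpha> - v m 0 * cnj (d m))"
        unfolding split[OF m L] by simp
    qed
    also have "\<dots> = - (\<Sum>m\<in>{1..n}. of_real (c m) * (v' m 0 * cnj \<alpha> - v m 0 * cnj (d m)))"
      by (simp add: sum_negf)
    finally show ?thesis by simp
  qed
  \<comment> \<open>Value 1 and all slopes 0 isolate the flux of v.\<close>
  have t1: "(\<Sum>m\<in>{1..n}. of_real (c m) * v' m 0) = 0"
    using trans[of "\<lambda>_. 0" 1] by simp
  have t0: "v i 0 = v k 0" if ik: "i \<in> {1..n}" "k \<in> {1..n}" for i k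
  proof (cases "i = k")
    case False
    \<comment> \<open>Slopes 1 / c i and - 1 / c k on two branches have zero flux, and with value 0
      they isolate the difference of v at the vertex on these branches.\<close>
    define d where "d m = (if m = i then 1 / complex_of_real (c i) else 0) - (if m = k then 1 / complex_of_real (c k) else 0)" for m
    have cd: "of_real (c m) * (z m * d m) = (if m = i then z i else 0) - (if m = k then z k else 0)" if "m \<in> {1..n}" for z m
      using c_pos[OF ik(1)] c_pos[OF ik(2)] False by (auto simp: d_def)
    have sum: "(\<Sum>m\<in>{1..n}. of_real (c m) * (z m * d m)) = z i - z k" for z
    proof -
      have "(\<Sum>m\<in>{1..n}. of_real (c m) * (z m * d m)) = (\<Sum>m\<in>{1..n}. (if m = i then z i else 0) - (if m = k then z k else 0))"
        by (rule sum.cong[OF refl cd])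
      then show ?thesis using ik by (simp add: sum_subtractf)
    qed
    have cn: "cnj (d m) = d m" for m by (simp add: d_def)
    have "(\<Sum>m\<in>{1..n}. of_real (c m) * d m) = 0" using sum[of "\<lambda>_. 1"] by simp
    from trans[OF this, of 0] have "(\<Sum>m\<in>{1..n}. of_real (c m) * (v m 0 * d m)) = 0" by (simp add: cn sum_negf)
    then show ?thesis unfolding sum[of "\<lambda>m. v m 0"] by simp
  qed simp
  have H2: "u k \<in> H2" if k: "k \<in> {1..n}" for k
  proof -
    have ae: "(\<integral>x. u k x * vderiv m \<phi> x \<partial>branch) = (\<integral>x. v k x * vderiv m \<phi> x \<partial>branch)" if \<phi>: "\<phi> \<in> test_functions" for m \<phi>
    proof (rule integral_cong_AE)
      show "(\<lambda>x. u k x * vderiv m \<phi> x) \<in> borel_measurable branch" "(\<lambda>x. v k x * vderiv m \<phi> x) \<in> borel_measurable branch"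
        by (intro borel_measurable_integrable L2_mult_integrable uL vL k test_functions_L2 test_functions_vderiv \<phi>)+
      show "AE x in branch. u k x * vderiv m \<phi> x = v k x * vderiv m \<phi> x" using v(2)[OF k] by eventually_elim simp
    qed
    have "is_weak_deriv 1 (u k) (v' k)" "is_weak_deriv 2 (u k) (g k)"
      using regular_weak_derivs[OF v(1)[OF k]] unfolding is_weak_deriv_def by (simp_all add: ae)
    then show ?thesis using uL[OF k] vL(2)[OF k] gL[OF k] by (auto simp: H2_def)
  qed
  have "T0 n v"
    unfolding T0_def using C1_on_halfline_continuous(1)[OF cc] t0 by blast
  moreover have "T1 n c v"
    unfolding T1_def
  proof (intro conjI ballI)
    show "C1_halfline (v k)" if "k \<in> {1..n}" for k
      using cc[OF that] unfolding C1_halfline_def C1_on_halfline_def by blast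
    have "(\<Sum>k\<in>{1..n}. of_real (c k) * vector_derivative (v k) (at 0 within {0..})) = (\<Sum>k\<in>{1..n}. of_real (c k) * v' k 0)"
    proof (rule sum.cong[OF refl])
      fix k assume k: "k \<in> {1..n}"
      have "(v k has_vector_derivative v' k 0) (at 0 within {0..})" using cc[OF k] unfolding C1_on_halfline_def by blast
      from vector_derivative_at_0[OF this] show "of_real (c k) * vector_derivative (v k) (at 0 within {0..}) = of_real (c k) * v' k 0" by simp
    qed
    then show "(\<Sum>k\<in>{1..n}. of_real (c k) * vector_derivative (v k) (at 0 within {0..})) = 0" using t1 by simp
  qed
  ultimately show ?thesis unfolding dom_A_def using H2 v(2) by blast
qed

section \<open>Powers of the operator\<close>

text \<open>On the domain, \<mu>^j times the transform of A u equals \<mu>^(j+1) times that of u, so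
  the exponent shifts by one. In the converse direction membership in the domain comes first: \<mu>
  V u is controlled by V u and \<mu>^(j+1) V u together.\<close>

lemma dom_A_pow_iff:
  "u \<in> H n \<Longrightarrow> u \<in> dom_A_pow n c a j \<longleftrightarrow> (\<lambda>k \<mu>. of_real \<mu> ^ j * V n c a u k \<mu>) \<in> L2_sigma n c a"
proof (induction j arbitrary: u)
  case 0
  then show ?case using V_in_L2_sigma[OF 0] by (simp add: L2_sigma_def)
next
  case (Suc j)
  let ?M = "sigma_measure n c a"
  have VL: "V n c a u k \<in> L2 (?M k)" if "k \<in> {1..n}" for k using V_in_L2_sigma[OF Suc.prems] that by (simp add: prod_L2_def)
  have m: "(\<lambda>\<mu>. complex_of_real \<mu> ^ i * V n c a w k \<mu>) \<in> borel_measurable (?M k)" if "k \<in> {1..n}" "w \<in> H n" for i k w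
  proof -
    have "V n c a w k \<in> borel_measurable (?M k)" using V_in_L2_sigma[OF that(2)] that(1) by (simp add: prod_L2_def L2_def)
    moreover have "(\<lambda>\<mu>. complex_of_real \<mu> ^ i) \<in> borel_measurable (?M k)"
      by (intro borel_measurable_sigma_measure borel_measurable_continuous_onI continuous_intros)
    ultimately show ?thesis by (rule borel_measurable_times[rotated])
  qed
  have step: "(\<lambda>k \<mu>. of_real \<mu> ^ j * V n c a (A c a u) k \<mu>) \<in> L2_sigma n c a \<longleftrightarrow> (\<lambda>k \<mu>. of_real \<mu> ^ Suc j * V n c a u k \<mu>) \<in> L2_sigma n c a"
    if D: "u \<in> dom_A n c"
  proof -
    have "(\<lambda>\<mu>. of_real \<mu> ^ j * V n c a (A c a u) k \<mu>) \<in> L2 (?M k) \<longleftrightarrow> (\<lambda>\<mu>. of_real \<mu> ^ Suc j * V n c a u k \<mu>) \<in> L2 (?M k)" if k: "k \<in> {1..n}" for k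
    proof -
      have "AE \<mu> in ?M k. of_real \<mu> ^ j * V n c a (A c a u) k \<mu> = of_real \<mu> ^ Suc j * V n c a u k \<mu>"
        using dom_A_transform(3)[OF D k] by eventually_elim (simp add: mult_ac)
      moreover from this have "AE \<mu> in ?M k. of_real \<mu> ^ Suc j * V n c a u k \<mu> = of_real \<mu> ^ j * V n c a (A c a u) k \<mu>"
        by eventually_elim (rule sym)
      ultimately show ?thesis
        using L2_cong_AE m[OF k Suc.prems, of "Suc j"] m[OF k dom_A_transform(2)[OF D], of j] by blast
    qed
    then show ?thesis by (simp add: L2_sigma_def prod_L2_def)
  qed
  show ?case
  proof
    assume "u \<in> dom_A_pow n c a (Suc j)"
    then have D: "u \<in> dom_A n c" "A c a u \<in> dom_A_pow n c a j" by auto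
    then show "(\<lambda>k \<mu>. of_real \<mu> ^ Suc j * V n c a u k \<mu>) \<in> L2_sigma n c a"
      using Suc.IH[OF dom_A_transform(2)[OF D(1)]] step by blast
  next
    assume S: "(\<lambda>k \<mu>. of_real \<mu> ^ Suc j * V n c a u k \<mu>) \<in> L2_sigma n c a"
    have "(\<lambda>\<mu>. of_real \<mu> * V n c a u k \<mu>) \<in> L2 (?M k)" if k: "k \<in> {1..n}" for k
    proof (rule L2_bound)
      have "(\<lambda>\<mu>. of_real \<mu> ^ Suc j * V n c a u k \<mu>) \<in> L2 (?M k)" using S k by (simp add: L2_sigma_def prod_L2_def)
      from L2_integrable[OF VL[OF k]] L2_integrable[OF this]
      show "integrable (?M k) (\<lambda>\<mu>. (cmod (V n c a u k \<mu>))\<^sup>2 + (cmod (of_real \<mu> ^ Suc j * V n c a u k \<mu>))\<^sup>2)"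
        by (rule Bochner_Integration.integrable_add)
      show "(\<lambda>\<mu>. of_real \<mu> * V n c a u k \<mu>) \<in> borel_measurable (?M k)" using m[OF k Suc.prems, of 1] by simp
      \<comment> \<open>For |\<mu>| \<le> 1 the first term dominates, otherwise the second.\<close>
      have "(cmod (of_real \<mu> * z))\<^sup>2 \<le> (cmod z)\<^sup>2 + (cmod (of_real \<mu> ^ Suc j * z))\<^sup>2" for \<mu> and z :: complex
      proof (cases "\<bar>\<mu>\<bar> \<le> 1")
        case True
        then have "(cmod (of_real \<mu> * z))\<^sup>2 \<le> (cmod z)\<^sup>2" by (intro power_mono) (auto simp: norm_mult mult_left_le_one_le)
        then show ?thesis by (simp add: add_increasing2)
      next
        case False
        then have "\<bar>\<mu>\<bar> ^ 1 \<le> \<bar>\<mu>\<bar> ^ Suc j" by (intro power_increasing) auto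
        then have "(cmod (of_real \<mu> * z))\<^sup>2 \<le> (cmod (of_real \<mu> ^ Suc j * z))\<^sup>2"
          by (intro power_mono) (auto simp: norm_mult norm_power intro: mult_right_mono)
        then show ?thesis by (simp add: add_increasing)
      qed
      then show "AE \<mu> in ?M k. (cmod (of_real \<mu> * V n c a u k \<mu>))\<^sup>2 \<le> (cmod (V n c a u k \<mu>))\<^sup>2 + (cmod (of_real \<mu> ^ Suc j * V n c a u k \<mu>))\<^sup>2"
        by simp
    qed
    then have D: "u \<in> dom_A n c" by (intro dom_A_if_transform[OF Suc.prems]) (simp add: prod_L2_def)
    then show "u \<in> dom_A_pow n c a (Suc j)"
      using Suc.IH[OF dom_A_transform(2)[OF D]] step[OF D] S by simp
  qed
qed

end

theorem theorem7p7:
  fixes n j :: nat and c a :: "nat \<Rightarrow> real" and u :: "nat \<Rightarrow> real \<Rightarrow> complex"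
  assumes "n \<ge> 2"
    and "\<forall>k\<in>{1..n}. c k > 0"
    and "0 \<le> a 1"
    and "\<forall>k\<in>{1..<n}. a k \<le> a (Suc k)"
    and "u \<in> H n"
  shows "(u \<in> dom_A_pow n c a j \<longleftrightarrow>
            (\<lambda>k \<mu>. of_real \<mu> ^ j * V n c a u k \<mu>) \<in> L2_sigma n c a) \<and>
         ((\<lambda>k \<mu>. of_real \<mu> ^ j * V n c a u k \<mu>) \<in> L2_sigma n c a \<longleftrightarrow>
            (\<forall>k\<in>{1..n}. (\<lambda>\<mu>. of_real \<mu> ^ j * V n c a u k \<mu>) \<in> L2 (sigma_measure n c a k)))"
proof -
  have a: "a 1 \<le> a k" if "1 \<le> k" "k \<le> n" for k
    using that
  proof (induction k rule: dec_induct)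
    case (step i)
    then have "a i \<le> a (Suc i)" using assms(4) by auto
    with step show ?case by auto
  qed simp
  interpret star_network n c a
    by unfold_locales (use assms a in auto)
  show ?thesis using dom_A_pow_iff[OF assms(5)] by (simp add: L2_sigma_def prod_L2_def)
qed

end
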